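(* $\mathbf{Lex}$ is closed in $\mathbf{Cat}$ under bifiltered bicolimits: for every small bifiltered 2-category $I$ and every diagram $\mathcal{C}_{(-)} : I\to\mathbf{Lex}$, the bicolimit in $\mathbf{Cat}$ of the underlying diagram of categories is a category with finite limits and, with its bicolimit inclusions, provides a bicolimit of $\mathcal{C}_{(-)}$ in $\mathbf{Lex}$.
   Context: $\mathbf{Cat}$ is the 2-category of small categories, functors and natural transformations. $\mathbf{Lex}$ is the 2-category of small categories with finite limits, lex functors (functors preserving finite limits up to isomorphism) and natural transformations, with its (non-full) forgetful 2-functor $\mathbf{Lex}\to\mathbf{Cat}$. The (conical) bicolimit of a pseudofunctor $F : I \to \mathcal{B}$ into a 2-category is an object $\mathrm{bicolim}\,F$ with equivalences, pseudonatural in $X$, between $\mathcal{B}[\mathrm{bicolim}\,F, X]$ and the category of pseudococones from $F$ to $X$. A 2-category $I$ is bifiltered if it is non-empty and: (1) any two objects $i,i'$ admit 1-cells $i\to i''\leftarrow i'$; (2) for any parallel $d,d' : i \rightrightarrows i'$ there are $f : i'\to i''$ and an invertible 2-cell $fd \simeq fd'$; (3) for any parallel 2-cells $\alpha,\alpha' : d \Rightarrow d' : i \to i'$ there is $f : i'\to i''$ with $f*\alpha=f*\alpha'$. *)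

theory Defs
  imports "HOL-Library.FuncSet"
begin

unbundle cardinal_syntax

record ('o, 'a) cat =
  Obj :: "'o set"
  Arr :: "'a set"
  Dom :: "'a \<Rightarrow> 'o"
  Cod :: "'a \<Rightarrow> 'o"
  Id :: "'o \<Rightarrow> 'a"
  Comp :: "'a \<Rightarrow> 'a \<Rightarrow> 'a"  (infixl "\<cdot>\<index>" 70)

definition hom :: "('o, 'a) cat \<Rightarrow> 'o \<Rightarrow> 'o \<Rightarrow> 'a set" where
  "hom C x y = {f \<in> Arr C. Dom C f = x \<and> Cod C f = y}"

locale category =
  fixes C :: "('o, 'a) cat"
  assumes Dom_in: "f \<in> Arr C \<Longrightarrow> Dom C f \<in> Obj C"
    and Cod_in: "f \<in> Arr C \<Longrightarrow> Cod C f \<in> Obj C"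
    and Id_in: "x \<in> Obj C \<Longrightarrow> Id C x \<in> hom C x x"
    and Comp_in: "\<lbrakk>f \<in> hom C x y; g \<in> hom C y z\<rbrakk> \<Longrightarrow> g \<cdot>\<^bsub>C\<^esub> f \<in> hom C x z"
    and Comp_Id: "f \<in> hom C x y \<Longrightarrow> f \<cdot>\<^bsub>C\<^esub> Id C x = f"
    and Id_Comp: "f \<in> hom C x y \<Longrightarrow> Id C y \<cdot>\<^bsub>C\<^esub> f = f"
    and Comp_assoc: "\<lbrakk>f \<in> hom C w x; g \<in> hom C x y; h \<in> hom C y z\<rbrakk> \<Longrightarrow>
      h \<cdot>\<^bsub>C\<^esub> g \<cdot>\<^bsub>C\<^esub> f = h \<cdot>\<^bsub>C\<^esub> (g \<cdot>\<^bsub>C\<^esub> f)"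

definition is_iso :: "('o, 'a) cat \<Rightarrow> 'a \<Rightarrow> bool" where
  "is_iso C f \<longleftrightarrow> f \<in> Arr C \<and>
     (\<exists>g \<in> hom C (Cod C f) (Dom C f).
        g \<cdot>\<^bsub>C\<^esub> f = Id C (Dom C f) \<and> f \<cdot>\<^bsub>C\<^esub> g = Id C (Cod C f))"

text \<open>Functors carry their source and target, and their maps are extensional (undefined outside
  the source category), so that equality of functors is equality of records.  The same applies to
  natural transformations.\<close>

record ('o, 'a, 'p, 'b) func =
  Src :: "('o, 'a) cat"
  Tgt :: "('p, 'b) cat"
  OMap :: "'o \<Rightarrow> 'p"
  AMap :: "'a \<Rightarrow> 'b"

locale cat_functor =
  S: category "Src F" + T: category "Tgt F" for F :: "('o, 'a, 'p, 'b) func" +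
  assumes OMap_in: "x \<in> Obj (Src F) \<Longrightarrow> OMap F x \<in> Obj (Tgt F)"
    and AMap_in: "f \<in> hom (Src F) x y \<Longrightarrow> AMap F f \<in> hom (Tgt F) (OMap F x) (OMap F y)"
    and AMap_Id: "x \<in> Obj (Src F) \<Longrightarrow> AMap F (Id (Src F) x) = Id (Tgt F) (OMap F x)"
    and AMap_Comp: "\<lbrakk>f \<in> hom (Src F) x y; g \<in> hom (Src F) y z\<rbrakk> \<Longrightarrow>
      AMap F (g \<cdot>\<^bsub>Src F\<^esub> f) = AMap F g \<cdot>\<^bsub>Tgt F\<^esub> AMap F f"
    and OMap_ext: "OMap F \<in> extensional (Obj (Src F))"
    and AMap_ext: "AMap F \<in> extensional (Arr (Src F))"

definition func_id :: "('o, 'a) cat \<Rightarrow> ('o, 'a, 'o, 'a) func" where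
  "func_id C = \<lparr>Src = C, Tgt = C, OMap = (\<lambda>x\<in>Obj C. x), AMap = (\<lambda>f\<in>Arr C. f)\<rparr>"

definition func_comp ::
  "('p, 'b, 'q, 'c) func \<Rightarrow> ('o, 'a, 'p, 'b) func \<Rightarrow> ('o, 'a, 'q, 'c) func" where
  "func_comp G F = \<lparr>Src = Src F, Tgt = Tgt G,
     OMap = compose (Obj (Src F)) (OMap G) (OMap F),
     AMap = compose (Arr (Src F)) (AMap G) (AMap F)\<rparr>"

record ('o, 'a, 'p, 'b) nt =
  NSrc :: "('o, 'a, 'p, 'b) func"
  NTgt :: "('o, 'a, 'p, 'b) func"
  NMap :: "'o \<Rightarrow> 'b"

locale nat_trans =
  F: cat_functor "NSrc \<tau>" + G: cat_functor "NTgt \<tau>" for \<tau> :: "('o, 'a, 'p, 'b) nt" +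
  assumes Src_eq: "Src (NTgt \<tau>) = Src (NSrc \<tau>)"
    and Tgt_eq: "Tgt (NTgt \<tau>) = Tgt (NSrc \<tau>)"
    and NMap_in: "x \<in> Obj (Src (NSrc \<tau>)) \<Longrightarrow>
      NMap \<tau> x \<in> hom (Tgt (NSrc \<tau>)) (OMap (NSrc \<tau>) x) (OMap (NTgt \<tau>) x)"
    and naturality: "f \<in> hom (Src (NSrc \<tau>)) x y \<Longrightarrow>
      NMap \<tau> y \<cdot>\<^bsub>Tgt (NSrc \<tau>)\<^esub> AMap (NSrc \<tau>) f = AMap (NTgt \<tau>) f \<cdot>\<^bsub>Tgt (NSrc \<tau>)\<^esub> NMap \<tau> x"
    and NMap_ext: "NMap \<tau> \<in> extensional (Obj (Src (NSrc \<tau>)))"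

definition nat_iso :: "('o, 'a, 'p, 'b) nt \<Rightarrow> bool" where
  "nat_iso \<tau> \<longleftrightarrow> nat_trans \<tau> \<and> (\<forall>x \<in> Obj (Src (NSrc \<tau>)). is_iso (Tgt (NSrc \<tau>)) (NMap \<tau> x))"

definition nt_id :: "('o, 'a, 'p, 'b) func \<Rightarrow> ('o, 'a, 'p, 'b) nt" where
  "nt_id F = \<lparr>NSrc = F, NTgt = F, NMap = (\<lambda>x\<in>Obj (Src F). Id (Tgt F) (OMap F x))\<rparr>"

definition nt_vcomp ::
  "('o, 'a, 'p, 'b) nt \<Rightarrow> ('o, 'a, 'p, 'b) nt \<Rightarrow> ('o, 'a, 'p, 'b) nt" where
  "nt_vcomp \<tau> \<sigma> = \<lparr>NSrc = NSrc \<sigma>, NTgt = NTgt \<tau>,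
     NMap = (\<lambda>x\<in>Obj (Src (NSrc \<sigma>)). NMap \<tau> x \<cdot>\<^bsub>Tgt (NSrc \<sigma>)\<^esub> NMap \<sigma> x)\<rparr>"

definition nt_hcomp ::
  "('p, 'b, 'q, 'c) nt \<Rightarrow> ('o, 'a, 'p, 'b) nt \<Rightarrow> ('o, 'a, 'q, 'c) nt" where
  "nt_hcomp \<tau> \<sigma> = \<lparr>NSrc = func_comp (NSrc \<tau>) (NSrc \<sigma>), NTgt = func_comp (NTgt \<tau>) (NTgt \<sigma>),
     NMap = (\<lambda>x\<in>Obj (Src (NSrc \<sigma>)).
       NMap \<tau> (OMap (NTgt \<sigma>) x) \<cdot>\<^bsub>Tgt (NSrc \<tau>)\<^esub> AMap (NSrc \<tau>) (NMap \<sigma> x))\<rparr>"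

definition is_equivalence :: "('o, 'a, 'p, 'b) func \<Rightarrow> bool" where
  "is_equivalence F \<longleftrightarrow> cat_functor F \<and>
     (\<exists>G \<eta> \<epsilon>. cat_functor G \<and> Src G = Tgt F \<and> Tgt G = Src F \<and>
        nat_iso \<eta> \<and> NSrc \<eta> = func_id (Src F) \<and> NTgt \<eta> = func_comp G F \<and>
        nat_iso \<epsilon> \<and> NSrc \<epsilon> = func_comp F G \<and> NTgt \<epsilon> = func_id (Tgt F))"

definition is_cone :: "('j, 'k, 'o, 'a) func \<Rightarrow> 'o \<Rightarrow> ('j \<Rightarrow> 'a) \<Rightarrow> bool" where
  "is_cone D x \<pi> \<longleftrightarrow> x \<in> Obj (Tgt D) \<and>
     (\<forall>j \<in> Obj (Src D). \<pi> j \<in> hom (Tgt D) x (OMap D j)) \<and>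
     (\<forall>u \<in> Arr (Src D). AMap D u \<cdot>\<^bsub>Tgt D\<^esub> \<pi> (Dom (Src D) u) = \<pi> (Cod (Src D) u))"

definition is_limit :: "('j, 'k, 'o, 'a) func \<Rightarrow> 'o \<Rightarrow> ('j \<Rightarrow> 'a) \<Rightarrow> bool" where
  "is_limit D x \<pi> \<longleftrightarrow> is_cone D x \<pi> \<and>
     (\<forall>y \<rho>. is_cone D y \<rho> \<longrightarrow>
        (\<exists>!h. h \<in> hom (Tgt D) y x \<and> (\<forall>j \<in> Obj (Src D). \<pi> j \<cdot>\<^bsub>Tgt D\<^esub> h = \<rho> j)))"

text \<open>Every finite category is isomorphic to one whose objects and arrows are natural numbers,
  so it suffices to index finite diagrams by the latter.\<close>

definition finite_diagram :: "(nat, nat, 'o, 'a) func \<Rightarrow> bool" where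
  "finite_diagram D \<longleftrightarrow> cat_functor D \<and> finite (Obj (Src D)) \<and> finite (Arr (Src D))"

definition has_finite_limits :: "('o, 'a) cat \<Rightarrow> bool" where
  "has_finite_limits C \<longleftrightarrow> category C \<and>
     (\<forall>D. finite_diagram D \<and> Tgt D = C \<longrightarrow> (\<exists>x \<pi>. is_limit D x \<pi>))"

definition preserves_finite_limits :: "('o, 'a, 'p, 'b) func \<Rightarrow> bool" where
  "preserves_finite_limits F \<longleftrightarrow>
     (\<forall>D x \<pi>. finite_diagram D \<and> Tgt D = Src F \<and> is_limit D x \<pi> \<longrightarrow>
        is_limit (func_comp F D) (OMap F x) (\<lambda>j. AMap F (\<pi> j)))"

text \<open>A 2-category is given by its underlying category of objects and 1-cells and by the category
  of 1-cells and 2-cells under vertical composition, together with horizontal composition.\<close>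

record ('o, 'm, 'c) twocat =
  Cells1 :: "('o, 'm) cat"
  Cells2 :: "('m, 'c) cat"
  HComp :: "'c \<Rightarrow> 'c \<Rightarrow> 'c"  (infixl "\<star>\<index>" 70)

abbreviation comp1 (infixl "\<circ>\<index>" 70) where
  "g \<circ>\<^bsub>B\<^esub> f \<equiv> g \<cdot>\<^bsub>Cells1 B\<^esub> f"

abbreviation vcomp (infixl "\<bullet>\<index>" 65) where
  "\<beta> \<bullet>\<^bsub>B\<^esub> \<alpha> \<equiv> \<beta> \<cdot>\<^bsub>Cells2 B\<^esub> \<alpha>"

abbreviation lwhisker (infixl "\<rhd>\<index>" 70) where
  "g \<rhd>\<^bsub>B\<^esub> \<alpha> \<equiv> Id (Cells2 B) g \<star>\<^bsub>B\<^esub> \<alpha>"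

abbreviation rwhisker (infixl "\<lhd>\<index>" 70) where
  "\<beta> \<lhd>\<^bsub>B\<^esub> f \<equiv> \<beta> \<star>\<^bsub>B\<^esub> Id (Cells2 B) f"

locale two_category =
  C1: category "Cells1 B" + C2: category "Cells2 B" for B :: "('o, 'm, 'c) twocat" +
  assumes Obj_Cells2: "Obj (Cells2 B) = Arr (Cells1 B)"
    and parallel: "\<alpha> \<in> hom (Cells2 B) f g \<Longrightarrow>
      Dom (Cells1 B) f = Dom (Cells1 B) g \<and> Cod (Cells1 B) f = Cod (Cells1 B) g"
    and HComp_in: "\<lbrakk>\<alpha> \<in> hom (Cells2 B) f f'; \<beta> \<in> hom (Cells2 B) g g';
        Cod (Cells1 B) f = Dom (Cells1 B) g\<rbrakk> \<Longrightarrow>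
      \<beta> \<star>\<^bsub>B\<^esub> \<alpha> \<in> hom (Cells2 B) (g \<circ>\<^bsub>B\<^esub> f) (g' \<circ>\<^bsub>B\<^esub> f')"
    and HComp_Id: "\<lbrakk>f \<in> hom (Cells1 B) X Y; g \<in> hom (Cells1 B) Y Z\<rbrakk> \<Longrightarrow>
      Id (Cells2 B) g \<star>\<^bsub>B\<^esub> Id (Cells2 B) f = Id (Cells2 B) (g \<circ>\<^bsub>B\<^esub> f)"
    and interchange: "\<lbrakk>\<alpha> \<in> hom (Cells2 B) f f'; \<alpha>' \<in> hom (Cells2 B) f' f'';
        \<beta> \<in> hom (Cells2 B) g g'; \<beta>' \<in> hom (Cells2 B) g' g'';
        Cod (Cells1 B) f = Dom (Cells1 B) g\<rbrakk> \<Longrightarrow>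
      (\<beta>' \<bullet>\<^bsub>B\<^esub> \<beta>) \<star>\<^bsub>B\<^esub> (\<alpha>' \<bullet>\<^bsub>B\<^esub> \<alpha>) = (\<beta>' \<star>\<^bsub>B\<^esub> \<alpha>') \<bullet>\<^bsub>B\<^esub> (\<beta> \<star>\<^bsub>B\<^esub> \<alpha>)"
    and lwhisker_Id1: "\<lbrakk>\<alpha> \<in> hom (Cells2 B) f f'; f \<in> hom (Cells1 B) X Y\<rbrakk> \<Longrightarrow>
      Id (Cells1 B) Y \<rhd>\<^bsub>B\<^esub> \<alpha> = \<alpha>"
    and rwhisker_Id1: "\<lbrakk>\<alpha> \<in> hom (Cells2 B) f f'; f \<in> hom (Cells1 B) X Y\<rbrakk> \<Longrightarrow>
      \<alpha> \<lhd>\<^bsub>B\<^esub> Id (Cells1 B) X = \<alpha>"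
    and HComp_assoc: "\<lbrakk>\<alpha> \<in> hom (Cells2 B) f f'; \<beta> \<in> hom (Cells2 B) g g';
        \<gamma> \<in> hom (Cells2 B) h h'; Cod (Cells1 B) f = Dom (Cells1 B) g;
        Cod (Cells1 B) g = Dom (Cells1 B) h\<rbrakk> \<Longrightarrow>
      \<gamma> \<star>\<^bsub>B\<^esub> \<beta> \<star>\<^bsub>B\<^esub> \<alpha> = \<gamma> \<star>\<^bsub>B\<^esub> (\<beta> \<star>\<^bsub>B\<^esub> \<alpha>)"

definition homcat :: "('o, 'm, 'c) twocat \<Rightarrow> 'o \<Rightarrow> 'o \<Rightarrow> ('m, 'c) cat" where
  "homcat B X Y = \<lparr>Obj = hom (Cells1 B) X Y,
     Arr = {\<alpha> \<in> Arr (Cells2 B). Dom (Cells2 B) \<alpha> \<in> hom (Cells1 B) X Y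
                             \<and> Cod (Cells2 B) \<alpha> \<in> hom (Cells1 B) X Y},
     Dom = Dom (Cells2 B), Cod = Cod (Cells2 B), Id = Id (Cells2 B), Comp = Comp (Cells2 B)\<rparr>"

locale bifiltered = two_category I for I :: "('i, 'd, 'e) twocat" +
  assumes nonempty: "Obj (Cells1 I) \<noteq> {}"
    and cospan: "\<lbrakk>i \<in> Obj (Cells1 I); i' \<in> Obj (Cells1 I)\<rbrakk> \<Longrightarrow>
      \<exists>i'' d d'. d \<in> hom (Cells1 I) i i'' \<and> d' \<in> hom (Cells1 I) i' i''"
    and coinsert: "\<lbrakk>d \<in> hom (Cells1 I) i i'; d' \<in> hom (Cells1 I) i i'\<rbrakk> \<Longrightarrow>
      \<exists>i'' f \<alpha>. f \<in> hom (Cells1 I) i' i'' \<and>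
        \<alpha> \<in> hom (Cells2 I) (f \<circ>\<^bsub>I\<^esub> d) (f \<circ>\<^bsub>I\<^esub> d') \<and> is_iso (Cells2 I) \<alpha>"
    and coequify: "\<lbrakk>d \<in> hom (Cells1 I) i i'; \<alpha> \<in> hom (Cells2 I) d d'; \<alpha>' \<in> hom (Cells2 I) d d'\<rbrakk> \<Longrightarrow>
      \<exists>i'' f. f \<in> hom (Cells1 I) i' i'' \<and> f \<rhd>\<^bsub>I\<^esub> \<alpha> = f \<rhd>\<^bsub>I\<^esub> \<alpha>'"

text \<open>\<open>PUnit F i\<close> is the invertible 2-cell from the identity of \<open>F i\<close> to the image of the identity
  of \<open>i\<close>, and \<open>PComp F e d\<close> is the invertible 2-cell from \<open>F e \<circ> F d\<close> to \<open>F (e \<circ> d)\<close>.\<close>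

record ('i, 'd, 'e, 'o, 'm, 'c) psfun =
  P0 :: "'i \<Rightarrow> 'o"
  P1 :: "'d \<Rightarrow> 'm"
  P2 :: "'e \<Rightarrow> 'c"
  PUnit :: "'i \<Rightarrow> 'c"
  PComp :: "'d \<Rightarrow> 'd \<Rightarrow> 'c"

locale pseudofunctor = I: two_category I + B: two_category B
  for I :: "('i, 'd, 'e) twocat" and B :: "('o, 'm, 'c) twocat"
    and F :: "('i, 'd, 'e, 'o, 'm, 'c) psfun" +
  assumes P0_in: "i \<in> Obj (Cells1 I) \<Longrightarrow> P0 F i \<in> Obj (Cells1 B)"
    and P1_in: "d \<in> hom (Cells1 I) i j \<Longrightarrow> P1 F d \<in> hom (Cells1 B) (P0 F i) (P0 F j)"
    and P2_in: "\<alpha> \<in> hom (Cells2 I) d d' \<Longrightarrow> P2 F \<alpha> \<in> hom (Cells2 B) (P1 F d) (P1 F d')"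
    and P2_Id: "d \<in> Arr (Cells1 I) \<Longrightarrow> P2 F (Id (Cells2 I) d) = Id (Cells2 B) (P1 F d)"
    and P2_vcomp: "\<lbrakk>\<alpha> \<in> hom (Cells2 I) d d'; \<beta> \<in> hom (Cells2 I) d' d''\<rbrakk> \<Longrightarrow>
      P2 F (\<beta> \<bullet>\<^bsub>I\<^esub> \<alpha>) = P2 F \<beta> \<bullet>\<^bsub>B\<^esub> P2 F \<alpha>"
    and PUnit_in: "i \<in> Obj (Cells1 I) \<Longrightarrow>
      PUnit F i \<in> hom (Cells2 B) (Id (Cells1 B) (P0 F i)) (P1 F (Id (Cells1 I) i))"
    and PUnit_iso: "i \<in> Obj (Cells1 I) \<Longrightarrow> is_iso (Cells2 B) (PUnit F i)"
    and PComp_in: "\<lbrakk>d \<in> hom (Cells1 I) i j; e \<in> hom (Cells1 I) j k\<rbrakk> \<Longrightarrow>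
      PComp F e d \<in> hom (Cells2 B) (P1 F e \<circ>\<^bsub>B\<^esub> P1 F d) (P1 F (e \<circ>\<^bsub>I\<^esub> d))"
    and PComp_iso: "\<lbrakk>d \<in> hom (Cells1 I) i j; e \<in> hom (Cells1 I) j k\<rbrakk> \<Longrightarrow>
      is_iso (Cells2 B) (PComp F e d)"
    and PComp_natural: "\<lbrakk>d \<in> hom (Cells1 I) i j; e \<in> hom (Cells1 I) j k;
        \<alpha> \<in> hom (Cells2 I) d d'; \<beta> \<in> hom (Cells2 I) e e'\<rbrakk> \<Longrightarrow>
      P2 F (\<beta> \<star>\<^bsub>I\<^esub> \<alpha>) \<bullet>\<^bsub>B\<^esub> PComp F e d = PComp F e' d' \<bullet>\<^bsub>B\<^esub> (P2 F \<beta> \<star>\<^bsub>B\<^esub> P2 F \<alpha>)"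
    and PComp_assoc: "\<lbrakk>c \<in> hom (Cells1 I) h i; d \<in> hom (Cells1 I) i j; e \<in> hom (Cells1 I) j k\<rbrakk> \<Longrightarrow>
      PComp F e (d \<circ>\<^bsub>I\<^esub> c) \<bullet>\<^bsub>B\<^esub> (P1 F e \<rhd>\<^bsub>B\<^esub> PComp F d c)
        = PComp F (e \<circ>\<^bsub>I\<^esub> d) c \<bullet>\<^bsub>B\<^esub> (PComp F e d \<lhd>\<^bsub>B\<^esub> P1 F c)"
    and PComp_unit_right: "d \<in> hom (Cells1 I) i j \<Longrightarrow>
      PComp F d (Id (Cells1 I) i) \<bullet>\<^bsub>B\<^esub> (P1 F d \<rhd>\<^bsub>B\<^esub> PUnit F i) = Id (Cells2 B) (P1 F d)"
    and PComp_unit_left: "d \<in> hom (Cells1 I) i j \<Longrightarrow>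
      PComp F (Id (Cells1 I) j) d \<bullet>\<^bsub>B\<^esub> (PUnit F j \<lhd>\<^bsub>B\<^esub> P1 F d) = Id (Cells2 B) (P1 F d)"

text \<open>A pseudococone from \<open>F\<close> to \<open>X\<close> consists of 1-cells \<open>Leg q i : F i \<rightarrow> X\<close> and invertible 2-cells
  \<open>Cell q d : Leg q j \<circ> F d \<Rightarrow> Leg q i\<close> for \<open>d : i \<rightarrow> j\<close>.\<close>

record ('i, 'd, 'm, 'c) cocone =
  Leg :: "'i \<Rightarrow> 'm"
  Cell :: "'d \<Rightarrow> 'c"

locale pseudococone =
  fixes I :: "('i, 'd, 'e) twocat" and B :: "('o, 'm, 'c) twocat"
    and F :: "('i, 'd, 'e, 'o, 'm, 'c) psfun" and X :: 'o and q :: "('i, 'd, 'm, 'c) cocone"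
  assumes vertex_in: "X \<in> Obj (Cells1 B)"
    and Leg_in: "i \<in> Obj (Cells1 I) \<Longrightarrow> Leg q i \<in> hom (Cells1 B) (P0 F i) X"
    and Cell_in: "d \<in> hom (Cells1 I) i j \<Longrightarrow>
      Cell q d \<in> hom (Cells2 B) (Leg q j \<circ>\<^bsub>B\<^esub> P1 F d) (Leg q i)"
    and Cell_iso: "d \<in> Arr (Cells1 I) \<Longrightarrow> is_iso (Cells2 B) (Cell q d)"
    and Cell_natural: "\<lbrakk>d \<in> hom (Cells1 I) i j; \<alpha> \<in> hom (Cells2 I) d d'\<rbrakk> \<Longrightarrow>
      Cell q d' \<bullet>\<^bsub>B\<^esub> (Leg q j \<rhd>\<^bsub>B\<^esub> P2 F \<alpha>) = Cell q d"
    and Cell_Id: "i \<in> Obj (Cells1 I) \<Longrightarrow>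
      Cell q (Id (Cells1 I) i) \<bullet>\<^bsub>B\<^esub> (Leg q i \<rhd>\<^bsub>B\<^esub> PUnit F i) = Id (Cells2 B) (Leg q i)"
    and Cell_comp: "\<lbrakk>d \<in> hom (Cells1 I) i j; e \<in> hom (Cells1 I) j k\<rbrakk> \<Longrightarrow>
      Cell q (e \<circ>\<^bsub>I\<^esub> d) \<bullet>\<^bsub>B\<^esub> (Leg q k \<rhd>\<^bsub>B\<^esub> PComp F e d) = Cell q d \<bullet>\<^bsub>B\<^esub> (Cell q e \<lhd>\<^bsub>B\<^esub> P1 F d)"
    and Leg_ext: "Leg q \<in> extensional (Obj (Cells1 I))"
    and Cell_ext: "Cell q \<in> extensional (Arr (Cells1 I))"

record ('i, 'd, 'm, 'c) modif =
  MSrc :: "('i, 'd, 'm, 'c) cocone"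
  MTgt :: "('i, 'd, 'm, 'c) cocone"
  MMap :: "'i \<Rightarrow> 'c"

locale modification =
  fixes I :: "('i, 'd, 'e) twocat" and B :: "('o, 'm, 'c) twocat"
    and F :: "('i, 'd, 'e, 'o, 'm, 'c) psfun" and X :: 'o and m :: "('i, 'd, 'm, 'c) modif"
  assumes MSrc_cocone: "pseudococone I B F X (MSrc m)"
    and MTgt_cocone: "pseudococone I B F X (MTgt m)"
    and MMap_in: "i \<in> Obj (Cells1 I) \<Longrightarrow> MMap m i \<in> hom (Cells2 B) (Leg (MSrc m) i) (Leg (MTgt m) i)"
    and MMap_Cell: "d \<in> hom (Cells1 I) i j \<Longrightarrow>
      MMap m i \<bullet>\<^bsub>B\<^esub> Cell (MSrc m) d = Cell (MTgt m) d \<bullet>\<^bsub>B\<^esub> (MMap m j \<lhd>\<^bsub>B\<^esub> P1 F d)"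
    and MMap_ext: "MMap m \<in> extensional (Obj (Cells1 I))"

definition pscocones ::
  "('i, 'd, 'e) twocat \<Rightarrow> ('o, 'm, 'c) twocat \<Rightarrow> ('i, 'd, 'e, 'o, 'm, 'c) psfun \<Rightarrow> 'o \<Rightarrow>
   (('i, 'd, 'm, 'c) cocone, ('i, 'd, 'm, 'c) modif) cat" where
  "pscocones I B F X = \<lparr>
     Obj = {q. pseudococone I B F X q},
     Arr = {m. modification I B F X m},
     Dom = MSrc,
     Cod = MTgt,
     Id = (\<lambda>q. \<lparr>MSrc = q, MTgt = q, MMap = (\<lambda>i\<in>Obj (Cells1 I). Id (Cells2 B) (Leg q i))\<rparr>),
     Comp = (\<lambda>n m. \<lparr>MSrc = MSrc m, MTgt = MTgt n,
                     MMap = (\<lambda>i\<in>Obj (Cells1 I). MMap n i \<bullet>\<^bsub>B\<^esub> MMap m i)\<rparr>)\<rparr>"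

text \<open>The action of \<open>B[L, -]\<close> and of \<open>X \<mapsto> pscocones I B F X\<close> on 1-cells and 2-cells of \<open>B\<close>.
  Together with \<open>homcat B L\<close> and \<open>pscocones I B F\<close> they are strict 2-functors into categories.\<close>

definition hom_post1 ::
  "('o, 'm, 'c) twocat \<Rightarrow> 'o \<Rightarrow> 'm \<Rightarrow> ('m, 'c, 'm, 'c) func" where
  "hom_post1 B L f = \<lparr>
     Src = homcat B L (Dom (Cells1 B) f),
     Tgt = homcat B L (Cod (Cells1 B) f),
     OMap = (\<lambda>g\<in>Obj (homcat B L (Dom (Cells1 B) f)). f \<circ>\<^bsub>B\<^esub> g),
     AMap = (\<lambda>\<alpha>\<in>Arr (homcat B L (Dom (Cells1 B) f)). f \<rhd>\<^bsub>B\<^esub> \<alpha>)\<rparr>"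

definition hom_post2 ::
  "('o, 'm, 'c) twocat \<Rightarrow> 'o \<Rightarrow> 'c \<Rightarrow> ('m, 'c, 'm, 'c) nt" where
  "hom_post2 B L \<phi> = \<lparr>
     NSrc = hom_post1 B L (Dom (Cells2 B) \<phi>),
     NTgt = hom_post1 B L (Cod (Cells2 B) \<phi>),
     NMap = (\<lambda>g\<in>Obj (homcat B L (Dom (Cells1 B) (Dom (Cells2 B) \<phi>))). \<phi> \<lhd>\<^bsub>B\<^esub> g)\<rparr>"

definition whisker_cocone ::
  "('i, 'd, 'e) twocat \<Rightarrow> ('o, 'm, 'c) twocat \<Rightarrow> 'm \<Rightarrow>
   ('i, 'd, 'm, 'c) cocone \<Rightarrow> ('i, 'd, 'm, 'c) cocone" where
  "whisker_cocone I B f q = \<lparr>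
     Leg = (\<lambda>i\<in>Obj (Cells1 I). f \<circ>\<^bsub>B\<^esub> Leg q i),
     Cell = (\<lambda>d\<in>Arr (Cells1 I). f \<rhd>\<^bsub>B\<^esub> Cell q d)\<rparr>"

definition cocone_post1 ::
  "('i, 'd, 'e) twocat \<Rightarrow> ('o, 'm, 'c) twocat \<Rightarrow> ('i, 'd, 'e, 'o, 'm, 'c) psfun \<Rightarrow> 'm \<Rightarrow>
   (('i, 'd, 'm, 'c) cocone, ('i, 'd, 'm, 'c) modif,
    ('i, 'd, 'm, 'c) cocone, ('i, 'd, 'm, 'c) modif) func" where
  "cocone_post1 I B F f = \<lparr>
     Src = pscocones I B F (Dom (Cells1 B) f),
     Tgt = pscocones I B F (Cod (Cells1 B) f),
     OMap = (\<lambda>q\<in>Obj (pscocones I B F (Dom (Cells1 B) f)). whisker_cocone I B f q),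
     AMap = (\<lambda>m\<in>Arr (pscocones I B F (Dom (Cells1 B) f)).
       \<lparr>MSrc = whisker_cocone I B f (MSrc m), MTgt = whisker_cocone I B f (MTgt m),
        MMap = (\<lambda>i\<in>Obj (Cells1 I). f \<rhd>\<^bsub>B\<^esub> MMap m i)\<rparr>)\<rparr>"

definition cocone_post2 ::
  "('i, 'd, 'e) twocat \<Rightarrow> ('o, 'm, 'c) twocat \<Rightarrow> ('i, 'd, 'e, 'o, 'm, 'c) psfun \<Rightarrow> 'c \<Rightarrow>
   (('i, 'd, 'm, 'c) cocone, ('i, 'd, 'm, 'c) modif,
    ('i, 'd, 'm, 'c) cocone, ('i, 'd, 'm, 'c) modif) nt" where
  "cocone_post2 I B F \<phi> = \<lparr>
     NSrc = cocone_post1 I B F (Dom (Cells2 B) \<phi>),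
     NTgt = cocone_post1 I B F (Cod (Cells2 B) \<phi>),
     NMap = (\<lambda>q\<in>Obj (pscocones I B F (Dom (Cells1 B) (Dom (Cells2 B) \<phi>))).
       \<lparr>MSrc = whisker_cocone I B (Dom (Cells2 B) \<phi>) q,
        MTgt = whisker_cocone I B (Cod (Cells2 B) \<phi>) q,
        MMap = (\<lambda>i\<in>Obj (Cells1 I). \<phi> \<lhd>\<^bsub>B\<^esub> Leg q i)\<rparr>)\<rparr>"

text \<open>Equivalences \<open>E X : H X \<rightarrow> K X\<close>, pseudonatural in the object \<open>X\<close> of \<open>B\<close>, between two strict
  2-functors \<open>H\<close> and \<open>K\<close> from \<open>B\<close> to categories, with invertible structure 2-cells
  \<open>\<theta> f : K f \<circ> E X \<Rightarrow> E Y \<circ> H f\<close> for \<open>f : X \<rightarrow> Y\<close>.\<close>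

locale pseudonatural_equivalence =
  fixes B :: "('o, 'm, 'c) twocat"
    and H0 :: "'o \<Rightarrow> ('p, 'a) cat"
    and H1 :: "'m \<Rightarrow> ('p, 'a, 'p, 'a) func"
    and H2 :: "'c \<Rightarrow> ('p, 'a, 'p, 'a) nt"
    and K0 :: "'o \<Rightarrow> ('q, 'b) cat"
    and K1 :: "'m \<Rightarrow> ('q, 'b, 'q, 'b) func"
    and K2 :: "'c \<Rightarrow> ('q, 'b, 'q, 'b) nt"
    and E :: "'o \<Rightarrow> ('p, 'a, 'q, 'b) func"
    and \<theta> :: "'m \<Rightarrow> ('p, 'a, 'q, 'b) nt"
  assumes E_equiv: "X \<in> Obj (Cells1 B) \<Longrightarrow>
      is_equivalence (E X) \<and> Src (E X) = H0 X \<and> Tgt (E X) = K0 X"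
    and \<theta>_iso: "f \<in> hom (Cells1 B) X Y \<Longrightarrow>
      nat_iso (\<theta> f) \<and> NSrc (\<theta> f) = func_comp (K1 f) (E X) \<and> NTgt (\<theta> f) = func_comp (E Y) (H1 f)"
    and \<theta>_natural: "\<lbrakk>f \<in> hom (Cells1 B) X Y; \<phi> \<in> hom (Cells2 B) f g\<rbrakk> \<Longrightarrow>
      nt_vcomp (\<theta> g) (nt_hcomp (K2 \<phi>) (nt_id (E X)))
        = nt_vcomp (nt_hcomp (nt_id (E Y)) (H2 \<phi>)) (\<theta> f)"
    and \<theta>_Id: "X \<in> Obj (Cells1 B) \<Longrightarrow> \<theta> (Id (Cells1 B) X) = nt_id (E X)"
    and \<theta>_comp: "\<lbrakk>f \<in> hom (Cells1 B) X Y; g \<in> hom (Cells1 B) Y Z\<rbrakk> \<Longrightarrow>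
      \<theta> (g \<circ>\<^bsub>B\<^esub> f)
        = nt_vcomp (nt_hcomp (\<theta> g) (nt_id (H1 f))) (nt_hcomp (nt_id (K1 g)) (\<theta> f))"

text \<open>\<open>L\<close> is a bicolimit of \<open>F\<close> in \<open>B\<close> with bicolimit inclusions \<open>q\<close>: the inclusions are the
  pseudococone which the equivalence at \<open>L\<close> assigns to the identity of \<open>L\<close>.\<close>

definition is_bicolimit ::
  "('i, 'd, 'e) twocat \<Rightarrow> ('o, 'm, 'c) twocat \<Rightarrow> ('i, 'd, 'e, 'o, 'm, 'c) psfun \<Rightarrow> 'o \<Rightarrow>
   ('i, 'd, 'm, 'c) cocone \<Rightarrow> bool" where
  "is_bicolimit I B F L q \<longleftrightarrow> L \<in> Obj (Cells1 B) \<and>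
     (\<exists>E \<theta>. pseudonatural_equivalence B
        (homcat B L) (hom_post1 B L) (hom_post2 B L)
        (pscocones I B F) (cocone_post1 I B F) (cocone_post2 I B F) E \<theta> \<and>
        q = OMap (E L) (Id (Cells1 B) L))"

text \<open>HOL has no type of all small sets.  A type \<open>'u\<close> whose cardinality is infinite and regular plays
  the role of a universe, a set being small if it has fewer elements than \<open>'u\<close>.  This covers
  cardinalities that are inaccessible, as for a Grothendieck universe, but also successor
  cardinalities, for which small means bounded by a fixed infinite cardinal.  Up to isomorphism,
  small categories have their objects and arrows in \<open>'u\<close>.\<close>

definition universe :: "'u itself \<Rightarrow> bool" where
  "universe _ \<longleftrightarrow> infinite (UNIV :: 'u set) \<and> regularCard |UNIV :: 'u set|"

definition small :: "'u itself \<Rightarrow> 'a set \<Rightarrow> bool" where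
  "small _ A \<longleftrightarrow> |A| <o |UNIV :: 'u set|"

definition small_cat :: "('u, 'u) cat \<Rightarrow> bool" where
  "small_cat C \<longleftrightarrow> category C \<and> small TYPE('u) (Obj C) \<and> small TYPE('u) (Arr C)"

definition small_twocat :: "'u itself \<Rightarrow> ('i, 'd, 'e) twocat \<Rightarrow> bool" where
  "small_twocat U I \<longleftrightarrow> two_category I \<and>
     small U (Obj (Cells1 I)) \<and> small U (Arr (Cells1 I)) \<and> small U (Arr (Cells2 I))"

definition lex_cat :: "('u, 'u) cat \<Rightarrow> bool" where
  "lex_cat C \<longleftrightarrow> small_cat C \<and> has_finite_limits C"

definition small_functor :: "('u, 'u, 'u, 'u) func \<Rightarrow> bool" where
  "small_functor F \<longleftrightarrow> cat_functor F \<and> small_cat (Src F) \<and> small_cat (Tgt F)"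

definition lex_functor :: "('u, 'u, 'u, 'u) func \<Rightarrow> bool" where
  "lex_functor F \<longleftrightarrow> cat_functor F \<and> lex_cat (Src F) \<and> lex_cat (Tgt F) \<and> preserves_finite_limits F"

definition Cat :: "(('u, 'u) cat, ('u, 'u, 'u, 'u) func, ('u, 'u, 'u, 'u) nt) twocat" where
  "Cat = \<lparr>
     Cells1 = \<lparr>Obj = {C. small_cat C}, Arr = {F. small_functor F},
       Dom = Src, Cod = Tgt, Id = func_id, Comp = func_comp\<rparr>,
     Cells2 = \<lparr>Obj = {F. small_functor F},
       Arr = {\<tau>. nat_trans \<tau> \<and> small_functor (NSrc \<tau>) \<and> small_functor (NTgt \<tau>)},
       Dom = NSrc, Cod = NTgt, Id = nt_id, Comp = nt_vcomp\<rparr>,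
     HComp = nt_hcomp\<rparr>"

text \<open>The cells of \<open>Lex\<close> are literally cells of \<open>Cat\<close>, with the same operations, so the forgetful
  2-functor is the identity on cells, and the diagram of categories underlying a pseudofunctor
  \<open>F\<close> into \<open>Lex\<close> is \<open>F\<close> itself, regarded as a pseudofunctor into \<open>Cat\<close>.\<close>

definition Lex :: "(('u, 'u) cat, ('u, 'u, 'u, 'u) func, ('u, 'u, 'u, 'u) nt) twocat" where
  "Lex = \<lparr>
     Cells1 = \<lparr>Obj = {C. lex_cat C}, Arr = {F. lex_functor F},
       Dom = Src, Cod = Tgt, Id = func_id, Comp = func_comp\<rparr>,
     Cells2 = \<lparr>Obj = {F. lex_functor F},
       Arr = {\<tau>. nat_trans \<tau> \<and> lex_functor (NSrc \<tau>) \<and> lex_functor (NTgt \<tau>)},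
       Dom = NSrc, Cod = NTgt, Id = nt_id, Comp = nt_vcomp\<rparr>,
     HComp = nt_hcomp\<rparr>"

end

theory Submission
  imports Defs
begin

text \<open>The bicolimit in \<open>Cat\<close> is built from germs.  An object is an object of some \<open>F i\<close>; an arrow from
  \<open>x\<close> in \<open>F i\<close> to \<open>y\<close> in \<open>F j\<close> is a germ of arrows \<open>F d x \<rightarrow> F e y\<close> in \<open>F k\<close>, for \<open>d : i \<rightarrow> k\<close> and
  \<open>e : j \<rightarrow> k\<close>.  Bifilteredness makes germs compose: two stages can be compared at a third one,
  in an essentially unique way.

  A pseudococone with vertex \<open>X\<close> is a bicolimit if and only if every object of \<open>X\<close> is isomorphic to one
  that comes from a stage, every arrow between such objects comes from a later stage, and
  arrows of a stage that agree in \<open>X\<close> already agree at a later stage.  A finite diagram in \<open>X\<close> is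
  determined by finitely many arrows and equations, so it lifts, up to isomorphism, to a single stage
  \<open>F m\<close>.  There it has a limit.  The transition functors preserve this limit, and every cone over
  the diagram in \<open>X\<close> also comes from a later stage, so the image of the limit in \<open>X\<close> is a limit.

  Thus \<open>X\<close> has finite limits, the inclusions preserve them, and a functor on \<open>X\<close> is lex as soon as its
  composites with the inclusions are.  Therefore the equivalence between functors and pseudococones
  for \<open>Cat\<close> restricts to one for \<open>Lex\<close>.\<close>

section \<open>Categories, functors and natural transformations\<close>

text \<open>\<open>F\<close> is only a pseudofunctor, so a direct calculus of germs would carry its
  coherence cells through every equation. The strict model \<open>T\<close> confines them to the
  arrow map \<open>push\<close>: an object of stage \<open>k\<close> is a formal pair
  \<open>(d, x)\<close>, and pushing along \<open>u\<close> merely composes the first component. The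
  2-cells of \<open>I\<close> remain, because 1-cells into a later stage can be matched only up to a
  chosen invertible 2-cell. Any two choices are reconciled by \<open>coequify\<close>, and
  \<open>K_natural\<close> transports arrows across them. For the same reason, truth at some later
  stage becomes a usable notion only if it also respects invertible 2-cells; \<open>stable\<close>
  records this, and then finitely many such facts hold at one stage. The theorem speaks of every
  bicolimit in \<open>Cat\<close>, not only of the category of germs, so the limit argument is
  carried out for any pseudococone with the three germ conditions. Finally, \<open>Lex\<close>
  contains all natural transformations between lex functors, so in the passage from
  \<open>Cat\<close> to \<open>Lex\<close> only essential surjectivity on pseudococones asks for a
  new argument.\<close>

lemma in_hom: "f \<in> hom C x y \<longleftrightarrow> f \<in> Arr C \<and> Dom C f = x \<and> Cod C f = y"
  by (simp add: hom_def)

lemma Dom_Obj [simp]: "category C \<Longrightarrow> f \<in> Arr C \<Longrightarrow> Dom C f \<in> Obj C"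
  by (rule category.Dom_in)

lemma Cod_Obj [simp]: "category C \<Longrightarrow> f \<in> Arr C \<Longrightarrow> Cod C f \<in> Obj C"
  by (rule category.Cod_in)

lemma Id_hom [simp]:
  assumes "category C" "x \<in> Obj C"
  shows "Id C x \<in> Arr C" "Dom C (Id C x) = x" "Cod C (Id C x) = x"
  using category.Id_in[OF assms] by (auto simp: in_hom)

lemma Comp_hom [simp]:
  assumes "category C" "f \<in> Arr C" "g \<in> Arr C" "Cod C f = Dom C g"
  shows "g \<cdot>\<^bsub>C\<^esub> f \<in> Arr C" "Dom C (g \<cdot>\<^bsub>C\<^esub> f) = Dom C f" "Cod C (g \<cdot>\<^bsub>C\<^esub> f) = Cod C g"
  using category.Comp_in[OF assms(1), of f "Dom C f" "Cod C f" g "Cod C g"] assms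
  by (auto simp: in_hom)

lemma Comp_Id_right [simp]:
  "category C \<Longrightarrow> f \<in> Arr C \<Longrightarrow> Dom C f = x \<Longrightarrow> f \<cdot>\<^bsub>C\<^esub> Id C x = f"
  using category.Comp_Id[of C f x "Cod C f"] by (auto simp: in_hom)

lemma Comp_Id_left [simp]:
  "category C \<Longrightarrow> f \<in> Arr C \<Longrightarrow> Cod C f = x \<Longrightarrow> Id C x \<cdot>\<^bsub>C\<^esub> f = f"
  using category.Id_Comp[of C f "Dom C f" x] by (auto simp: in_hom)

lemma Comp_assoc [simp]:
  assumes "category C" "f \<in> Arr C" "g \<in> Arr C" "h \<in> Arr C" "Cod C f = Dom C g" "Cod C g = Dom C h"
  shows "h \<cdot>\<^bsub>C\<^esub> g \<cdot>\<^bsub>C\<^esub> f = h \<cdot>\<^bsub>C\<^esub> (g \<cdot>\<^bsub>C\<^esub> f)"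
  using category.Comp_assoc[OF assms(1), of f "Dom C f" "Cod C f" g "Cod C g" h "Cod C h"] assms
  by (auto simp: in_hom)

lemma categoryI:
  assumes "\<And>f. f \<in> Arr C \<Longrightarrow> Dom C f \<in> Obj C" "\<And>f. f \<in> Arr C \<Longrightarrow> Cod C f \<in> Obj C"
    and "\<And>x. x \<in> Obj C \<Longrightarrow> Id C x \<in> Arr C \<and> Dom C (Id C x) = x \<and> Cod C (Id C x) = x"
    and "\<And>f g. \<lbrakk>f \<in> Arr C; g \<in> Arr C; Cod C f = Dom C g\<rbrakk> \<Longrightarrow>
      g \<cdot>\<^bsub>C\<^esub> f \<in> Arr C \<and> Dom C (g \<cdot>\<^bsub>C\<^esub> f) = Dom C f \<and> Cod C (g \<cdot>\<^bsub>C\<^esub> f) = Cod C g"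
    and "\<And>f. f \<in> Arr C \<Longrightarrow> f \<cdot>\<^bsub>C\<^esub> Id C (Dom C f) = f"
    and "\<And>f. f \<in> Arr C \<Longrightarrow> Id C (Cod C f) \<cdot>\<^bsub>C\<^esub> f = f"
    and "\<And>f g h. \<lbrakk>f \<in> Arr C; g \<in> Arr C; h \<in> Arr C; Cod C f = Dom C g; Cod C g = Dom C h\<rbrakk> \<Longrightarrow>
      h \<cdot>\<^bsub>C\<^esub> g \<cdot>\<^bsub>C\<^esub> f = h \<cdot>\<^bsub>C\<^esub> (g \<cdot>\<^bsub>C\<^esub> f)"
  shows "category C"
  by unfold_locales (auto simp: in_hom assms)

lemma is_isoI:
  assumes "f \<in> Arr C" "g \<in> Arr C" "Dom C g = Cod C f" "Cod C g = Dom C f"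
    "g \<cdot>\<^bsub>C\<^esub> f = Id C (Dom C f)" "f \<cdot>\<^bsub>C\<^esub> g = Id C (Cod C f)"
  shows "is_iso C f"
  using assms by (auto simp: is_iso_def in_hom)

text \<open>A term for the inverse lets conjugates be written as composites that the simplifier can
  reduce. In a category the choice is harmless because inverses are unique.\<close>

definition inverse_arr :: "('o, 'a) cat \<Rightarrow> 'a \<Rightarrow> 'a" where
  "inverse_arr C f = (SOME g. g \<in> hom C (Cod C f) (Dom C f) \<and>
     g \<cdot>\<^bsub>C\<^esub> f = Id C (Dom C f) \<and> f \<cdot>\<^bsub>C\<^esub> g = Id C (Cod C f))"

lemma is_iso_Arr [simp]: "is_iso C f \<Longrightarrow> f \<in> Arr C"
  by (simp add: is_iso_def)

lemma inverse_arr [simp]: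
  assumes "is_iso C f"
  shows "inverse_arr C f \<in> Arr C" "Dom C (inverse_arr C f) = Cod C f"
    "Cod C (inverse_arr C f) = Dom C f"
    "inverse_arr C f \<cdot>\<^bsub>C\<^esub> f = Id C (Dom C f)" "f \<cdot>\<^bsub>C\<^esub> inverse_arr C f = Id C (Cod C f)"
proof -
  have "\<exists>g. g \<in> hom C (Cod C f) (Dom C f) \<and>
     g \<cdot>\<^bsub>C\<^esub> f = Id C (Dom C f) \<and> f \<cdot>\<^bsub>C\<^esub> g = Id C (Cod C f)"
    using assms unfolding is_iso_def by auto
  from someI_ex[OF this, folded inverse_arr_def]
  show "inverse_arr C f \<in> Arr C" "Dom C (inverse_arr C f) = Cod C f"
    "Cod C (inverse_arr C f) = Dom C f"
    "inverse_arr C f \<cdot>\<^bsub>C\<^esub> f = Id C (Dom C f)" "f \<cdot>\<^bsub>C\<^esub> inverse_arr C f = Id C (Cod C f)"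
    by (auto simp: in_hom)
qed

text \<open>Composites are normalised to the right, so cancellation must also be available in front
  of a further factor \<open>k\<close>.\<close>

lemma inverse_arr_cancel [simp]:
  assumes "category C" "is_iso C f" "k \<in> Arr C"
  shows "Cod C k = Dom C f \<Longrightarrow> inverse_arr C f \<cdot>\<^bsub>C\<^esub> (f \<cdot>\<^bsub>C\<^esub> k) = k"
    and "Cod C k = Cod C f \<Longrightarrow> f \<cdot>\<^bsub>C\<^esub> (inverse_arr C f \<cdot>\<^bsub>C\<^esub> k) = k"
  by (subst Comp_assoc[symmetric]; use assms in \<open>simp del: Comp_assoc\<close>)+

lemma is_iso_inverse [simp]: "is_iso C f \<Longrightarrow> is_iso C (inverse_arr C f)"
  by (rule is_isoI[of _ _ f]) auto

lemma is_iso_Id [simp]: "category C \<Longrightarrow> x \<in> Obj C \<Longrightarrow> is_iso C (Id C x)"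
  by (rule is_isoI[of _ _ "Id C x"]) auto

lemma is_iso_Comp [simp]:
  "\<lbrakk>category C; is_iso C f; is_iso C g; Cod C f = Dom C g\<rbrakk> \<Longrightarrow> is_iso C (g \<cdot>\<^bsub>C\<^esub> f)"
  by (rule is_isoI[of _ _ "inverse_arr C f \<cdot>\<^bsub>C\<^esub> inverse_arr C g"]) auto

lemma iso_cancel_left:
  assumes "category C" "is_iso C f" "g \<in> Arr C" "h \<in> Arr C" "Cod C g = Dom C f" "Cod C h = Dom C f"
    "f \<cdot>\<^bsub>C\<^esub> g = f \<cdot>\<^bsub>C\<^esub> h"
  shows "g = h"
  by (metis assms inverse_arr_cancel(1))

lemma iso_cancel_right:
  assumes "category C" "is_iso C f" "g \<in> Arr C" "h \<in> Arr C" "Dom C g = Cod C f" "Dom C h = Cod C f"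
    "g \<cdot>\<^bsub>C\<^esub> f = h \<cdot>\<^bsub>C\<^esub> f"
  shows "g = h"
proof -
  have "g \<cdot>\<^bsub>C\<^esub> f \<cdot>\<^bsub>C\<^esub> inverse_arr C f = h \<cdot>\<^bsub>C\<^esub> f \<cdot>\<^bsub>C\<^esub> inverse_arr C f"
    using assms(7) by simp
  then show ?thesis using assms(1-6) by simp
qed

lemma inverse_arr_eqI:
  assumes "category C" "is_iso C f" "g \<in> Arr C" "Dom C g = Cod C f" "g \<cdot>\<^bsub>C\<^esub> f = Id C (Dom C f)"
  shows "inverse_arr C f = g"
  by (rule iso_cancel_right[OF assms(1,2)]) (use assms in auto)

text \<open>Passes between a commutative square with two invertible sides and a conjugate. The arrow
  maps \<open>push\<close> and \<open>ev\<close> are defined as conjugates but reasoned about as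
  squares, where no inverses occur.\<close>

lemma Comp_eq_conj_iff:
  assumes "category C" "is_iso C f" "is_iso C g" "h \<in> Arr C" "k \<in> Arr C"
    "Dom C h = Dom C f" "Cod C h = Dom C g" "Dom C k = Cod C f" "Cod C k = Cod C g"
  shows "k \<cdot>\<^bsub>C\<^esub> f = g \<cdot>\<^bsub>C\<^esub> h \<longleftrightarrow> k = g \<cdot>\<^bsub>C\<^esub> (h \<cdot>\<^bsub>C\<^esub> inverse_arr C f)"
proof
  assume *: "k \<cdot>\<^bsub>C\<^esub> f = g \<cdot>\<^bsub>C\<^esub> h"
  show "k = g \<cdot>\<^bsub>C\<^esub> (h \<cdot>\<^bsub>C\<^esub> inverse_arr C f)"
    by (rule iso_cancel_right[OF assms(1,2)]) (use assms * in auto)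
qed (use assms in auto)

section \<open>Functors\<close>

lemma functor_cat [simp]: "cat_functor F \<Longrightarrow> category (Src F)" "cat_functor F \<Longrightarrow> category (Tgt F)"
  by (simp_all add: cat_functor_def)

lemma functor_OMap [simp]:
  "cat_functor F \<Longrightarrow> D = Tgt F \<Longrightarrow> x \<in> Obj (Src F) \<Longrightarrow> OMap F x \<in> Obj D"
  using cat_functor.OMap_in[of F] by auto

lemma functor_AMap [simp]:
  assumes "cat_functor F" "D = Tgt F" "f \<in> Arr (Src F)"
  shows "AMap F f \<in> Arr D" "Dom D (AMap F f) = OMap F (Dom (Src F) f)"
    "Cod D (AMap F f) = OMap F (Cod (Src F) f)"
  using cat_functor.AMap_in[of F f] assms by (auto simp: in_hom)

lemma functor_Id [simp]:
  "cat_functor F \<Longrightarrow> C = Src F \<Longrightarrow> x \<in> Obj C \<Longrightarrow> AMap F (Id C x) = Id (Tgt F) (OMap F x)"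
  by (simp add: cat_functor.AMap_Id)

lemma functor_Comp [simp]:
  assumes "cat_functor F" "C = Src F" "f \<in> Arr C" "g \<in> Arr C" "Cod C f = Dom C g"
  shows "AMap F (g \<cdot>\<^bsub>C\<^esub> f) = AMap F g \<cdot>\<^bsub>Tgt F\<^esub> AMap F f"
  using cat_functor.AMap_Comp[of F f "Dom C f" "Cod C f" g "Cod C g"] assms by (auto simp: in_hom)

lemma functor_iso [simp]:
  assumes "cat_functor F" "D = Tgt F" "is_iso (Src F) f"
  shows "is_iso D (AMap F f)"
proof (rule is_isoI[of _ _ "AMap F (inverse_arr (Src F) f)"])
  show "AMap F (inverse_arr (Src F) f) \<cdot>\<^bsub>D\<^esub> AMap F f = Id D (Dom D (AMap F f))"
    using assms functor_Comp[OF assms(1) refl, of f "inverse_arr (Src F) f"] by simp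
  show "AMap F f \<cdot>\<^bsub>D\<^esub> AMap F (inverse_arr (Src F) f) = Id D (Cod D (AMap F f))"
    using assms functor_Comp[OF assms(1) refl, of "inverse_arr (Src F) f" f] by simp
qed (use assms in auto)

lemma cat_functorI:
  assumes "category (Src F)" "category (Tgt F)"
    and "\<And>x. x \<in> Obj (Src F) \<Longrightarrow> OMap F x \<in> Obj (Tgt F)"
    and "\<And>f. f \<in> Arr (Src F) \<Longrightarrow> AMap F f \<in> hom (Tgt F) (OMap F (Dom (Src F) f)) (OMap F (Cod (Src F) f))"
    and "\<And>x. x \<in> Obj (Src F) \<Longrightarrow> AMap F (Id (Src F) x) = Id (Tgt F) (OMap F x)"
    and "\<And>f g. \<lbrakk>f \<in> Arr (Src F); g \<in> Arr (Src F); Cod (Src F) f = Dom (Src F) g\<rbrakk> \<Longrightarrow>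
      AMap F (g \<cdot>\<^bsub>Src F\<^esub> f) = AMap F g \<cdot>\<^bsub>Tgt F\<^esub> AMap F f"
    and "OMap F \<in> extensional (Obj (Src F))" "AMap F \<in> extensional (Arr (Src F))"
  shows "cat_functor F"
  using assms unfolding cat_functor_def cat_functor_axioms_def in_hom by auto

text \<open>Both maps are extensional, so agreement on the source category already gives equality of
  records. This is why the laws of functor composition hold as equations.\<close>

lemma func_eqI:
  fixes F G :: "('o, 'a, 'p, 'b) func"
  assumes "cat_functor F" "cat_functor G" "Src F = Src G" "Tgt F = Tgt G"
    "\<And>x. x \<in> Obj (Src G) \<Longrightarrow> OMap F x = OMap G x" "\<And>f. f \<in> Arr (Src G) \<Longrightarrow> AMap F f = AMap G f"
  shows "F = G"
proof -
  have "OMap F = OMap G"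
    by (rule extensionalityI[of _ "Obj (Src G)"])
      (use assms cat_functor.OMap_ext[of F] cat_functor.OMap_ext[of G] in auto)
  moreover have "AMap F = AMap G"
    by (rule extensionalityI[of _ "Arr (Src G)"])
      (use assms cat_functor.AMap_ext[of F] cat_functor.AMap_ext[of G] in auto)
  ultimately show ?thesis using assms(3,4) by (intro func.equality) auto
qed

lemma func_id_sel [simp]:
  "Src (func_id C) = C" "Tgt (func_id C) = C"
  "x \<in> Obj C \<Longrightarrow> OMap (func_id C) x = x" "f \<in> Arr C \<Longrightarrow> AMap (func_id C) f = f"
  by (simp_all add: func_id_def)

lemma func_comp_sel [simp]:
  "Src (func_comp G F) = Src F" "Tgt (func_comp G F) = Tgt G"
  "x \<in> Obj (Src F) \<Longrightarrow> OMap (func_comp G F) x = OMap G (OMap F x)"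
  "f \<in> Arr (Src F) \<Longrightarrow> AMap (func_comp G F) f = AMap G (AMap F f)"
  by (simp_all add: func_comp_def compose_def)

lemma func_id_functor [simp]: "category C \<Longrightarrow> cat_functor (func_id C)"
  by (rule cat_functorI) (simp_all add: in_hom, simp_all add: func_id_def)

lemma func_comp_functor [simp]:
  assumes "cat_functor F" "cat_functor G" "Tgt F = Src G"
  shows "cat_functor (func_comp G F)"
  by (rule cat_functorI) (use assms in \<open>auto simp: in_hom\<close>, auto simp: func_comp_def)

lemma func_comp_id [simp]:
  "cat_functor F \<Longrightarrow> C = Src F \<Longrightarrow> func_comp F (func_id C) = F"
  "cat_functor F \<Longrightarrow> D = Tgt F \<Longrightarrow> func_comp (func_id D) F = F"
  by (rule func_eqI; simp)+

lemma func_comp_assoc: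
  "\<lbrakk>cat_functor F; cat_functor G; cat_functor H; Tgt F = Src G; Tgt G = Src H\<rbrakk> \<Longrightarrow>
    func_comp (func_comp H G) F = func_comp H (func_comp G F)"
  by (rule func_eqI; simp)

section \<open>Natural transformations and their two compositions\<close>

lemma nat_trans_functor [simp]:
  "nat_trans \<tau> \<Longrightarrow> cat_functor (NSrc \<tau>)" "nat_trans \<tau> \<Longrightarrow> cat_functor (NTgt \<tau>)"
  by (simp_all add: nat_trans_def)

lemma nat_trans_NTgt:
  "nat_trans \<tau> \<Longrightarrow> Src (NTgt \<tau>) = Src (NSrc \<tau>)" "nat_trans \<tau> \<Longrightarrow> Tgt (NTgt \<tau>) = Tgt (NSrc \<tau>)"
  by (simp_all add: nat_trans.Src_eq nat_trans.Tgt_eq)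

lemma nat_trans_NMap [simp]:
  assumes "nat_trans \<tau>" "D = Tgt (NSrc \<tau>)" "x \<in> Obj (Src (NSrc \<tau>))"
  shows "NMap \<tau> x \<in> Arr D" "Dom D (NMap \<tau> x) = OMap (NSrc \<tau>) x" "Cod D (NMap \<tau> x) = OMap (NTgt \<tau>) x"
  using nat_trans.NMap_in[OF assms(1,3)] assms(2) by (auto simp: in_hom)

lemma nat_trans_natural:
  assumes "nat_trans \<tau>" "f \<in> Arr (Src (NSrc \<tau>))"
  shows "NMap \<tau> (Cod (Src (NSrc \<tau>)) f) \<cdot>\<^bsub>Tgt (NSrc \<tau>)\<^esub> AMap (NSrc \<tau>) f
    = AMap (NTgt \<tau>) f \<cdot>\<^bsub>Tgt (NSrc \<tau>)\<^esub> NMap \<tau> (Dom (Src (NSrc \<tau>)) f)"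
  using nat_trans.naturality[OF assms(1), of f] assms(2) by (auto simp: in_hom)

lemma nat_transI:
  assumes "cat_functor (NSrc \<tau>)" "cat_functor (NTgt \<tau>)"
    "Src (NTgt \<tau>) = Src (NSrc \<tau>)" "Tgt (NTgt \<tau>) = Tgt (NSrc \<tau>)"
    and "\<And>x. x \<in> Obj (Src (NSrc \<tau>)) \<Longrightarrow>
      NMap \<tau> x \<in> hom (Tgt (NSrc \<tau>)) (OMap (NSrc \<tau>) x) (OMap (NTgt \<tau>) x)"
    and "\<And>f. f \<in> Arr (Src (NSrc \<tau>)) \<Longrightarrow>
      NMap \<tau> (Cod (Src (NSrc \<tau>)) f) \<cdot>\<^bsub>Tgt (NSrc \<tau>)\<^esub> AMap (NSrc \<tau>) f
        = AMap (NTgt \<tau>) f \<cdot>\<^bsub>Tgt (NSrc \<tau>)\<^esub> NMap \<tau> (Dom (Src (NSrc \<tau>)) f)"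
    and "NMap \<tau> \<in> extensional (Obj (Src (NSrc \<tau>)))"
  shows "nat_trans \<tau>"
  using assms unfolding nat_trans_def nat_trans_axioms_def in_hom by auto

lemma nt_eqI:
  fixes \<sigma> \<tau> :: "('o, 'a, 'p, 'b) nt"
  assumes "nat_trans \<sigma>" "nat_trans \<tau>" "NSrc \<sigma> = NSrc \<tau>" "NTgt \<sigma> = NTgt \<tau>"
    "\<And>x. x \<in> Obj (Src (NSrc \<tau>)) \<Longrightarrow> NMap \<sigma> x = NMap \<tau> x"
  shows "\<sigma> = \<tau>"
proof -
  have "NMap \<sigma> = NMap \<tau>"
    by (rule extensionalityI[of _ "Obj (Src (NSrc \<tau>))"])
      (use assms nat_trans.NMap_ext[of \<sigma>] nat_trans.NMap_ext[of \<tau>] in auto)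
  then show ?thesis using assms(3,4) by (intro nt.equality) auto
qed

lemma nt_id_sel [simp]:
  "NSrc (nt_id F) = F" "NTgt (nt_id F) = F"
  "x \<in> Obj (Src F) \<Longrightarrow> NMap (nt_id F) x = Id (Tgt F) (OMap F x)"
  by (simp_all add: nt_id_def)

lemma nt_vcomp_sel [simp]:
  "NSrc (nt_vcomp \<tau> \<sigma>) = NSrc \<sigma>" "NTgt (nt_vcomp \<tau> \<sigma>) = NTgt \<tau>"
  "x \<in> Obj (Src (NSrc \<sigma>)) \<Longrightarrow> NMap (nt_vcomp \<tau> \<sigma>) x = NMap \<tau> x \<cdot>\<^bsub>Tgt (NSrc \<sigma>)\<^esub> NMap \<sigma> x"
  by (simp_all add: nt_vcomp_def)

lemma nt_hcomp_sel [simp]: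
  "NSrc (nt_hcomp \<tau> \<sigma>) = func_comp (NSrc \<tau>) (NSrc \<sigma>)"
  "NTgt (nt_hcomp \<tau> \<sigma>) = func_comp (NTgt \<tau>) (NTgt \<sigma>)"
  "x \<in> Obj (Src (NSrc \<sigma>)) \<Longrightarrow> NMap (nt_hcomp \<tau> \<sigma>) x =
     NMap \<tau> (OMap (NTgt \<sigma>) x) \<cdot>\<^bsub>Tgt (NSrc \<tau>)\<^esub> AMap (NSrc \<tau>) (NMap \<sigma> x)"
  by (simp_all add: nt_hcomp_def)

lemma nt_id_nat_trans [simp]: "cat_functor F \<Longrightarrow> nat_trans (nt_id F)"
  by (rule nat_transI) (auto simp: in_hom, auto simp: nt_id_def)

lemma nt_vcomp_nat_trans [simp]:
  assumes "nat_trans \<sigma>" "nat_trans \<tau>" "NTgt \<sigma> = NSrc \<tau>"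
  shows "nat_trans (nt_vcomp \<tau> \<sigma>)"
proof (rule nat_transI)
  have [simp]: "Src (NSrc \<tau>) = Src (NSrc \<sigma>)" "Tgt (NSrc \<tau>) = Tgt (NSrc \<sigma>)"
    using assms nat_trans_NTgt[of \<sigma>] by auto
  have [simp]: "Src (NTgt \<tau>) = Src (NSrc \<sigma>)" "Tgt (NTgt \<tau>) = Tgt (NSrc \<sigma>)"
    using assms nat_trans_NTgt[of \<tau>] by auto
  note [simp] = assms(3)
  show "NMap (nt_vcomp \<tau> \<sigma>) (Cod (Src (NSrc (nt_vcomp \<tau> \<sigma>))) f) \<cdot>\<^bsub>Tgt (NSrc (nt_vcomp \<tau> \<sigma>))\<^esub>
      AMap (NSrc (nt_vcomp \<tau> \<sigma>)) f
    = AMap (NTgt (nt_vcomp \<tau> \<sigma>)) f \<cdot>\<^bsub>Tgt (NSrc (nt_vcomp \<tau> \<sigma>))\<^esub>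
      NMap (nt_vcomp \<tau> \<sigma>) (Dom (Src (NSrc (nt_vcomp \<tau> \<sigma>))) f)"
    if "f \<in> Arr (Src (NSrc (nt_vcomp \<tau> \<sigma>)))" for f
  proof -
    let ?C = "Src (NSrc \<sigma>)" and ?D = "Tgt (NSrc \<sigma>)"
    have f: "f \<in> Arr ?C" using that by simp
    have "NMap \<tau> (Cod ?C f) \<cdot>\<^bsub>?D\<^esub> (AMap (NSrc \<tau>) f \<cdot>\<^bsub>?D\<^esub> NMap \<sigma> (Dom ?C f))
        = AMap (NTgt \<tau>) f \<cdot>\<^bsub>?D\<^esub> (NMap \<tau> (Dom ?C f) \<cdot>\<^bsub>?D\<^esub> NMap \<sigma> (Dom ?C f))"
      using nat_trans_natural[OF assms(2), of f] f assms(1,2)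
      by (simp flip: Comp_assoc)
    then show ?thesis using nat_trans_natural[OF assms(1), of f] f assms(1,2) by simp
  qed
qed (use assms nat_trans_NTgt[of \<sigma>] nat_trans_NTgt[of \<tau>] in \<open>auto simp: in_hom\<close>,
    auto simp: nt_vcomp_def)

lemma nt_hcomp_nat_trans [simp]:
  assumes "nat_trans \<sigma>" "nat_trans \<tau>" "Tgt (NSrc \<sigma>) = Src (NSrc \<tau>)"
  shows "nat_trans (nt_hcomp \<tau> \<sigma>)"
proof (rule nat_transI)
  have [simp]: "Src (NTgt \<tau>) = Src (NSrc \<tau>)" "Tgt (NTgt \<tau>) = Tgt (NSrc \<tau>)"
     "Src (NTgt \<sigma>) = Src (NSrc \<sigma>)" "Tgt (NTgt \<sigma>) = Src (NSrc \<tau>)" "Tgt (NSrc \<sigma>) = Src (NSrc \<tau>)"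
    using assms nat_trans_NTgt[of \<tau>] nat_trans_NTgt[of \<sigma>] by auto
  show "NMap (nt_hcomp \<tau> \<sigma>) (Cod (Src (NSrc (nt_hcomp \<tau> \<sigma>))) f) \<cdot>\<^bsub>Tgt (NSrc (nt_hcomp \<tau> \<sigma>))\<^esub>
      AMap (NSrc (nt_hcomp \<tau> \<sigma>)) f
    = AMap (NTgt (nt_hcomp \<tau> \<sigma>)) f \<cdot>\<^bsub>Tgt (NSrc (nt_hcomp \<tau> \<sigma>))\<^esub>
      NMap (nt_hcomp \<tau> \<sigma>) (Dom (Src (NSrc (nt_hcomp \<tau> \<sigma>))) f)"
    if "f \<in> Arr (Src (NSrc (nt_hcomp \<tau> \<sigma>)))" for f
  proof -
    let ?C = "Src (NSrc \<sigma>)" and ?D = "Src (NSrc \<tau>)" and ?E = "Tgt (NSrc \<tau>)"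
    have f: "f \<in> Arr ?C" using that by simp
    let ?x = "Dom ?C f" and ?y = "Cod ?C f"
    have "AMap (NSrc \<tau>) (NMap \<sigma> ?y) \<cdot>\<^bsub>?E\<^esub> AMap (NSrc \<tau>) (AMap (NSrc \<sigma>) f)
        = AMap (NSrc \<tau>) (AMap (NTgt \<sigma>) f) \<cdot>\<^bsub>?E\<^esub> AMap (NSrc \<tau>) (NMap \<sigma> ?x)"
      using nat_trans_natural[OF assms(1), of f] f assms(1,2) by (simp flip: functor_Comp)
    then have "NMap \<tau> (OMap (NTgt \<sigma>) ?y) \<cdot>\<^bsub>?E\<^esub> (AMap (NSrc \<tau>) (NMap \<sigma> ?y) \<cdot>\<^bsub>?E\<^esub> AMap (NSrc \<tau>) (AMap (NSrc \<sigma>) f))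
       = NMap \<tau> (OMap (NTgt \<sigma>) ?y) \<cdot>\<^bsub>?E\<^esub> AMap (NSrc \<tau>) (AMap (NTgt \<sigma>) f) \<cdot>\<^bsub>?E\<^esub> AMap (NSrc \<tau>) (NMap \<sigma> ?x)"
      using f assms(1,2) by simp
    also have "NMap \<tau> (OMap (NTgt \<sigma>) ?y) \<cdot>\<^bsub>?E\<^esub> AMap (NSrc \<tau>) (AMap (NTgt \<sigma>) f)
       = AMap (NTgt \<tau>) (AMap (NTgt \<sigma>) f) \<cdot>\<^bsub>?E\<^esub> NMap \<tau> (OMap (NTgt \<sigma>) ?x)"
      using nat_trans_natural[OF assms(2), of "AMap (NTgt \<sigma>) f"] f assms(1,2) by simp
    finally show ?thesis using f assms(1,2) by simp
  qed
qed (use assms nat_trans_NTgt[of \<sigma>] nat_trans_NTgt[of \<tau>] in \<open>auto simp: in_hom\<close>,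
    auto simp: nt_hcomp_def)

lemma nt_vcomp_id [simp]:
  "nat_trans \<tau> \<Longrightarrow> F = NSrc \<tau> \<Longrightarrow> nt_vcomp \<tau> (nt_id F) = \<tau>"
  "nat_trans \<tau> \<Longrightarrow> F = NTgt \<tau> \<Longrightarrow> nt_vcomp (nt_id F) \<tau> = \<tau>"
  by (rule nt_eqI; simp add: nat_trans_NTgt)+

lemma nt_vcomp_assoc:
  assumes "nat_trans \<rho>" "nat_trans \<sigma>" "nat_trans \<tau>" "NTgt \<rho> = NSrc \<sigma>" "NTgt \<sigma> = NSrc \<tau>"
  shows "nt_vcomp (nt_vcomp \<tau> \<sigma>) \<rho> = nt_vcomp \<tau> (nt_vcomp \<sigma> \<rho>)"
proof -
  have [simp]: "Src (NSrc \<tau>) = Src (NSrc \<rho>)" "Tgt (NSrc \<tau>) = Tgt (NSrc \<rho>)"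
    "Src (NSrc \<sigma>) = Src (NSrc \<rho>)" "Tgt (NSrc \<sigma>) = Tgt (NSrc \<rho>)"
    using assms nat_trans_NTgt[of \<rho>] nat_trans_NTgt[of \<sigma>] by auto
  show ?thesis by (rule nt_eqI) (use assms in auto)
qed

lemma nt_hcomp_id [simp]:
  assumes "cat_functor F" "cat_functor G" "Tgt F = Src G"
  shows "nt_hcomp (nt_id G) (nt_id F) = nt_id (func_comp G F)"
  by (rule nt_eqI) (use assms in auto)

lemma nt_hcomp_func_id [simp]:
  "\<lbrakk>nat_trans \<tau>; C = Tgt (NSrc \<tau>)\<rbrakk> \<Longrightarrow> nt_hcomp (nt_id (func_id C)) \<tau> = \<tau>"
  "\<lbrakk>nat_trans \<tau>; C = Src (NSrc \<tau>)\<rbrakk> \<Longrightarrow> nt_hcomp \<tau> (nt_id (func_id C)) = \<tau>"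
  by (rule nt_eqI; simp add: nat_trans_NTgt)+

lemma nt_hcomp_assoc:
  assumes "nat_trans \<rho>" "nat_trans \<sigma>" "nat_trans \<tau>"
    "Tgt (NSrc \<rho>) = Src (NSrc \<sigma>)" "Tgt (NSrc \<sigma>) = Src (NSrc \<tau>)"
  shows "nt_hcomp (nt_hcomp \<tau> \<sigma>) \<rho> = nt_hcomp \<tau> (nt_hcomp \<sigma> \<rho>)"
  using nat_trans_NTgt[of \<tau>] nat_trans_NTgt[of \<sigma>] nat_trans_NTgt[of \<rho>]
  by (intro nt_eqI) (use assms in \<open>auto simp: func_comp_assoc\<close>)

lemma nt_interchange:
  assumes "nat_trans \<alpha>" "nat_trans \<alpha>'" "NTgt \<alpha> = NSrc \<alpha>'" "nat_trans \<beta>" "nat_trans \<beta>'"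
    "NTgt \<beta> = NSrc \<beta>'" "Tgt (NSrc \<alpha>) = Src (NSrc \<beta>)"
  shows "nt_hcomp (nt_vcomp \<beta>' \<beta>) (nt_vcomp \<alpha>' \<alpha>) = nt_vcomp (nt_hcomp \<beta>' \<alpha>') (nt_hcomp \<beta> \<alpha>)"
proof -
  let ?C = "Src (NSrc \<alpha>)" and ?D = "Src (NSrc \<beta>)" and ?E = "Tgt (NSrc \<beta>)"
  have [simp]: "Src (NSrc \<alpha>') = ?C" "Tgt (NSrc \<alpha>') = ?D" "Src (NSrc \<beta>') = ?D" "Tgt (NSrc \<beta>') = ?E"
    "Src (NTgt \<alpha>') = ?C" "Tgt (NTgt \<alpha>') = ?D" "Src (NTgt \<beta>') = ?D" "Tgt (NTgt \<beta>') = ?E"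
    "Tgt (NSrc \<alpha>) = ?D" "NTgt \<alpha> = NSrc \<alpha>'" "NTgt \<beta> = NSrc \<beta>'"
    using assms nat_trans_NTgt[of \<alpha>] nat_trans_NTgt[of \<beta>] nat_trans_NTgt[of \<alpha>'] nat_trans_NTgt[of \<beta>']
    by auto
  note [simp] = assms(1,2,4,5)
  show ?thesis
  proof (rule nt_eqI)
    fix x assume "x \<in> Obj (Src (NSrc (nt_vcomp (nt_hcomp \<beta>' \<alpha>') (nt_hcomp \<beta> \<alpha>))))"
    then have x: "x \<in> Obj ?C" by simp
    \<comment> \<open>Naturality of \<open>\<beta>\<close> at the component of
      \<open>\<alpha>'\<close> is the one exchange that interchange needs; the rest is functoriality
      and associativity.\<close>
    have "NMap \<beta> (OMap (NTgt \<alpha>') x) \<cdot>\<^bsub>?E\<^esub> AMap (NSrc \<beta>) (NMap \<alpha>' x)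
        = AMap (NSrc \<beta>') (NMap \<alpha>' x) \<cdot>\<^bsub>?E\<^esub> NMap \<beta> (OMap (NSrc \<alpha>') x)"
      using nat_trans_natural[OF assms(4), of "NMap \<alpha>' x"] x by simp
    then have "NMap \<beta> (OMap (NTgt \<alpha>') x) \<cdot>\<^bsub>?E\<^esub> (AMap (NSrc \<beta>) (NMap \<alpha>' x) \<cdot>\<^bsub>?E\<^esub> AMap (NSrc \<beta>) (NMap \<alpha> x))
        = AMap (NSrc \<beta>') (NMap \<alpha>' x) \<cdot>\<^bsub>?E\<^esub> (NMap \<beta> (OMap (NSrc \<alpha>') x) \<cdot>\<^bsub>?E\<^esub> AMap (NSrc \<beta>) (NMap \<alpha> x))"
      using x by (simp flip: Comp_assoc)
    then show "NMap (nt_hcomp (nt_vcomp \<beta>' \<beta>) (nt_vcomp \<alpha>' \<alpha>)) x =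
        NMap (nt_vcomp (nt_hcomp \<beta>' \<alpha>') (nt_hcomp \<beta> \<alpha>)) x"
      using x by simp
  qed auto
qed

lemma nat_iso_nat_trans [simp]: "nat_iso \<tau> \<Longrightarrow> nat_trans \<tau>"
  by (simp add: nat_iso_def)

lemma nat_iso_NMap [simp]:
  "nat_iso \<tau> \<Longrightarrow> D = Tgt (NSrc \<tau>) \<Longrightarrow> x \<in> Obj (Src (NSrc \<tau>)) \<Longrightarrow> is_iso D (NMap \<tau> x)"
  by (simp add: nat_iso_def)

definition nt_inverse :: "('o, 'a, 'p, 'b) nt \<Rightarrow> ('o, 'a, 'p, 'b) nt" where
  "nt_inverse \<tau> = \<lparr>NSrc = NTgt \<tau>, NTgt = NSrc \<tau>,
     NMap = (\<lambda>x\<in>Obj (Src (NSrc \<tau>)). inverse_arr (Tgt (NSrc \<tau>)) (NMap \<tau> x))\<rparr>"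

lemma nt_inverse_sel [simp]:
  "NSrc (nt_inverse \<tau>) = NTgt \<tau>" "NTgt (nt_inverse \<tau>) = NSrc \<tau>"
  "x \<in> Obj (Src (NSrc \<tau>)) \<Longrightarrow> NMap (nt_inverse \<tau>) x = inverse_arr (Tgt (NSrc \<tau>)) (NMap \<tau> x)"
  by (simp_all add: nt_inverse_def)

lemma nt_inverse_nat_trans:
  assumes "nat_iso \<tau>"
  shows "nat_trans (nt_inverse \<tau>)"
proof (rule nat_transI)
  have [simp]: "Src (NTgt \<tau>) = Src (NSrc \<tau>)" "Tgt (NTgt \<tau>) = Tgt (NSrc \<tau>)"
    using assms nat_trans_NTgt[of \<tau>] by auto
  note [simp] = assms
  let ?C = "Src (NSrc \<tau>)" and ?D = "Tgt (NSrc \<tau>)"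
  show "NMap (nt_inverse \<tau>) (Cod (Src (NSrc (nt_inverse \<tau>))) f) \<cdot>\<^bsub>Tgt (NSrc (nt_inverse \<tau>))\<^esub>
      AMap (NSrc (nt_inverse \<tau>)) f =
    AMap (NTgt (nt_inverse \<tau>)) f \<cdot>\<^bsub>Tgt (NSrc (nt_inverse \<tau>))\<^esub>
      NMap (nt_inverse \<tau>) (Dom (Src (NSrc (nt_inverse \<tau>))) f)"
    if "f \<in> Arr (Src (NSrc (nt_inverse \<tau>)))" for f
  proof -
    have f: "f \<in> Arr ?C" using that by simp
    have "NMap \<tau> (Cod ?C f) \<cdot>\<^bsub>?D\<^esub> (AMap (NSrc \<tau>) f \<cdot>\<^bsub>?D\<^esub> inverse_arr ?D (NMap \<tau> (Dom ?C f)))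
      = AMap (NTgt \<tau>) f"
      using nat_trans_natural[of \<tau> f] f by (simp flip: Comp_assoc, simp)
    from arg_cong[OF this, of "\<lambda>h. inverse_arr ?D (NMap \<tau> (Cod ?C f)) \<cdot>\<^bsub>?D\<^esub> h"]
    show ?thesis using f by simp
  qed
  show "NMap (nt_inverse \<tau>) \<in> extensional (Obj (Src (NSrc (nt_inverse \<tau>))))"
    by (simp add: nt_inverse_def)
qed (use assms nat_trans_NTgt[of \<tau>] in \<open>auto simp: in_hom\<close>)

lemma nt_inverse_vcomp [simp]:
  assumes "nat_iso \<tau>"
  shows "nt_vcomp (nt_inverse \<tau>) \<tau> = nt_id (NSrc \<tau>)" "nt_vcomp \<tau> (nt_inverse \<tau>) = nt_id (NTgt \<tau>)"
  by (rule nt_eqI; use assms nat_trans_NTgt[of \<tau>] nt_inverse_nat_trans[OF assms] in simp)+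

lemma nat_isoI:
  assumes "nat_trans \<tau>" "nat_trans \<sigma>" "NSrc \<sigma> = NTgt \<tau>"
    "nt_vcomp \<sigma> \<tau> = nt_id (NSrc \<tau>)" "nt_vcomp \<tau> \<sigma> = nt_id (NTgt \<tau>)"
  shows "nat_iso \<tau>"
  unfolding nat_iso_def
proof (intro conjI ballI)
  note [simp] = assms(1,2,3) nat_trans_NTgt[OF assms(1)]
  \<comment> \<open>The target of \<open>\<sigma>\<close> is not among the hypotheses; it is read
    off the first composite, whose target is known.\<close>
  have NT: "NTgt \<sigma> = NSrc \<tau>" using arg_cong[OF assms(4), of NTgt] by simp
  fix x assume x: "x \<in> Obj (Src (NSrc \<tau>))"
  show "is_iso (Tgt (NSrc \<tau>)) (NMap \<tau> x)"
    by (rule is_isoI[of _ _ "NMap \<sigma> x"])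
      (use x NT arg_cong[OF assms(4), of "\<lambda>\<rho>. NMap \<rho> x"] arg_cong[OF assms(5), of "\<lambda>\<rho>. NMap \<rho> x"]
        in auto)
qed (rule assms(1))

section \<open>Equivalences as fully faithful and essentially surjective functors\<close>

definition weak_equivalence :: "('o, 'a, 'p, 'b) func \<Rightarrow> bool" where
  "weak_equivalence F \<longleftrightarrow> cat_functor F \<and>
     (\<forall>f\<in>Arr (Src F). \<forall>g\<in>Arr (Src F). Dom (Src F) f = Dom (Src F) g \<and> Cod (Src F) f = Cod (Src F) g \<and>
        AMap F f = AMap F g \<longrightarrow> f = g) \<and>
     (\<forall>x\<in>Obj (Src F). \<forall>y\<in>Obj (Src F). \<forall>h\<in>hom (Tgt F) (OMap F x) (OMap F y).
        \<exists>f\<in>hom (Src F) x y. AMap F f = h) \<and>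
     (\<forall>z\<in>Obj (Tgt F). \<exists>x\<in>Obj (Src F). \<exists>f\<in>hom (Tgt F) (OMap F x) z. is_iso (Tgt F) f)"

lemma weak_equivalenceD:
  assumes "weak_equivalence F"
  shows "cat_functor F"
    and "\<lbrakk>f \<in> Arr (Src F); g \<in> Arr (Src F); Dom (Src F) f = Dom (Src F) g; Cod (Src F) f = Cod (Src F) g;
        AMap F f = AMap F g\<rbrakk> \<Longrightarrow> f = g"
    and "\<lbrakk>x \<in> Obj (Src F); y \<in> Obj (Src F); h \<in> hom (Tgt F) (OMap F x) (OMap F y)\<rbrakk> \<Longrightarrow>
        \<exists>f\<in>hom (Src F) x y. AMap F f = h"
    and "z \<in> Obj (Tgt F) \<Longrightarrow> \<exists>x\<in>Obj (Src F). \<exists>f\<in>hom (Tgt F) (OMap F x) z. is_iso (Tgt F) f"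
  using assms unfolding weak_equivalence_def by blast+

lemma weak_equivalenceI:
  assumes "cat_functor F"
    and "\<And>f g. \<lbrakk>f \<in> Arr (Src F); g \<in> Arr (Src F); Dom (Src F) f = Dom (Src F) g;
        Cod (Src F) f = Cod (Src F) g; AMap F f = AMap F g\<rbrakk> \<Longrightarrow> f = g"
    and "\<And>x y h. \<lbrakk>x \<in> Obj (Src F); y \<in> Obj (Src F); h \<in> hom (Tgt F) (OMap F x) (OMap F y)\<rbrakk> \<Longrightarrow>
        \<exists>f\<in>hom (Src F) x y. AMap F f = h"
    and "\<And>z. z \<in> Obj (Tgt F) \<Longrightarrow> \<exists>x\<in>Obj (Src F). \<exists>f\<in>hom (Tgt F) (OMap F x) z. is_iso (Tgt F) f"
  shows "weak_equivalence F"
  unfolding weak_equivalence_def using assms by blast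

text \<open>Lift the isomorphism and its inverse separately by fullness; faithfulness then forces
  the two lifts to be mutually inverse.\<close>

lemma weak_equivalence_full_iso:
  assumes F: "weak_equivalence F" and "x \<in> Obj (Src F)" "y \<in> Obj (Src F)"
    and h: "h \<in> hom (Tgt F) (OMap F x) (OMap F y)" "is_iso (Tgt F) h"
  shows "\<exists>f\<in>hom (Src F) x y. is_iso (Src F) f \<and> AMap F f = h"
proof -
  note [simp] = weak_equivalenceD(1)[OF F]
  obtain f where f: "f \<in> hom (Src F) x y" "AMap F f = h"
    using weak_equivalenceD(3)[OF F assms(2,3) h(1)] by blast
  have "inverse_arr (Tgt F) h \<in> hom (Tgt F) (OMap F y) (OMap F x)"
    using h by (auto simp: in_hom)
  then obtain g where g: "g \<in> hom (Src F) y x" "AMap F g = inverse_arr (Tgt F) h"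
    using weak_equivalenceD(3)[OF F assms(3,2)] by blast
  note fg = f(1)[unfolded in_hom] g(1)[unfolded in_hom]
  have "g \<cdot>\<^bsub>Src F\<^esub> f = Id (Src F) x"
    by (rule weak_equivalenceD(2)[OF F]) (use fg f(2) g(2) h assms(2) in \<open>auto simp: in_hom\<close>)
  moreover have "f \<cdot>\<^bsub>Src F\<^esub> g = Id (Src F) y"
    by (rule weak_equivalenceD(2)[OF F]) (use fg f(2) g(2) h assms(3) in \<open>auto simp: in_hom\<close>)
  ultimately have "is_iso (Src F) f"
    by (intro is_isoI[of _ _ g]) (use fg in auto)
  with f show ?thesis by blast
qed

text \<open>Chosen preimages \<open>g z\<close> with isomorphisms \<open>e z\<close> determine a
  quasi-inverse. Since \<open>F\<close> is faithful, functoriality of the quasi-inverse and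
  naturality of the unit are verified after applying \<open>F\<close>, where they are cancellations
  of \<open>e\<close>.\<close>

lemma weak_equivalence_is_equivalence:
  assumes WF: "weak_equivalence F"
  shows "is_equivalence F"
proof -
  let ?C = "Src F" and ?D = "Tgt F"
  note F [simp] = weak_equivalenceD(1)[OF WF]
  note faithful = weak_equivalenceD(2)[OF WF] and full = weak_equivalenceD(3)[OF WF]
  obtain g e where ge: "\<And>z. z \<in> Obj ?D \<Longrightarrow> g z \<in> Obj ?C \<and> e z \<in> hom ?D (OMap F (g z)) z \<and> is_iso ?D (e z)"
    using weak_equivalenceD(4)[OF WF] by metis
  then have [simp]: "g z \<in> Obj ?C" "e z \<in> Arr ?D" "Dom ?D (e z) = OMap F (g z)" "Cod ?D (e z) = z"
    "is_iso ?D (e z)" if "z \<in> Obj ?D" for z using that by (auto simp: in_hom)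
  \<comment> \<open>Conjugation by the chosen isomorphisms moves \<open>h\<close> between objects in
    the image of \<open>F\<close>, where fullness applies.\<close>
  define conj where "conj h = inverse_arr ?D (e (Cod ?D h)) \<cdot>\<^bsub>?D\<^esub> (h \<cdot>\<^bsub>?D\<^esub> e (Dom ?D h))" for h
  have "\<exists>f\<in>hom ?C (g (Dom ?D h)) (g (Cod ?D h)). AMap F f = conj h" if "h \<in> Arr ?D" for h
    using that by (intro full) (auto simp: conj_def in_hom)
  then obtain G1 where "\<And>h. h \<in> Arr ?D \<Longrightarrow> G1 h \<in> hom ?C (g (Dom ?D h)) (g (Cod ?D h)) \<and> AMap F (G1 h) = conj h"
    by metis
  then have G1 [simp]: "G1 h \<in> Arr ?C" "Dom ?C (G1 h) = g (Dom ?D h)" "Cod ?C (G1 h) = g (Cod ?D h)"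
    "AMap F (G1 h) = conj h" if "h \<in> Arr ?D" for h using that by (auto simp: in_hom)
  define G where "G = \<lparr>Src = ?D, Tgt = ?C, OMap = (\<lambda>z\<in>Obj ?D. g z), AMap = (\<lambda>h\<in>Arr ?D. G1 h)\<rparr>"
  have G_sel [simp]: "Src G = ?D" "Tgt G = ?C" "\<And>z. z \<in> Obj ?D \<Longrightarrow> OMap G z = g z"
    "\<And>h. h \<in> Arr ?D \<Longrightarrow> AMap G h = G1 h" by (simp_all add: G_def)
  have GF [simp]: "cat_functor G"
  proof (rule cat_functorI)
    fix z assume "z \<in> Obj (Src G)"
    then show "AMap G (Id (Src G) z) = Id (Tgt G) (OMap G z)"
      by simp (rule faithful; simp add: conj_def)
  next
    fix h k assume "h \<in> Arr (Src G)" "k \<in> Arr (Src G)" "Cod (Src G) h = Dom (Src G) k"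
    then show "AMap G (k \<cdot>\<^bsub>Src G\<^esub> h) = AMap G k \<cdot>\<^bsub>Tgt G\<^esub> AMap G h"
      by simp (rule faithful; simp add: conj_def)
  qed (auto simp: in_hom, auto simp: G_def)
  \<comment> \<open>The unit at \<open>x\<close> is the lift of the inverse of the counit at
    \<open>F x\<close>, so that after \<open>F\<close> its naturality square cancels against
    \<open>conj\<close>.\<close>
  have "\<exists>f\<in>hom ?C x (g (OMap F x)). is_iso ?C f \<and> AMap F f = inverse_arr ?D (e (OMap F x))"
    if "x \<in> Obj ?C" for x
    using that by (intro weak_equivalence_full_iso[OF WF]) (auto simp: in_hom)
  then obtain n where "\<And>x. x \<in> Obj ?C \<Longrightarrow> n x \<in> hom ?C x (g (OMap F x)) \<and> is_iso ?C (n x) \<and>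
      AMap F (n x) = inverse_arr ?D (e (OMap F x))"
    by metis
  then have n [simp]: "n x \<in> Arr ?C" "Dom ?C (n x) = x" "Cod ?C (n x) = g (OMap F x)" "is_iso ?C (n x)"
    "AMap F (n x) = inverse_arr ?D (e (OMap F x))" if "x \<in> Obj ?C" for x
    using that by (auto simp: in_hom)
  define \<eta> where "\<eta> = \<lparr>NSrc = func_id ?C, NTgt = func_comp G F, NMap = (\<lambda>x\<in>Obj ?C. n x)\<rparr>"
  have \<eta>_sel [simp]: "NSrc \<eta> = func_id ?C" "NTgt \<eta> = func_comp G F" "\<And>x. x \<in> Obj ?C \<Longrightarrow> NMap \<eta> x = n x"
    by (simp_all add: \<eta>_def)
  have \<eta>: "nat_trans \<eta>"
  proof (rule nat_transI)
    fix f assume "f \<in> Arr (Src (NSrc \<eta>))"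
    then show "NMap \<eta> (Cod (Src (NSrc \<eta>)) f) \<cdot>\<^bsub>Tgt (NSrc \<eta>)\<^esub> AMap (NSrc \<eta>) f =
         AMap (NTgt \<eta>) f \<cdot>\<^bsub>Tgt (NSrc \<eta>)\<^esub> NMap \<eta> (Dom (Src (NSrc \<eta>)) f)"
      by simp (rule faithful; simp add: conj_def)
  qed (auto simp: in_hom, auto simp: \<eta>_def)
  define \<epsilon> where "\<epsilon> = \<lparr>NSrc = func_comp F G, NTgt = func_id ?D, NMap = (\<lambda>z\<in>Obj ?D. e z)\<rparr>"
  have \<epsilon>_sel [simp]: "NSrc \<epsilon> = func_comp F G" "NTgt \<epsilon> = func_id ?D" "\<And>z. z \<in> Obj ?D \<Longrightarrow> NMap \<epsilon> z = e z"
    by (simp_all add: \<epsilon>_def)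
  have \<epsilon>: "nat_trans \<epsilon>"
    by (rule nat_transI) (simp_all add: in_hom conj_def, simp_all add: \<epsilon>_def)
  show ?thesis
    unfolding is_equivalence_def
    by (intro conjI exI[of _ G] exI[of _ \<eta>] exI[of _ \<epsilon>]) (use \<eta> \<epsilon> in \<open>auto simp: nat_iso_def\<close>)
qed

text \<open>Naturality of the unit recovers \<open>f\<close> from \<open>G (F f)\<close>, which
  makes \<open>F\<close> faithful; the counit makes \<open>G\<close> faithful in the same way.
  Fullness of \<open>F\<close> is then deduced from faithfulness of \<open>G\<close>.\<close>

lemma is_equivalence_weak_equivalence:
  assumes "is_equivalence F"
  shows "weak_equivalence F"
proof -
  let ?C = "Src F" and ?D = "Tgt F"
  obtain G \<eta> \<epsilon> where FG [simp]: "cat_functor F" "cat_functor G" "Src G = ?D" "Tgt G = ?C"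
    and \<eta> [simp]: "nat_iso \<eta>" "NSrc \<eta> = func_id ?C" "NTgt \<eta> = func_comp G F"
    and \<epsilon> [simp]: "nat_iso \<epsilon>" "NSrc \<epsilon> = func_comp F G" "NTgt \<epsilon> = func_id ?D"
    using assms unfolding is_equivalence_def by blast
  have nat_\<eta>: "NMap \<eta> (Cod ?C f) \<cdot>\<^bsub>?C\<^esub> f = AMap G (AMap F f) \<cdot>\<^bsub>?C\<^esub> NMap \<eta> (Dom ?C f)" if "f \<in> Arr ?C" for f
    using nat_trans_natural[of \<eta> f] that by simp
  have nat_\<epsilon>: "NMap \<epsilon> (Cod ?D f) \<cdot>\<^bsub>?D\<^esub> AMap F (AMap G f) = f \<cdot>\<^bsub>?D\<^esub> NMap \<epsilon> (Dom ?D f)" if "f \<in> Arr ?D" for f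
    using nat_trans_natural[of \<epsilon> f] that by simp
  have faithful_F: "f = g" if "f \<in> Arr ?C" "g \<in> Arr ?C" "Dom ?C f = Dom ?C g" "Cod ?C f = Cod ?C g"
    "AMap F f = AMap F g" for f g
    by (rule iso_cancel_left[of ?C "NMap \<eta> (Cod ?C f)"]) (use that nat_\<eta>[of f] nat_\<eta>[of g] in auto)
  have faithful_G: "f = g" if "f \<in> Arr ?D" "g \<in> Arr ?D" "Dom ?D f = Dom ?D g" "Cod ?D f = Cod ?D g"
    "AMap G f = AMap G g" for f g
    by (rule iso_cancel_right[of ?D "NMap \<epsilon> (Dom ?D f)"])
      (use that nat_\<epsilon>[of f, symmetric] nat_\<epsilon>[of g, symmetric] in auto)
  show ?thesis
  proof (rule weak_equivalenceI)
    fix x y h assume xy: "x \<in> Obj ?C" "y \<in> Obj ?C" and h: "h \<in> hom ?D (OMap F x) (OMap F y)"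
    \<comment> \<open>Naturality of the unit leaves no other candidate: a preimage of
      \<open>h\<close> must be this conjugate of \<open>G h\<close>.\<close>
    define f where "f = inverse_arr ?C (NMap \<eta> y) \<cdot>\<^bsub>?C\<^esub> (AMap G h \<cdot>\<^bsub>?C\<^esub> NMap \<eta> x)"
    note h' [simp] = h[unfolded in_hom]
    have f [simp]: "f \<in> Arr ?C" "Dom ?C f = x" "Cod ?C f = y" using xy by (auto simp: f_def)
    have \<eta>f: "NMap \<eta> y \<cdot>\<^bsub>?C\<^esub> f = AMap G h \<cdot>\<^bsub>?C\<^esub> NMap \<eta> x" using xy by (simp add: f_def)
    have "AMap G (AMap F f) = AMap G h"
    proof (rule iso_cancel_right[of ?C "NMap \<eta> x"])
      show "AMap G (AMap F f) \<cdot>\<^bsub>?C\<^esub> NMap \<eta> x = AMap G h \<cdot>\<^bsub>?C\<^esub> NMap \<eta> x"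
        using nat_\<eta>[of f] xy \<eta>f by simp
    qed (use xy in auto)
    then have "AMap F f = h" by (intro faithful_G) (use xy in auto)
    then show "\<exists>f\<in>hom ?C x y. AMap F f = h" using f by (intro bexI[of _ f]) (auto simp: in_hom)
  next
    fix z assume "z \<in> Obj ?D"
    then show "\<exists>x\<in>Obj ?C. \<exists>f\<in>hom ?D (OMap F x) z. is_iso ?D f"
      by (intro bexI[of _ "OMap G z"] bexI[of _ "NMap \<epsilon> z"]) (auto simp: in_hom)
  qed (use faithful_F in auto)
qed

text \<open>Each of the three conditions survives conjugation by the natural isomorphism with
  components \<open>t\<close>. The purpose is to replace the unspecified equivalence in the
  definition of a bicolimit by whiskering of its inclusions.\<close>

lemma weak_equivalence_transport:
  assumes G: "weak_equivalence G" and F [simp]: "cat_functor F" "Src F = Src G" "Tgt F = Tgt G"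
    and t: "\<And>x. x \<in> Obj (Src G) \<Longrightarrow> t x \<in> hom (Tgt G) (OMap F x) (OMap G x) \<and> is_iso (Tgt G) (t x)"
    and nat: "\<And>f. f \<in> Arr (Src G) \<Longrightarrow>
      t (Cod (Src G) f) \<cdot>\<^bsub>Tgt G\<^esub> AMap F f = AMap G f \<cdot>\<^bsub>Tgt G\<^esub> t (Dom (Src G) f)"
  shows "weak_equivalence F"
proof (rule weak_equivalenceI)
  let ?C = "Src G" and ?D = "Tgt G"
  note [simp] = weak_equivalenceD(1)[OF G]
  have t' [simp]: "t x \<in> Arr ?D" "Dom ?D (t x) = OMap F x" "Cod ?D (t x) = OMap G x" "is_iso ?D (t x)"
    if "x \<in> Obj ?C" for x using t that by (auto simp: in_hom)
  show "f = g" if "f \<in> Arr (Src F)" "g \<in> Arr (Src F)" "Dom (Src F) f = Dom (Src F) g"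
    "Cod (Src F) f = Cod (Src F) g" "AMap F f = AMap F g" for f g
  proof (rule weak_equivalenceD(2)[OF G])
    show "AMap G f = AMap G g"
      by (rule iso_cancel_right[of ?D "t (Dom ?C f)"]) (use that nat[of f] nat[of g] in auto)
  qed (use that in auto)
  show "\<exists>f\<in>hom (Src F) x y. AMap F f = h"
    if "x \<in> Obj (Src F)" "y \<in> Obj (Src F)" "h \<in> hom (Tgt F) (OMap F x) (OMap F y)" for x y h
  proof -
    have xy: "x \<in> Obj ?C" "y \<in> Obj ?C" using that by simp_all
    have h: "h \<in> Arr ?D" "Dom ?D h = OMap F x" "Cod ?D h = OMap F y" using that by (auto simp: in_hom)
    have conj: "t y \<cdot>\<^bsub>?D\<^esub> (h \<cdot>\<^bsub>?D\<^esub> inverse_arr ?D (t x)) \<in> hom ?D (OMap G x) (OMap G y)"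
      using that h by (auto simp: in_hom)
    then obtain f where f: "f \<in> hom ?C x y" "AMap G f = t y \<cdot>\<^bsub>?D\<^esub> (h \<cdot>\<^bsub>?D\<^esub> inverse_arr ?D (t x))"
      using weak_equivalenceD(3)[OF G _ _ conj] xy by auto
    note f' = f(1)[unfolded in_hom]
    have "AMap F f = h"
      by (rule iso_cancel_left[of ?D "t y"]) (use that h f' f(2) nat[of f] in auto)
    then show ?thesis using f by auto
  qed
  show "\<exists>x\<in>Obj (Src F). \<exists>f\<in>hom (Tgt F) (OMap F x) z. is_iso (Tgt F) f" if z: "z \<in> Obj (Tgt F)" for z
  proof -
    obtain x f where "x \<in> Obj ?C" "f \<in> hom ?D (OMap G x) z" "is_iso ?D f"
      using weak_equivalenceD(4)[OF G, of z] z by auto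
    then show ?thesis
      by (intro bexI[of _ x] bexI[of _ "f \<cdot>\<^bsub>?D\<^esub> t x"]) (auto simp: in_hom)
  qed
qed (rule F)

section \<open>The 2-categories of categories and of categories with finite limits\<close>

lemma Cat_sel [simp]:
  "Obj (Cells1 Cat) = {C. small_cat C}" "Arr (Cells1 Cat) = {F. small_functor F}"
  "Dom (Cells1 Cat) = Src" "Cod (Cells1 Cat) = Tgt" "Id (Cells1 Cat) = func_id"
  "Comp (Cells1 Cat) = func_comp"
  "Obj (Cells2 Cat) = {F. small_functor F}"
  "Arr (Cells2 Cat) = {\<tau>. nat_trans \<tau> \<and> small_functor (NSrc \<tau>) \<and> small_functor (NTgt \<tau>)}"
  "Dom (Cells2 Cat) = NSrc" "Cod (Cells2 Cat) = NTgt" "Id (Cells2 Cat) = nt_id"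
  "Comp (Cells2 Cat) = nt_vcomp" "HComp Cat = nt_hcomp"
  by (simp_all add: Cat_def)

lemma Lex_sel [simp]:
  "Obj (Cells1 Lex) = {C. lex_cat C}" "Arr (Cells1 Lex) = {F. lex_functor F}"
  "Dom (Cells1 Lex) = Src" "Cod (Cells1 Lex) = Tgt" "Id (Cells1 Lex) = func_id"
  "Comp (Cells1 Lex) = func_comp"
  "Obj (Cells2 Lex) = {F. lex_functor F}"
  "Arr (Cells2 Lex) = {\<tau>. nat_trans \<tau> \<and> lex_functor (NSrc \<tau>) \<and> lex_functor (NTgt \<tau>)}"
  "Dom (Cells2 Lex) = NSrc" "Cod (Cells2 Lex) = NTgt" "Id (Cells2 Lex) = nt_id"
  "Comp (Cells2 Lex) = nt_vcomp" "HComp Lex = nt_hcomp"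
  by (simp_all add: Lex_def)

lemma small_functorD [simp]:
  "small_functor F \<Longrightarrow> cat_functor F" "small_functor F \<Longrightarrow> small_cat (Src F)"
  "small_functor F \<Longrightarrow> small_cat (Tgt F)"
  unfolding small_functor_def by simp_all

lemma small_cat_category [simp]: "small_cat C \<Longrightarrow> category C"
  by (simp add: small_cat_def)

lemma small_functor_id [simp]: "small_cat C \<Longrightarrow> small_functor (func_id C)"
  unfolding small_functor_def by simp

lemma small_functor_comp [simp]:
  "\<lbrakk>small_functor F; small_functor G; Tgt F = Src G\<rbrakk> \<Longrightarrow> small_functor (func_comp G F)"
  unfolding small_functor_def by simp

lemma lex_functorD:
  "lex_functor F \<Longrightarrow> small_functor F" "lex_functor F \<Longrightarrow> lex_cat (Src F)"
  "lex_functor F \<Longrightarrow> lex_cat (Tgt F)" "lex_functor F \<Longrightarrow> preserves_finite_limits F"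
  unfolding small_functor_def lex_functor_def lex_cat_def by simp_all

lemma two_category_Cat: "two_category Cat"
proof -
  have c1: "category (Cells1 Cat)"
    by (rule categoryI) (simp_all add: func_comp_assoc)
  have c2: "category (Cells2 Cat)"
    by (rule categoryI) (auto simp: nt_vcomp_assoc)
  show ?thesis
  proof (intro two_category.intro two_category_axioms.intro c1 c2)
    fix \<alpha> f f' \<alpha>' f'' \<beta> g g' \<beta>' g''
    assume "\<alpha> \<in> hom (Cells2 Cat) f f'" "\<alpha>' \<in> hom (Cells2 Cat) f' f''" "\<beta> \<in> hom (Cells2 Cat) g g'"
      "\<beta>' \<in> hom (Cells2 Cat) g' g''" "Cod (Cells1 Cat) f = Dom (Cells1 Cat) g"
    then show "(\<beta>' \<bullet>\<^bsub>Cat\<^esub> \<beta>) \<star>\<^bsub>Cat\<^esub> (\<alpha>' \<bullet>\<^bsub>Cat\<^esub> \<alpha>) = \<beta>' \<star>\<^bsub>Cat\<^esub> \<alpha>' \<bullet>\<^bsub>Cat\<^esub> (\<beta> \<star>\<^bsub>Cat\<^esub> \<alpha>)"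
      by (auto simp: in_hom nt_interchange)
  next
    fix \<alpha> f f' \<beta> g g' \<gamma> h h'
    assume "\<alpha> \<in> hom (Cells2 Cat) f f'" "\<beta> \<in> hom (Cells2 Cat) g g'" "\<gamma> \<in> hom (Cells2 Cat) h h'"
      "Cod (Cells1 Cat) f = Dom (Cells1 Cat) g" "Cod (Cells1 Cat) g = Dom (Cells1 Cat) h"
    then show "\<gamma> \<star>\<^bsub>Cat\<^esub> \<beta> \<star>\<^bsub>Cat\<^esub> \<alpha> = \<gamma> \<star>\<^bsub>Cat\<^esub> (\<beta> \<star>\<^bsub>Cat\<^esub> \<alpha>)"
      by (auto simp: in_hom nt_hcomp_assoc)
  next
    fix \<alpha> f f' \<beta> g g'
    assume "\<alpha> \<in> hom (Cells2 Cat) f f'" "\<beta> \<in> hom (Cells2 Cat) g g'" "Cod (Cells1 Cat) f = Dom (Cells1 Cat) g"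
    then show "\<beta> \<star>\<^bsub>Cat\<^esub> \<alpha> \<in> hom (Cells2 Cat) (g \<circ>\<^bsub>Cat\<^esub> f) (g' \<circ>\<^bsub>Cat\<^esub> f')"
      using nat_trans_NTgt[of \<alpha>] nat_trans_NTgt[of \<beta>] by (auto simp: in_hom)
  qed (auto simp: in_hom nat_trans_NTgt)
qed

text \<open>Invertibility for vertical composition is componentwise, because the inverses of the
  components of a natural transformation are again natural.\<close>

lemma is_iso_Cat_iff [simp]:
  assumes "nat_trans \<tau>" "small_functor (NSrc \<tau>)" "small_functor (NTgt \<tau>)"
  shows "is_iso (Cells2 Cat) \<tau> \<longleftrightarrow> nat_iso \<tau>"
proof
  assume "is_iso (Cells2 Cat) \<tau>"
  then show "nat_iso \<tau>" unfolding is_iso_def using assms by (auto simp: in_hom intro: nat_isoI)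
next
  assume "nat_iso \<tau>"
  then show "is_iso (Cells2 Cat) \<tau>"
    using assms nt_inverse_nat_trans[of \<tau>] by (intro is_isoI[of _ _ "nt_inverse \<tau>"]) auto
qed

lemma is_iso_Lex_iff [simp]:
  assumes "nat_trans \<tau>" "lex_functor (NSrc \<tau>)" "lex_functor (NTgt \<tau>)"
  shows "is_iso (Cells2 Lex) \<tau> \<longleftrightarrow> nat_iso \<tau>"
proof
  assume "is_iso (Cells2 Lex) \<tau>"
  then show "nat_iso \<tau>" unfolding is_iso_def using assms by (auto simp: in_hom intro: nat_isoI)
next
  assume "nat_iso \<tau>"
  then show "is_iso (Cells2 Lex) \<tau>"
    using assms nt_inverse_nat_trans[of \<tau>] by (intro is_isoI[of _ _ "nt_inverse \<tau>"]) auto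
qed

section \<open>Bicolimits in terms of whiskering\<close>

lemma two_category_simps [simp]:
  assumes "two_category B"
  shows "category (Cells1 B)" "category (Cells2 B)" "Obj (Cells2 B) = Arr (Cells1 B)"
  using assms by (auto simp: two_category_def two_category.Obj_Cells2)

lemma Dom_Cod_2cell [simp]:
  assumes "two_category B" "\<alpha> \<in> Arr (Cells2 B)"
  shows "Dom (Cells1 B) (Cod (Cells2 B) \<alpha>) = Dom (Cells1 B) (Dom (Cells2 B) \<alpha>)"
    "Cod (Cells1 B) (Cod (Cells2 B) \<alpha>) = Cod (Cells1 B) (Dom (Cells2 B) \<alpha>)"
  using two_category.parallel[OF assms(1), of \<alpha>] assms(2) by (auto simp: in_hom)

lemma Dom_2cell_Arr [simp]:
  assumes "two_category B" "\<alpha> \<in> Arr (Cells2 B)"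
  shows "Dom (Cells2 B) \<alpha> \<in> Arr (Cells1 B)" "Cod (Cells2 B) \<alpha> \<in> Arr (Cells1 B)"
  using Dom_Obj[of "Cells2 B" \<alpha>] Cod_Obj[of "Cells2 B" \<alpha>] assms by auto

lemma HComp_hom [simp]:
  assumes "two_category B" "\<alpha> \<in> Arr (Cells2 B)" "\<beta> \<in> Arr (Cells2 B)"
    "Cod (Cells1 B) (Dom (Cells2 B) \<alpha>) = Dom (Cells1 B) (Dom (Cells2 B) \<beta>)"
  shows "\<beta> \<star>\<^bsub>B\<^esub> \<alpha> \<in> Arr (Cells2 B)"
    "Dom (Cells2 B) (\<beta> \<star>\<^bsub>B\<^esub> \<alpha>) = Dom (Cells2 B) \<beta> \<circ>\<^bsub>B\<^esub> Dom (Cells2 B) \<alpha>"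
    "Cod (Cells2 B) (\<beta> \<star>\<^bsub>B\<^esub> \<alpha>) = Cod (Cells2 B) \<beta> \<circ>\<^bsub>B\<^esub> Cod (Cells2 B) \<alpha>"
  using two_category.HComp_in[OF assms(1), of \<alpha> _ _ \<beta>] assms(2-) by (auto simp: in_hom)

lemma HComp_Id [simp]:
  assumes "two_category B" "f \<in> Arr (Cells1 B)" "g \<in> Arr (Cells1 B)" "Cod (Cells1 B) f = Dom (Cells1 B) g"
  shows "Id (Cells2 B) g \<star>\<^bsub>B\<^esub> Id (Cells2 B) f = Id (Cells2 B) (g \<circ>\<^bsub>B\<^esub> f)"
  using two_category.HComp_Id[OF assms(1), of f _ _ g] assms(2-) by (auto simp: in_hom)

lemma interchange:
  assumes "two_category B" "\<alpha> \<in> Arr (Cells2 B)" "\<alpha>' \<in> Arr (Cells2 B)" "\<beta> \<in> Arr (Cells2 B)" "\<beta>' \<in> Arr (Cells2 B)"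
    "Cod (Cells2 B) \<alpha> = Dom (Cells2 B) \<alpha>'" "Cod (Cells2 B) \<beta> = Dom (Cells2 B) \<beta>'"
    "Cod (Cells1 B) (Dom (Cells2 B) \<alpha>) = Dom (Cells1 B) (Dom (Cells2 B) \<beta>)"
  shows "(\<beta>' \<bullet>\<^bsub>B\<^esub> \<beta>) \<star>\<^bsub>B\<^esub> (\<alpha>' \<bullet>\<^bsub>B\<^esub> \<alpha>) = (\<beta>' \<star>\<^bsub>B\<^esub> \<alpha>') \<bullet>\<^bsub>B\<^esub> (\<beta> \<star>\<^bsub>B\<^esub> \<alpha>)"
  using two_category.interchange[OF assms(1), of \<alpha> _ _ \<alpha>' _ \<beta> _ _ \<beta>'] assms(2-) by (auto simp: in_hom)

lemma lwhisker_vcomp [simp]: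
  assumes "two_category B" "g \<in> Arr (Cells1 B)" "\<alpha> \<in> Arr (Cells2 B)" "\<beta> \<in> Arr (Cells2 B)"
    "Cod (Cells2 B) \<alpha> = Dom (Cells2 B) \<beta>" "Cod (Cells1 B) (Dom (Cells2 B) \<alpha>) = Dom (Cells1 B) g"
  shows "g \<rhd>\<^bsub>B\<^esub> (\<beta> \<bullet>\<^bsub>B\<^esub> \<alpha>) = (g \<rhd>\<^bsub>B\<^esub> \<beta>) \<bullet>\<^bsub>B\<^esub> (g \<rhd>\<^bsub>B\<^esub> \<alpha>)"
  using interchange[of B \<alpha> \<beta> "Id (Cells2 B) g" "Id (Cells2 B) g"] assms by simp

lemma rwhisker_vcomp [simp]:
  assumes "two_category B" "f \<in> Arr (Cells1 B)" "\<alpha> \<in> Arr (Cells2 B)" "\<beta> \<in> Arr (Cells2 B)"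
    "Cod (Cells2 B) \<alpha> = Dom (Cells2 B) \<beta>" "Cod (Cells1 B) f = Dom (Cells1 B) (Dom (Cells2 B) \<alpha>)"
  shows "(\<beta> \<bullet>\<^bsub>B\<^esub> \<alpha>) \<lhd>\<^bsub>B\<^esub> f = (\<beta> \<lhd>\<^bsub>B\<^esub> f) \<bullet>\<^bsub>B\<^esub> (\<alpha> \<lhd>\<^bsub>B\<^esub> f)"
  using interchange[of B "Id (Cells2 B) f" "Id (Cells2 B) f" \<alpha> \<beta>] assms by simp

text \<open>Both sides are the horizontal composite of \<open>\<beta>\<close> and
  \<open>\<alpha>\<close>, decomposed in the two possible orders.\<close>

lemma whisker_exchange:
  assumes "two_category B" "\<alpha> \<in> Arr (Cells2 B)" "\<beta> \<in> Arr (Cells2 B)"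
    "Cod (Cells1 B) (Dom (Cells2 B) \<alpha>) = Dom (Cells1 B) (Dom (Cells2 B) \<beta>)"
  shows "(\<beta> \<lhd>\<^bsub>B\<^esub> Cod (Cells2 B) \<alpha>) \<bullet>\<^bsub>B\<^esub> (Dom (Cells2 B) \<beta> \<rhd>\<^bsub>B\<^esub> \<alpha>)
    = (Cod (Cells2 B) \<beta> \<rhd>\<^bsub>B\<^esub> \<alpha>) \<bullet>\<^bsub>B\<^esub> (\<beta> \<lhd>\<^bsub>B\<^esub> Dom (Cells2 B) \<alpha>)"
  using interchange[of B \<alpha> "Id (Cells2 B) (Cod (Cells2 B) \<alpha>)" "Id (Cells2 B) (Dom (Cells2 B) \<beta>)" \<beta>]
    interchange[of B "Id (Cells2 B) (Dom (Cells2 B) \<alpha>)" \<alpha> \<beta> "Id (Cells2 B) (Cod (Cells2 B) \<beta>)"] assms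
  by simp

lemma HComp_unit [simp]:
  assumes "two_category B" "\<alpha> \<in> Arr (Cells2 B)"
  shows "Y = Cod (Cells1 B) (Dom (Cells2 B) \<alpha>) \<Longrightarrow> Id (Cells1 B) Y \<rhd>\<^bsub>B\<^esub> \<alpha> = \<alpha>"
    "X = Dom (Cells1 B) (Dom (Cells2 B) \<alpha>) \<Longrightarrow> \<alpha> \<lhd>\<^bsub>B\<^esub> Id (Cells1 B) X = \<alpha>"
  using two_category.lwhisker_Id1[OF assms(1), of \<alpha>] two_category.rwhisker_Id1[OF assms(1), of \<alpha>] assms
  by (auto simp: in_hom)

lemma HComp_assoc [simp]:
  assumes "two_category B" "\<alpha> \<in> Arr (Cells2 B)" "\<beta> \<in> Arr (Cells2 B)" "\<gamma> \<in> Arr (Cells2 B)"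
    "Cod (Cells1 B) (Dom (Cells2 B) \<alpha>) = Dom (Cells1 B) (Dom (Cells2 B) \<beta>)"
    "Cod (Cells1 B) (Dom (Cells2 B) \<beta>) = Dom (Cells1 B) (Dom (Cells2 B) \<gamma>)"
  shows "\<gamma> \<star>\<^bsub>B\<^esub> \<beta> \<star>\<^bsub>B\<^esub> \<alpha> = \<gamma> \<star>\<^bsub>B\<^esub> (\<beta> \<star>\<^bsub>B\<^esub> \<alpha>)"
  using two_category.HComp_assoc[OF assms(1), of \<alpha> _ _ \<beta> _ _ \<gamma>] assms(2-) by (auto simp: in_hom)

lemma lwhisker_lwhisker [simp]:
  assumes "two_category B" "\<alpha> \<in> Arr (Cells2 B)" "f \<in> Arr (Cells1 B)" "g \<in> Arr (Cells1 B)"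
    "Cod (Cells1 B) (Dom (Cells2 B) \<alpha>) = Dom (Cells1 B) f" "Cod (Cells1 B) f = Dom (Cells1 B) g"
  shows "g \<rhd>\<^bsub>B\<^esub> (f \<rhd>\<^bsub>B\<^esub> \<alpha>) = (g \<circ>\<^bsub>B\<^esub> f) \<rhd>\<^bsub>B\<^esub> \<alpha>"
  using HComp_assoc[of B \<alpha> "Id (Cells2 B) f" "Id (Cells2 B) g"] assms by (simp del: HComp_assoc)

lemma is_iso_HComp [simp]:
  assumes "two_category B" "is_iso (Cells2 B) \<alpha>" "is_iso (Cells2 B) \<beta>"
    "Cod (Cells1 B) (Dom (Cells2 B) \<alpha>) = Dom (Cells1 B) (Dom (Cells2 B) \<beta>)"
  shows "is_iso (Cells2 B) (\<beta> \<star>\<^bsub>B\<^esub> \<alpha>)"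
proof (rule is_isoI[of _ _ "inverse_arr (Cells2 B) \<beta> \<star>\<^bsub>B\<^esub> inverse_arr (Cells2 B) \<alpha>"])
  let ?i = "inverse_arr (Cells2 B)"
  have arr: "\<alpha> \<in> Arr (Cells2 B)" "\<beta> \<in> Arr (Cells2 B)" using assms by auto
  show "?i \<beta> \<star>\<^bsub>B\<^esub> ?i \<alpha> \<bullet>\<^bsub>B\<^esub> (\<beta> \<star>\<^bsub>B\<^esub> \<alpha>) = Id (Cells2 B) (Dom (Cells2 B) (\<beta> \<star>\<^bsub>B\<^esub> \<alpha>))"
    using interchange[of B \<alpha> "?i \<alpha>" \<beta> "?i \<beta>"] assms arr by simp
  show "\<beta> \<star>\<^bsub>B\<^esub> \<alpha> \<bullet>\<^bsub>B\<^esub> (?i \<beta> \<star>\<^bsub>B\<^esub> ?i \<alpha>) = Id (Cells2 B) (Cod (Cells2 B) (\<beta> \<star>\<^bsub>B\<^esub> \<alpha>))"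
    using interchange[of B "?i \<alpha>" \<alpha> "?i \<beta>" \<beta>] assms arr by simp
qed (use assms is_iso_Arr in auto)

section \<open>Hom categories and postcomposition\<close>

lemma homcat_sel [simp]:
  "Obj (homcat B X Y) = hom (Cells1 B) X Y"
  "Dom (homcat B X Y) = Dom (Cells2 B)" "Cod (homcat B X Y) = Cod (Cells2 B)"
  "Id (homcat B X Y) = Id (Cells2 B)" "Comp (homcat B X Y) = Comp (Cells2 B)"
  by (simp_all add: homcat_def)

lemma Arr_homcat:
  "two_category B \<Longrightarrow> \<alpha> \<in> Arr (homcat B X Y) \<longleftrightarrow>
     \<alpha> \<in> Arr (Cells2 B) \<and> Dom (Cells1 B) (Dom (Cells2 B) \<alpha>) = X \<and> Cod (Cells1 B) (Dom (Cells2 B) \<alpha>) = Y"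
  by (auto simp: homcat_def in_hom)

lemma category_homcat [simp]: "two_category B \<Longrightarrow> category (homcat B X Y)"
  by (rule categoryI) (auto simp: Arr_homcat in_hom)

lemma hom_homcat:
  "\<lbrakk>two_category B; f \<in> hom (Cells1 B) X Y\<rbrakk> \<Longrightarrow> hom (homcat B X Y) f g = hom (Cells2 B) f g"
  by (auto simp: in_hom Arr_homcat)

lemma is_iso_homcat:
  assumes "two_category B"
  shows "is_iso (homcat B X Y) \<alpha> \<longleftrightarrow> is_iso (Cells2 B) \<alpha> \<and> \<alpha> \<in> Arr (homcat B X Y)"
proof
  assume "is_iso (homcat B X Y) \<alpha>"
  then show "is_iso (Cells2 B) \<alpha> \<and> \<alpha> \<in> Arr (homcat B X Y)"
    using assms unfolding is_iso_def by (auto simp: Arr_homcat in_hom)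
next
  assume *: "is_iso (Cells2 B) \<alpha> \<and> \<alpha> \<in> Arr (homcat B X Y)"
  then show "is_iso (homcat B X Y) \<alpha>"
    using assms by (intro is_isoI[of _ _ "inverse_arr (Cells2 B) \<alpha>"]) (auto simp: Arr_homcat)
qed

lemma hom_post1_sel [simp]:
  "Src (hom_post1 B L f) = homcat B L (Dom (Cells1 B) f)"
  "Tgt (hom_post1 B L f) = homcat B L (Cod (Cells1 B) f)"
  "g \<in> hom (Cells1 B) L (Dom (Cells1 B) f) \<Longrightarrow> OMap (hom_post1 B L f) g = f \<circ>\<^bsub>B\<^esub> g"
  "\<alpha> \<in> Arr (homcat B L (Dom (Cells1 B) f)) \<Longrightarrow> AMap (hom_post1 B L f) \<alpha> = f \<rhd>\<^bsub>B\<^esub> \<alpha>"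
  by (simp_all add: hom_post1_def)

lemma hom_post2_sel [simp]:
  "NSrc (hom_post2 B L \<phi>) = hom_post1 B L (Dom (Cells2 B) \<phi>)"
  "NTgt (hom_post2 B L \<phi>) = hom_post1 B L (Cod (Cells2 B) \<phi>)"
  "g \<in> hom (Cells1 B) L (Dom (Cells1 B) (Dom (Cells2 B) \<phi>)) \<Longrightarrow> NMap (hom_post2 B L \<phi>) g = \<phi> \<lhd>\<^bsub>B\<^esub> g"
  by (simp_all add: hom_post2_def)

lemma hom_post1_functor [simp]:
  assumes "two_category B" "f \<in> Arr (Cells1 B)"
  shows "cat_functor (hom_post1 B L f)"
  by (rule cat_functorI) (use assms in \<open>auto simp: Arr_homcat in_hom\<close>, auto simp: hom_post1_def)

lemma hom_post2_nat_trans [simp]: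
  assumes "two_category B" "\<phi> \<in> Arr (Cells2 B)"
  shows "nat_trans (hom_post2 B L \<phi>)"
  by (rule nat_transI)
    (use assms in \<open>auto simp: Arr_homcat in_hom whisker_exchange\<close>, auto simp: hom_post2_def)

section \<open>Pseudococones and their modifications\<close>

lemma whisker_cocone_sel [simp]:
  "i \<in> Obj (Cells1 I) \<Longrightarrow> Leg (whisker_cocone I B f q) i = f \<circ>\<^bsub>B\<^esub> Leg q i"
  "d \<in> Arr (Cells1 I) \<Longrightarrow> Cell (whisker_cocone I B f q) d = f \<rhd>\<^bsub>B\<^esub> Cell q d"
  by (simp_all add: whisker_cocone_def)

lemma pscocones_sel [simp]:
  "Obj (pscocones I B F X) = {q. pseudococone I B F X q}"
  "Arr (pscocones I B F X) = {m. modification I B F X m}"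
  "Dom (pscocones I B F X) = MSrc" "Cod (pscocones I B F X) = MTgt"
  by (simp_all add: pscocones_def)

lemma pscocones_Id_sel [simp]:
  "MSrc (Id (pscocones I B F X) q) = q" "MTgt (Id (pscocones I B F X) q) = q"
  "i \<in> Obj (Cells1 I) \<Longrightarrow> MMap (Id (pscocones I B F X) q) i = Id (Cells2 B) (Leg q i)"
  by (simp_all add: pscocones_def)

lemma pscocones_Comp_sel [simp]:
  "MSrc (n \<cdot>\<^bsub>pscocones I B F X\<^esub> m) = MSrc m" "MTgt (n \<cdot>\<^bsub>pscocones I B F X\<^esub> m) = MTgt n"
  "i \<in> Obj (Cells1 I) \<Longrightarrow> MMap (n \<cdot>\<^bsub>pscocones I B F X\<^esub> m) i = MMap n i \<bullet>\<^bsub>B\<^esub> MMap m i"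
  by (simp_all add: pscocones_def)

lemma cocone_simps:
  assumes "pseudococone I B F X q"
  shows "X \<in> Obj (Cells1 B)"
    "\<And>i. i \<in> Obj (Cells1 I) \<Longrightarrow> Leg q i \<in> Arr (Cells1 B)"
    "\<And>i. i \<in> Obj (Cells1 I) \<Longrightarrow> Dom (Cells1 B) (Leg q i) = P0 F i"
    "\<And>i. i \<in> Obj (Cells1 I) \<Longrightarrow> Cod (Cells1 B) (Leg q i) = X"
    "\<And>d. d \<in> Arr (Cells1 I) \<Longrightarrow> Cell q d \<in> Arr (Cells2 B)"
    "\<And>d. d \<in> Arr (Cells1 I) \<Longrightarrow> Dom (Cells2 B) (Cell q d) = Leg q (Cod (Cells1 I) d) \<circ>\<^bsub>B\<^esub> P1 F d"
    "\<And>d. d \<in> Arr (Cells1 I) \<Longrightarrow> Cod (Cells2 B) (Cell q d) = Leg q (Dom (Cells1 I) d)"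
    "\<And>d. d \<in> Arr (Cells1 I) \<Longrightarrow> is_iso (Cells2 B) (Cell q d)"
  using pseudococone.vertex_in[OF assms] pseudococone.Leg_in[OF assms]
    pseudococone.Cell_in[OF assms] pseudococone.Cell_iso[OF assms] by (auto simp: in_hom)

lemma cocone_natural:
  "\<lbrakk>pseudococone I B F X q; \<alpha> \<in> Arr (Cells2 I); Dom (Cells2 I) \<alpha> \<in> Arr (Cells1 I)\<rbrakk> \<Longrightarrow>
    Cell q (Cod (Cells2 I) \<alpha>) \<bullet>\<^bsub>B\<^esub> (Leg q (Cod (Cells1 I) (Dom (Cells2 I) \<alpha>)) \<rhd>\<^bsub>B\<^esub> P2 F \<alpha>) = Cell q (Dom (Cells2 I) \<alpha>)"
  by (rule pseudococone.Cell_natural) (auto simp: in_hom)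

lemma cocone_comp:
  "\<lbrakk>pseudococone I B F X q; d \<in> Arr (Cells1 I); e \<in> Arr (Cells1 I); Cod (Cells1 I) d = Dom (Cells1 I) e\<rbrakk> \<Longrightarrow>
    Cell q (e \<circ>\<^bsub>I\<^esub> d) \<bullet>\<^bsub>B\<^esub> (Leg q (Cod (Cells1 I) e) \<rhd>\<^bsub>B\<^esub> PComp F e d)
      = Cell q d \<bullet>\<^bsub>B\<^esub> (Cell q e \<lhd>\<^bsub>B\<^esub> P1 F d)"
  by (rule pseudococone.Cell_comp[of _ _ _ _ _ d "Dom (Cells1 I) d" "Cod (Cells1 I) d" e]) (auto simp: in_hom)

lemma cocone_eqI:
  fixes q r :: "('i, 'd, 'm, 'c) cocone"
  assumes q: "pseudococone I B F X q" and r: "pseudococone I B F X r"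
    and "\<And>i. i \<in> Obj (Cells1 I) \<Longrightarrow> Leg q i = Leg r i" "\<And>d. d \<in> Arr (Cells1 I) \<Longrightarrow> Cell q d = Cell r d"
  shows "q = r"
proof -
  have "Leg q = Leg r"
    by (rule extensionalityI[of _ "Obj (Cells1 I)"]) (use assms pseudococone.Leg_ext[OF q] pseudococone.Leg_ext[OF r] in auto)
  moreover have "Cell q = Cell r"
    by (rule extensionalityI[of _ "Arr (Cells1 I)"]) (use assms pseudococone.Cell_ext[OF q] pseudococone.Cell_ext[OF r] in auto)
  ultimately show ?thesis by (intro cocone.equality) auto
qed

lemma modification_simps:
  assumes "modification I B F X m"
  shows "pseudococone I B F X (MSrc m)" "pseudococone I B F X (MTgt m)"
    "\<And>i. i \<in> Obj (Cells1 I) \<Longrightarrow> MMap m i \<in> Arr (Cells2 B)"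
    "\<And>i. i \<in> Obj (Cells1 I) \<Longrightarrow> Dom (Cells2 B) (MMap m i) = Leg (MSrc m) i"
    "\<And>i. i \<in> Obj (Cells1 I) \<Longrightarrow> Cod (Cells2 B) (MMap m i) = Leg (MTgt m) i"
  using modification.MSrc_cocone[OF assms] modification.MTgt_cocone[OF assms]
    modification.MMap_in[OF assms] by (auto simp: in_hom)

lemma modification_Cell:
  "\<lbrakk>modification I B F X m; d \<in> Arr (Cells1 I)\<rbrakk> \<Longrightarrow>
    MMap m (Dom (Cells1 I) d) \<bullet>\<^bsub>B\<^esub> Cell (MSrc m) d =
    Cell (MTgt m) d \<bullet>\<^bsub>B\<^esub> (MMap m (Cod (Cells1 I) d) \<lhd>\<^bsub>B\<^esub> P1 F d)"
  by (rule modification.MMap_Cell) (auto simp: in_hom)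

lemma modification_eqI:
  fixes m n :: "('i, 'd, 'm, 'c) modif"
  assumes m: "modification I B F X m" and n: "modification I B F X n"
    and "MSrc m = MSrc n" "MTgt m = MTgt n" "\<And>i. i \<in> Obj (Cells1 I) \<Longrightarrow> MMap m i = MMap n i"
  shows "m = n"
proof -
  have "MMap m = MMap n"
    by (rule extensionalityI[of _ "Obj (Cells1 I)"]) (use assms modification.MMap_ext[OF m] modification.MMap_ext[OF n] in auto)
  then show ?thesis using assms(3,4) by (intro modif.equality) auto
qed

text \<open>The comparison functor that the Yoneda principle attaches to the pseudococone
  \<open>q\<close>: it sends a 1-cell out of \<open>L\<close> to the whiskering of \<open>q\<close>
  with it. \<open>bicolimitI\<close> and \<open>bicolimitD\<close> show that \<open>q\<close> is a
  bicolimit exactly when all these functors are equivalences.\<close>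

definition cocone_action ::
  "('i, 'd, 'e) twocat \<Rightarrow> ('o, 'm, 'c) twocat \<Rightarrow> ('i, 'd, 'e, 'o, 'm, 'c) psfun \<Rightarrow> 'o \<Rightarrow>
   ('i, 'd, 'm, 'c) cocone \<Rightarrow> 'o \<Rightarrow> ('m, 'c, ('i, 'd, 'm, 'c) cocone, ('i, 'd, 'm, 'c) modif) func" where
  "cocone_action I B F L q X = \<lparr>
     Src = homcat B L X, Tgt = pscocones I B F X,
     OMap = (\<lambda>f\<in>hom (Cells1 B) L X. whisker_cocone I B f q),
     AMap = (\<lambda>\<alpha>\<in>Arr (homcat B L X).
       \<lparr>MSrc = whisker_cocone I B (Dom (Cells2 B) \<alpha>) q, MTgt = whisker_cocone I B (Cod (Cells2 B) \<alpha>) q,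
        MMap = (\<lambda>i\<in>Obj (Cells1 I). \<alpha> \<lhd>\<^bsub>B\<^esub> Leg q i)\<rparr>)\<rparr>"

lemma cocone_action_sel [simp]:
  "Src (cocone_action I B F L q X) = homcat B L X" "Tgt (cocone_action I B F L q X) = pscocones I B F X"
  "f \<in> hom (Cells1 B) L X \<Longrightarrow> OMap (cocone_action I B F L q X) f = whisker_cocone I B f q"
  by (simp_all add: cocone_action_def)

lemma cocone_action_AMap_sel [simp]:
  assumes "\<alpha> \<in> Arr (homcat B L X)"
  shows "MSrc (AMap (cocone_action I B F L q X) \<alpha>) = whisker_cocone I B (Dom (Cells2 B) \<alpha>) q"
    "MTgt (AMap (cocone_action I B F L q X) \<alpha>) = whisker_cocone I B (Cod (Cells2 B) \<alpha>) q"
    "i \<in> Obj (Cells1 I) \<Longrightarrow> MMap (AMap (cocone_action I B F L q X) \<alpha>) i = \<alpha> \<lhd>\<^bsub>B\<^esub> Leg q i"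
  using assms by (simp_all add: cocone_action_def)

lemma cocone_post1_sel [simp]:
  "Src (cocone_post1 I B F f) = pscocones I B F (Dom (Cells1 B) f)"
  "Tgt (cocone_post1 I B F f) = pscocones I B F (Cod (Cells1 B) f)"
  "pseudococone I B F (Dom (Cells1 B) f) q \<Longrightarrow> OMap (cocone_post1 I B F f) q = whisker_cocone I B f q"
  by (simp_all add: cocone_post1_def)

lemma cocone_post1_AMap_sel [simp]:
  assumes "modification I B F (Dom (Cells1 B) f) m"
  shows "MSrc (AMap (cocone_post1 I B F f) m) = whisker_cocone I B f (MSrc m)"
    "MTgt (AMap (cocone_post1 I B F f) m) = whisker_cocone I B f (MTgt m)"
    "i \<in> Obj (Cells1 I) \<Longrightarrow> MMap (AMap (cocone_post1 I B F f) m) i = f \<rhd>\<^bsub>B\<^esub> MMap m i"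
  using assms by (simp_all add: cocone_post1_def)

lemma cocone_post2_sel [simp]:
  "NSrc (cocone_post2 I B F \<phi>) = cocone_post1 I B F (Dom (Cells2 B) \<phi>)"
  "NTgt (cocone_post2 I B F \<phi>) = cocone_post1 I B F (Cod (Cells2 B) \<phi>)"
  by (simp_all add: cocone_post2_def)

text \<open>Whiskering \<open>q\<close> with \<open>\<phi>\<close> can be read with
  \<open>\<phi>\<close> fixed, as a component of \<open>cocone_post2\<close>, or with
  \<open>q\<close> fixed, as the action on an arrow. Identifying the two readings lets one set of
  lemmas serve both.\<close>

lemma cocone_post2_NMap [simp]:
  assumes "two_category B" "\<phi> \<in> Arr (Cells2 B)" "X = Dom (Cells1 B) (Dom (Cells2 B) \<phi>)" "pseudococone I B F X q"
  shows "NMap (cocone_post2 I B F \<phi>) q =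
    AMap (cocone_action I B F X q (Cod (Cells1 B) (Dom (Cells2 B) \<phi>))) \<phi>"
  using assms by (simp add: cocone_post2_def cocone_action_def Arr_homcat)

context pseudofunctor
begin

lemma two_cats [simp]: "two_category I" "two_category B"
  by unfold_locales

lemma pseudofunctor_simps [simp]:
  "i \<in> Obj (Cells1 I) \<Longrightarrow> P0 F i \<in> Obj (Cells1 B)"
  "d \<in> Arr (Cells1 I) \<Longrightarrow> P1 F d \<in> Arr (Cells1 B)"
  "d \<in> Arr (Cells1 I) \<Longrightarrow> Dom (Cells1 B) (P1 F d) = P0 F (Dom (Cells1 I) d)"
  "d \<in> Arr (Cells1 I) \<Longrightarrow> Cod (Cells1 B) (P1 F d) = P0 F (Cod (Cells1 I) d)"
  "\<alpha> \<in> Arr (Cells2 I) \<Longrightarrow> P2 F \<alpha> \<in> Arr (Cells2 B)"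
  "\<alpha> \<in> Arr (Cells2 I) \<Longrightarrow> Dom (Cells2 B) (P2 F \<alpha>) = P1 F (Dom (Cells2 I) \<alpha>)"
  "\<alpha> \<in> Arr (Cells2 I) \<Longrightarrow> Cod (Cells2 B) (P2 F \<alpha>) = P1 F (Cod (Cells2 I) \<alpha>)"
  "i \<in> Obj (Cells1 I) \<Longrightarrow> PUnit F i \<in> Arr (Cells2 B)"
  "i \<in> Obj (Cells1 I) \<Longrightarrow> Dom (Cells2 B) (PUnit F i) = Id (Cells1 B) (P0 F i)"
  "i \<in> Obj (Cells1 I) \<Longrightarrow> Cod (Cells2 B) (PUnit F i) = P1 F (Id (Cells1 I) i)"
  using P0_in[of i] P1_in[of d] P2_in[of \<alpha>] PUnit_in[of i] by (auto simp: in_hom)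

lemma PComp_simps [simp]:
  assumes "d \<in> Arr (Cells1 I)" "e \<in> Arr (Cells1 I)" "Cod (Cells1 I) d = Dom (Cells1 I) e"
  shows "PComp F e d \<in> Arr (Cells2 B)" "Dom (Cells2 B) (PComp F e d) = P1 F e \<circ>\<^bsub>B\<^esub> P1 F d"
    "Cod (Cells2 B) (PComp F e d) = P1 F (e \<circ>\<^bsub>I\<^esub> d)" "is_iso (Cells2 B) (PComp F e d)"
  using PComp_in[of d _ _ e] PComp_iso[of d _ _ e] assms by (auto simp: in_hom)

lemma category_pscocones [simp]: "category (pscocones I B F X)"
proof (rule categoryI)
  fix m assume "m \<in> Arr (pscocones I B F X)"
  then have m: "modification I B F X m" by simp
  note [simp] = modification_simps[OF m] cocone_simps[OF modification_simps(1)[OF m]]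
    cocone_simps[OF modification_simps(2)[OF m]]
  show "Dom (pscocones I B F X) m \<in> Obj (pscocones I B F X)"
    "Cod (pscocones I B F X) m \<in> Obj (pscocones I B F X)" by simp_all
  show "m \<cdot>\<^bsub>pscocones I B F X\<^esub> Id (pscocones I B F X) (Dom (pscocones I B F X) m) = m"
    by (intro modif.equality ext)
      (use modification.MMap_ext[OF m] in \<open>auto simp: pscocones_def extensional_def\<close>)
  show "Id (pscocones I B F X) (Cod (pscocones I B F X) m) \<cdot>\<^bsub>pscocones I B F X\<^esub> m = m"
    by (intro modif.equality ext)
      (use modification.MMap_ext[OF m] in \<open>auto simp: pscocones_def extensional_def\<close>)
next
  fix q assume "q \<in> Obj (pscocones I B F X)"
  then have q: "pseudococone I B F X q" by simp
  note [simp] = cocone_simps[OF q]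
  have "modification I B F X (Id (pscocones I B F X) q)"
    by (rule modification.intro) (use q in \<open>auto simp: in_hom\<close>, auto simp: pscocones_def)
  then show "Id (pscocones I B F X) q \<in> Arr (pscocones I B F X) \<and>
         Dom (pscocones I B F X) (Id (pscocones I B F X) q) = q \<and>
         Cod (pscocones I B F X) (Id (pscocones I B F X) q) = q" by simp
next
  fix m n assume "m \<in> Arr (pscocones I B F X)" "n \<in> Arr (pscocones I B F X)"
    "Cod (pscocones I B F X) m = Dom (pscocones I B F X) n"
  then have m: "modification I B F X m" and n: "modification I B F X n" and mn: "MTgt m = MSrc n" by auto
  note [simp] = modification_simps[OF m] modification_simps[OF n] cocone_simps[OF modification_simps(1)[OF m]]
    cocone_simps[OF modification_simps(1)[OF n]] cocone_simps[OF modification_simps(2)[OF n]] mn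
  have "modification I B F X (n \<cdot>\<^bsub>pscocones I B F X\<^esub> m)"
  proof (rule modification.intro)
    fix d i j assume "d \<in> hom (Cells1 I) i j"
    then have [simp]: "d \<in> Arr (Cells1 I)" "i = Dom (Cells1 I) d" "j = Cod (Cells1 I) d" by (auto simp: in_hom)
    have "MMap n i \<bullet>\<^bsub>B\<^esub> (MMap m i \<bullet>\<^bsub>B\<^esub> Cell (MSrc m) d) = (MMap n i \<bullet>\<^bsub>B\<^esub> Cell (MSrc n) d) \<bullet>\<^bsub>B\<^esub> (MMap m j \<lhd>\<^bsub>B\<^esub> P1 F d)"
      using modification_Cell[OF m, of d] by simp
    then show "MMap (n \<cdot>\<^bsub>pscocones I B F X\<^esub> m) i \<bullet>\<^bsub>B\<^esub> Cell (MSrc (n \<cdot>\<^bsub>pscocones I B F X\<^esub> m)) d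
      = Cell (MTgt (n \<cdot>\<^bsub>pscocones I B F X\<^esub> m)) d \<bullet>\<^bsub>B\<^esub> (MMap (n \<cdot>\<^bsub>pscocones I B F X\<^esub> m) j \<lhd>\<^bsub>B\<^esub> P1 F d)"
      using modification_Cell[OF n, of d] by simp
  qed (use m n in \<open>auto simp: in_hom\<close>, auto simp: pscocones_def)
  then show "n \<cdot>\<^bsub>pscocones I B F X\<^esub> m \<in> Arr (pscocones I B F X) \<and>
      Dom (pscocones I B F X) (n \<cdot>\<^bsub>pscocones I B F X\<^esub> m) = Dom (pscocones I B F X) m \<and>
      Cod (pscocones I B F X) (n \<cdot>\<^bsub>pscocones I B F X\<^esub> m) = Cod (pscocones I B F X) n" by simp
next
  fix l m n assume "l \<in> Arr (pscocones I B F X)" "m \<in> Arr (pscocones I B F X)" "n \<in> Arr (pscocones I B F X)"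
    "Cod (pscocones I B F X) l = Dom (pscocones I B F X) m" "Cod (pscocones I B F X) m = Dom (pscocones I B F X) n"
  then have l: "modification I B F X l" and m: "modification I B F X m" and n: "modification I B F X n"
    and [simp]: "MTgt l = MSrc m" "MTgt m = MSrc n" by auto
  note [simp] = modification_simps[OF l] modification_simps[OF m] modification_simps[OF n]
  show "n \<cdot>\<^bsub>pscocones I B F X\<^esub> m \<cdot>\<^bsub>pscocones I B F X\<^esub> l = n \<cdot>\<^bsub>pscocones I B F X\<^esub> (m \<cdot>\<^bsub>pscocones I B F X\<^esub> l)"
    by (intro modif.equality ext) (auto simp: pscocones_def)
qed

lemma whisker_cocone_cocone [simp]:
  assumes f: "f \<in> Arr (Cells1 B)" and q: "pseudococone I B F (Dom (Cells1 B) f) q" and Y: "Y = Cod (Cells1 B) f"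
  shows "pseudococone I B F Y (whisker_cocone I B f q)"
proof (rule pseudococone.intro)
  note [simp] = cocone_simps[OF q] f Y
  show "Cell (whisker_cocone I B f q) d' \<bullet>\<^bsub>B\<^esub> (Leg (whisker_cocone I B f q) j \<rhd>\<^bsub>B\<^esub> P2 F \<alpha>) = Cell (whisker_cocone I B f q) d"
    if "d \<in> hom (Cells1 I) i j" "\<alpha> \<in> hom (Cells2 I) d d'" for d i j \<alpha> d'
  proof -
    have \<alpha> [simp]: "\<alpha> \<in> Arr (Cells2 I)" "d = Dom (Cells2 I) \<alpha>" "d' = Cod (Cells2 I) \<alpha>"
      "j = Cod (Cells1 I) (Dom (Cells2 I) \<alpha>)" using that by (auto simp: in_hom)
    show ?thesis
      using arg_cong[OF cocone_natural[OF q, of \<alpha>], of "\<lambda>\<beta>. f \<rhd>\<^bsub>B\<^esub> \<beta>"] by simp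
  qed
  show "Cell (whisker_cocone I B f q) (Id (Cells1 I) i) \<bullet>\<^bsub>B\<^esub> (Leg (whisker_cocone I B f q) i \<rhd>\<^bsub>B\<^esub> PUnit F i) =
         Id (Cells2 B) (Leg (whisker_cocone I B f q) i)"
    if "i \<in> Obj (Cells1 I)" for i
    using that arg_cong[OF pseudococone.Cell_Id[OF q that], of "\<lambda>\<beta>. f \<rhd>\<^bsub>B\<^esub> \<beta>"] by simp
  show "Cell (whisker_cocone I B f q) (e \<circ>\<^bsub>I\<^esub> d) \<bullet>\<^bsub>B\<^esub> (Leg (whisker_cocone I B f q) k \<rhd>\<^bsub>B\<^esub> PComp F e d) =
         Cell (whisker_cocone I B f q) d \<bullet>\<^bsub>B\<^esub> (Cell (whisker_cocone I B f q) e \<lhd>\<^bsub>B\<^esub> P1 F d)"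
    if "d \<in> hom (Cells1 I) i j" "e \<in> hom (Cells1 I) j k" for d i j e k
  proof -
    have [simp]: "d \<in> Arr (Cells1 I)" "e \<in> Arr (Cells1 I)" "j = Dom (Cells1 I) e" "Cod (Cells1 I) d = Dom (Cells1 I) e" "k = Cod (Cells1 I) e"
      using that by (auto simp: in_hom)
    show ?thesis
      using arg_cong[OF cocone_comp[OF q, of d e], of "\<lambda>\<beta>. f \<rhd>\<^bsub>B\<^esub> \<beta>"] by simp
  qed
qed (use cocone_simps[OF q] f Y in \<open>auto simp: in_hom\<close>, auto simp: whisker_cocone_def)

end

lemma nat_iso_nt_id [simp]: "cat_functor F \<Longrightarrow> nat_iso (nt_id F)"
  by (simp add: nat_iso_def)

context pseudofunctor
begin

lemma whisker_cocone_comp: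
  assumes "pseudococone I B F (Dom (Cells1 B) f) q" "f \<in> Arr (Cells1 B)" "g \<in> Arr (Cells1 B)"
    "Cod (Cells1 B) f = Dom (Cells1 B) g"
  shows "whisker_cocone I B g (whisker_cocone I B f q) = whisker_cocone I B (g \<circ>\<^bsub>B\<^esub> f) q"
  by (rule cocone_eqI[of I B F "Cod (Cells1 B) g"])
    (use assms cocone_simps[OF assms(1)] in auto)

lemma whisker_cocone_Id [simp]:
  assumes "pseudococone I B F L q"
  shows "whisker_cocone I B (Id (Cells1 B) L) q = q"
  by (rule cocone_eqI[of I B F L]) (use assms cocone_simps[OF assms(1)] in auto)

text \<open>Compatibility with the structure cells is the exchange law for \<open>\<alpha>\<close>
  and the cells of \<open>q\<close>.\<close>

lemma modification_cocone_action [simp]: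
  assumes q: "pseudococone I B F L q" and \<alpha>: "\<alpha> \<in> Arr (homcat B L X)"
  shows "modification I B F X (AMap (cocone_action I B F L q X) \<alpha>)"
proof (rule modification.intro)
  have \<alpha>' [simp]: "\<alpha> \<in> Arr (Cells2 B)" "Dom (Cells1 B) (Dom (Cells2 B) \<alpha>) = L" "Cod (Cells1 B) (Dom (Cells2 B) \<alpha>) = X"
    using \<alpha> by (auto simp: Arr_homcat)
  note [simp] = cocone_simps[OF q] \<alpha>
  show "pseudococone I B F X (MSrc (AMap (cocone_action I B F L q X) \<alpha>))"
    "pseudococone I B F X (MTgt (AMap (cocone_action I B F L q X) \<alpha>))" using q by auto
  fix d i j assume "d \<in> hom (Cells1 I) i j"
  then have [simp]: "d \<in> Arr (Cells1 I)" "i = Dom (Cells1 I) d" "j = Cod (Cells1 I) d" by (auto simp: in_hom)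
  show "MMap (AMap (cocone_action I B F L q X) \<alpha>) i \<bullet>\<^bsub>B\<^esub> Cell (MSrc (AMap (cocone_action I B F L q X) \<alpha>)) d =
    Cell (MTgt (AMap (cocone_action I B F L q X) \<alpha>)) d \<bullet>\<^bsub>B\<^esub>
      (MMap (AMap (cocone_action I B F L q X) \<alpha>) j \<lhd>\<^bsub>B\<^esub> P1 F d)"
    using whisker_exchange[of B "Cell q d" \<alpha>] by simp
qed (use \<alpha> cocone_simps[OF q] in \<open>auto simp: in_hom Arr_homcat\<close>,
    use \<alpha> in \<open>simp add: cocone_action_def\<close>)

lemma cocone_action_functor [simp]:
  assumes q: "pseudococone I B F L q" and X: "X \<in> Obj (Cells1 B)"
  shows "cat_functor (cocone_action I B F L q X)"
proof (rule cat_functorI)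
  note [simp] = cocone_simps[OF q] q X
  fix f assume "f \<in> Obj (Src (cocone_action I B F L q X))"
  then have f: "f \<in> Arr (Cells1 B)" "Dom (Cells1 B) f = L" "Cod (Cells1 B) f = X" by (auto simp: in_hom)
  then show "OMap (cocone_action I B F L q X) f \<in> Obj (Tgt (cocone_action I B F L q X))"
    by (simp add: in_hom)
  have Id_f [simp]: "Id (Cells2 B) f \<in> Arr (homcat B L X)" using f by (simp add: Arr_homcat)
  have "AMap (cocone_action I B F L q X) (Id (Cells2 B) f) = Id (pscocones I B F X) (whisker_cocone I B f q)"
    by (rule modification_eqI[of I B F X]) (use f Id_hom[of "pscocones I B F X"] in auto)
  then show "AMap (cocone_action I B F L q X) (Id (Src (cocone_action I B F L q X)) f) =
    Id (Tgt (cocone_action I B F L q X)) (OMap (cocone_action I B F L q X) f)"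
    using f by (simp add: in_hom)
next
  note [simp] = cocone_simps[OF q] q X
  fix \<alpha> \<beta> assume "\<alpha> \<in> Arr (Src (cocone_action I B F L q X))" "\<beta> \<in> Arr (Src (cocone_action I B F L q X))"
    "Cod (Src (cocone_action I B F L q X)) \<alpha> = Dom (Src (cocone_action I B F L q X)) \<beta>"
  then have [simp]: "\<alpha> \<in> Arr (homcat B L X)" "\<beta> \<in> Arr (homcat B L X)"
    and ab [simp]: "Cod (Cells2 B) \<alpha> = Dom (Cells2 B) \<beta>" by auto
  have *: "\<beta> \<bullet>\<^bsub>B\<^esub> \<alpha> \<in> Arr (homcat B L X)" using Comp_hom(1)[of "homcat B L X" \<alpha> \<beta>] by simp
  have [simp]: "\<alpha> \<in> Arr (Cells2 B)" "Dom (Cells1 B) (Dom (Cells2 B) \<alpha>) = L" "Cod (Cells1 B) (Dom (Cells2 B) \<alpha>) = X"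
    "\<beta> \<in> Arr (Cells2 B)" "Dom (Cells1 B) (Dom (Cells2 B) \<beta>) = L" "Cod (Cells1 B) (Dom (Cells2 B) \<beta>) = X"
    by (metis \<open>\<alpha> \<in> Arr (homcat B L X)\<close> \<open>\<beta> \<in> Arr (homcat B L X)\<close> two_cats(2) Arr_homcat)+
  have "AMap (cocone_action I B F L q X) (\<beta> \<bullet>\<^bsub>B\<^esub> \<alpha>) =
    AMap (cocone_action I B F L q X) \<beta> \<cdot>\<^bsub>pscocones I B F X\<^esub> AMap (cocone_action I B F L q X) \<alpha>"
    by (rule modification_eqI[of I B F X])
      (use * Comp_hom(1)[of "pscocones I B F X" "AMap (cocone_action I B F L q X) \<alpha>" "AMap (cocone_action I B F L q X) \<beta>"] in auto)
  then show "AMap (cocone_action I B F L q X) (\<beta> \<cdot>\<^bsub>Src (cocone_action I B F L q X)\<^esub> \<alpha>) =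
    AMap (cocone_action I B F L q X) \<beta> \<cdot>\<^bsub>Tgt (cocone_action I B F L q X)\<^esub> AMap (cocone_action I B F L q X) \<alpha>"
    by simp
qed (use q X cocone_simps[OF q] in \<open>auto simp: in_hom Arr_homcat\<close>, auto simp: cocone_action_def in_hom Arr_homcat extensional_def)

lemma modification_cocone_post1 [simp]:
  assumes f: "f \<in> Arr (Cells1 B)" and m: "modification I B F (Dom (Cells1 B) f) m" and Y: "Y = Cod (Cells1 B) f"
  shows "modification I B F Y (AMap (cocone_post1 I B F f) m)"
proof (rule modification.intro)
  note [simp] = modification_simps[OF m] cocone_simps[OF modification_simps(1)[OF m]]
    cocone_simps[OF modification_simps(2)[OF m]] f m Y
  fix d i j assume "d \<in> hom (Cells1 I) i j"
  then have [simp]: "d \<in> Arr (Cells1 I)" "i = Dom (Cells1 I) d" "j = Cod (Cells1 I) d" by (auto simp: in_hom)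
  show "MMap (AMap (cocone_post1 I B F f) m) i \<bullet>\<^bsub>B\<^esub> Cell (MSrc (AMap (cocone_post1 I B F f) m)) d =
    Cell (MTgt (AMap (cocone_post1 I B F f) m)) d \<bullet>\<^bsub>B\<^esub> (MMap (AMap (cocone_post1 I B F f) m) j \<lhd>\<^bsub>B\<^esub> P1 F d)"
    using arg_cong[OF modification_Cell[OF m, of d], of "\<lambda>\<beta>. f \<rhd>\<^bsub>B\<^esub> \<beta>"] by simp
qed (use f m Y modification_simps[OF m] cocone_simps[OF modification_simps(1)[OF m]]
    cocone_simps[OF modification_simps(2)[OF m]] in \<open>auto simp: in_hom\<close>, auto simp: cocone_post1_def)

lemma cocone_post1_functor [simp]:
  assumes f: "f \<in> Arr (Cells1 B)"
  shows "cat_functor (cocone_post1 I B F f)"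
proof (rule cat_functorI)
  let ?X = "Dom (Cells1 B) f" and ?Y = "Cod (Cells1 B) f"
  note [simp] = f
  fix q assume "q \<in> Obj (Src (cocone_post1 I B F f))"
  then have q [simp]: "pseudococone I B F ?X q" by simp
  note [simp] = cocone_simps[OF q]
  have Id_q [simp]: "modification I B F ?X (Id (pscocones I B F ?X) q)"
    using Id_hom(1)[of "pscocones I B F ?X" q] by simp
  have "AMap (cocone_post1 I B F f) (Id (pscocones I B F ?X) q) = Id (pscocones I B F ?Y) (whisker_cocone I B f q)"
    by (rule modification_eqI[of I B F ?Y])
      (use Id_hom(1)[of "pscocones I B F ?Y" "whisker_cocone I B f q"] in auto)
  then show "AMap (cocone_post1 I B F f) (Id (Src (cocone_post1 I B F f)) q) =
    Id (Tgt (cocone_post1 I B F f)) (OMap (cocone_post1 I B F f) q)" by simp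
next
  let ?X = "Dom (Cells1 B) f" and ?Y = "Cod (Cells1 B) f"
  note [simp] = f
  fix m n assume "m \<in> Arr (Src (cocone_post1 I B F f))" "n \<in> Arr (Src (cocone_post1 I B F f))"
    "Cod (Src (cocone_post1 I B F f)) m = Dom (Src (cocone_post1 I B F f)) n"
  then have m [simp]: "modification I B F ?X m" and n [simp]: "modification I B F ?X n" and mn [simp]: "MTgt m = MSrc n"
    by auto
  note [simp] = modification_simps[OF m] modification_simps[OF n] cocone_simps[OF modification_simps(1)[OF m]]
    cocone_simps[OF modification_simps(2)[OF m]] cocone_simps[OF modification_simps(2)[OF n]]
    cocone_simps[OF modification_simps(1)[OF n]]
  have [simp]: "modification I B F ?X (n \<cdot>\<^bsub>pscocones I B F ?X\<^esub> m)"
    using Comp_hom(1)[of "pscocones I B F ?X" m n] by simp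
  have "AMap (cocone_post1 I B F f) (n \<cdot>\<^bsub>pscocones I B F ?X\<^esub> m) =
    AMap (cocone_post1 I B F f) n \<cdot>\<^bsub>pscocones I B F ?Y\<^esub> AMap (cocone_post1 I B F f) m"
    by (rule modification_eqI[of I B F ?Y])
      (use Comp_hom(1)[of "pscocones I B F ?Y" "AMap (cocone_post1 I B F f) m" "AMap (cocone_post1 I B F f) n"] in auto)
  then show "AMap (cocone_post1 I B F f) (n \<cdot>\<^bsub>Src (cocone_post1 I B F f)\<^esub> m) =
    AMap (cocone_post1 I B F f) n \<cdot>\<^bsub>Tgt (cocone_post1 I B F f)\<^esub> AMap (cocone_post1 I B F f) m" by simp
next
  fix m assume "m \<in> Arr (Src (cocone_post1 I B F f))"
  then show "AMap (cocone_post1 I B F f) m \<in> hom (Tgt (cocone_post1 I B F f))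
      (OMap (cocone_post1 I B F f) (Dom (Src (cocone_post1 I B F f)) m))
      (OMap (cocone_post1 I B F f) (Cod (Src (cocone_post1 I B F f)) m))"
    using f modification_simps(1,2)[of I B F "Dom (Cells1 B) f" m] by (simp add: in_hom)
qed (use f in auto, auto simp: cocone_post1_def extensional_def)

text \<open>Whiskering twice is whiskering with the composite, because composition in
  \<open>B\<close> is strictly associative. The comparison functors are therefore natural in 1-cells
  on the nose.\<close>

lemma cocone_post1_action:
  assumes q: "pseudococone I B F L q" and f: "f \<in> Arr (Cells1 B)"
  shows "func_comp (cocone_post1 I B F f) (cocone_action I B F L q (Dom (Cells1 B) f))
    = func_comp (cocone_action I B F L q (Cod (Cells1 B) f)) (hom_post1 B L f)" (is "?P = ?Q")
proof (rule func_eqI)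
  note [simp] = cocone_simps[OF q] q f
  show "OMap ?P g = OMap ?Q g" if "g \<in> Obj (Src ?Q)" for g
  proof -
    have g: "g \<in> Arr (Cells1 B)" "Dom (Cells1 B) g = L" "Cod (Cells1 B) g = Dom (Cells1 B) f"
      using that by (auto simp: in_hom)
    then show ?thesis by (simp add: in_hom whisker_cocone_comp)
  qed
  show "AMap ?P \<alpha> = AMap ?Q \<alpha>" if "\<alpha> \<in> Arr (Src ?Q)" for \<alpha>
  proof (rule modification_eqI[of I B F "Cod (Cells1 B) f"])
    have \<alpha>: "\<alpha> \<in> Arr (homcat B L (Dom (Cells1 B) f))" using that by simp
    then have \<alpha>' [simp]: "\<alpha> \<in> Arr (Cells2 B)" "Dom (Cells1 B) (Dom (Cells2 B) \<alpha>) = L"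
      "Cod (Cells1 B) (Dom (Cells2 B) \<alpha>) = Dom (Cells1 B) f" by (auto simp: Arr_homcat)
    note [simp] = \<alpha>
    have [simp]: "f \<rhd>\<^bsub>B\<^esub> \<alpha> \<in> Arr (homcat B L (Cod (Cells1 B) f))" by (simp add: Arr_homcat)
    show "modification I B F (Cod (Cells1 B) f) (AMap ?P \<alpha>)" "modification I B F (Cod (Cells1 B) f) (AMap ?Q \<alpha>)"
      by simp_all
    show "MSrc (AMap ?P \<alpha>) = MSrc (AMap ?Q \<alpha>)" "MTgt (AMap ?P \<alpha>) = MTgt (AMap ?Q \<alpha>)"
      by (simp_all add: whisker_cocone_comp)
    show "MMap (AMap ?P \<alpha>) i = MMap (AMap ?Q \<alpha>) i" if "i \<in> Obj (Cells1 I)" for i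
      using that by simp
  qed
qed (use q f in simp_all)

lemma cocone_post2_nat_trans [simp]:
  assumes \<phi>: "\<phi> \<in> Arr (Cells2 B)"
  shows "nat_trans (cocone_post2 I B F \<phi>)"
proof (rule nat_transI)
  let ?f = "Dom (Cells2 B) \<phi>" and ?g = "Cod (Cells2 B) \<phi>"
  let ?X = "Dom (Cells1 B) ?f" and ?Y = "Cod (Cells1 B) ?f"
  note [simp] = \<phi>
  have [simp]: "\<phi> \<in> Arr (homcat B ?X ?Y)" by (simp add: Arr_homcat)
  show "cat_functor (NSrc (cocone_post2 I B F \<phi>))" "cat_functor (NTgt (cocone_post2 I B F \<phi>))"
    "Src (NTgt (cocone_post2 I B F \<phi>)) = Src (NSrc (cocone_post2 I B F \<phi>))"
    "Tgt (NTgt (cocone_post2 I B F \<phi>)) = Tgt (NSrc (cocone_post2 I B F \<phi>))" by simp_all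
  show "NMap (cocone_post2 I B F \<phi>) \<in> extensional (Obj (Src (NSrc (cocone_post2 I B F \<phi>))))"
    by (simp add: cocone_post2_def)
  show "NMap (cocone_post2 I B F \<phi>) q \<in> hom (Tgt (NSrc (cocone_post2 I B F \<phi>)))
      (OMap (NSrc (cocone_post2 I B F \<phi>)) q) (OMap (NTgt (cocone_post2 I B F \<phi>)) q)"
    if "q \<in> Obj (Src (NSrc (cocone_post2 I B F \<phi>)))" for q
    using that by (simp add: in_hom)
  show "NMap (cocone_post2 I B F \<phi>) (Cod (Src (NSrc (cocone_post2 I B F \<phi>))) m)
      \<cdot>\<^bsub>Tgt (NSrc (cocone_post2 I B F \<phi>))\<^esub> AMap (NSrc (cocone_post2 I B F \<phi>)) m =
    AMap (NTgt (cocone_post2 I B F \<phi>)) m \<cdot>\<^bsub>Tgt (NSrc (cocone_post2 I B F \<phi>))\<^esub>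
      NMap (cocone_post2 I B F \<phi>) (Dom (Src (NSrc (cocone_post2 I B F \<phi>))) m)"
    if "m \<in> Arr (Src (NSrc (cocone_post2 I B F \<phi>)))" for m
  proof -
    have m [simp]: "modification I B F ?X m" using that by simp
    note [simp] = modification_simps[OF m] cocone_simps[OF modification_simps(1)[OF m]]
      cocone_simps[OF modification_simps(2)[OF m]]
    let ?A = "AMap (cocone_action I B F ?X (MTgt m) ?Y) \<phi>" and ?B = "AMap (cocone_action I B F ?X (MSrc m) ?Y) \<phi>"
    have "?A \<cdot>\<^bsub>pscocones I B F ?Y\<^esub> AMap (cocone_post1 I B F ?f) m
        = AMap (cocone_post1 I B F ?g) m \<cdot>\<^bsub>pscocones I B F ?Y\<^esub> ?B"
    proof (rule modification_eqI[of I B F ?Y])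
      show "modification I B F ?Y (?A \<cdot>\<^bsub>pscocones I B F ?Y\<^esub> AMap (cocone_post1 I B F ?f) m)"
        using Comp_hom(1)[of "pscocones I B F ?Y" "AMap (cocone_post1 I B F ?f) m" ?A] by simp
      show "modification I B F ?Y (AMap (cocone_post1 I B F ?g) m \<cdot>\<^bsub>pscocones I B F ?Y\<^esub> ?B)"
        using Comp_hom(1)[of "pscocones I B F ?Y" ?B "AMap (cocone_post1 I B F ?g) m"] by simp
      fix i assume i: "i \<in> Obj (Cells1 I)"
      show "MMap (?A \<cdot>\<^bsub>pscocones I B F ?Y\<^esub> AMap (cocone_post1 I B F ?f) m) i =
        MMap (AMap (cocone_post1 I B F ?g) m \<cdot>\<^bsub>pscocones I B F ?Y\<^esub> ?B) i"
        using i whisker_exchange[of B "MMap m i" \<phi>] by simp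
    qed simp_all
    then show ?thesis by simp
  qed
qed

text \<open>The squares of \<open>cocone_post1_action\<close> commute strictly, so identities can
  serve as the structure cells of the pseudonatural equivalence. What is left are equations between
  identities and the compatibility with 2-cells of \<open>B\<close>. The inclusions come out as
  \<open>q\<close> because whiskering with the identity of \<open>L\<close> does nothing.\<close>

lemma bicolimitI:
  assumes q: "pseudococone I B F L q"
    and W: "\<And>X. X \<in> Obj (Cells1 B) \<Longrightarrow> weak_equivalence (cocone_action I B F L q X)"
  shows "is_bicolimit I B F L q"
proof -
  note [simp] = cocone_simps[OF q] q
  let ?E = "cocone_action I B F L q"
  let ?\<theta> = "\<lambda>f. nt_id (func_comp (cocone_post1 I B F f) (?E (Dom (Cells1 B) f)))"
  have "pseudonatural_equivalence B (homcat B L) (hom_post1 B L) (hom_post2 B L)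
        (pscocones I B F) (cocone_post1 I B F) (cocone_post2 I B F) ?E ?\<theta>"
  proof (rule pseudonatural_equivalence.intro)
    show "is_equivalence (?E X) \<and> Src (?E X) = homcat B L X \<and> Tgt (?E X) = pscocones I B F X"
      if "X \<in> Obj (Cells1 B)" for X using W[OF that] by (simp add: weak_equivalence_is_equivalence)
    show "nat_iso (?\<theta> f) \<and> NSrc (?\<theta> f) = func_comp (cocone_post1 I B F f) (?E X) \<and>
           NTgt (?\<theta> f) = func_comp (?E Y) (hom_post1 B L f)"
      if "f \<in> hom (Cells1 B) X Y" for f X Y
    proof -
      have f [simp]: "f \<in> Arr (Cells1 B)" "X = Dom (Cells1 B) f" "Y = Cod (Cells1 B) f" using that by (auto simp: in_hom)
      show ?thesis
        by (simp add: cocone_post1_action)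
    qed
    show "nt_vcomp (?\<theta> g) (nt_hcomp (cocone_post2 I B F \<phi>) (nt_id (?E X))) =
       nt_vcomp (nt_hcomp (nt_id (?E Y)) (hom_post2 B L \<phi>)) (?\<theta> f)"
      if "f \<in> hom (Cells1 B) X Y" "\<phi> \<in> hom (Cells2 B) f g" for f X Y \<phi> g
    proof -
      have \<phi> [simp]: "\<phi> \<in> Arr (Cells2 B)" "f = Dom (Cells2 B) \<phi>" "g = Cod (Cells2 B) \<phi>"
        "X = Dom (Cells1 B) f" "Y = Cod (Cells1 B) f" using that by (auto simp: in_hom)
      have "nt_hcomp (cocone_post2 I B F \<phi>) (nt_id (?E X)) = nt_hcomp (nt_id (?E Y)) (hom_post2 B L \<phi>)"
        (is "?P = ?Q")
      proof (rule nt_eqI)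
        show "NSrc ?P = NSrc ?Q" using cocone_post1_action[OF q, of f] by simp
        show "NTgt ?P = NTgt ?Q" using cocone_post1_action[OF q, of g] by simp
        fix h assume "h \<in> Obj (Src (NSrc ?Q))"
        then have h [simp]: "h \<in> Arr (Cells1 B)" "Dom (Cells1 B) h = L" "Cod (Cells1 B) h = Dom (Cells1 B) (Dom (Cells2 B) \<phi>)"
          by (auto simp: in_hom)
        have [simp]: "h \<in> hom (Cells1 B) L (Dom (Cells1 B) (Dom (Cells2 B) \<phi>))"
          "\<phi> \<in> Arr (homcat B (Dom (Cells1 B) (Dom (Cells2 B) \<phi>)) (Cod (Cells1 B) (Dom (Cells2 B) \<phi>)))"
          "\<phi> \<lhd>\<^bsub>B\<^esub> h \<in> Arr (homcat B L (Cod (Cells1 B) (Dom (Cells2 B) \<phi>)))"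
          "Id (Cells2 B) h \<in> Arr (homcat B L (Dom (Cells1 B) (Dom (Cells2 B) \<phi>)))"
          by (auto simp: in_hom Arr_homcat)
        have "AMap (cocone_action I B F X (whisker_cocone I B h q) Y) \<phi> = AMap (?E Y) (\<phi> \<lhd>\<^bsub>B\<^esub> h)"
          by (rule modification_eqI[of I B F Y]) (simp_all add: whisker_cocone_comp)
        then show "NMap ?P h = NMap ?Q h"
          using functor_Id[of "?E X" "homcat B L X" h]
          by (simp add: whisker_cocone_comp in_hom)
      qed simp_all
      then show ?thesis using cocone_post1_action[OF q, of f] cocone_post1_action[OF q, of g] by simp
    qed
    show "?\<theta> (Id (Cells1 B) X) = nt_id (?E X)" if "X \<in> Obj (Cells1 B)" for X
    proof -
      have "cocone_post1 I B F (Id (Cells1 B) X) = func_id (pscocones I B F X)"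
      proof (rule func_eqI)
        fix m assume "m \<in> Arr (Src (func_id (pscocones I B F X)))"
        then have m: "modification I B F X m" by simp
        note [simp] = modification_simps[OF m] cocone_simps[OF modification_simps(1)[OF m]]
          cocone_simps[OF modification_simps(2)[OF m]]
        have "AMap (cocone_post1 I B F (Id (Cells1 B) X)) m = m"
          by (rule modification_eqI[of I B F X]) (use that m in simp_all)
        then show "AMap (cocone_post1 I B F (Id (Cells1 B) X)) m = AMap (func_id (pscocones I B F X)) m" using m by simp
      qed (use that in simp_all)
      then show ?thesis using that by simp
    qed
    show "?\<theta> (g \<circ>\<^bsub>B\<^esub> f) = nt_vcomp (nt_hcomp (?\<theta> g) (nt_id (hom_post1 B L f))) (nt_hcomp (nt_id (cocone_post1 I B F g)) (?\<theta> f))"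
      if "f \<in> hom (Cells1 B) X Y" "g \<in> hom (Cells1 B) Y Z" for f X Y g Z
    proof -
      have [simp]: "f \<in> Arr (Cells1 B)" "g \<in> Arr (Cells1 B)" "X = Dom (Cells1 B) f" "Y = Dom (Cells1 B) g"
        "Cod (Cells1 B) f = Dom (Cells1 B) g" using that by (auto simp: in_hom)
      have "cocone_post1 I B F (g \<circ>\<^bsub>B\<^esub> f) = func_comp (cocone_post1 I B F g) (cocone_post1 I B F f)"
      proof (rule func_eqI)
        fix m assume "m \<in> Arr (Src (func_comp (cocone_post1 I B F g) (cocone_post1 I B F f)))"
        then have m [simp]: "modification I B F (Dom (Cells1 B) f) m" by simp
        note [simp] = modification_simps[OF m] cocone_simps[OF modification_simps(1)[OF m]]
          cocone_simps[OF modification_simps(2)[OF m]]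
        have "AMap (cocone_post1 I B F (g \<circ>\<^bsub>B\<^esub> f)) m = AMap (cocone_post1 I B F g) (AMap (cocone_post1 I B F f) m)"
          by (rule modification_eqI[of I B F "Cod (Cells1 B) g"])
            (use m modification_cocone_post1[of f m] in \<open>simp_all add: whisker_cocone_comp\<close>)
        then show "AMap (cocone_post1 I B F (g \<circ>\<^bsub>B\<^esub> f)) m = AMap (func_comp (cocone_post1 I B F g) (cocone_post1 I B F f)) m"
          using m by simp
      qed (auto simp: whisker_cocone_comp)
      then show ?thesis using cocone_post1_action[OF q, of f] by (simp add: func_comp_assoc)
    qed
  qed
  moreover have "q = OMap (?E L) (Id (Cells1 B) L)" by (simp add: in_hom)
  ultimately show ?thesis unfolding is_bicolimit_def by (intro conjI exI[of _ ?E] exI[of _ ?\<theta>]) simp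
qed

text \<open>A Yoneda argument: the component of \<open>\<theta> f\<close> at the identity of
  \<open>L\<close> is an isomorphism from the whiskering of \<open>q\<close> with \<open>f\<close>
  to the image of \<open>f\<close> under the given equivalence. It is natural in \<open>f\<close>,
  so whiskering is isomorphic to an equivalence and hence an equivalence itself.\<close>

lemma bicolimitD:
  assumes "is_bicolimit I B F L q"
  shows "pseudococone I B F L q"
    and "X \<in> Obj (Cells1 B) \<Longrightarrow> weak_equivalence (cocone_action I B F L q X)"
proof -
  obtain E \<theta> where L [simp]: "L \<in> Obj (Cells1 B)" and q_def: "q = OMap (E L) (Id (Cells1 B) L)"
    and ps: "pseudonatural_equivalence B
        (homcat B L) (hom_post1 B L) (hom_post2 B L)
        (pscocones I B F) (cocone_post1 I B F) (cocone_post2 I B F) E \<theta>"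
    using assms unfolding is_bicolimit_def by blast
  have E: "weak_equivalence (E X)" "Src (E X) = homcat B L X" "Tgt (E X) = pscocones I B F X"
    if "X \<in> Obj (Cells1 B)" for X
    using pseudonatural_equivalence.E_equiv[OF ps that] is_equivalence_weak_equivalence by auto
  note [simp] = E(2,3) weak_equivalenceD(1)[OF E(1)]
  have id [simp]: "Id (Cells1 B) L \<in> hom (Cells1 B) L L" by (simp add: in_hom)
  have q: "pseudococone I B F L q"
    using functor_OMap[of "E L" "pscocones I B F L" "Id (Cells1 B) L"] by (simp add: q_def)
  then show "pseudococone I B F L q" .
  note [simp] = q cocone_simps[OF q]
  assume X [simp]: "X \<in> Obj (Cells1 B)"
  show "weak_equivalence (cocone_action I B F L q X)"
  proof (rule weak_equivalence_transport[OF E(1)[OF X], of _ "\<lambda>f. NMap (\<theta> f) (Id (Cells1 B) L)"])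
    fix f assume "f \<in> Obj (Src (E X))"
    then have f: "f \<in> hom (Cells1 B) L X" by simp
    note f' [simp] = f[unfolded in_hom]
    have \<theta>: "nat_iso (\<theta> f)" "NSrc (\<theta> f) = func_comp (cocone_post1 I B F f) (E L)"
      "NTgt (\<theta> f) = func_comp (E X) (hom_post1 B L f)"
      using pseudonatural_equivalence.\<theta>_iso[OF ps f] by auto
    then show "NMap (\<theta> f) (Id (Cells1 B) L) \<in> hom (Tgt (E X)) (OMap (cocone_action I B F L q X) f) (OMap (E X) f) \<and>
        is_iso (Tgt (E X)) (NMap (\<theta> f) (Id (Cells1 B) L))"
      using id f by (simp add: in_hom q_def[symmetric] del: pscocones_sel)
  next
    fix \<phi> assume "\<phi> \<in> Arr (Src (E X))"
    then have \<phi>: "\<phi> \<in> Arr (homcat B L X)" by simp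
    then have \<phi>' [simp]: "\<phi> \<in> Arr (Cells2 B)" "Dom (Cells1 B) (Dom (Cells2 B) \<phi>) = L" "Cod (Cells1 B) (Dom (Cells2 B) \<phi>) = X"
      by (auto simp: Arr_homcat)
    let ?f = "Dom (Cells2 B) \<phi>" and ?g = "Cod (Cells2 B) \<phi>"
    have f: "?f \<in> hom (Cells1 B) L X" and g: "?g \<in> hom (Cells1 B) L X" by (auto simp: in_hom)
    have \<theta>: "nat_iso (\<theta> ?f)" "NSrc (\<theta> ?f) = func_comp (cocone_post1 I B F ?f) (E L)"
      "NTgt (\<theta> ?f) = func_comp (E X) (hom_post1 B L ?f)"
      "nat_iso (\<theta> ?g)" "NSrc (\<theta> ?g) = func_comp (cocone_post1 I B F ?g) (E L)"
      "NTgt (\<theta> ?g) = func_comp (E X) (hom_post1 B L ?g)"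
      using pseudonatural_equivalence.\<theta>_iso[OF ps f] pseudonatural_equivalence.\<theta>_iso[OF ps g] by auto
    have "nt_vcomp (\<theta> ?g) (nt_hcomp (cocone_post2 I B F \<phi>) (nt_id (E L)))
        = nt_vcomp (nt_hcomp (nt_id (E X)) (hom_post2 B L \<phi>)) (\<theta> ?f)"
      by (rule pseudonatural_equivalence.\<theta>_natural[OF ps f]) (simp add: in_hom)
    \<comment> \<open>Evaluated at the identity of \<open>L\<close>, compatibility of
      \<open>\<theta>\<close> with 2-cells becomes naturality of the comparison in
      \<open>f\<close>.\<close>
    from arg_cong[OF this, of "\<lambda>\<tau>. NMap \<tau> (Id (Cells1 B) L)"]
    have "NMap (\<theta> ?g) (Id (Cells1 B) L) \<cdot>\<^bsub>pscocones I B F X\<^esub>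
        (AMap (cocone_action I B F L q X) \<phi> \<cdot>\<^bsub>pscocones I B F X\<^esub> AMap (cocone_post1 I B F ?f) (Id (pscocones I B F L) q))
      = (Id (pscocones I B F X) (OMap (E X) ?g) \<cdot>\<^bsub>pscocones I B F X\<^esub> AMap (E X) \<phi>) \<cdot>\<^bsub>pscocones I B F X\<^esub> NMap (\<theta> ?f) (Id (Cells1 B) L)"
      using \<theta> id f g by (simp add: q_def[symmetric])
    moreover have "NMap (\<theta> ?g) (Id (Cells1 B) L) \<in> Arr (pscocones I B F X)"
      "Dom (pscocones I B F X) (NMap (\<theta> ?g) (Id (Cells1 B) L)) = whisker_cocone I B ?g q"
      using \<theta> id by (simp_all add: q_def[symmetric] del: pscocones_sel)
    moreover have "Id (pscocones I B F X) (OMap (E X) ?g) \<cdot>\<^bsub>pscocones I B F X\<^esub> AMap (E X) \<phi> = AMap (E X) \<phi>"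
      by (rule Comp_Id_left) (use \<phi> in \<open>simp_all del: pscocones_sel\<close>)
    ultimately show "NMap (\<theta> (Cod (Src (E X)) \<phi>)) (Id (Cells1 B) L) \<cdot>\<^bsub>Tgt (E X)\<^esub> AMap (cocone_action I B F L q X) \<phi> =
         AMap (E X) \<phi> \<cdot>\<^bsub>Tgt (E X)\<^esub> NMap (\<theta> (Dom (Src (E X)) \<phi>)) (Id (Cells1 B) L)"
      using \<phi> id f g by simp
  qed simp_all
qed

end

section \<open>A strict model of a diagram of categories\<close>

locale cat_diagram = bifiltered I + pseudofunctor I "Cat :: (('u, 'u) cat, ('u, 'u, 'u, 'u) func, ('u, 'u, 'u, 'u) nt) twocat" F
  for I :: "('i, 'd, 'e) twocat"
    and F :: "('i, 'd, 'e, ('u, 'u) cat, ('u, 'u, 'u, 'u) func, ('u, 'u, 'u, 'u) nt) psfun"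
begin

abbreviation "I1 \<equiv> Cells1 I"
abbreviation "I2 \<equiv> Cells2 I"
abbreviation "C \<equiv> P0 F"
abbreviation "Fo d \<equiv> OMap (P1 F d)"
abbreviation "Fa d \<equiv> AMap (P1 F d)"
abbreviation "two \<alpha> \<equiv> NMap (P2 F \<alpha>)"
abbreviation "phi e d \<equiv> NMap (PComp F e d)"
abbreviation "eta i \<equiv> NMap (PUnit F i)"

lemma C_simps [simp]:
  "i \<in> Obj I1 \<Longrightarrow> small_cat (C i)"
  "d \<in> Arr I1 \<Longrightarrow> small_functor (P1 F d)"
  "d \<in> Arr I1 \<Longrightarrow> Src (P1 F d) = C (Dom I1 d)"
  "d \<in> Arr I1 \<Longrightarrow> Tgt (P1 F d) = C (Cod I1 d)"
  using pseudofunctor_simps(1)[of i] pseudofunctor_simps(2-4)[of d] by simp_all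

lemma nt_simps [simp]:
  "\<alpha> \<in> Arr I2 \<Longrightarrow> nat_trans (P2 F \<alpha>)"
  "\<alpha> \<in> Arr I2 \<Longrightarrow> NSrc (P2 F \<alpha>) = P1 F (Dom I2 \<alpha>)"
  "\<alpha> \<in> Arr I2 \<Longrightarrow> NTgt (P2 F \<alpha>) = P1 F (Cod I2 \<alpha>)"
  "i \<in> Obj I1 \<Longrightarrow> nat_trans (PUnit F i)"
  "i \<in> Obj I1 \<Longrightarrow> NSrc (PUnit F i) = func_id (C i)"
  "i \<in> Obj I1 \<Longrightarrow> NTgt (PUnit F i) = P1 F (Id I1 i)"
  using pseudofunctor_simps(5-7)[of \<alpha>] pseudofunctor_simps(8-10)[of i] by simp_all

lemma PComp_nt_simps [simp]:
  assumes "d \<in> Arr I1" "e \<in> Arr I1" "Cod I1 d = Dom I1 e"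
  shows "nat_iso (PComp F e d)" "NSrc (PComp F e d) = func_comp (P1 F e) (P1 F d)"
    "NTgt (PComp F e d) = P1 F (e \<circ>\<^bsub>I\<^esub> d)"
  using PComp_simps[OF assms] assms by simp_all

lemma Fa_in [simp]:
  assumes "d \<in> Arr I1" "k = Cod I1 d" "a \<in> Arr (C (Dom I1 d))"
  shows "Fa d a \<in> Arr (C k)" "Dom (C k) (Fa d a) = Fo d (Dom (C (Dom I1 d)) a)"
    "Cod (C k) (Fa d a) = Fo d (Cod (C (Dom I1 d)) a)"
  using assms by simp_all

lemma two_in [simp]:
  assumes "\<alpha> \<in> Arr I2" "k = Cod I1 (Dom I2 \<alpha>)" "x \<in> Obj (C (Dom I1 (Dom I2 \<alpha>)))"
  shows "two \<alpha> x \<in> Arr (C k)" "Dom (C k) (two \<alpha> x) = Fo (Dom I2 \<alpha>) x" "Cod (C k) (two \<alpha> x) = Fo (Cod I2 \<alpha>) x"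
  using assms by simp_all

lemma phi_in [simp]:
  assumes "d \<in> Arr I1" "e \<in> Arr I1" "Cod I1 d = Dom I1 e" "x \<in> Obj (C (Dom I1 d))" "k = Cod I1 e"
  shows "phi e d x \<in> Arr (C k)" "Dom (C k) (phi e d x) = Fo e (Fo d x)" "Cod (C k) (phi e d x) = Fo (e \<circ>\<^bsub>I\<^esub> d) x"
    "is_iso (C k) (phi e d x)"
  using assms by simp_all

lemma eta_in [simp]:
  assumes "i \<in> Obj I1" "x \<in> Obj (C i)"
  shows "eta i x \<in> Arr (C i)" "Dom (C i) (eta i x) = x" "Cod (C i) (eta i x) = Fo (Id I1 i) x"
    "is_iso (C i) (eta i x)"
  using PUnit_iso[of i] pseudofunctor_simps(8-10)[of i] assms by simp_all

lemma two_natural: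
  assumes "\<alpha> \<in> Arr I2" "i = Dom I1 (Dom I2 \<alpha>)" "k = Cod I1 (Dom I2 \<alpha>)" "a \<in> Arr (C i)"
  shows "two \<alpha> (Cod (C i) a) \<cdot>\<^bsub>C k\<^esub> Fa (Dom I2 \<alpha>) a = Fa (Cod I2 \<alpha>) a \<cdot>\<^bsub>C k\<^esub> two \<alpha> (Dom (C i) a)"
  using nat_trans_natural[of "P2 F \<alpha>" a] assms by simp

lemma phi_natural:
  assumes "d \<in> Arr I1" "e \<in> Arr I1" "Cod I1 d = Dom I1 e" "i = Dom I1 d" "k = Cod I1 e" "a \<in> Arr (C i)"
  shows "phi e d (Cod (C i) a) \<cdot>\<^bsub>C k\<^esub> Fa e (Fa d a) = Fa (e \<circ>\<^bsub>I\<^esub> d) a \<cdot>\<^bsub>C k\<^esub> phi e d (Dom (C i) a)"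
  using nat_trans_natural[of "PComp F e d" a] assms by simp

lemma eta_natural:
  assumes "i \<in> Obj I1" "a \<in> Arr (C i)"
  shows "eta i (Cod (C i) a) \<cdot>\<^bsub>C i\<^esub> a = Fa (Id I1 i) a \<cdot>\<^bsub>C i\<^esub> eta i (Dom (C i) a)"
  using nat_trans_natural[of "PUnit F i" a] assms by simp

lemma two_Id [simp]:
  "\<lbrakk>d \<in> Arr I1; x \<in> Obj (C (Dom I1 d))\<rbrakk> \<Longrightarrow> two (Id I2 d) x = Id (C (Cod I1 d)) (Fo d x)"
  using P2_Id[of d] by simp

lemma two_vcomp:
  "\<lbrakk>\<alpha> \<in> Arr I2; \<beta> \<in> Arr I2; Cod I2 \<alpha> = Dom I2 \<beta>; k = Cod I1 (Dom I2 \<alpha>); x \<in> Obj (C (Dom I1 (Dom I2 \<alpha>)))\<rbrakk> \<Longrightarrow>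
    two (\<beta> \<bullet>\<^bsub>I\<^esub> \<alpha>) x = two \<beta> x \<cdot>\<^bsub>C k\<^esub> two \<alpha> x"
  using P2_vcomp[of \<alpha> "Dom I2 \<alpha>" "Cod I2 \<alpha>" \<beta> "Cod I2 \<beta>"] by (simp add: in_hom)

text \<open>Naturality of the composition cells, read at an object. With an identity 2-cell in one
  of the two slots, it yields the behaviour of \<open>K\<close> under pushing and its
  naturality.\<close>

lemma phi_two:
  assumes "\<alpha> \<in> Arr I2" "\<beta> \<in> Arr I2" "Cod I1 (Dom I2 \<alpha>) = Dom I1 (Dom I2 \<beta>)" "k = Cod I1 (Dom I2 \<beta>)"
    "x \<in> Obj (C (Dom I1 (Dom I2 \<alpha>)))"
  shows "two (\<beta> \<star>\<^bsub>I\<^esub> \<alpha>) x \<cdot>\<^bsub>C k\<^esub> phi (Dom I2 \<beta>) (Dom I2 \<alpha>) x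
    = phi (Cod I2 \<beta>) (Cod I2 \<alpha>) x \<cdot>\<^bsub>C k\<^esub> (two \<beta> (Fo (Cod I2 \<alpha>) x) \<cdot>\<^bsub>C k\<^esub> Fa (Dom I2 \<beta>) (two \<alpha> x))"
proof -
  have "P2 F (\<beta> \<star>\<^bsub>I\<^esub> \<alpha>) \<bullet>\<^bsub>Cat\<^esub> PComp F (Dom I2 \<beta>) (Dom I2 \<alpha>) =
    PComp F (Cod I2 \<beta>) (Cod I2 \<alpha>) \<bullet>\<^bsub>Cat\<^esub> (P2 F \<beta> \<star>\<^bsub>Cat\<^esub> P2 F \<alpha>)"
    by (rule PComp_natural[of _ "Dom I1 (Dom I2 \<alpha>)" "Dom I1 (Dom I2 \<beta>)" _ k]) (use assms in \<open>auto simp: in_hom\<close>)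
  from arg_cong[OF this, of "\<lambda>\<tau>. NMap \<tau> x"] show ?thesis using assms by simp
qed

lemma phi_assoc:
  assumes "c \<in> Arr I1" "d \<in> Arr I1" "e \<in> Arr I1" "Cod I1 c = Dom I1 d" "Cod I1 d = Dom I1 e" "k = Cod I1 e"
    "x \<in> Obj (C (Dom I1 c))"
  shows "phi e (d \<circ>\<^bsub>I\<^esub> c) x \<cdot>\<^bsub>C k\<^esub> Fa e (phi d c x) = phi (e \<circ>\<^bsub>I\<^esub> d) c x \<cdot>\<^bsub>C k\<^esub> phi e d (Fo c x)"
proof -
  have "PComp F e (d \<circ>\<^bsub>I\<^esub> c) \<bullet>\<^bsub>Cat\<^esub> (P1 F e \<rhd>\<^bsub>Cat\<^esub> PComp F d c) = PComp F (e \<circ>\<^bsub>I\<^esub> d) c \<bullet>\<^bsub>Cat\<^esub> (PComp F e d \<lhd>\<^bsub>Cat\<^esub> P1 F c)"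
    by (rule PComp_assoc) (use assms in \<open>auto simp: in_hom\<close>)
  from arg_cong[OF this, of "\<lambda>\<tau>. NMap \<tau> x"] show ?thesis using assms by simp
qed

lemma phi_unit:
  assumes "d \<in> Arr I1" "i = Dom I1 d" "k = Cod I1 d" "x \<in> Obj (C i)"
  shows "phi d (Id I1 i) x \<cdot>\<^bsub>C k\<^esub> Fa d (eta i x) = Id (C k) (Fo d x)"
    "phi (Id I1 k) d x \<cdot>\<^bsub>C k\<^esub> eta k (Fo d x) = Id (C k) (Fo d x)"
  using arg_cong[OF PComp_unit_right[of d i k], of "\<lambda>\<tau>. NMap \<tau> x"]
    arg_cong[OF PComp_unit_left[of d i k], of "\<lambda>\<tau>. NMap \<tau> x"] assms by (simp_all add: in_hom)

text \<open>\<open>T k\<close> is equivalent to \<open>F k\<close>: its object \<open>(d, x)\<close>, with \<open>x\<close> in \<open>F i\<close> and \<open>d : i \<rightarrow> k\<close>, stands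
  for \<open>F d x\<close>.  Unlike \<open>F\<close>, the assignment \<open>T\<close> is a strict 2-functor.\<close>

definition T :: "'i \<Rightarrow> ('d \<times> 'u, ('d \<times> 'u) \<times> ('d \<times> 'u) \<times> 'u) cat" where
  "T k = \<lparr>Obj = {(d, x). d \<in> Arr I1 \<and> Cod I1 d = k \<and> x \<in> Obj (C (Dom I1 d))},
     Arr = {((d, x), (e, y), a). d \<in> Arr I1 \<and> Cod I1 d = k \<and> x \<in> Obj (C (Dom I1 d)) \<and>
       e \<in> Arr I1 \<and> Cod I1 e = k \<and> y \<in> Obj (C (Dom I1 e)) \<and> a \<in> hom (C k) (Fo d x) (Fo e y)},
     Dom = (\<lambda>(X, Y, a). X), Cod = (\<lambda>(X, Y, a). Y),
     Id = (\<lambda>(d, x). ((d, x), (d, x), Id (C k) (Fo d x))),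
     Comp = (\<lambda>(Y', Z, b) (X, Y, a). (X, Z, b \<cdot>\<^bsub>C k\<^esub> a))\<rparr>"

definition push_obj :: "'d \<Rightarrow> 'd \<times> 'u \<Rightarrow> 'd \<times> 'u" where
  "push_obj u = (\<lambda>(d, x). (u \<circ>\<^bsub>I\<^esub> d, x))"

text \<open>\<open>F u a\<close> runs between \<open>F u (F d x)\<close> and
  \<open>F u (F e y)\<close>, whereas the pushed pairs stand for the images of \<open>x\<close> and
  \<open>y\<close> under the functors of the composite 1-cells. Conjugation by \<open>phi\<close>
  bridges the difference, and the coherence cells of \<open>F\<close> are hidden here.\<close>

definition push :: "'d \<Rightarrow> ('d \<times> 'u) \<times> ('d \<times> 'u) \<times> 'u \<Rightarrow> ('d \<times> 'u) \<times> ('d \<times> 'u) \<times> 'u" where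
  "push u = (\<lambda>((d, x), (e, y), a). ((u \<circ>\<^bsub>I\<^esub> d, x), (u \<circ>\<^bsub>I\<^esub> e, y),
     phi u e y \<cdot>\<^bsub>C (Cod I1 u)\<^esub> (Fa u a \<cdot>\<^bsub>C (Cod I1 u)\<^esub> inverse_arr (C (Cod I1 u)) (phi u d x))))"

text \<open>The comparison in \<open>T\<close> of two presentations of the same \<open>x\<close>
  along 1-cells related by \<open>\<alpha>\<close>. These arrows are the ones that become identities
  in the bicolimit.\<close>

definition K :: "'e \<Rightarrow> 'u \<Rightarrow> ('d \<times> 'u) \<times> ('d \<times> 'u) \<times> 'u" where
  "K \<alpha> x = ((Dom I2 \<alpha>, x), (Cod I2 \<alpha>, x), two \<alpha> x)"

text \<open>An arrow of a stage seen at a later stage through \<open>d\<close>, between objects that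
  both carry the same formal transition \<open>d\<close>.\<close>

definition im :: "'d \<Rightarrow> 'u \<Rightarrow> ('d \<times> 'u) \<times> ('d \<times> 'u) \<times> 'u" where
  "im d a = ((d, Dom (C (Dom I1 d)) a), (d, Cod (C (Dom I1 d)) a), Fa d a)"

text \<open>The pairs \<open>(e, F d x)\<close> and the composite of \<open>e\<close> and
  \<open>d\<close> paired with \<open>x\<close> present \<open>x\<close> at the same stage, with the
  transition \<open>d\<close> carried out or left formal. The composition cell is the canonical
  isomorphism between them; its germ will be the structure cell of the universal
  pseudococone.\<close>

definition Phi :: "'d \<Rightarrow> 'd \<Rightarrow> 'u \<Rightarrow> ('d \<times> 'u) \<times> ('d \<times> 'u) \<times> 'u" where
  "Phi e d x = ((e, Fo d x), (e \<circ>\<^bsub>I\<^esub> d, x), phi e d x)"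

lemma Obj_T: "X \<in> Obj (T k) \<longleftrightarrow> fst X \<in> Arr I1 \<and> Cod I1 (fst X) = k \<and> snd X \<in> Obj (C (Dom I1 (fst X)))"
  by (auto simp: T_def)

lemma Obj_T_pair [simp]: "(d, x) \<in> Obj (T k) \<longleftrightarrow> d \<in> Arr I1 \<and> Cod I1 d = k \<and> x \<in> Obj (C (Dom I1 d))"
  by (simp add: Obj_T)

lemma T_sel:
  "((d, x), (e, y), a) \<in> Arr (T k) \<longleftrightarrow> d \<in> Arr I1 \<and> Cod I1 d = k \<and> x \<in> Obj (C (Dom I1 d)) \<and>
       e \<in> Arr I1 \<and> Cod I1 e = k \<and> y \<in> Obj (C (Dom I1 e)) \<and>
       a \<in> Arr (C k) \<and> Dom (C k) a = Fo d x \<and> Cod (C k) a = Fo e y"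
  "Dom (T k) (X, Y, a) = X" "Cod (T k) (X, Y, a) = Y"
  "Id (T k) (d, x) = ((d, x), (d, x), Id (C k) (Fo d x))"
  "(Y', Z, b) \<cdot>\<^bsub>T k\<^esub> (X, Y, a) = (X, Z, b \<cdot>\<^bsub>C k\<^esub> a)"
  by (auto simp: T_def in_hom)

lemma Arr_T_cases:
  assumes "f \<in> Arr (T k)"
  obtains d x e y a where "f = ((d, x), (e, y), a)" "d \<in> Arr I1" "Cod I1 d = k" "x \<in> Obj (C (Dom I1 d))"
    "e \<in> Arr I1" "Cod I1 e = k" "y \<in> Obj (C (Dom I1 e))" "a \<in> Arr (C k)" "Dom (C k) a = Fo d x" "Cod (C k) a = Fo e y"
  using assms by (cases f) (auto simp: T_sel)

lemma category_T [simp]: "k \<in> Obj I1 \<Longrightarrow> category (T k)"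
  by (rule categoryI) (auto simp: T_sel elim!: Arr_T_cases)

lemma push_obj_simps [simp]:
  "push_obj u (d, x) = (u \<circ>\<^bsub>I\<^esub> d, x)"
  "snd (push_obj u X) = snd X" "fst (push_obj u X) = u \<circ>\<^bsub>I\<^esub> fst X"
  by (auto simp: push_obj_def split: prod.splits)

lemma push_obj_in [simp]:
  "\<lbrakk>u \<in> Arr I1; X \<in> Obj (T (Dom I1 u)); m = Cod I1 u\<rbrakk> \<Longrightarrow> push_obj u X \<in> Obj (T m)"
  by (cases X) simp

text \<open>Characterises the conjugate by the square it forms with \<open>phi\<close>, so that
  identities about \<open>push\<close> are proved without inverses.\<close>

lemma push_eqI:
  assumes "u \<in> Arr I1" "((d, x), (e, y), a) \<in> Arr (T (Dom I1 u))" "m = Cod I1 u"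
    "b \<in> Arr (C m)" "Dom (C m) b = Fo (u \<circ>\<^bsub>I\<^esub> d) x" "Cod (C m) b = Fo (u \<circ>\<^bsub>I\<^esub> e) y"
    "b \<cdot>\<^bsub>C m\<^esub> phi u d x = phi u e y \<cdot>\<^bsub>C m\<^esub> Fa u a"
  shows "push u ((d, x), (e, y), a) = ((u \<circ>\<^bsub>I\<^esub> d, x), (u \<circ>\<^bsub>I\<^esub> e, y), b)"
  using assms Comp_eq_conj_iff[of "C m" "phi u d x" "phi u e y" "Fa u a" b]
  by (simp add: push_def T_sel)

lemma push_hom [simp]:
  assumes "u \<in> Arr I1" "m = Cod I1 u" "f \<in> Arr (T (Dom I1 u))"
  shows "push u f \<in> Arr (T m)" "Dom (T m) (push u f) = push_obj u (Dom (T (Dom I1 u)) f)"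
    "Cod (T m) (push u f) = push_obj u (Cod (T (Dom I1 u)) f)"
  using assms by (auto simp: push_def T_sel elim!: Arr_T_cases)

lemma push_Id [simp]:
  assumes "u \<in> Arr I1" "k = Dom I1 u" "X \<in> Obj (T k)"
  shows "push u (Id (T k) X) = Id (T (Cod I1 u)) (push_obj u X)"
  using assms by (cases X) (simp add: T_sel, rule push_eqI, auto simp: T_sel)

lemma push_Comp [simp]:
  assumes u [simp]: "u \<in> Arr I1" and k: "k = Dom I1 u" and fg: "f \<in> Arr (T k)" "g \<in> Arr (T k)" "Cod (T k) f = Dom (T k) g"
  shows "push u (g \<cdot>\<^bsub>T k\<^esub> f) = push u g \<cdot>\<^bsub>T (Cod I1 u)\<^esub> push u f"
proof -
  obtain d x e y a where f: "f = ((d, x), (e, y), a)" "f \<in> Arr (T k)" using fg by (metis prod_cases3 prod.collapse)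
  obtain z w b where g: "g = ((e, y), (z, w), b)" "g \<in> Arr (T k)"
    using fg f by (metis prod.collapse T_sel(2,3))
  show ?thesis using f g k by (auto simp: T_sel push_def)
qed

text \<open>The associativity coherence of \<open>F\<close> merges the two successive conjugations
  by \<open>phi\<close> into one. This is where strictness of the model is earned.\<close>

lemma push_push [simp]:
  assumes "u \<in> Arr I1" "v \<in> Arr I1" "Cod I1 u = Dom I1 v" "f \<in> Arr (T (Dom I1 u))"
  shows "push v (push u f) = push (v \<circ>\<^bsub>I\<^esub> u) f"
proof -
  note [simp] = assms(1-3)
  from assms(4) obtain d x e y a where f: "f = ((d, x), (e, y), a)" "d \<in> Arr I1" "Cod I1 d = Dom I1 u" "x \<in> Obj (C (Dom I1 d))"
    "e \<in> Arr I1" "Cod I1 e = Dom I1 u" "y \<in> Obj (C (Dom I1 e))" "a \<in> Arr (C (Dom I1 u))"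
    "Dom (C (Dom I1 u)) a = Fo d x" "Cod (C (Dom I1 u)) a = Fo e y" by (rule Arr_T_cases)
  note [simp] = f(2-)
  let ?m = "Cod I1 v"
  define b where "b = phi u e y \<cdot>\<^bsub>C (Dom I1 v)\<^esub> (Fa u a \<cdot>\<^bsub>C (Dom I1 v)\<^esub> inverse_arr (C (Dom I1 v)) (phi u d x))"
  have b [simp]: "b \<in> Arr (C (Dom I1 v))" "Dom (C (Dom I1 v)) b = Fo (u \<circ>\<^bsub>I\<^esub> d) x" "Cod (C (Dom I1 v)) b = Fo (u \<circ>\<^bsub>I\<^esub> e) y"
    by (auto simp: b_def)
  have b_phi: "b \<cdot>\<^bsub>C (Dom I1 v)\<^esub> phi u d x = phi u e y \<cdot>\<^bsub>C (Dom I1 v)\<^esub> Fa u a"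
    by (simp add: b_def)
  define c where "c = phi (v \<circ>\<^bsub>I\<^esub> u) e y \<cdot>\<^bsub>C ?m\<^esub> (Fa (v \<circ>\<^bsub>I\<^esub> u) a \<cdot>\<^bsub>C ?m\<^esub> inverse_arr (C ?m) (phi (v \<circ>\<^bsub>I\<^esub> u) d x))"
  have c [simp]: "c \<in> Arr (C ?m)" "Dom (C ?m) c = Fo (v \<circ>\<^bsub>I\<^esub> (u \<circ>\<^bsub>I\<^esub> d)) x" "Cod (C ?m) c = Fo (v \<circ>\<^bsub>I\<^esub> (u \<circ>\<^bsub>I\<^esub> e)) y"
    by (auto simp: c_def)
  have c_phi: "c \<cdot>\<^bsub>C ?m\<^esub> phi (v \<circ>\<^bsub>I\<^esub> u) d x = phi (v \<circ>\<^bsub>I\<^esub> u) e y \<cdot>\<^bsub>C ?m\<^esub> Fa (v \<circ>\<^bsub>I\<^esub> u) a"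
    by (simp add: c_def)
  have "c \<cdot>\<^bsub>C ?m\<^esub> phi v (u \<circ>\<^bsub>I\<^esub> d) x = phi v (u \<circ>\<^bsub>I\<^esub> e) y \<cdot>\<^bsub>C ?m\<^esub> Fa v b"
  \<comment> \<open>Composing with the image of \<open>phi u d x\<close> produces one side of the
    associativity coherence at \<open>x\<close>; the other occurrence at \<open>y\<close> then
    follows the same pattern on the left.\<close>
  proof (rule iso_cancel_right[of "C ?m" "Fa v (phi u d x)"])
    have "c \<cdot>\<^bsub>C ?m\<^esub> phi v (u \<circ>\<^bsub>I\<^esub> d) x \<cdot>\<^bsub>C ?m\<^esub> Fa v (phi u d x)
      = c \<cdot>\<^bsub>C ?m\<^esub> phi (v \<circ>\<^bsub>I\<^esub> u) d x \<cdot>\<^bsub>C ?m\<^esub> phi v u (Fo d x)"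
      by (simp add: phi_assoc[of d u v])
    also have "\<dots> = phi (v \<circ>\<^bsub>I\<^esub> u) e y \<cdot>\<^bsub>C ?m\<^esub> (Fa (v \<circ>\<^bsub>I\<^esub> u) a \<cdot>\<^bsub>C ?m\<^esub> phi v u (Fo d x))"
      by (simp only: c_phi) simp
    also have "Fa (v \<circ>\<^bsub>I\<^esub> u) a \<cdot>\<^bsub>C ?m\<^esub> phi v u (Fo d x) = phi v u (Fo e y) \<cdot>\<^bsub>C ?m\<^esub> Fa v (Fa u a)"
      using phi_natural[of u v "Dom I1 u" ?m a] by simp
    also have "phi (v \<circ>\<^bsub>I\<^esub> u) e y \<cdot>\<^bsub>C ?m\<^esub> (phi v u (Fo e y) \<cdot>\<^bsub>C ?m\<^esub> Fa v (Fa u a))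
      = (phi v (u \<circ>\<^bsub>I\<^esub> e) y \<cdot>\<^bsub>C ?m\<^esub> Fa v (phi u e y)) \<cdot>\<^bsub>C ?m\<^esub> Fa v (Fa u a)"
      by (simp only: phi_assoc[of e u v] f assms) simp
    also have "\<dots> = phi v (u \<circ>\<^bsub>I\<^esub> e) y \<cdot>\<^bsub>C ?m\<^esub> Fa v (phi u e y \<cdot>\<^bsub>C (Dom I1 v)\<^esub> Fa u a)" by simp
    also have "\<dots> = phi v (u \<circ>\<^bsub>I\<^esub> e) y \<cdot>\<^bsub>C ?m\<^esub> Fa v b \<cdot>\<^bsub>C ?m\<^esub> Fa v (phi u d x)"
      by (simp flip: b_phi)
    finally show "c \<cdot>\<^bsub>C ?m\<^esub> phi v (u \<circ>\<^bsub>I\<^esub> d) x \<cdot>\<^bsub>C ?m\<^esub> Fa v (phi u d x)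
      = phi v (u \<circ>\<^bsub>I\<^esub> e) y \<cdot>\<^bsub>C ?m\<^esub> Fa v b \<cdot>\<^bsub>C ?m\<^esub> Fa v (phi u d x)" .
  qed auto
  then have "push v ((u \<circ>\<^bsub>I\<^esub> d, x), (u \<circ>\<^bsub>I\<^esub> e, y), b) = ((v \<circ>\<^bsub>I\<^esub> (u \<circ>\<^bsub>I\<^esub> d), x), (v \<circ>\<^bsub>I\<^esub> (u \<circ>\<^bsub>I\<^esub> e), y), c)"
    by (intro push_eqI) (auto simp: T_sel)
  then show ?thesis using f(1) by (simp add: push_def b_def c_def)
qed

text \<open>Precomposing with the unit cell reduces the square to naturality of \<open>eta\<close>,
  since the left unit coherence cancels \<open>eta\<close> against \<open>phi\<close> on both
  sides.\<close>

lemma push_one [simp]: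
  assumes "k \<in> Obj I1" "f \<in> Arr (T k)"
  shows "push (Id I1 k) f = f"
proof -
  note [simp] = assms(1)
  from assms(2) obtain d x e y a where f: "f = ((d, x), (e, y), a)" "d \<in> Arr I1" "Cod I1 d = k" "x \<in> Obj (C (Dom I1 d))"
    "e \<in> Arr I1" "Cod I1 e = k" "y \<in> Obj (C (Dom I1 e))" "a \<in> Arr (C k)"
    "Dom (C k) a = Fo d x" "Cod (C k) a = Fo e y" by (rule Arr_T_cases)
  note [simp] = f(2-)
  have "a \<cdot>\<^bsub>C k\<^esub> phi (Id I1 k) d x = phi (Id I1 k) e y \<cdot>\<^bsub>C k\<^esub> Fa (Id I1 k) a"
  proof (rule iso_cancel_right[of "C k" "eta k (Fo d x)"])
    have "phi (Id I1 k) e y \<cdot>\<^bsub>C k\<^esub> Fa (Id I1 k) a \<cdot>\<^bsub>C k\<^esub> eta k (Fo d x) =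
       phi (Id I1 k) e y \<cdot>\<^bsub>C k\<^esub> eta k (Fo e y) \<cdot>\<^bsub>C k\<^esub> a"
      using eta_natural[of k a] by simp
    then show "a \<cdot>\<^bsub>C k\<^esub> phi (Id I1 k) d x \<cdot>\<^bsub>C k\<^esub> eta k (Fo d x) =
      phi (Id I1 k) e y \<cdot>\<^bsub>C k\<^esub> Fa (Id I1 k) a \<cdot>\<^bsub>C k\<^esub> eta k (Fo d x)"
      using phi_unit(2)[OF _ refl, of d k x] phi_unit(2)[OF _ refl, of e k y] by (simp del: Comp_assoc) simp
  qed auto
  then show ?thesis unfolding f(1) by (subst push_eqI[of _ _ _ _ _ _ k a]) (auto simp: T_sel)
qed

lemma K_hom [simp]:
  assumes "\<alpha> \<in> Arr I2" "k = Cod I1 (Dom I2 \<alpha>)" "x \<in> Obj (C (Dom I1 (Dom I2 \<alpha>)))"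
  shows "K \<alpha> x \<in> Arr (T k)" "Dom (T k) (K \<alpha> x) = (Dom I2 \<alpha>, x)" "Cod (T k) (K \<alpha> x) = (Cod I2 \<alpha>, x)"
  using assms by (simp_all add: K_def T_sel)

lemma K_Id [simp]:
  "\<lbrakk>d \<in> Arr I1; x \<in> Obj (C (Dom I1 d))\<rbrakk> \<Longrightarrow> K (Id I2 d) x = Id (T (Cod I1 d)) (d, x)"
  by (simp add: K_def T_sel)

lemma K_vcomp:
  "\<lbrakk>\<alpha> \<in> Arr I2; \<beta> \<in> Arr I2; Cod I2 \<alpha> = Dom I2 \<beta>; k = Cod I1 (Dom I2 \<alpha>); x \<in> Obj (C (Dom I1 (Dom I2 \<alpha>)))\<rbrakk> \<Longrightarrow>
    K (\<beta> \<bullet>\<^bsub>I\<^esub> \<alpha>) x = K \<beta> x \<cdot>\<^bsub>T k\<^esub> K \<alpha> x"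
  by (simp add: K_def T_sel two_vcomp)

lemma K_iso [simp]:
  assumes "is_iso I2 \<alpha>" "k = Cod I1 (Dom I2 \<alpha>)" "x \<in> Obj (C (Dom I1 (Dom I2 \<alpha>)))"
  shows "is_iso (T k) (K \<alpha> x)"
proof (rule is_isoI[of _ _ "K (inverse_arr I2 \<alpha>) x"])
  have \<alpha>: "\<alpha> \<in> Arr I2" using assms by simp
  let ?\<beta> = "inverse_arr I2 \<alpha>"
  have \<beta> [simp]: "Dom I1 (Cod I2 \<alpha>) = Dom I1 (Dom I2 \<alpha>)" "Cod I1 (Cod I2 \<alpha>) = Cod I1 (Dom I2 \<alpha>)" using \<alpha> by auto
  show "K ?\<beta> x \<cdot>\<^bsub>T k\<^esub> K \<alpha> x = Id (T k) (Dom (T k) (K \<alpha> x))"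
    using K_vcomp[of \<alpha> ?\<beta> k x] assms \<alpha> by simp
  show "K \<alpha> x \<cdot>\<^bsub>T k\<^esub> K ?\<beta> x = Id (T k) (Cod (T k) (K \<alpha> x))"
    using K_vcomp[of ?\<beta> \<alpha> k x] assms \<alpha> by simp
qed (use assms is_iso_Arr in auto)

lemma push_K [simp]:
  assumes "u \<in> Arr I1" "\<alpha> \<in> Arr I2" "Dom I1 u = Cod I1 (Dom I2 \<alpha>)" "x \<in> Obj (C (Dom I1 (Dom I2 \<alpha>)))"
  shows "push u (K \<alpha> x) = K (u \<rhd>\<^bsub>I\<^esub> \<alpha>) x"
  unfolding K_def
  by (subst push_eqI[of _ _ _ _ _ _ "Cod I1 u" "two (u \<rhd>\<^bsub>I\<^esub> \<alpha>) x"])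
    (use assms phi_two[of \<alpha> "Id I2 u" "Cod I1 u" x] in \<open>auto simp: T_sel\<close>)

text \<open>A 2-cell of \<open>I\<close> acts as a natural transformation between the two pushing
  functors, with component \<open>K\<close> of the whiskered cell at a formal pair. It is the device
  for exchanging one transition 1-cell for an isomorphic one.\<close>

lemma K_natural:
  assumes "\<alpha> \<in> Arr I2" "f \<in> Arr (T (Dom I1 (Dom I2 \<alpha>)))" "k = Dom I1 (Dom I2 \<alpha>)" "m = Cod I1 (Dom I2 \<alpha>)"
    "Dom (T k) f = (d, x)" "Cod (T k) f = (e, y)"
  shows "K (\<alpha> \<lhd>\<^bsub>I\<^esub> e) y \<cdot>\<^bsub>T m\<^esub> push (Dom I2 \<alpha>) f = push (Cod I2 \<alpha>) f \<cdot>\<^bsub>T m\<^esub> K (\<alpha> \<lhd>\<^bsub>I\<^esub> d) x"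
proof -
  obtain a where f: "f = ((d, x), (e, y), a)" using assms(5,6) by (cases f) (auto simp: T_sel)
  let ?u = "Dom I2 \<alpha>" and ?v = "Cod I2 \<alpha>"
  note [simp] = assms(1,3,4)
  have a [simp]: "d \<in> Arr I1" "Cod I1 d = Dom I1 ?u" "x \<in> Obj (C (Dom I1 d))"
    "e \<in> Arr I1" "Cod I1 e = Dom I1 ?u" "y \<in> Obj (C (Dom I1 e))" "a \<in> Arr (C (Dom I1 ?u))"
    "Dom (C (Dom I1 ?u)) a = Fo d x" "Cod (C (Dom I1 ?u)) a = Fo e y" using assms(2) f by (auto simp: T_sel)
  have 1: "two (\<alpha> \<lhd>\<^bsub>I\<^esub> d) x \<cdot>\<^bsub>C m\<^esub> phi ?u d x = phi ?v d x \<cdot>\<^bsub>C m\<^esub> two \<alpha> (Fo d x)"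
    and 2: "two (\<alpha> \<lhd>\<^bsub>I\<^esub> e) y \<cdot>\<^bsub>C m\<^esub> phi ?u e y = phi ?v e y \<cdot>\<^bsub>C m\<^esub> two \<alpha> (Fo e y)"
    using phi_two[of "Id I2 d" \<alpha> m x] phi_two[of "Id I2 e" \<alpha> m y] by auto
  have 3: "two \<alpha> (Fo e y) \<cdot>\<^bsub>C m\<^esub> Fa ?u a = Fa ?v a \<cdot>\<^bsub>C m\<^esub> two \<alpha> (Fo d x)"
    using two_natural[of \<alpha> _ m a] by simp
  have "two (\<alpha> \<lhd>\<^bsub>I\<^esub> e) y \<cdot>\<^bsub>C m\<^esub> (phi ?u e y \<cdot>\<^bsub>C m\<^esub> (Fa ?u a \<cdot>\<^bsub>C m\<^esub> inverse_arr (C m) (phi ?u d x)))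
    = (two (\<alpha> \<lhd>\<^bsub>I\<^esub> e) y \<cdot>\<^bsub>C m\<^esub> phi ?u e y) \<cdot>\<^bsub>C m\<^esub> (Fa ?u a \<cdot>\<^bsub>C m\<^esub> inverse_arr (C m) (phi ?u d x))" by simp
  also have "\<dots> = phi ?v e y \<cdot>\<^bsub>C m\<^esub> ((two \<alpha> (Fo e y) \<cdot>\<^bsub>C m\<^esub> Fa ?u a) \<cdot>\<^bsub>C m\<^esub> inverse_arr (C m) (phi ?u d x))"
    unfolding 2 by simp
  also have "\<dots> = phi ?v e y \<cdot>\<^bsub>C m\<^esub> (Fa ?v a \<cdot>\<^bsub>C m\<^esub> (inverse_arr (C m) (phi ?v d x) \<cdot>\<^bsub>C m\<^esub>
      ((phi ?v d x \<cdot>\<^bsub>C m\<^esub> two \<alpha> (Fo d x)) \<cdot>\<^bsub>C m\<^esub> inverse_arr (C m) (phi ?u d x))))"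
    unfolding 3 by simp
  also have "\<dots> = phi ?v e y \<cdot>\<^bsub>C m\<^esub> (Fa ?v a \<cdot>\<^bsub>C m\<^esub> (inverse_arr (C m) (phi ?v d x) \<cdot>\<^bsub>C m\<^esub> two (\<alpha> \<lhd>\<^bsub>I\<^esub> d) x))"
    unfolding 1[symmetric] by simp
  finally show ?thesis by (simp add: f K_def T_sel push_def)
qed

lemma is_iso_TI:
  assumes "k \<in> Obj I1" "((d, x), (e, y), a) \<in> Arr (T k)" "is_iso (C k) a"
  shows "is_iso (T k) ((d, x), (e, y), a)"
  by (rule is_isoI[of _ _ "((e, y), (d, x), inverse_arr (C k) a)"]) (use assms in \<open>auto simp: T_sel\<close>)

lemma im_hom [simp]:
  assumes "d \<in> Arr I1" "k = Cod I1 d" "a \<in> Arr (C (Dom I1 d))"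
  shows "im d a \<in> Arr (T k)" "Dom (T k) (im d a) = (d, Dom (C (Dom I1 d)) a)"
    "Cod (T k) (im d a) = (d, Cod (C (Dom I1 d)) a)"
  using assms by (simp_all add: im_def T_sel)

lemma im_Id [simp]:
  "\<lbrakk>d \<in> Arr I1; i = Dom I1 d; x \<in> Obj (C i)\<rbrakk> \<Longrightarrow> im d (Id (C i) x) = Id (T (Cod I1 d)) (d, x)"
  by (simp add: im_def T_sel)

lemma im_Comp [simp]:
  "\<lbrakk>d \<in> Arr I1; i = Dom I1 d; a \<in> Arr (C i); b \<in> Arr (C i); Cod (C i) a = Dom (C i) b\<rbrakk> \<Longrightarrow>
    im d (b \<cdot>\<^bsub>C i\<^esub> a) = im d b \<cdot>\<^bsub>T (Cod I1 d)\<^esub> im d a"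
  by (simp add: im_def T_sel)

lemma push_im [simp]:
  "\<lbrakk>d \<in> Arr I1; u \<in> Arr I1; Cod I1 d = Dom I1 u; a \<in> Arr (C (Dom I1 d))\<rbrakk> \<Longrightarrow> push u (im d a) = im (u \<circ>\<^bsub>I\<^esub> d) a"
  unfolding im_def
  by (subst push_eqI[of _ _ _ _ _ _ "Cod I1 u" "Fa (u \<circ>\<^bsub>I\<^esub> d) a"])
    (auto simp: T_sel phi_natural)

lemma Phi_hom [simp]:
  assumes "d \<in> Arr I1" "e \<in> Arr I1" "Cod I1 d = Dom I1 e" "k = Cod I1 e" "x \<in> Obj (C (Dom I1 d))"
  shows "Phi e d x \<in> Arr (T k)" "Dom (T k) (Phi e d x) = (e, Fo d x)" "Cod (T k) (Phi e d x) = (e \<circ>\<^bsub>I\<^esub> d, x)"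
    "is_iso (T k) (Phi e d x)"
  using assms is_iso_TI[of k e "Fo d x" "e \<circ>\<^bsub>I\<^esub> d" x "phi e d x"] by (simp_all add: Phi_def T_sel)

lemma push_Phi [simp]:
  "\<lbrakk>d \<in> Arr I1; e \<in> Arr I1; u \<in> Arr I1; Cod I1 d = Dom I1 e; Cod I1 e = Dom I1 u; x \<in> Obj (C (Dom I1 d))\<rbrakk> \<Longrightarrow>
    push u (Phi e d x) = Phi (u \<circ>\<^bsub>I\<^esub> e) d x"
  unfolding Phi_def
  by (subst push_eqI[of _ _ _ _ _ _ "Cod I1 u" "phi (u \<circ>\<^bsub>I\<^esub> e) d x"])
    (auto simp: T_sel phi_assoc)

lemma Phi_natural:
  assumes "d \<in> Arr I1" "e \<in> Arr I1" "Cod I1 d = Dom I1 e" "k = Cod I1 e" "i = Dom I1 d" "a \<in> Arr (C i)"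
  shows "Phi e d (Cod (C i) a) \<cdot>\<^bsub>T k\<^esub> im e (Fa d a) = im (e \<circ>\<^bsub>I\<^esub> d) a \<cdot>\<^bsub>T k\<^esub> Phi e d (Dom (C i) a)"
  using assms by (simp add: Phi_def im_def T_sel phi_natural)

text \<open>Together with \<open>Phi_comp\<close> and \<open>Phi_unit\<close>, this restates the
  naturality and coherence of the structure cells of \<open>F\<close> inside \<open>T\<close>. After
  passing to germs the three identities become the axioms of a pseudococone.\<close>

lemma K_Phi:
  assumes "\<alpha> \<in> Arr I2" "e \<in> Arr I1" "Cod I1 (Dom I2 \<alpha>) = Dom I1 e" "k = Cod I1 e" "x \<in> Obj (C (Dom I1 (Dom I2 \<alpha>)))"
  shows "K (e \<rhd>\<^bsub>I\<^esub> \<alpha>) x \<cdot>\<^bsub>T k\<^esub> Phi e (Dom I2 \<alpha>) x = Phi e (Cod I2 \<alpha>) x \<cdot>\<^bsub>T k\<^esub> im e (two \<alpha> x)"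
  using assms phi_two[of \<alpha> "Id I2 e" k x] by (simp add: K_def Phi_def im_def T_sel)

lemma Phi_comp:
  assumes "c \<in> Arr I1" "d \<in> Arr I1" "e \<in> Arr I1" "Cod I1 c = Dom I1 d" "Cod I1 d = Dom I1 e" "k = Cod I1 e"
    "x \<in> Obj (C (Dom I1 c))"
  shows "Phi e (d \<circ>\<^bsub>I\<^esub> c) x \<cdot>\<^bsub>T k\<^esub> im e (phi d c x) = Phi (e \<circ>\<^bsub>I\<^esub> d) c x \<cdot>\<^bsub>T k\<^esub> Phi e d (Fo c x)"
  using assms by (simp add: Phi_def im_def T_sel phi_assoc)

lemma Phi_unit:
  assumes "e \<in> Arr I1" "i = Dom I1 e" "k = Cod I1 e" "x \<in> Obj (C i)"
  shows "Phi e (Id I1 i) x \<cdot>\<^bsub>T k\<^esub> im e (eta i x) = Id (T k) (e, x)"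
  using assms by (simp add: Phi_def im_def T_sel phi_unit)

text \<open>Up to the canonical isomorphisms \<open>Phi\<close>, every arrow of \<open>T k\<close>
  is an arrow of \<open>F k\<close>. Hence whatever is defined on arrows coming from stages and on
  structure cells is determined on all germs.\<close>

lemma T_decompose:
  assumes k [simp]: "k \<in> Obj I1" and f: "((d, x), (e, y), a) \<in> Arr (T k)"
  shows "((d, x), (e, y), a) =
    Phi (Id I1 k) e y \<cdot>\<^bsub>T k\<^esub> (im (Id I1 k) a \<cdot>\<^bsub>T k\<^esub> inverse_arr (T k) (Phi (Id I1 k) d x))"
proof -
  have a [simp]: "d \<in> Arr I1" "Cod I1 d = k" "x \<in> Obj (C (Dom I1 d))" "e \<in> Arr I1" "Cod I1 e = k" "y \<in> Obj (C (Dom I1 e))"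
    "a \<in> Arr (C k)" "Dom (C k) a = Fo d x" "Cod (C k) a = Fo e y" using f by (auto simp: T_sel)
  \<comment> \<open>Pushing along an identity changes nothing, yet by definition it is a conjugate
    by \<open>phi\<close>; comparing the two gives the decomposition.\<close>
  have "push (Id I1 k) ((d, x), (e, y), a) = ((d, x), (e, y), a)" using f by simp
  then have "phi (Id I1 k) e y \<cdot>\<^bsub>C k\<^esub> (Fa (Id I1 k) a \<cdot>\<^bsub>C k\<^esub> inverse_arr (C k) (phi (Id I1 k) d x)) = a"
    by (simp add: push_def)
  from arg_cong[OF this, of "\<lambda>h. h \<cdot>\<^bsub>C k\<^esub> phi (Id I1 k) d x"]
  have "((d, x), (e, y), a) \<cdot>\<^bsub>T k\<^esub> Phi (Id I1 k) d x = Phi (Id I1 k) e y \<cdot>\<^bsub>T k\<^esub> im (Id I1 k) a"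
    by (simp add: Phi_def im_def T_sel)
  then show ?thesis
    using Comp_eq_conj_iff[of "T k" "Phi (Id I1 k) d x" "Phi (Id I1 k) e y" "im (Id I1 k) a" "((d, x), (e, y), a)"] f
    by (simp add: T_sel)
qed

end

text \<open>Applies a commuting square in front of a further factor \<open>h\<close>, where the
  right-nested normal form hides the left-hand side from rewriting.\<close>

lemma Comp_square:
  assumes "category C" "g \<cdot>\<^bsub>C\<^esub> f = g' \<cdot>\<^bsub>C\<^esub> f'" "f \<in> Arr C" "g \<in> Arr C" "f' \<in> Arr C" "g' \<in> Arr C" "h \<in> Arr C"
    "Cod C f = Dom C g" "Cod C f' = Dom C g'" "Cod C h = Dom C f" "Cod C h = Dom C f'"
  shows "g \<cdot>\<^bsub>C\<^esub> (f \<cdot>\<^bsub>C\<^esub> h) = g' \<cdot>\<^bsub>C\<^esub> (f' \<cdot>\<^bsub>C\<^esub> h)"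
  using assms Comp_assoc[of C h f g] Comp_assoc[of C h f' g'] by simp

section \<open>The bicolimit as a category of germs\<close>

context bifiltered
begin

lemma two_category_I [simp]: "two_category I"
  by unfold_locales

lemma cospanE:
  assumes "i \<in> Obj (Cells1 I)" "i' \<in> Obj (Cells1 I)"
  obtains u v where "u \<in> Arr (Cells1 I)" "v \<in> Arr (Cells1 I)" "Dom (Cells1 I) u = i" "Dom (Cells1 I) v = i'"
    "Cod (Cells1 I) v = Cod (Cells1 I) u"
  using cospan[OF assms] by (auto simp: in_hom)

lemma coinsertE:
  assumes "d \<in> Arr (Cells1 I)" "d' \<in> Arr (Cells1 I)" "Dom (Cells1 I) d' = Dom (Cells1 I) d"
    "Cod (Cells1 I) d' = Cod (Cells1 I) d"
  obtains f \<alpha> where "f \<in> Arr (Cells1 I)" "Dom (Cells1 I) f = Cod (Cells1 I) d" "is_iso (Cells2 I) \<alpha>"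
    "Dom (Cells2 I) \<alpha> = f \<circ>\<^bsub>I\<^esub> d" "Cod (Cells2 I) \<alpha> = f \<circ>\<^bsub>I\<^esub> d'"
  using coinsert[of d _ _ d'] assms by (auto simp: in_hom)

lemma coequifyE:
  assumes "\<alpha> \<in> Arr (Cells2 I)" "\<beta> \<in> Arr (Cells2 I)" "Dom (Cells2 I) \<beta> = Dom (Cells2 I) \<alpha>" "Cod (Cells2 I) \<beta> = Cod (Cells2 I) \<alpha>"
  obtains f where "f \<in> Arr (Cells1 I)" "Dom (Cells1 I) f = Cod (Cells1 I) (Dom (Cells2 I) \<alpha>)" "f \<rhd>\<^bsub>I\<^esub> \<alpha> = f \<rhd>\<^bsub>I\<^esub> \<beta>"
  using coequify[of "Dom (Cells2 I) \<alpha>" "Dom (Cells1 I) (Dom (Cells2 I) \<alpha>)" "Cod (Cells1 I) (Dom (Cells2 I) \<alpha>)" \<alpha> "Cod (Cells2 I) \<alpha>" \<beta>]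
    assms by (auto simp: in_hom)

text \<open>The targets are joined by a cospan, and \<open>coinsert\<close> makes the two resulting
  composites isomorphic one step later.\<close>

lemma iso_squareE:
  assumes "d \<in> Arr (Cells1 I)" "d' \<in> Arr (Cells1 I)" "Dom (Cells1 I) d' = Dom (Cells1 I) d"
  obtains u v \<epsilon> where "u \<in> Arr (Cells1 I)" "Dom (Cells1 I) u = Cod (Cells1 I) d" "v \<in> Arr (Cells1 I)"
    "Dom (Cells1 I) v = Cod (Cells1 I) d'" "Cod (Cells1 I) v = Cod (Cells1 I) u"
    "is_iso (Cells2 I) \<epsilon>" "Dom (Cells2 I) \<epsilon> = u \<circ>\<^bsub>I\<^esub> d" "Cod (Cells2 I) \<epsilon> = v \<circ>\<^bsub>I\<^esub> d'"
proof -
  obtain u v where uv: "u \<in> Arr (Cells1 I)" "v \<in> Arr (Cells1 I)" "Dom (Cells1 I) u = Cod (Cells1 I) d"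
    "Dom (Cells1 I) v = Cod (Cells1 I) d'" "Cod (Cells1 I) v = Cod (Cells1 I) u"
    using assms by (elim cospanE[of "Cod (Cells1 I) d" "Cod (Cells1 I) d'", rotated 2]) auto
  obtain f \<epsilon> where f: "f \<in> Arr (Cells1 I)" "Dom (Cells1 I) f = Cod (Cells1 I) u" "is_iso (Cells2 I) \<epsilon>"
    "Dom (Cells2 I) \<epsilon> = f \<circ>\<^bsub>I\<^esub> (u \<circ>\<^bsub>I\<^esub> d)" "Cod (Cells2 I) \<epsilon> = f \<circ>\<^bsub>I\<^esub> (v \<circ>\<^bsub>I\<^esub> d')"
    using coinsertE[of "u \<circ>\<^bsub>I\<^esub> d" "v \<circ>\<^bsub>I\<^esub> d'"] uv assms by auto
  show ?thesis
    by (rule that[of "f \<circ>\<^bsub>I\<^esub> u" "f \<circ>\<^bsub>I\<^esub> v" \<epsilon>]) (use uv f assms in auto)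
qed

text \<open>Two fillings of the same span are isomorphic after going further, compatibly with their
  2-cells. This is the essential uniqueness behind composition of germs: \<open>\<sigma>\<close>
  matches the legs on one side, \<open>\<tau>\<close> those on the other, and the last equation says
  that they carry \<open>\<epsilon>\<close> to \<open>\<epsilon>'\<close>.\<close>

lemma iso_squares_mergeE:
  assumes "e \<in> Arr (Cells1 I)" "e' \<in> Arr (Cells1 I)" "Dom (Cells1 I) e' = Dom (Cells1 I) e"
    and "u \<in> Arr (Cells1 I)" "Dom (Cells1 I) u = Cod (Cells1 I) e" "v \<in> Arr (Cells1 I)"
    "Dom (Cells1 I) v = Cod (Cells1 I) e'" "Cod (Cells1 I) v = Cod (Cells1 I) u"
    and "u' \<in> Arr (Cells1 I)" "Dom (Cells1 I) u' = Cod (Cells1 I) e" "v' \<in> Arr (Cells1 I)"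
    "Dom (Cells1 I) v' = Cod (Cells1 I) e'" "Cod (Cells1 I) v' = Cod (Cells1 I) u'"
    and "\<epsilon> \<in> Arr (Cells2 I)" "Dom (Cells2 I) \<epsilon> = u \<circ>\<^bsub>I\<^esub> e" "Cod (Cells2 I) \<epsilon> = v \<circ>\<^bsub>I\<^esub> e'"
    and "\<epsilon>' \<in> Arr (Cells2 I)" "Dom (Cells2 I) \<epsilon>' = u' \<circ>\<^bsub>I\<^esub> e" "Cod (Cells2 I) \<epsilon>' = v' \<circ>\<^bsub>I\<^esub> e'"
  obtains s t \<sigma> \<tau> where "s \<in> Arr (Cells1 I)" "Dom (Cells1 I) s = Cod (Cells1 I) u" "t \<in> Arr (Cells1 I)"
    "Dom (Cells1 I) t = Cod (Cells1 I) u'" "Cod (Cells1 I) t = Cod (Cells1 I) s"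
    "is_iso (Cells2 I) \<sigma>" "Dom (Cells2 I) \<sigma> = s \<circ>\<^bsub>I\<^esub> u" "Cod (Cells2 I) \<sigma> = t \<circ>\<^bsub>I\<^esub> u'"
    "is_iso (Cells2 I) \<tau>" "Dom (Cells2 I) \<tau> = s \<circ>\<^bsub>I\<^esub> v" "Cod (Cells2 I) \<tau> = t \<circ>\<^bsub>I\<^esub> v'"
    "(\<tau> \<lhd>\<^bsub>I\<^esub> e') \<bullet>\<^bsub>I\<^esub> (s \<rhd>\<^bsub>I\<^esub> \<epsilon>) = (t \<rhd>\<^bsub>I\<^esub> \<epsilon>') \<bullet>\<^bsub>I\<^esub> (\<sigma> \<lhd>\<^bsub>I\<^esub> e)"
proof -
  note [simp] = assms
  obtain a b \<sigma>0 where [simp]: "a \<in> Arr (Cells1 I)" "Dom (Cells1 I) a = Cod (Cells1 I) u" "b \<in> Arr (Cells1 I)"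
    "Dom (Cells1 I) b = Cod (Cells1 I) u'" "Cod (Cells1 I) b = Cod (Cells1 I) a"
    "is_iso (Cells2 I) \<sigma>0" "Dom (Cells2 I) \<sigma>0 = a \<circ>\<^bsub>I\<^esub> u" "Cod (Cells2 I) \<sigma>0 = b \<circ>\<^bsub>I\<^esub> u'"
    by (rule iso_squareE[of u u']) auto
  obtain c \<tau>0 where [simp]: "c \<in> Arr (Cells1 I)" "Dom (Cells1 I) c = Cod (Cells1 I) a" "is_iso (Cells2 I) \<tau>0"
    "Dom (Cells2 I) \<tau>0 = c \<circ>\<^bsub>I\<^esub> (a \<circ>\<^bsub>I\<^esub> v)" "Cod (Cells2 I) \<tau>0 = c \<circ>\<^bsub>I\<^esub> (b \<circ>\<^bsub>I\<^esub> v')"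
    using coinsertE[of "a \<circ>\<^bsub>I\<^esub> v" "b \<circ>\<^bsub>I\<^esub> v'"] by auto
  have [simp]: "\<sigma>0 \<in> Arr (Cells2 I)" "\<tau>0 \<in> Arr (Cells2 I)" by (auto intro: is_iso_Arr)
  \<comment> \<open>Both pastings lead from the 1-cell through \<open>a\<close>, \<open>u\<close>,
    \<open>e\<close> to the one through \<open>b\<close>, \<open>v'\<close>, \<open>e'\<close>.
    Nothing relates the independently chosen \<open>\<sigma>0\<close> and \<open>\<tau>0\<close>, so
    the two pastings are forced to agree by \<open>coequify\<close>.\<close>
  let ?p = "(\<tau>0 \<lhd>\<^bsub>I\<^esub> e') \<bullet>\<^bsub>I\<^esub> (c \<circ>\<^bsub>I\<^esub> a \<rhd>\<^bsub>I\<^esub> \<epsilon>)"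
  let ?q = "(c \<circ>\<^bsub>I\<^esub> b \<rhd>\<^bsub>I\<^esub> \<epsilon>') \<bullet>\<^bsub>I\<^esub> ((c \<rhd>\<^bsub>I\<^esub> \<sigma>0) \<lhd>\<^bsub>I\<^esub> e)"
  obtain w where [simp]: "w \<in> Arr (Cells1 I)" "Dom (Cells1 I) w = Cod (Cells1 I) c" and w: "w \<rhd>\<^bsub>I\<^esub> ?p = w \<rhd>\<^bsub>I\<^esub> ?q"
    by (rule coequifyE[of ?p ?q]) auto
  show ?thesis
    by (rule that[of "w \<circ>\<^bsub>I\<^esub> (c \<circ>\<^bsub>I\<^esub> a)" "w \<circ>\<^bsub>I\<^esub> (c \<circ>\<^bsub>I\<^esub> b)" "w \<circ>\<^bsub>I\<^esub> c \<rhd>\<^bsub>I\<^esub> \<sigma>0" "w \<rhd>\<^bsub>I\<^esub> \<tau>0"])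
      (use w in \<open>auto\<close>)
qed

end

section \<open>Equality and composition of germs\<close>

context cat_diagram
begin

lemma K_square:
  assumes "\<alpha> \<in> Arr I2" "Dom I2 \<alpha> = u" "Cod I2 \<alpha> = v" "f \<in> Arr (T k)" "Dom I1 u = k" "Cod I1 u = m"
    "Dom (T k) f = (d, x)" "Cod (T k) f = (e, y)"
  shows "K (\<alpha> \<lhd>\<^bsub>I\<^esub> e) y \<cdot>\<^bsub>T m\<^esub> push u f = push v f \<cdot>\<^bsub>T m\<^esub> K (\<alpha> \<lhd>\<^bsub>I\<^esub> d) x"
  using K_natural[OF assms(1), of f k m d x e y] assms by metis

text \<open>Only the objects \<open>x\<close> and \<open>y\<close> must coincide; the 1-cells
  through which they are presented may differ, and \<open>\<beta>\<close> and
  \<open>\<gamma>\<close> match them at a common stage. No compatibility between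
  \<open>\<beta>\<close> and \<open>\<gamma>\<close> is demanded, because parallel 2-cells become
  equal later on by \<open>coequify\<close>.\<close>

definition germ_eq :: "'i \<times> ('d \<times> 'u) \<times> ('d \<times> 'u) \<times> 'u \<Rightarrow> 'i \<times> ('d \<times> 'u) \<times> ('d \<times> 'u) \<times> 'u \<Rightarrow> bool"
  (infix "\<simeq>" 50) where
  "\<rho> \<simeq> \<rho>' \<longleftrightarrow> (\<exists>k f k' f' d x e y d' e' u v \<beta> \<gamma>. \<rho> = (k, f) \<and> \<rho>' = (k', f') \<and>
     k \<in> Obj I1 \<and> k' \<in> Obj I1 \<and> f \<in> Arr (T k) \<and> f' \<in> Arr (T k') \<and>
     Dom (T k) f = (d, x) \<and> Cod (T k) f = (e, y) \<and> Dom (T k') f' = (d', x) \<and> Cod (T k') f' = (e', y) \<and>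
     u \<in> Arr I1 \<and> Dom I1 u = k \<and> v \<in> Arr I1 \<and> Dom I1 v = k' \<and> Cod I1 v = Cod I1 u \<and>
     is_iso I2 \<beta> \<and> Dom I2 \<beta> = u \<circ>\<^bsub>I\<^esub> d \<and> Cod I2 \<beta> = v \<circ>\<^bsub>I\<^esub> d' \<and>
     is_iso I2 \<gamma> \<and> Dom I2 \<gamma> = u \<circ>\<^bsub>I\<^esub> e \<and> Cod I2 \<gamma> = v \<circ>\<^bsub>I\<^esub> e' \<and>
     K \<gamma> y \<cdot>\<^bsub>T (Cod I1 u)\<^esub> push u f = push v f' \<cdot>\<^bsub>T (Cod I1 u)\<^esub> K \<beta> x)"

lemma T_ends:
  assumes "f \<in> Arr (T k)" "Dom (T k) f = (d, x)" "Cod (T k) f = (e, y)"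
  shows "k \<in> Obj I1" "d \<in> Arr I1" "Cod I1 d = k" "x \<in> Obj (C (Dom I1 d))"
    "e \<in> Arr I1" "Cod I1 e = k" "y \<in> Obj (C (Dom I1 e))"
  using assms by (auto elim!: Arr_T_cases simp: T_sel)

lemma germ_eqI:
  assumes f: "f \<in> Arr (T k)" "Dom (T k) f = (d, x)" "Cod (T k) f = (e, y)"
    and f': "f' \<in> Arr (T k')" "Dom (T k') f' = (d', x)" "Cod (T k') f' = (e', y)"
    and "u \<in> Arr I1" "Dom I1 u = k" "v \<in> Arr I1" "Dom I1 v = k'" "Cod I1 v = Cod I1 u"
    and "is_iso I2 \<beta>" "Dom I2 \<beta> = u \<circ>\<^bsub>I\<^esub> d" "Cod I2 \<beta> = v \<circ>\<^bsub>I\<^esub> d'"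
    and "is_iso I2 \<gamma>" "Dom I2 \<gamma> = u \<circ>\<^bsub>I\<^esub> e" "Cod I2 \<gamma> = v \<circ>\<^bsub>I\<^esub> e'"
    and "K \<gamma> y \<cdot>\<^bsub>T (Cod I1 u)\<^esub> push u f = push v f' \<cdot>\<^bsub>T (Cod I1 u)\<^esub> K \<beta> x"
  shows "(k, f) \<simeq> (k', f')"
  unfolding germ_eq_def using assms T_ends(1)[OF f] T_ends(1)[OF f'] by blast

lemma germ_eqE:
  assumes "\<rho> \<simeq> \<rho>'"
  obtains k f k' f' d x e y d' e' u v \<beta> \<gamma> where "\<rho> = (k, f)" "\<rho>' = (k', f')"
    "k \<in> Obj I1" "k' \<in> Obj I1" "f \<in> Arr (T k)" "f' \<in> Arr (T k')"
    "Dom (T k) f = (d, x)" "Cod (T k) f = (e, y)" "Dom (T k') f' = (d', x)" "Cod (T k') f' = (e', y)"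
    "d \<in> Arr I1" "Cod I1 d = k" "x \<in> Obj (C (Dom I1 d))" "e \<in> Arr I1" "Cod I1 e = k" "y \<in> Obj (C (Dom I1 e))"
    "d' \<in> Arr I1" "Cod I1 d' = k'" "e' \<in> Arr I1" "Cod I1 e' = k'" "Dom I1 d' = Dom I1 d" "Dom I1 e' = Dom I1 e"
    "u \<in> Arr I1" "Dom I1 u = k" "v \<in> Arr I1" "Dom I1 v = k'" "Cod I1 v = Cod I1 u"
    "is_iso I2 \<beta>" "Dom I2 \<beta> = u \<circ>\<^bsub>I\<^esub> d" "Cod I2 \<beta> = v \<circ>\<^bsub>I\<^esub> d'"
    "is_iso I2 \<gamma>" "Dom I2 \<gamma> = u \<circ>\<^bsub>I\<^esub> e" "Cod I2 \<gamma> = v \<circ>\<^bsub>I\<^esub> e'" "\<beta> \<in> Arr I2" "\<gamma> \<in> Arr I2"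
    "K \<gamma> y \<cdot>\<^bsub>T (Cod I1 u)\<^esub> push u f = push v f' \<cdot>\<^bsub>T (Cod I1 u)\<^esub> K \<beta> x"
proof -
  from assms obtain k f k' f' d x e y d' e' u v \<beta> \<gamma> where *: "\<rho> = (k, f)" "\<rho>' = (k', f')"
    "k \<in> Obj I1" "k' \<in> Obj I1" "f \<in> Arr (T k)" "f' \<in> Arr (T k')"
    "Dom (T k) f = (d, x)" "Cod (T k) f = (e, y)" "Dom (T k') f' = (d', x)" "Cod (T k') f' = (e', y)"
    "u \<in> Arr I1" "Dom I1 u = k" "v \<in> Arr I1" "Dom I1 v = k'" "Cod I1 v = Cod I1 u"
    "is_iso I2 \<beta>" "Dom I2 \<beta> = u \<circ>\<^bsub>I\<^esub> d" "Cod I2 \<beta> = v \<circ>\<^bsub>I\<^esub> d'"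
    "is_iso I2 \<gamma>" "Dom I2 \<gamma> = u \<circ>\<^bsub>I\<^esub> e" "Cod I2 \<gamma> = v \<circ>\<^bsub>I\<^esub> e'"
    "K \<gamma> y \<cdot>\<^bsub>T (Cod I1 u)\<^esub> push u f = push v f' \<cdot>\<^bsub>T (Cod I1 u)\<^esub> K \<beta> x"
    unfolding germ_eq_def by blast
  note ends = T_ends[OF *(5,7,8)] T_ends[OF *(6,9,10)]
  have arr: "\<beta> \<in> Arr I2" "\<gamma> \<in> Arr I2" using * by auto
  have "Dom I1 d' = Dom I1 d" "Dom I1 e' = Dom I1 e"
    using Dom_Cod_2cell(1)[OF two_category_I arr(1)] Dom_Cod_2cell(1)[OF two_category_I arr(2)] * ends by auto
  with * ends arr show ?thesis by (intro that[of k f k' f' d x e y d' e' u v \<beta> \<gamma>]) simp_all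
qed

text \<open>The stage of the pushed arrow serves for the comparison, with an identity 1-cell on the
  other side and identity 2-cells.\<close>

lemma germ_push:
  assumes "f \<in> Arr (T k)" "u \<in> Arr I1" "Dom I1 u = k" "m = Cod I1 u"
  shows "(k, f) \<simeq> (m, push u f)"
proof -
  obtain d x e y where de: "Dom (T k) f = (d, x)" "Cod (T k) f = (e, y)" by (metis surj_pair)
  note ends = T_ends[OF assms(1) de]
  note [simp] = ends assms de
  show ?thesis
    by (rule germ_eqI[OF assms(1) de, of _ _ "u \<circ>\<^bsub>I\<^esub> d" "u \<circ>\<^bsub>I\<^esub> e" u "Id I1 m" "Id I2 (u \<circ>\<^bsub>I\<^esub> d)" "Id I2 (u \<circ>\<^bsub>I\<^esub> e)"]) auto
qed

lemma germ_conj: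
  assumes f: "f \<in> Arr (T k)" "Dom (T k) f = (d, x)" "Cod (T k) f = (e, y)"
    and f': "f' \<in> Arr (T k)" "Dom (T k) f' = (d', x)" "Cod (T k) f' = (e', y)"
    and "is_iso I2 \<beta>" "Dom I2 \<beta> = d" "Cod I2 \<beta> = d'" "is_iso I2 \<gamma>" "Dom I2 \<gamma> = e" "Cod I2 \<gamma> = e'"
    and "K \<gamma> y \<cdot>\<^bsub>T k\<^esub> f = f' \<cdot>\<^bsub>T k\<^esub> K \<beta> x"
  shows "(k, f) \<simeq> (k, f')"
  by (rule germ_eqI[OF f f', of "Id I1 k" "Id I1 k" \<beta> \<gamma>]) (use assms T_ends[OF f] T_ends[OF f'] in auto)

lemma germ_refl: "f \<in> Arr (T k) \<Longrightarrow> k \<in> Obj I1 \<Longrightarrow> (k, f) \<simeq> (k, f)"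
  using germ_push[of f k "Id I1 k" k] by simp

lemma germ_sym:
  assumes "\<rho> \<simeq> \<rho>'"
  shows "\<rho>' \<simeq> \<rho>"
  using assms
proof (cases rule: germ_eqE)
  case (1 k f k' f' d x e y d' e' u v \<beta> \<gamma>)
  note a [simp] = 1(1-35) and eq = 1(36)
  let ?T = "T (Cod I1 u)"
  have inv: "K (inverse_arr I2 \<beta>) x \<in> Arr ?T" "K (inverse_arr I2 \<gamma>) y \<in> Arr ?T"
    "Dom ?T (K (inverse_arr I2 \<beta>) x) = (v \<circ>\<^bsub>I\<^esub> d', x)" "Cod ?T (K (inverse_arr I2 \<beta>) x) = (u \<circ>\<^bsub>I\<^esub> d, x)"
    "Dom ?T (K (inverse_arr I2 \<gamma>) y) = (v \<circ>\<^bsub>I\<^esub> e', y)" "Cod ?T (K (inverse_arr I2 \<gamma>) y) = (u \<circ>\<^bsub>I\<^esub> e, y)"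
    "K (inverse_arr I2 \<gamma>) y \<cdot>\<^bsub>?T\<^esub> K \<gamma> y = Id ?T (u \<circ>\<^bsub>I\<^esub> e, y)"
    "K \<beta> x \<cdot>\<^bsub>?T\<^esub> K (inverse_arr I2 \<beta>) x = Id ?T (v \<circ>\<^bsub>I\<^esub> d', x)"
    using K_vcomp[of \<gamma> "inverse_arr I2 \<gamma>" "Cod I1 u" y] K_vcomp[of "inverse_arr I2 \<beta>" \<beta> "Cod I1 u" x] by auto
  note [simp] = inv
  have "K (inverse_arr I2 \<gamma>) y \<cdot>\<^bsub>?T\<^esub> (K \<gamma> y \<cdot>\<^bsub>?T\<^esub> push u f) = push u f"
    by (subst Comp_assoc[symmetric]) (simp_all del: Comp_assoc)
  then have "push u f = K (inverse_arr I2 \<gamma>) y \<cdot>\<^bsub>?T\<^esub> (push v f' \<cdot>\<^bsub>?T\<^esub> K \<beta> x)"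
    unfolding eq by (rule sym)
  then have "push u f \<cdot>\<^bsub>?T\<^esub> K (inverse_arr I2 \<beta>) x = K (inverse_arr I2 \<gamma>) y \<cdot>\<^bsub>?T\<^esub> push v f'"
    by simp
  then show ?thesis
    unfolding a(1,2)
    by (intro germ_eqI[of f' k' d' x e' y f k d e v u "inverse_arr I2 \<beta>" "inverse_arr I2 \<gamma>"]) auto
qed

text \<open>The middle arrow \<open>f'\<close> is pushed along \<open>v\<close> in one comparison
  and along \<open>u'\<close> in the other. A square over these two 1-cells brings the comparisons
  to one stage, where naturality of \<open>K\<close> joins them.\<close>

lemma germ_trans:
  assumes "\<rho> \<simeq> \<rho>'" "\<rho>' \<simeq> \<rho>''"
  shows "\<rho> \<simeq> \<rho>''"
  using assms(1)
proof (cases rule: germ_eqE)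
  case (1 k f k' f' d x e y d' e' u v \<beta> \<gamma>)
  note a [simp] = 1(1-35) and eq = 1(36)
  show ?thesis using assms(2)
  proof (cases rule: germ_eqE)
    case (1 k1 f1 k'' f'' d1 x1 e1 y1 d'' e'' u' v' \<beta>' \<gamma>')
    note b = 1(1-35) and eq' = 1(36)
    have same: "k1 = k'" "f1 = f'" "d1 = d'" "x1 = x" "e1 = e'" "y1 = y" using b(1,7,8) a by auto
    note [simp] = b(2-)[unfolded same]
    note eq' = eq'[unfolded same]
    obtain s t \<sigma> where [simp]: "s \<in> Arr I1" "Dom I1 s = Cod I1 u" "t \<in> Arr I1"
      "Dom I1 t = Cod I1 u'" "Cod I1 t = Cod I1 s"
      "is_iso I2 \<sigma>" "Dom I2 \<sigma> = s \<circ>\<^bsub>I\<^esub> v" "Cod I2 \<sigma> = t \<circ>\<^bsub>I\<^esub> u'"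
      by (rule iso_squareE[of v u']) auto
    have [simp]: "\<sigma> \<in> Arr I2" by (rule is_iso_Arr) simp
    let ?T = "T (Cod I1 s)"
    have 1: "K (s \<rhd>\<^bsub>I\<^esub> \<gamma>) y \<cdot>\<^bsub>?T\<^esub> push (s \<circ>\<^bsub>I\<^esub> u) f = push (s \<circ>\<^bsub>I\<^esub> v) f' \<cdot>\<^bsub>?T\<^esub> K (s \<rhd>\<^bsub>I\<^esub> \<beta>) x"
      using arg_cong[OF eq, of "push s"] by simp
    have 2: "K (\<sigma> \<lhd>\<^bsub>I\<^esub> e') y \<cdot>\<^bsub>?T\<^esub> push (s \<circ>\<^bsub>I\<^esub> v) f' = push (t \<circ>\<^bsub>I\<^esub> u') f' \<cdot>\<^bsub>?T\<^esub> K (\<sigma> \<lhd>\<^bsub>I\<^esub> d') x"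
      by (rule K_square[of _ _ _ _ k']) auto
    have 3: "K (t \<rhd>\<^bsub>I\<^esub> \<gamma>') y \<cdot>\<^bsub>?T\<^esub> push (t \<circ>\<^bsub>I\<^esub> u') f' = push (t \<circ>\<^bsub>I\<^esub> v') f'' \<cdot>\<^bsub>?T\<^esub> K (t \<rhd>\<^bsub>I\<^esub> \<beta>') x"
      using arg_cong[OF eq', of "push t"] by simp
    \<comment> \<open>The new matching of the sources pastes the two given ones with the square
      \<open>\<sigma>\<close> between them, and likewise for the targets.\<close>
    let ?\<beta> = "(t \<rhd>\<^bsub>I\<^esub> \<beta>') \<bullet>\<^bsub>I\<^esub> ((\<sigma> \<lhd>\<^bsub>I\<^esub> d') \<bullet>\<^bsub>I\<^esub> (s \<rhd>\<^bsub>I\<^esub> \<beta>))"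
    let ?\<gamma> = "(t \<rhd>\<^bsub>I\<^esub> \<gamma>') \<bullet>\<^bsub>I\<^esub> ((\<sigma> \<lhd>\<^bsub>I\<^esub> e') \<bullet>\<^bsub>I\<^esub> (s \<rhd>\<^bsub>I\<^esub> \<gamma>))"
    have "K ?\<gamma> y \<cdot>\<^bsub>?T\<^esub> push (s \<circ>\<^bsub>I\<^esub> u) f
      = K (t \<rhd>\<^bsub>I\<^esub> \<gamma>') y \<cdot>\<^bsub>?T\<^esub> (K (\<sigma> \<lhd>\<^bsub>I\<^esub> e') y \<cdot>\<^bsub>?T\<^esub> (K (s \<rhd>\<^bsub>I\<^esub> \<gamma>) y \<cdot>\<^bsub>?T\<^esub> push (s \<circ>\<^bsub>I\<^esub> u) f))"
      by (simp add: K_vcomp[of _ _ "Cod I1 s"])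
    also have "\<dots> = K (t \<rhd>\<^bsub>I\<^esub> \<gamma>') y \<cdot>\<^bsub>?T\<^esub> (K (\<sigma> \<lhd>\<^bsub>I\<^esub> e') y \<cdot>\<^bsub>?T\<^esub> (push (s \<circ>\<^bsub>I\<^esub> v) f' \<cdot>\<^bsub>?T\<^esub> K (s \<rhd>\<^bsub>I\<^esub> \<beta>) x))"
      unfolding 1 ..
    also have "\<dots> = K (t \<rhd>\<^bsub>I\<^esub> \<gamma>') y \<cdot>\<^bsub>?T\<^esub> (push (t \<circ>\<^bsub>I\<^esub> u') f' \<cdot>\<^bsub>?T\<^esub> (K (\<sigma> \<lhd>\<^bsub>I\<^esub> d') x \<cdot>\<^bsub>?T\<^esub> K (s \<rhd>\<^bsub>I\<^esub> \<beta>) x))"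
      by (subst Comp_square[OF _ 2]) auto
    also have "\<dots> = push (t \<circ>\<^bsub>I\<^esub> v') f'' \<cdot>\<^bsub>?T\<^esub> (K (t \<rhd>\<^bsub>I\<^esub> \<beta>') x \<cdot>\<^bsub>?T\<^esub> (K (\<sigma> \<lhd>\<^bsub>I\<^esub> d') x \<cdot>\<^bsub>?T\<^esub> K (s \<rhd>\<^bsub>I\<^esub> \<beta>) x))"
      by (rule Comp_square[OF _ 3]) auto
    also have "\<dots> = push (t \<circ>\<^bsub>I\<^esub> v') f'' \<cdot>\<^bsub>?T\<^esub> K ?\<beta> x"
      by (simp add: K_vcomp[of _ _ "Cod I1 s"])
    finally show ?thesis
      unfolding a(1) b(2)
      by (intro germ_eqI[of f k d x e y f'' k'' d'' e'' "s \<circ>\<^bsub>I\<^esub> u" "t \<circ>\<^bsub>I\<^esub> v'" ?\<beta> ?\<gamma>]) auto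
  qed
qed

text \<open>A relation instead of an operation: the composite depends on the cospan and on the
  2-cell that matches the two presentations of the middle object. Uniqueness holds only up to
  equality of germs.\<close>

definition germ_comp :: "'i \<times> ('d \<times> 'u) \<times> ('d \<times> 'u) \<times> 'u \<Rightarrow> 'i \<times> ('d \<times> 'u) \<times> ('d \<times> 'u) \<times> 'u \<Rightarrow>
    'i \<times> ('d \<times> 'u) \<times> ('d \<times> 'u) \<times> 'u \<Rightarrow> bool" where
  "germ_comp \<rho> \<rho>' \<tau> \<longleftrightarrow> (\<exists>k f k' g d x e y e' h z u v \<epsilon>. \<rho> = (k, f) \<and> \<rho>' = (k', g) \<and>
     k \<in> Obj I1 \<and> k' \<in> Obj I1 \<and> f \<in> Arr (T k) \<and> g \<in> Arr (T k') \<and>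
     Dom (T k) f = (d, x) \<and> Cod (T k) f = (e, y) \<and> Dom (T k') g = (e', y) \<and> Cod (T k') g = (h, z) \<and>
     u \<in> Arr I1 \<and> Dom I1 u = k \<and> v \<in> Arr I1 \<and> Dom I1 v = k' \<and> Cod I1 v = Cod I1 u \<and>
     is_iso I2 \<epsilon> \<and> Dom I2 \<epsilon> = u \<circ>\<^bsub>I\<^esub> e \<and> Cod I2 \<epsilon> = v \<circ>\<^bsub>I\<^esub> e' \<and>
     \<tau> = (Cod I1 u, push v g \<cdot>\<^bsub>T (Cod I1 u)\<^esub> (K \<epsilon> y \<cdot>\<^bsub>T (Cod I1 u)\<^esub> push u f)))"

lemma germ_compI:
  assumes f: "f \<in> Arr (T k)" "Dom (T k) f = (d, x)" "Cod (T k) f = (e, y)"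
    and g: "g \<in> Arr (T k')" "Dom (T k') g = (e', y)" "Cod (T k') g = (h, z)"
    and "u \<in> Arr I1" "Dom I1 u = k" "v \<in> Arr I1" "Dom I1 v = k'" "Cod I1 v = Cod I1 u"
    and "is_iso I2 \<epsilon>" "Dom I2 \<epsilon> = u \<circ>\<^bsub>I\<^esub> e" "Cod I2 \<epsilon> = v \<circ>\<^bsub>I\<^esub> e'"
    and "m = Cod I1 u" "c = push v g \<cdot>\<^bsub>T m\<^esub> (K \<epsilon> y \<cdot>\<^bsub>T m\<^esub> push u f)"
  shows "germ_comp (k, f) (k', g) (m, c)"
  unfolding germ_comp_def using assms T_ends(1)[OF f] T_ends(1)[OF g] by blast

lemma germ_compE:
  assumes "germ_comp \<rho> \<rho>' \<tau>"
  obtains k f k' g d x e y e' h z u v \<epsilon> where "\<rho> = (k, f)" "\<rho>' = (k', g)"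
    "k \<in> Obj I1" "k' \<in> Obj I1" "f \<in> Arr (T k)" "g \<in> Arr (T k')"
    "Dom (T k) f = (d, x)" "Cod (T k) f = (e, y)" "Dom (T k') g = (e', y)" "Cod (T k') g = (h, z)"
    "d \<in> Arr I1" "Cod I1 d = k" "x \<in> Obj (C (Dom I1 d))" "e \<in> Arr I1" "Cod I1 e = k" "y \<in> Obj (C (Dom I1 e))"
    "e' \<in> Arr I1" "Cod I1 e' = k'" "h \<in> Arr I1" "Cod I1 h = k'" "Dom I1 e' = Dom I1 e" "z \<in> Obj (C (Dom I1 h))"
    "u \<in> Arr I1" "Dom I1 u = k" "v \<in> Arr I1" "Dom I1 v = k'" "Cod I1 v = Cod I1 u"
    "is_iso I2 \<epsilon>" "\<epsilon> \<in> Arr I2" "Dom I2 \<epsilon> = u \<circ>\<^bsub>I\<^esub> e" "Cod I2 \<epsilon> = v \<circ>\<^bsub>I\<^esub> e'"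
    "\<tau> = (Cod I1 u, push v g \<cdot>\<^bsub>T (Cod I1 u)\<^esub> (K \<epsilon> y \<cdot>\<^bsub>T (Cod I1 u)\<^esub> push u f))"
proof -
  from assms obtain k f k' g d x e y e' h z u v \<epsilon> where *: "\<rho> = (k, f)" "\<rho>' = (k', g)"
    "k \<in> Obj I1" "k' \<in> Obj I1" "f \<in> Arr (T k)" "g \<in> Arr (T k')"
    "Dom (T k) f = (d, x)" "Cod (T k) f = (e, y)" "Dom (T k') g = (e', y)" "Cod (T k') g = (h, z)"
    "u \<in> Arr I1" "Dom I1 u = k" "v \<in> Arr I1" "Dom I1 v = k'" "Cod I1 v = Cod I1 u"
    "is_iso I2 \<epsilon>" "Dom I2 \<epsilon> = u \<circ>\<^bsub>I\<^esub> e" "Cod I2 \<epsilon> = v \<circ>\<^bsub>I\<^esub> e'"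
    "\<tau> = (Cod I1 u, push v g \<cdot>\<^bsub>T (Cod I1 u)\<^esub> (K \<epsilon> y \<cdot>\<^bsub>T (Cod I1 u)\<^esub> push u f))"
    unfolding germ_comp_def by blast
  note ends = T_ends[OF *(5,7,8)] T_ends[OF *(6,9,10)]
  have arr: "\<epsilon> \<in> Arr I2" using * by auto
  have "Dom I1 e' = Dom I1 e"
    using Dom_Cod_2cell(1)[OF two_category_I arr] * ends by auto
  with * ends arr show ?thesis by (intro that[of k f k' g d x e y e' h z u v \<epsilon>]) simp_all
qed

lemma germ_comp_exists:
  assumes f: "f \<in> Arr (T k)" "Dom (T k) f = (d, x)" "Cod (T k) f = (e, y)"
    and g: "g \<in> Arr (T k')" "Dom (T k') g = (e', y)" "Cod (T k') g = (h, z)"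
    and e: "Dom I1 e' = Dom I1 e"
  shows "\<exists>\<tau>. germ_comp (k, f) (k', g) \<tau>"
proof -
  note ends = T_ends[OF f] T_ends[OF g]
  obtain u v \<epsilon> where "u \<in> Arr I1" "Dom I1 u = Cod I1 e" "v \<in> Arr I1" "Dom I1 v = Cod I1 e'" "Cod I1 v = Cod I1 u"
    "is_iso I2 \<epsilon>" "Dom I2 \<epsilon> = u \<circ>\<^bsub>I\<^esub> e" "Cod I2 \<epsilon> = v \<circ>\<^bsub>I\<^esub> e'"
    by (rule iso_squareE[of e e']) (use ends e in auto)
  then have "germ_comp (k, f) (k', g) (Cod I1 u, push v g \<cdot>\<^bsub>T (Cod I1 u)\<^esub> (K \<epsilon> y \<cdot>\<^bsub>T (Cod I1 u)\<^esub> push u f))"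
    by (intro germ_compI[OF f g]) (use ends in auto)
  then show ?thesis by (rule exI)
qed

text \<open>The two composites are formed over two fillings of the same span, so
  \<open>iso_squares_mergeE\<close> brings them to one stage. There the coherence equation handles
  the middle object, and naturality of \<open>K\<close> handles the two arrows.\<close>

lemma germ_comp_unique:
  assumes "germ_comp \<rho> \<rho>' \<tau>" "germ_comp \<rho> \<rho>' \<tau>'"
  shows "\<tau> \<simeq> \<tau>'"
  using assms(1)
proof (cases rule: germ_compE)
  case (1 k f k' g d x e y e' h z u v \<epsilon>)
  note a [simp] = 1(1-31) and \<tau> = 1(32)
  show ?thesis using assms(2)
  proof (cases rule: germ_compE)
    case (1 k1 f1 k1' g1 d1 x1 e1 y1 e1' h1 z1 u' v' \<epsilon>')
    note b = 1(1,2,7-10,23-31) and \<tau>' = 1(32)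
    have same: "k1 = k" "f1 = f" "k1' = k'" "g1 = g" "d1 = d" "x1 = x" "e1 = e" "y1 = y" "e1' = e'" "h1 = h" "z1 = z"
      using b(1-6) a by auto
    note [simp] = b(7-)[unfolded same]
    note \<tau>' = \<tau>'[unfolded same]
    obtain s t \<sigma> \<tau>2 where [simp]: "s \<in> Arr I1" "Dom I1 s = Cod I1 u" "t \<in> Arr I1"
      "Dom I1 t = Cod I1 u'" "Cod I1 t = Cod I1 s"
      "is_iso I2 \<sigma>" "Dom I2 \<sigma> = s \<circ>\<^bsub>I\<^esub> u" "Cod I2 \<sigma> = t \<circ>\<^bsub>I\<^esub> u'"
      "is_iso I2 \<tau>2" "Dom I2 \<tau>2 = s \<circ>\<^bsub>I\<^esub> v" "Cod I2 \<tau>2 = t \<circ>\<^bsub>I\<^esub> v'"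
      and coh: "(\<tau>2 \<lhd>\<^bsub>I\<^esub> e') \<bullet>\<^bsub>I\<^esub> (s \<rhd>\<^bsub>I\<^esub> \<epsilon>) = (t \<rhd>\<^bsub>I\<^esub> \<epsilon>') \<bullet>\<^bsub>I\<^esub> (\<sigma> \<lhd>\<^bsub>I\<^esub> e)"
      by (rule iso_squares_mergeE[of e e' u v u' v' \<epsilon> \<epsilon>']) auto
    have [simp]: "\<sigma> \<in> Arr I2" "\<tau>2 \<in> Arr I2" by (auto intro: is_iso_Arr)
    let ?T = "T (Cod I1 s)"
    have 1: "K (\<tau>2 \<lhd>\<^bsub>I\<^esub> h) z \<cdot>\<^bsub>?T\<^esub> push (s \<circ>\<^bsub>I\<^esub> v) g = push (t \<circ>\<^bsub>I\<^esub> v') g \<cdot>\<^bsub>?T\<^esub> K (\<tau>2 \<lhd>\<^bsub>I\<^esub> e') y"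
      by (rule K_square[of _ _ _ _ k']) auto
    have 2: "K (\<sigma> \<lhd>\<^bsub>I\<^esub> e) y \<cdot>\<^bsub>?T\<^esub> push (s \<circ>\<^bsub>I\<^esub> u) f = push (t \<circ>\<^bsub>I\<^esub> u') f \<cdot>\<^bsub>?T\<^esub> K (\<sigma> \<lhd>\<^bsub>I\<^esub> d) x"
      by (rule K_square[of _ _ _ _ k]) auto
    have 3: "K (\<tau>2 \<lhd>\<^bsub>I\<^esub> e') y \<cdot>\<^bsub>?T\<^esub> K (s \<rhd>\<^bsub>I\<^esub> \<epsilon>) y = K (t \<rhd>\<^bsub>I\<^esub> \<epsilon>') y \<cdot>\<^bsub>?T\<^esub> K (\<sigma> \<lhd>\<^bsub>I\<^esub> e) y"
      using arg_cong[OF coh, of "\<lambda>\<alpha>. K \<alpha> y"] by (simp add: K_vcomp[of _ _ "Cod I1 s"])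
    let ?c = "push v g \<cdot>\<^bsub>T (Cod I1 u)\<^esub> (K \<epsilon> y \<cdot>\<^bsub>T (Cod I1 u)\<^esub> push u f)"
    let ?c' = "push v' g \<cdot>\<^bsub>T (Cod I1 u')\<^esub> (K \<epsilon>' y \<cdot>\<^bsub>T (Cod I1 u')\<^esub> push u' f)"
    have "K (\<tau>2 \<lhd>\<^bsub>I\<^esub> h) z \<cdot>\<^bsub>?T\<^esub> push s ?c
      = K (\<tau>2 \<lhd>\<^bsub>I\<^esub> h) z \<cdot>\<^bsub>?T\<^esub> (push (s \<circ>\<^bsub>I\<^esub> v) g \<cdot>\<^bsub>?T\<^esub> (K (s \<rhd>\<^bsub>I\<^esub> \<epsilon>) y \<cdot>\<^bsub>?T\<^esub> push (s \<circ>\<^bsub>I\<^esub> u) f))" by simp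
    also have "\<dots> = push (t \<circ>\<^bsub>I\<^esub> v') g \<cdot>\<^bsub>?T\<^esub> (K (\<tau>2 \<lhd>\<^bsub>I\<^esub> e') y \<cdot>\<^bsub>?T\<^esub> (K (s \<rhd>\<^bsub>I\<^esub> \<epsilon>) y \<cdot>\<^bsub>?T\<^esub> push (s \<circ>\<^bsub>I\<^esub> u) f))"
      by (rule Comp_square[OF _ 1]) auto
    also have "\<dots> = push (t \<circ>\<^bsub>I\<^esub> v') g \<cdot>\<^bsub>?T\<^esub> (K (t \<rhd>\<^bsub>I\<^esub> \<epsilon>') y \<cdot>\<^bsub>?T\<^esub> (K (\<sigma> \<lhd>\<^bsub>I\<^esub> e) y \<cdot>\<^bsub>?T\<^esub> push (s \<circ>\<^bsub>I\<^esub> u) f))"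
      by (subst Comp_square[OF _ 3]) auto
    also have "\<dots> = push t ?c' \<cdot>\<^bsub>?T\<^esub> K (\<sigma> \<lhd>\<^bsub>I\<^esub> d) x"
      unfolding 2 by simp
    finally show ?thesis
      unfolding \<tau> \<tau>'
      by (intro germ_eqI[of ?c _ "u \<circ>\<^bsub>I\<^esub> d" x "v \<circ>\<^bsub>I\<^esub> h" z ?c' _ "u' \<circ>\<^bsub>I\<^esub> d" "v' \<circ>\<^bsub>I\<^esub> h" s t "\<sigma> \<lhd>\<^bsub>I\<^esub> d" "\<tau>2 \<lhd>\<^bsub>I\<^esub> h"]) auto
  qed
qed

end

section \<open>Laws of the composition of germs\<close>

context cat_diagram
begin

text \<open>By uniqueness of composites, one well-chosen pair suffices: both are formed beyond the
  stage at which \<open>f\<close> and \<open>f'\<close> were compared.\<close>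

lemma germ_comp_cong_left:
  assumes \<rho>: "\<rho> \<simeq> \<rho>'" and \<tau>: "germ_comp \<rho> \<pi> \<tau>" and \<tau>': "germ_comp \<rho>' \<pi> \<tau>'"
  shows "\<tau> \<simeq> \<tau>'"
  using \<rho>
proof (cases rule: germ_eqE)
  case (1 k f k' f' d x e y d' e' p r \<beta> \<gamma>)
  note a [simp] = 1(1-35) and eq = 1(36)
  show ?thesis using \<tau>'
  proof (cases rule: germ_compE)
    case (1 k1 f1 l g d1 x1 e1 y1 eg h z)
    note b = 1(1-22)
    have same: "k1 = k'" "f1 = f'" "d1 = d'" "x1 = x" "e1 = e'" "y1 = y" using b(1,7,8) a by auto
    note [simp] = b(2-)[unfolded same]
    \<comment> \<open>A square is chosen for \<open>f'\<close> only; \<open>f\<close> is composed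
      with the same square after \<open>\<gamma>\<close> has matched the targets. The two composites
      then differ only by \<open>K\<close> of the whiskered \<open>\<beta>\<close> at the
      source.\<close>
    obtain u v \<epsilon> where [simp]: "u \<in> Arr I1" "Dom I1 u = Cod I1 p" "v \<in> Arr I1" "Dom I1 v = l" "Cod I1 v = Cod I1 u"
      "is_iso I2 \<epsilon>" "Dom I2 \<epsilon> = u \<circ>\<^bsub>I\<^esub> (r \<circ>\<^bsub>I\<^esub> e')" "Cod I2 \<epsilon> = v \<circ>\<^bsub>I\<^esub> eg"
      by (rule iso_squareE[of "r \<circ>\<^bsub>I\<^esub> e'" eg]) auto
    have [simp]: "\<epsilon> \<in> Arr I2" by (rule is_iso_Arr) simp
    let ?T = "T (Cod I1 u)"
    let ?c = "push v g \<cdot>\<^bsub>?T\<^esub> (K (\<epsilon> \<bullet>\<^bsub>I\<^esub> (u \<rhd>\<^bsub>I\<^esub> \<gamma>)) y \<cdot>\<^bsub>?T\<^esub> push (u \<circ>\<^bsub>I\<^esub> p) f)"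
    let ?c' = "push v g \<cdot>\<^bsub>?T\<^esub> (K \<epsilon> y \<cdot>\<^bsub>?T\<^esub> push (u \<circ>\<^bsub>I\<^esub> r) f')"
    have c: "germ_comp \<rho> \<pi> (Cod I1 u, ?c)"
      unfolding a(1) b(2) by (rule germ_compI[of f k d x e y g l eg h z]) auto
    have c': "germ_comp \<rho>' \<pi> (Cod I1 u, ?c')"
      unfolding a(2) b(2) by (rule germ_compI[of f' k' d' x e' y g l eg h z]) auto
    have 1: "K (u \<rhd>\<^bsub>I\<^esub> \<gamma>) y \<cdot>\<^bsub>?T\<^esub> push (u \<circ>\<^bsub>I\<^esub> p) f = push (u \<circ>\<^bsub>I\<^esub> r) f' \<cdot>\<^bsub>?T\<^esub> K (u \<rhd>\<^bsub>I\<^esub> \<beta>) x"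
      using arg_cong[OF eq, of "push u"] by simp
    have "?c = push v g \<cdot>\<^bsub>?T\<^esub> (K \<epsilon> y \<cdot>\<^bsub>?T\<^esub> (K (u \<rhd>\<^bsub>I\<^esub> \<gamma>) y \<cdot>\<^bsub>?T\<^esub> push (u \<circ>\<^bsub>I\<^esub> p) f))"
      by (simp add: K_vcomp[of _ _ "Cod I1 u"])
    also have "\<dots> = ?c' \<cdot>\<^bsub>?T\<^esub> K (u \<rhd>\<^bsub>I\<^esub> \<beta>) x" unfolding 1 by simp
    finally have *: "?c = ?c' \<cdot>\<^bsub>?T\<^esub> K (u \<rhd>\<^bsub>I\<^esub> \<beta>) x" .
    have "(Cod I1 u, ?c) \<simeq> (Cod I1 u, ?c')"
    proof (rule germ_conj[of _ _ "u \<circ>\<^bsub>I\<^esub> (p \<circ>\<^bsub>I\<^esub> d)" x "v \<circ>\<^bsub>I\<^esub> h" z _ "u \<circ>\<^bsub>I\<^esub> (r \<circ>\<^bsub>I\<^esub> d')" _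
          "u \<rhd>\<^bsub>I\<^esub> \<beta>" "Id I2 (v \<circ>\<^bsub>I\<^esub> h)"])
      show "K (Id I2 (v \<circ>\<^bsub>I\<^esub> h)) z \<cdot>\<^bsub>?T\<^esub> ?c = ?c' \<cdot>\<^bsub>?T\<^esub> K (u \<rhd>\<^bsub>I\<^esub> \<beta>) x"
        unfolding * by simp
    qed auto
    with germ_comp_unique[OF \<tau> c] germ_comp_unique[OF c' \<tau>'] show ?thesis
      using germ_trans by blast
  qed
qed

text \<open>Mirror image of \<open>germ_comp_cong_left\<close>: here \<open>\<beta>\<close> is
  absorbed into the matching of the middle object, and the composites differ by
  \<open>\<gamma>\<close> at the target.\<close>

lemma germ_comp_cong_right:
  assumes \<rho>: "\<rho> \<simeq> \<rho>'" and \<tau>: "germ_comp \<pi> \<rho> \<tau>" and \<tau>': "germ_comp \<pi> \<rho>' \<tau>'"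
  shows "\<tau> \<simeq> \<tau>'"
  using \<rho>
proof (cases rule: germ_eqE)
  case (1 k g k' g' d y e z d' e' p r \<beta> \<gamma>)
  note a [simp] = 1(1-35) and eq = 1(36)
  show ?thesis using \<tau>
  proof (cases rule: germ_compE)
    case (1 l f k1 g1 df x ef y1 d1 e1 z1)
    note b = 1(1-22)
    have same: "k1 = k" "g1 = g" "d1 = d" "y1 = y" "e1 = e" "z1 = z" using b(2,9,10) a by auto
    have b1: "\<pi> = (l, f)" by (rule b(1))
    note [simp] = b(3-)[unfolded same]
    obtain u v \<epsilon> where [simp]: "u \<in> Arr I1" "Dom I1 u = l" "v \<in> Arr I1" "Dom I1 v = Cod I1 p" "Cod I1 v = Cod I1 u"
      "is_iso I2 \<epsilon>" "Dom I2 \<epsilon> = u \<circ>\<^bsub>I\<^esub> ef" "Cod I2 \<epsilon> = v \<circ>\<^bsub>I\<^esub> (p \<circ>\<^bsub>I\<^esub> d)"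
      by (rule iso_squareE[of ef "p \<circ>\<^bsub>I\<^esub> d"]) auto
    have [simp]: "\<epsilon> \<in> Arr I2" by (rule is_iso_Arr) simp
    let ?T = "T (Cod I1 u)"
    let ?c = "push (v \<circ>\<^bsub>I\<^esub> p) g \<cdot>\<^bsub>?T\<^esub> (K \<epsilon> y \<cdot>\<^bsub>?T\<^esub> push u f)"
    let ?c' = "push (v \<circ>\<^bsub>I\<^esub> r) g' \<cdot>\<^bsub>?T\<^esub> (K ((v \<rhd>\<^bsub>I\<^esub> \<beta>) \<bullet>\<^bsub>I\<^esub> \<epsilon>) y \<cdot>\<^bsub>?T\<^esub> push u f)"
    have c: "germ_comp \<pi> \<rho> (Cod I1 u, ?c)"
      unfolding a(1) b1 by (rule germ_compI[of f l df x ef y g k d e z]) auto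
    have c': "germ_comp \<pi> \<rho>' (Cod I1 u, ?c')"
      unfolding a(2) b1 by (rule germ_compI[of f l df x ef y g' k' d' e' z]) auto
    have 1: "K (v \<rhd>\<^bsub>I\<^esub> \<gamma>) z \<cdot>\<^bsub>?T\<^esub> push (v \<circ>\<^bsub>I\<^esub> p) g = push (v \<circ>\<^bsub>I\<^esub> r) g' \<cdot>\<^bsub>?T\<^esub> K (v \<rhd>\<^bsub>I\<^esub> \<beta>) y"
      using arg_cong[OF eq, of "push v"] by simp
    have "K (v \<rhd>\<^bsub>I\<^esub> \<gamma>) z \<cdot>\<^bsub>?T\<^esub> ?c = push (v \<circ>\<^bsub>I\<^esub> r) g' \<cdot>\<^bsub>?T\<^esub> (K (v \<rhd>\<^bsub>I\<^esub> \<beta>) y \<cdot>\<^bsub>?T\<^esub> (K \<epsilon> y \<cdot>\<^bsub>?T\<^esub> push u f))"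
      by (rule Comp_square[OF _ 1]) auto
    also have "\<dots> = ?c'" by (simp add: K_vcomp[of _ _ "Cod I1 u"])
    finally have *: "K (v \<rhd>\<^bsub>I\<^esub> \<gamma>) z \<cdot>\<^bsub>?T\<^esub> ?c = ?c'" .
    have "(Cod I1 u, ?c) \<simeq> (Cod I1 u, ?c')"
    proof (rule germ_conj[of _ _ "u \<circ>\<^bsub>I\<^esub> df" x "v \<circ>\<^bsub>I\<^esub> (p \<circ>\<^bsub>I\<^esub> e)" z _ _ "v \<circ>\<^bsub>I\<^esub> (r \<circ>\<^bsub>I\<^esub> e')"
          "Id I2 (u \<circ>\<^bsub>I\<^esub> df)" "v \<rhd>\<^bsub>I\<^esub> \<gamma>"])
      show "K (v \<rhd>\<^bsub>I\<^esub> \<gamma>) z \<cdot>\<^bsub>?T\<^esub> ?c = ?c' \<cdot>\<^bsub>?T\<^esub> K (Id I2 (u \<circ>\<^bsub>I\<^esub> df)) x"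
        unfolding * by simp
    qed auto
    with germ_comp_unique[OF \<tau> c] germ_comp_unique[OF c' \<tau>'] show ?thesis
      using germ_trans by blast
  qed
qed

text \<open>With the squares chosen one after the other, both bracketings yield literally the same
  representative \<open>\<omega>\<close> at the last stage. Uniqueness of composites then covers all
  other choices.\<close>

lemma germ_comp_assoc:
  assumes f: "f \<in> Arr (T k)" "Dom (T k) f = (d1, x1)" "Cod (T k) f = (d2, x2)"
    and g: "g \<in> Arr (T k')" "Dom (T k') g = (e2, x2)" "Cod (T k') g = (e3, x3)" "Dom I1 e2 = Dom I1 d2"
    and h: "h \<in> Arr (T k'')" "Dom (T k'') h = (h3, x3)" "Cod (T k'') h = (h4, x4)" "Dom I1 h3 = Dom I1 e3"
  shows "\<exists>\<tau> \<chi> \<omega>. germ_comp (k, f) (k', g) \<tau> \<and> germ_comp \<tau> (k'', h) \<omega> \<and> germ_comp (k', g) (k'', h) \<chi> \<and>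
    germ_comp (k, f) \<chi> \<omega>"
proof -
  note [simp] = T_ends[OF f] T_ends[OF g(1-3)] T_ends[OF h(1-3)] f g h
  obtain u v \<epsilon> where [simp]: "u \<in> Arr I1" "Dom I1 u = k" "v \<in> Arr I1" "Dom I1 v = k'" "Cod I1 v = Cod I1 u"
      "is_iso I2 \<epsilon>" "Dom I2 \<epsilon> = u \<circ>\<^bsub>I\<^esub> d2" "Cod I2 \<epsilon> = v \<circ>\<^bsub>I\<^esub> e2"
    by (rule iso_squareE[of d2 e2]) auto
  obtain u' v' \<epsilon>' where [simp]: "u' \<in> Arr I1" "Dom I1 u' = Cod I1 u" "v' \<in> Arr I1" "Dom I1 v' = k''" "Cod I1 v' = Cod I1 u'"
      "is_iso I2 \<epsilon>'" "Dom I2 \<epsilon>' = u' \<circ>\<^bsub>I\<^esub> (v \<circ>\<^bsub>I\<^esub> e3)" "Cod I2 \<epsilon>' = v' \<circ>\<^bsub>I\<^esub> h3"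
    by (rule iso_squareE[of "v \<circ>\<^bsub>I\<^esub> e3" h3]) auto
  have [simp]: "\<epsilon> \<in> Arr I2" "\<epsilon>' \<in> Arr I2" by (auto intro: is_iso_Arr)
  let ?T = "T (Cod I1 u)" and ?T' = "T (Cod I1 u')"
  let ?gf = "push v g \<cdot>\<^bsub>?T\<^esub> (K \<epsilon> x2 \<cdot>\<^bsub>?T\<^esub> push u f)"
  let ?hg = "push v' h \<cdot>\<^bsub>?T'\<^esub> (K \<epsilon>' x3 \<cdot>\<^bsub>?T'\<^esub> push (u' \<circ>\<^bsub>I\<^esub> v) g)"
  let ?hgf = "push v' h \<cdot>\<^bsub>?T'\<^esub> (K \<epsilon>' x3 \<cdot>\<^bsub>?T'\<^esub> push u' ?gf)"
  have gf: "germ_comp (k, f) (k', g) (Cod I1 u, ?gf)"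
    by (rule germ_compI[of f k d1 x1 d2 x2 g k' e2 e3 x3 u v \<epsilon>]) auto
  have h_gf: "germ_comp (Cod I1 u, ?gf) (k'', h) (Cod I1 u', ?hgf)"
    by (rule germ_compI[of ?gf _ "u \<circ>\<^bsub>I\<^esub> d1" x1 "v \<circ>\<^bsub>I\<^esub> e3" x3 h k'' h3 h4 x4 u' v' \<epsilon>']) auto
  have hg: "germ_comp (k', g) (k'', h) (Cod I1 u', ?hg)"
    by (rule germ_compI[of g k' e2 x2 e3 x3 h k'' h3 h4 x4 "u' \<circ>\<^bsub>I\<^esub> v" v' \<epsilon>']) auto
  have hg_f: "germ_comp (k, f) (Cod I1 u', ?hg) (Cod I1 u', ?hgf)"
    by (rule germ_compI[of f k d1 x1 d2 x2 ?hg "Cod I1 u'" "u' \<circ>\<^bsub>I\<^esub> (v \<circ>\<^bsub>I\<^esub> e2)" "v' \<circ>\<^bsub>I\<^esub> h4" x4 "u' \<circ>\<^bsub>I\<^esub> u" "Id I1 (Cod I1 u')" "u' \<rhd>\<^bsub>I\<^esub> \<epsilon>"])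
      auto
  from gf h_gf hg hg_f show ?thesis by blast
qed

text \<open>The identity of \<open>x\<close> is represented at the stage of \<open>x\<close> itself,
  and \<open>d\<close> carries it to the stage of \<open>f\<close>, where the middle objects
  coincide and no 2-cell is needed.\<close>

lemma germ_comp_Id_right:
  assumes f: "f \<in> Arr (T k)" "Dom (T k) f = (d, x)" "Cod (T k) f = (e, y)"
  shows "germ_comp (Dom I1 d, Id (T (Dom I1 d)) (Id I1 (Dom I1 d), x)) (k, f) (k, f)"
proof -
  note [simp] = T_ends[OF f] f
  show ?thesis
    by (rule germ_compI[of _ _ "Id I1 (Dom I1 d)" x "Id I1 (Dom I1 d)" x f k d e y d "Id I1 k" "Id I2 d"]) auto
qed

lemma germ_comp_Id_left:
  assumes f: "f \<in> Arr (T k)" "Dom (T k) f = (d, x)" "Cod (T k) f = (e, y)"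
  shows "germ_comp (k, f) (Dom I1 e, Id (T (Dom I1 e)) (Id I1 (Dom I1 e), y)) (k, f)"
proof -
  note [simp] = T_ends[OF f] f
  show ?thesis
    by (rule germ_compI[of f k d x e y _ "Dom I1 e" "Id I1 (Dom I1 e)" "Id I1 (Dom I1 e)" y "Id I1 k" e "Id I2 e"]) auto
qed

lemma germ_comp_stage:
  assumes f: "f \<in> Arr (T k)" and g: "g \<in> Arr (T k)" and "Cod (T k) f = Dom (T k) g"
  shows "germ_comp (k, f) (k, g) (k, g \<cdot>\<^bsub>T k\<^esub> f)"
proof -
  obtain d x e y h z where *: "Dom (T k) f = (d, x)" "Cod (T k) f = (e, y)" "Dom (T k) g = (e, y)" "Cod (T k) g = (h, z)"
    using assms(3) by (metis surj_pair)
  note [simp] = T_ends[OF f *(1,2)] T_ends[OF g *(3,4)] f g *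
  show ?thesis
    by (rule germ_compI[of f k d x e y g k e h z "Id I1 k" "Id I1 k" "Id I2 e"]) auto
qed

text \<open>The object of the bicolimit that a formal pair presents: pushing changes the transition
  1-cell but neither its source nor \<open>x\<close>.\<close>

definition base :: "'d \<times> 'u \<Rightarrow> 'i \<times> 'u" where
  "base X = (Dom I1 (fst X), snd X)"

lemma base_simps [simp]: "base (d, x) = (Dom I1 d, x)"
  "u \<in> Arr I1 \<Longrightarrow> X \<in> Obj (T (Dom I1 u)) \<Longrightarrow> base (push_obj u X) = base X"
  by (auto simp: base_def Obj_T)

definition bobj :: "('i \<times> 'u) set" where
  "bobj = {(i, x). i \<in> Obj I1 \<and> x \<in> Obj (C i)}"

definition reps :: "('i \<times> ('d \<times> 'u) \<times> ('d \<times> 'u) \<times> 'u) set" where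
  "reps = {(k, f). k \<in> Obj I1 \<and> f \<in> Arr (T k)}"

end

text \<open>The objects and arrows of the bicolimit are encoded in the universe by injections \<open>eo\<close> and
  \<open>enc\<close>; an arrow is the code of a representative of its germ.\<close>

locale germ_model = cat_diagram I F
  for I :: "('i, 'd, 'e) twocat"
    and F :: "('i, 'd, 'e, ('u, 'u) cat, ('u, 'u, 'u, 'u) func, ('u, 'u, 'u, 'u) nt) psfun" +
  fixes eo :: "'i \<times> 'u \<Rightarrow> 'u" and enc :: "'i \<times> ('d \<times> 'u) \<times> ('d \<times> 'u) \<times> 'u \<Rightarrow> 'u"
  assumes eo_inj: "inj_on eo bobj" and enc_inj: "inj_on enc reps"
    and bobj_small: "small TYPE('u) bobj" and reps_small: "small TYPE('u) reps"
begin

definition rep :: "'i \<times> ('d \<times> 'u) \<times> ('d \<times> 'u) \<times> 'u \<Rightarrow> 'i \<times> ('d \<times> 'u) \<times> ('d \<times> 'u) \<times> 'u" where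
  "rep \<rho> = (SOME \<rho>'. \<rho>' \<simeq> \<rho>)"

definition germ :: "'i \<Rightarrow> ('d \<times> 'u) \<times> ('d \<times> 'u) \<times> 'u \<Rightarrow> 'u" where
  "germ k f = enc (rep (k, f))"

definition germ_obj :: "'i \<Rightarrow> 'u \<Rightarrow> 'u" where
  "germ_obj i x = eo (i, x)"

definition dec :: "'u \<Rightarrow> 'i \<times> ('d \<times> 'u) \<times> ('d \<times> 'u) \<times> 'u" where
  "dec = inv_into reps enc"

definition germ_cat :: "('u, 'u) cat" where
  "germ_cat = \<lparr>Obj = eo ` bobj, Arr = enc ` rep ` reps,
     Dom = (\<lambda>\<alpha>. eo (base (Dom (T (fst (dec \<alpha>))) (snd (dec \<alpha>))))),
     Cod = (\<lambda>\<alpha>. eo (base (Cod (T (fst (dec \<alpha>))) (snd (dec \<alpha>))))),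
     Id = (\<lambda>X. let (i, x) = inv_into bobj eo X in germ i (Id (T i) (Id I1 i, x))),
     Comp = (\<lambda>\<beta> \<alpha>. enc (rep (SOME \<tau>. germ_comp (dec \<alpha>) (dec \<beta>) \<tau>)))\<rparr>"

lemma repsI [simp]: "k \<in> Obj I1 \<Longrightarrow> f \<in> Arr (T k) \<Longrightarrow> (k, f) \<in> reps"
  by (simp add: reps_def)

lemma rep_eq: "\<rho> \<in> reps \<Longrightarrow> rep \<rho> \<simeq> \<rho>"
  unfolding rep_def by (rule someI[of _ \<rho>]) (auto simp: reps_def intro: germ_refl)

lemma germ_eq_reps: "\<rho> \<simeq> \<rho>' \<Longrightarrow> \<rho> \<in> reps \<and> \<rho>' \<in> reps"
  by (auto elim!: germ_eqE)

lemma rep_reps [simp]: "\<rho> \<in> reps \<Longrightarrow> rep \<rho> \<in> reps"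
  using germ_eq_reps rep_eq by blast

text \<open>Equivalent germs give the same predicate to the choice operator, so the chosen
  representatives are equal and not merely equivalent.\<close>

lemma rep_cong: "\<rho> \<simeq> \<rho>' \<Longrightarrow> rep \<rho> = rep \<rho>'"
proof -
  assume *: "\<rho> \<simeq> \<rho>'"
  have "(\<lambda>\<tau>. \<tau> \<simeq> \<rho>) = (\<lambda>\<tau>. \<tau> \<simeq> \<rho>')"
    using germ_trans[OF _ *] germ_trans[OF _ germ_sym[OF *]] by auto
  then show ?thesis by (simp add: rep_def)
qed

lemma germ_eq_iff:
  assumes "k \<in> Obj I1" "f \<in> Arr (T k)" "k' \<in> Obj I1" "f' \<in> Arr (T k')"
  shows "germ k f = germ k' f' \<longleftrightarrow> (k, f) \<simeq> (k', f')"
proof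
  assume "germ k f = germ k' f'"
  then have "rep (k, f) = rep (k', f')"
    unfolding germ_def using enc_inj assms by (auto dest: inj_onD)
  then show "(k, f) \<simeq> (k', f')"
    using rep_eq[of "(k, f)"] rep_eq[of "(k', f')"] assms germ_sym germ_trans repsI by metis
qed (simp add: germ_def rep_cong)

lemma dec_enc [simp]: "\<rho> \<in> reps \<Longrightarrow> dec (enc \<rho>) = \<rho>"
  using enc_inj by (simp add: dec_def)

lemma germ_eq_base:
  assumes "\<rho> \<simeq> \<rho>'"
  shows "base (Dom (T (fst \<rho>)) (snd \<rho>)) = base (Dom (T (fst \<rho>')) (snd \<rho>'))"
    "base (Cod (T (fst \<rho>)) (snd \<rho>)) = base (Cod (T (fst \<rho>')) (snd \<rho>'))"
  using assms by (auto elim!: germ_eqE)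

lemma germ_cat_obj [simp]:
  "i \<in> Obj I1 \<Longrightarrow> x \<in> Obj (C i) \<Longrightarrow> germ_obj i x \<in> Obj germ_cat"
  by (auto simp: germ_cat_def germ_obj_def bobj_def)

lemma germ_cat_objE:
  assumes "X \<in> Obj germ_cat"
  obtains i x where "i \<in> Obj I1" "x \<in> Obj (C i)" "X = germ_obj i x"
  using assms by (auto simp: germ_cat_def germ_obj_def bobj_def)

lemma germ_obj_eq_iff:
  "\<lbrakk>i \<in> Obj I1; x \<in> Obj (C i); i' \<in> Obj I1; x' \<in> Obj (C i')\<rbrakk> \<Longrightarrow>
    germ_obj i x = germ_obj i' x' \<longleftrightarrow> i = i' \<and> x = x'"
  using inj_onD[OF eo_inj, of "(i, x)" "(i', x')"] by (auto simp: germ_obj_def bobj_def)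

lemma germ_hom [simp]:
  assumes "k \<in> Obj I1" "f \<in> Arr (T k)"
  shows "germ k f \<in> Arr germ_cat"
    "Dom germ_cat (germ k f) = germ_obj (Dom I1 (fst (Dom (T k) f))) (snd (Dom (T k) f))"
    "Cod germ_cat (germ k f) = germ_obj (Dom I1 (fst (Cod (T k) f))) (snd (Cod (T k) f))"
  using germ_eq_base[OF rep_eq[of "(k, f)"]] assms
  by (auto simp: germ_cat_def germ_def germ_obj_def base_def)

lemma germ_cat_arrE:
  assumes "\<alpha> \<in> Arr germ_cat"
  obtains k f where "k \<in> Obj I1" "f \<in> Arr (T k)" "\<alpha> = germ k f"
  using assms by (auto simp: germ_cat_def germ_def reps_def)

text \<open>Composition in \<open>germ_cat\<close> works with the chosen representatives. They are
  exchanged for the given ones one factor at a time, through the mixed composite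
  \<open>\<tau>'\<close>.\<close>

lemma germ_Comp:
  assumes "germ_comp (k, f) (k', g) (m, c)" "k \<in> Obj I1" "f \<in> Arr (T k)" "k' \<in> Obj I1" "g \<in> Arr (T k')"
  shows "germ k' g \<cdot>\<^bsub>germ_cat\<^esub> germ k f = germ m c"
proof -
  let ?\<rho> = "rep (k, f)" and ?\<rho>' = "rep (k', g)"
  have 1: "?\<rho> \<simeq> (k, f)" and 2: "?\<rho>' \<simeq> (k', g)" using assms by (auto intro: rep_eq)
  \<comment> \<open>Equivalent germs present the same end objects, so the chosen representatives are
    composable whenever the given ones are.\<close>
  have "\<exists>\<tau>. germ_comp ?\<rho> ?\<rho>' \<tau>"
    using 1
  proof (cases rule: germ_eqE)
    case (1 k1 f1 k2 f2 d x e y d' e')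
    note a = this(1-22)
    show ?thesis using 2
    proof (cases rule: germ_eqE)
      case (1 k1' g1 k2' g2 h z l w h' l')
      note b = this(1-22)
      show ?thesis using assms(1)
        by (cases rule: germ_compE)
          (use a b germ_comp_exists[of f1 k1 d x e y g1 k1' h l w] in auto)
    qed
  qed
  then have *: "germ_comp ?\<rho> ?\<rho>' (SOME \<tau>. germ_comp ?\<rho> ?\<rho>' \<tau>)" (is "germ_comp _ _ ?\<tau>") by (rule someI_ex)
  have "\<exists>\<tau>. germ_comp (k, f) ?\<rho>' \<tau>"
    using 2
  proof (cases rule: germ_eqE)
    case (1 k1' g1 k2' g2 h z l w h' l')
    note b = this(1-22)
    show ?thesis using assms(1)
      by (cases rule: germ_compE) (use b germ_comp_exists[of f k _ _ _ _ g1 k1' h l w] in auto)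
  qed
  then obtain \<tau>' where \<tau>': "germ_comp (k, f) ?\<rho>' \<tau>'" ..
  have "?\<tau> \<simeq> \<tau>'" by (rule germ_comp_cong_left[OF 1 * \<tau>'])
  also have "\<tau>' \<simeq> (m, c)" by (rule germ_comp_cong_right[OF 2 \<tau>' assms(1)])
  finally (germ_trans) have "rep ?\<tau> = rep (m, c)" by (rule rep_cong)
  then show ?thesis using assms(2-) by (simp add: germ_cat_def germ_def)
qed

lemma germ_Id [simp]:
  "i \<in> Obj I1 \<Longrightarrow> x \<in> Obj (C i) \<Longrightarrow> Id germ_cat (germ_obj i x) = germ i (Id (T i) (Id I1 i, x))"
  using eo_inj by (simp add: germ_cat_def germ_obj_def bobj_def)

lemma category_germ_cat [simp]: "category germ_cat"
proof (rule categoryI)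
  fix \<alpha> assume "\<alpha> \<in> Arr germ_cat"
  then obtain k f where k: "k \<in> Obj I1" and f: "f \<in> Arr (T k)" and \<alpha>: "\<alpha> = germ k f" by (rule germ_cat_arrE)
  obtain d x e y where de: "Dom (T k) f = (d, x)" "Cod (T k) f = (e, y)" by (metis surj_pair)
  note [simp] = T_ends[OF f de] f de k \<alpha>
  show "Dom germ_cat \<alpha> \<in> Obj germ_cat" "Cod germ_cat \<alpha> \<in> Obj germ_cat" by simp_all
  show "\<alpha> \<cdot>\<^bsub>germ_cat\<^esub> Id germ_cat (Dom germ_cat \<alpha>) = \<alpha>"
    using germ_Comp[OF germ_comp_Id_right[OF f de]] by simp
  show "Id germ_cat (Cod germ_cat \<alpha>) \<cdot>\<^bsub>germ_cat\<^esub> \<alpha> = \<alpha>"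
    using germ_Comp[OF germ_comp_Id_left[OF f de]] by simp
next
  fix X assume "X \<in> Obj germ_cat"
  then obtain i x where "i \<in> Obj I1" "x \<in> Obj (C i)" "X = germ_obj i x" by (rule germ_cat_objE)
  then show "Id germ_cat X \<in> Arr germ_cat \<and> Dom germ_cat (Id germ_cat X) = X \<and> Cod germ_cat (Id germ_cat X) = X" by simp
next
  fix \<alpha> \<beta> assume "\<alpha> \<in> Arr germ_cat" "\<beta> \<in> Arr germ_cat" and \<alpha>\<beta>: "Cod germ_cat \<alpha> = Dom germ_cat \<beta>"
  then obtain k f k' g where k: "k \<in> Obj I1" and f: "f \<in> Arr (T k)" and \<alpha>: "\<alpha> = germ k f"
    and k': "k' \<in> Obj I1" and g: "g \<in> Arr (T k')" and \<beta>: "\<beta> = germ k' g" by (metis germ_cat_arrE)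
  obtain d x e y where de: "Dom (T k) f = (d, x)" "Cod (T k) f = (e, y)" by (metis surj_pair)
  obtain d' x' e' y' where de': "Dom (T k') g = (d', x')" "Cod (T k') g = (e', y')" by (metis surj_pair)
  note [simp] = T_ends[OF f de] f de k \<alpha> T_ends[OF g de'] g de' k' \<beta>
  \<comment> \<open>Injectivity of the encoding turns equality of end objects into equality of stage
    and object, which is all that a composite of germs requires.\<close>
  have m: "Dom I1 d' = Dom I1 e" "x' = y" using \<alpha>\<beta> by (auto simp: germ_obj_eq_iff)
  obtain \<tau> where \<tau>: "germ_comp (k, f) (k', g) \<tau>"
    using germ_comp_exists[OF f de g, of d' e' y'] m de' by auto
  then show "\<beta> \<cdot>\<^bsub>germ_cat\<^esub> \<alpha> \<in> Arr germ_cat \<and> Dom germ_cat (\<beta> \<cdot>\<^bsub>germ_cat\<^esub> \<alpha>) = Dom germ_cat \<alpha> \<and>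
    Cod germ_cat (\<beta> \<cdot>\<^bsub>germ_cat\<^esub> \<alpha>) = Cod germ_cat \<beta>"
  proof (cases rule: germ_compE)
    case (1 k1 f1 k1' g1 d1 x1 e1 y1 e1' h1 z1 u v \<epsilon>)
    note a [simp] = 1(3-31)
    have "\<beta> \<cdot>\<^bsub>germ_cat\<^esub> \<alpha> = germ (Cod I1 u) (push v g1 \<cdot>\<^bsub>T (Cod I1 u)\<^esub> (K \<epsilon> y1 \<cdot>\<^bsub>T (Cod I1 u)\<^esub> push u f1))"
      unfolding \<alpha> \<beta> by (rule germ_Comp) (use \<tau> 1(32) in auto)
    then show ?thesis using 1(1,2) de de' m by simp
  qed
next
  fix \<alpha> \<beta> \<gamma> assume "\<alpha> \<in> Arr germ_cat" "\<beta> \<in> Arr germ_cat" "\<gamma> \<in> Arr germ_cat"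
    and \<alpha>\<beta>: "Cod germ_cat \<alpha> = Dom germ_cat \<beta>" and \<beta>\<gamma>: "Cod germ_cat \<beta> = Dom germ_cat \<gamma>"
  then obtain k f k' g k'' h where k: "k \<in> Obj I1" and f: "f \<in> Arr (T k)" and \<alpha>: "\<alpha> = germ k f"
    and k': "k' \<in> Obj I1" and g: "g \<in> Arr (T k')" and \<beta>: "\<beta> = germ k' g"
    and k'': "k'' \<in> Obj I1" and h: "h \<in> Arr (T k'')" and \<gamma>: "\<gamma> = germ k'' h" by (metis germ_cat_arrE)
  obtain d1 x1 d2 x2 where de: "Dom (T k) f = (d1, x1)" "Cod (T k) f = (d2, x2)" by (metis surj_pair)
  obtain e2 x2' e3 x3 where de': "Dom (T k') g = (e2, x2')" "Cod (T k') g = (e3, x3)" by (metis surj_pair)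
  obtain h3 x3' h4 x4 where de'': "Dom (T k'') h = (h3, x3')" "Cod (T k'') h = (h4, x4)" by (metis surj_pair)
  note ends = T_ends[OF f de] T_ends[OF g de'] T_ends[OF h de'']
  have m: "Dom I1 e2 = Dom I1 d2" "x2' = x2" "Dom I1 h3 = Dom I1 e3" "x3' = x3"
    using \<alpha>\<beta> \<beta>\<gamma> ends f de g de' h de'' k k' k'' \<alpha> \<beta> \<gamma> by (auto simp: germ_obj_eq_iff)
  obtain \<tau> \<chi> \<omega> where *: "germ_comp (k, f) (k', g) \<tau>" "germ_comp \<tau> (k'', h) \<omega>" "germ_comp (k', g) (k'', h) \<chi>"
    "germ_comp (k, f) \<chi> \<omega>"
    using germ_comp_assoc[OF f de g, of e2 e3 x3 h k'' h3 h4 x4] de' de'' m h by auto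
  obtain m1 t1 m2 t2 m3 t3 where eq: "\<tau> = (m1, t1)" "\<chi> = (m2, t2)" "\<omega> = (m3, t3)" by (metis surj_pair)
  have t: "m1 \<in> Obj I1" "t1 \<in> Arr (T m1)" "m2 \<in> Obj I1" "t2 \<in> Arr (T m2)"
    using *(2,4) eq by (auto elim: germ_compE)
  show "\<gamma> \<cdot>\<^bsub>germ_cat\<^esub> \<beta> \<cdot>\<^bsub>germ_cat\<^esub> \<alpha> = \<gamma> \<cdot>\<^bsub>germ_cat\<^esub> (\<beta> \<cdot>\<^bsub>germ_cat\<^esub> \<alpha>)"
    using germ_Comp[OF *(1)[unfolded eq]] germ_Comp[OF *(2)[unfolded eq]] germ_Comp[OF *(3)[unfolded eq]]
      germ_Comp[OF *(4)[unfolded eq]] k f k' g k'' h t by (simp add: \<alpha> \<beta> \<gamma>)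
qed

lemma germ_Comp_stage [simp]:
  "\<lbrakk>k \<in> Obj I1; f \<in> Arr (T k); g \<in> Arr (T k); Cod (T k) f = Dom (T k) g\<rbrakk> \<Longrightarrow>
    germ k (g \<cdot>\<^bsub>T k\<^esub> f) = germ k g \<cdot>\<^bsub>germ_cat\<^esub> germ k f"
  using germ_Comp[OF germ_comp_stage] by simp

lemma germ_push_eq [simp]:
  "\<lbrakk>u \<in> Arr I1; m = Cod I1 u; f \<in> Arr (T (Dom I1 u))\<rbrakk> \<Longrightarrow> germ m (push u f) = germ (Dom I1 u) f"
  using germ_push[of f "Dom I1 u" u m] germ_eq_iff[of "Dom I1 u" f m "push u f"] by simp

text \<open>From here on identities are normalised towards \<open>Id germ_cat\<close> by
  \<open>germ_Id_stage\<close>; keeping the opposite rule as well would make the simplifier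
  loop.\<close>

declare germ_Id [simp del]

lemma germ_Id_stage [simp]:
  assumes "k \<in> Obj I1" "d \<in> Arr I1" "Cod I1 d = k" "x \<in> Obj (C (Dom I1 d))"
  shows "germ k (Id (T k) (d, x)) = Id germ_cat (germ_obj (Dom I1 d) x)"
  using germ_push_eq[of d k "Id (T (Dom I1 d)) (Id I1 (Dom I1 d), x)"] assms
  by (simp add: germ_Id del: germ_push_eq)

text \<open>By \<open>coinsert\<close> and \<open>coequify\<close>, every 2-cell of \<open>I\<close> becomes invertible after composition with a
  1-cell, so that germs identify 1-cells that are related by any 2-cell.\<close>

lemma germ_K [simp]:
  assumes \<alpha>: "\<alpha> \<in> Arr I2" and k: "k = Cod I1 (Dom I2 \<alpha>)" and x: "x \<in> Obj (C (Dom I1 (Dom I2 \<alpha>)))"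
  shows "germ k (K \<alpha> x) = Id germ_cat (germ_obj (Dom I1 (Dom I2 \<alpha>)) x)"
proof -
  let ?d = "Dom I2 \<alpha>" and ?d' = "Cod I2 \<alpha>"
  note [simp] = \<alpha> k x
  obtain u \<beta> where u [simp]: "u \<in> Arr I1" "Dom I1 u = Cod I1 ?d" "is_iso I2 \<beta>"
    "Dom I2 \<beta> = u \<circ>\<^bsub>I\<^esub> ?d" "Cod I2 \<beta> = u \<circ>\<^bsub>I\<^esub> ?d'"
    by (rule coinsertE[of ?d ?d']) auto
  have [simp]: "\<beta> \<in> Arr I2" by (rule is_iso_Arr) simp
  obtain v where v [simp]: "v \<in> Arr I1" "Dom I1 v = Cod I1 u" and eq: "v \<rhd>\<^bsub>I\<^esub> (u \<rhd>\<^bsub>I\<^esub> \<alpha>) = v \<rhd>\<^bsub>I\<^esub> \<beta>"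
    by (rule coequifyE[of "u \<rhd>\<^bsub>I\<^esub> \<alpha>" \<beta>]) auto
  let ?w = "v \<circ>\<^bsub>I\<^esub> u" and ?m = "Cod I1 v"
  have "(?m, K (v \<rhd>\<^bsub>I\<^esub> \<beta>) x) \<simeq> (?m, Id (T ?m) (?w \<circ>\<^bsub>I\<^esub> ?d', x))"
    by (rule germ_conj[of _ _ "?w \<circ>\<^bsub>I\<^esub> ?d" x "?w \<circ>\<^bsub>I\<^esub> ?d'" x _ "?w \<circ>\<^bsub>I\<^esub> ?d'" "?w \<circ>\<^bsub>I\<^esub> ?d'" "v \<rhd>\<^bsub>I\<^esub> \<beta>" "Id I2 (?w \<circ>\<^bsub>I\<^esub> ?d')"]) auto
  then have "germ ?m (K (v \<rhd>\<^bsub>I\<^esub> \<beta>) x) = germ ?m (Id (T ?m) (?w \<circ>\<^bsub>I\<^esub> ?d', x))"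
    by (subst germ_eq_iff) auto
  moreover have "germ k (K \<alpha> x) = germ ?m (push ?w (K \<alpha> x))" by (subst germ_push_eq) auto
  moreover have "push ?w (K \<alpha> x) = K (v \<rhd>\<^bsub>I\<^esub> \<beta>) x" unfolding eq[symmetric] by simp
  ultimately have "germ k (K \<alpha> x) = germ ?m (Id (T ?m) (?w \<circ>\<^bsub>I\<^esub> ?d', x))" by metis
  then show ?thesis by simp
qed

text \<open>For parallel representatives, \<open>coinsert\<close> provides one 2-cell
  \<open>\<sigma>\<close> between the two transition 1-cells, and \<open>coequify\<close> makes both
  matching cells equal to whiskerings of \<open>\<sigma>\<close>. Naturality of \<open>K\<close>
  then turns the comparison into an equality of two pushes along a single 1-cell.\<close>

lemma germ_parallel_eq:
  assumes k: "k \<in> Obj I1" and f: "f \<in> Arr (T k)" and g: "g \<in> Arr (T k)"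
    and "Dom (T k) f = Dom (T k) g" "Cod (T k) f = Cod (T k) g" and eq: "germ k f = germ k g"
  shows "\<exists>u. u \<in> Arr I1 \<and> Dom I1 u = k \<and> push u f = push u g"
proof -
  have "(k, f) \<simeq> (k, g)" using eq germ_eq_iff k f g by simp
  then show ?thesis
  proof (cases rule: germ_eqE)
    case (1 k1 f1 k2 f2 d x e y d' e' u v \<beta> \<gamma>)
    have same: "k1 = k" "f1 = f" "k2 = k" "f2 = g" "d' = d" "e' = e" using 1(1-10) assms(4,5) by auto
    note [simp] = 1(3-19,23-35)[unfolded same] and eq = 1(36)[unfolded same]
    obtain s \<sigma> where [simp]: "s \<in> Arr I1" "Dom I1 s = Cod I1 u" "is_iso I2 \<sigma>" "Dom I2 \<sigma> = s \<circ>\<^bsub>I\<^esub> u" "Cod I2 \<sigma> = s \<circ>\<^bsub>I\<^esub> v"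
      by (rule coinsertE[of u v]) auto
    have [simp]: "\<sigma> \<in> Arr I2" by (rule is_iso_Arr) simp
    \<comment> \<open>The matching at the source is corrected first, then the one at the target;
      whiskering preserves the first correction.\<close>
    obtain t where [simp]: "t \<in> Arr I1" "Dom I1 t = Cod I1 s" and t: "t \<rhd>\<^bsub>I\<^esub> (s \<rhd>\<^bsub>I\<^esub> \<beta>) = t \<rhd>\<^bsub>I\<^esub> (\<sigma> \<lhd>\<^bsub>I\<^esub> d)"
      by (rule coequifyE[of "s \<rhd>\<^bsub>I\<^esub> \<beta>" "\<sigma> \<lhd>\<^bsub>I\<^esub> d"]) auto
    obtain w where [simp]: "w \<in> Arr I1" "Dom I1 w = Cod I1 t"
      and w: "w \<rhd>\<^bsub>I\<^esub> (t \<circ>\<^bsub>I\<^esub> s \<rhd>\<^bsub>I\<^esub> \<gamma>) = w \<rhd>\<^bsub>I\<^esub> (t \<rhd>\<^bsub>I\<^esub> (\<sigma> \<lhd>\<^bsub>I\<^esub> e))"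
      by (rule coequifyE[of "t \<circ>\<^bsub>I\<^esub> s \<rhd>\<^bsub>I\<^esub> \<gamma>" "t \<rhd>\<^bsub>I\<^esub> (\<sigma> \<lhd>\<^bsub>I\<^esub> e)"]) auto
    let ?s = "w \<circ>\<^bsub>I\<^esub> (t \<circ>\<^bsub>I\<^esub> s)" and ?\<sigma> = "w \<circ>\<^bsub>I\<^esub> t \<rhd>\<^bsub>I\<^esub> \<sigma>" and ?m = "Cod I1 w"
    have \<beta>: "?s \<rhd>\<^bsub>I\<^esub> \<beta> = ?\<sigma> \<lhd>\<^bsub>I\<^esub> d" using arg_cong[OF t, of "\<lambda>\<alpha>. w \<rhd>\<^bsub>I\<^esub> \<alpha>"] by simp
    have \<gamma>: "?s \<rhd>\<^bsub>I\<^esub> \<gamma> = ?\<sigma> \<lhd>\<^bsub>I\<^esub> e" using w by simp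
    have 1: "K (?s \<rhd>\<^bsub>I\<^esub> \<gamma>) y \<cdot>\<^bsub>T ?m\<^esub> push (?s \<circ>\<^bsub>I\<^esub> u) f = push (?s \<circ>\<^bsub>I\<^esub> v) g \<cdot>\<^bsub>T ?m\<^esub> K (?s \<rhd>\<^bsub>I\<^esub> \<beta>) x"
      using arg_cong[OF eq, of "push ?s"] by simp
    have 2: "K (?\<sigma> \<lhd>\<^bsub>I\<^esub> e) y \<cdot>\<^bsub>T ?m\<^esub> push (?s \<circ>\<^bsub>I\<^esub> u) g = push (?s \<circ>\<^bsub>I\<^esub> v) g \<cdot>\<^bsub>T ?m\<^esub> K (?\<sigma> \<lhd>\<^bsub>I\<^esub> d) x"
      by (rule K_square[of _ _ _ _ k]) auto
    have "push (?s \<circ>\<^bsub>I\<^esub> u) f = push (?s \<circ>\<^bsub>I\<^esub> u) g"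
      by (rule iso_cancel_left[of "T ?m" "K (?\<sigma> \<lhd>\<^bsub>I\<^esub> e) y"]) (use 1 2 \<beta> \<gamma> in auto)
    then show ?thesis by (intro exI[of _ "?s \<circ>\<^bsub>I\<^esub> u"]) auto
  qed
qed

end

section \<open>Pseudococones on a diagram of categories\<close>

locale cat_cocone = cat_diagram I F
  for I :: "('i, 'd, 'e) twocat"
    and F :: "('i, 'd, 'e, ('u, 'u) cat, ('u, 'u, 'u, 'u) func, ('u, 'u, 'u, 'u) nt) psfun" +
  fixes X :: "('u, 'u) cat" and q :: "('i, 'd, ('u, 'u, 'u, 'u) func, ('u, 'u, 'u, 'u) nt) cocone"
  assumes q: "pseudococone I Cat F X q"
begin

abbreviation "qo i \<equiv> OMap (Leg q i)"
abbreviation "qa i \<equiv> AMap (Leg q i)"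
abbreviation "cell d \<equiv> NMap (Cell q d)"

lemma small_X [simp]: "small_cat X" "category X"
  using cocone_simps(1)[OF q] by simp_all

lemma leg_simps [simp]:
  "i \<in> Obj I1 \<Longrightarrow> small_functor (Leg q i)"
  "i \<in> Obj I1 \<Longrightarrow> Src (Leg q i) = C i" "i \<in> Obj I1 \<Longrightarrow> Tgt (Leg q i) = X"
  using cocone_simps(2-4)[OF q] by simp_all

lemma cell_simps [simp]:
  assumes "d \<in> Arr I1"
  shows "nat_iso (Cell q d)" "NSrc (Cell q d) = func_comp (Leg q (Cod I1 d)) (P1 F d)" "NTgt (Cell q d) = Leg q (Dom I1 d)"
proof -
  note * = cocone_simps(5-8)[OF q assms]
  show "NSrc (Cell q d) = func_comp (Leg q (Cod I1 d)) (P1 F d)" "NTgt (Cell q d) = Leg q (Dom I1 d)"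
    using * by simp_all
  have "nat_trans (Cell q d)" "small_functor (NSrc (Cell q d))" "small_functor (NTgt (Cell q d))"
    using *(1) by auto
  then show "nat_iso (Cell q d)" using *(4) by (simp only: is_iso_Cat_iff)
qed

lemma qa_in [simp]:
  assumes "i \<in> Obj I1" "a \<in> Arr (C i)"
  shows "qa i a \<in> Arr X" "Dom X (qa i a) = qo i (Dom (C i) a)" "Cod X (qa i a) = qo i (Cod (C i) a)"
  using assms by simp_all

lemma qa_Comp [simp]:
  "\<lbrakk>i \<in> Obj I1; a \<in> Arr (C i); b \<in> Arr (C i); Cod (C i) a = Dom (C i) b\<rbrakk> \<Longrightarrow> qa i (b \<cdot>\<^bsub>C i\<^esub> a) = qa i b \<cdot>\<^bsub>X\<^esub> qa i a"
  by simp

lemma cell_in [simp]: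
  assumes "d \<in> Arr I1" "x \<in> Obj (C (Dom I1 d))"
  shows "cell d x \<in> Arr X" "Dom X (cell d x) = qo (Cod I1 d) (Fo d x)" "Cod X (cell d x) = qo (Dom I1 d) x"
    "is_iso X (cell d x)"
  using assms by simp_all

lemma cell_natural:
  assumes "d \<in> Arr I1" "a \<in> Arr (C (Dom I1 d))"
  shows "cell d (Cod (C (Dom I1 d)) a) \<cdot>\<^bsub>X\<^esub> qa (Cod I1 d) (Fa d a) = qa (Dom I1 d) a \<cdot>\<^bsub>X\<^esub> cell d (Dom (C (Dom I1 d)) a)"
  using nat_trans_natural[of "Cell q d" a] assms by simp

lemma cell_two:
  assumes "\<alpha> \<in> Arr I2" "x \<in> Obj (C (Dom I1 (Dom I2 \<alpha>)))"
  shows "cell (Cod I2 \<alpha>) x \<cdot>\<^bsub>X\<^esub> qa (Cod I1 (Dom I2 \<alpha>)) (two \<alpha> x) = cell (Dom I2 \<alpha>) x"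
  using arg_cong[OF cocone_natural[OF q assms(1)], of "\<lambda>\<tau>. NMap \<tau> x"] assms by simp

lemma cell_comp:
  assumes "d \<in> Arr I1" "e \<in> Arr I1" "Cod I1 d = Dom I1 e" "x \<in> Obj (C (Dom I1 d))"
  shows "cell (e \<circ>\<^bsub>I\<^esub> d) x \<cdot>\<^bsub>X\<^esub> qa (Cod I1 e) (phi e d x) = cell d x \<cdot>\<^bsub>X\<^esub> cell e (Fo d x)"
  using arg_cong[OF cocone_comp[OF q assms(1-3)], of "\<lambda>\<tau>. NMap \<tau> x"] assms by simp

text \<open>The value of a germ in the vertex. The leg at \<open>k\<close> gives an arrow between
  the images of \<open>F d x\<close> and \<open>F e y\<close>; the structure cells move its ends to
  the images of \<open>x\<close> and \<open>y\<close>, so that the value no longer depends on the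
  stage of representation.\<close>

definition ev :: "'i \<Rightarrow> ('d \<times> 'u) \<times> ('d \<times> 'u) \<times> 'u \<Rightarrow> 'u" where
  "ev k = (\<lambda>((d, x), (e, y), a). cell e y \<cdot>\<^bsub>X\<^esub> (qa k a \<cdot>\<^bsub>X\<^esub> inverse_arr X (cell d x)))"

definition evo :: "'d \<times> 'u \<Rightarrow> 'u" where
  "evo = (\<lambda>(d, x). qo (Dom I1 d) x)"

lemma evo_pair [simp]: "evo (d, x) = qo (Dom I1 d) x"
  by (simp add: evo_def)

lemma evo_push [simp]: "u \<in> Arr I1 \<Longrightarrow> Z \<in> Obj (T (Dom I1 u)) \<Longrightarrow> evo (push_obj u Z) = evo Z"
  by (cases Z) (auto simp: Obj_T)

lemma ev_hom [simp]:
  assumes "k \<in> Obj I1" "f \<in> Arr (T k)"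
  shows "ev k f \<in> Arr X" "Dom X (ev k f) = evo (Dom (T k) f)" "Cod X (ev k f) = evo (Cod (T k) f)"
  using assms by (auto elim!: Arr_T_cases simp: ev_def T_sel)

lemma ev_eqI:
  assumes "k \<in> Obj I1" "((d, x), (e, y), a) \<in> Arr (T k)" "h \<in> Arr X" "Dom X h = qo (Dom I1 d) x" "Cod X h = qo (Dom I1 e) y"
    "h \<cdot>\<^bsub>X\<^esub> cell d x = cell e y \<cdot>\<^bsub>X\<^esub> qa k a"
  shows "ev k ((d, x), (e, y), a) = h"
  using Comp_eq_conj_iff[of X "cell d x" "cell e y" "qa k a" h] assms by (simp add: ev_def T_sel)

lemma ev_cell:
  assumes "k \<in> Obj I1" "((d, x), (e, y), a) \<in> Arr (T k)"
  shows "ev k ((d, x), (e, y), a) \<cdot>\<^bsub>X\<^esub> cell d x = cell e y \<cdot>\<^bsub>X\<^esub> qa k a"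
  using assms by (simp add: ev_def T_sel)

lemma ev_Id [simp]: "k \<in> Obj I1 \<Longrightarrow> Z \<in> Obj (T k) \<Longrightarrow> ev k (Id (T k) Z) = Id X (evo Z)"
  by (cases Z) (simp add: T_sel, rule ev_eqI, auto simp: T_sel)

lemma ev_Comp [simp]:
  assumes k [simp]: "k \<in> Obj I1" and fg: "f \<in> Arr (T k)" "g \<in> Arr (T k)" "Cod (T k) f = Dom (T k) g"
  shows "ev k (g \<cdot>\<^bsub>T k\<^esub> f) = ev k g \<cdot>\<^bsub>X\<^esub> ev k f"
proof -
  obtain d x e y a where f: "f = ((d, x), (e, y), a)" "f \<in> Arr (T k)" using fg by (metis prod_cases3 prod.collapse)
  obtain z w b where g: "g = ((e, y), (z, w), b)" "g \<in> Arr (T k)"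
    using fg f by (metis prod.collapse T_sel(2,3))
  show ?thesis using f g by (auto simp: T_sel ev_def)
qed

text \<open>The composition axiom of the cells absorbs the conjugation by \<open>phi\<close>, and
  their naturality brings \<open>F u a\<close> back to the original stage.\<close>

lemma ev_push [simp]:
  assumes u [simp]: "u \<in> Arr I1" and m: "m = Cod I1 u" and f: "f \<in> Arr (T (Dom I1 u))"
  shows "ev m (push u f) = ev (Dom I1 u) f"
proof -
  let ?k = "Dom I1 u"
  from f obtain d x e y a where f_eq: "f = ((d, x), (e, y), a)" and [simp]: "d \<in> Arr I1" "Cod I1 d = ?k" "x \<in> Obj (C (Dom I1 d))"
    "e \<in> Arr I1" "Cod I1 e = ?k" "y \<in> Obj (C (Dom I1 e))" "a \<in> Arr (C ?k)" "Dom (C ?k) a = Fo d x" "Cod (C ?k) a = Fo e y"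
    by (rule Arr_T_cases)
  note [simp] = m
  define b where "b = phi u e y \<cdot>\<^bsub>C m\<^esub> (Fa u a \<cdot>\<^bsub>C m\<^esub> inverse_arr (C m) (phi u d x))"
  have b [simp]: "b \<in> Arr (C (Cod I1 u))" "Dom (C (Cod I1 u)) b = Fo (u \<circ>\<^bsub>I\<^esub> d) x" "Cod (C (Cod I1 u)) b = Fo (u \<circ>\<^bsub>I\<^esub> e) y"
    by (simp_all add: b_def)
  have b_phi: "b \<cdot>\<^bsub>C (Cod I1 u)\<^esub> phi u d x = phi u e y \<cdot>\<^bsub>C (Cod I1 u)\<^esub> Fa u a" by (simp add: b_def)
  have push_f: "push u f = ((u \<circ>\<^bsub>I\<^esub> d, x), (u \<circ>\<^bsub>I\<^esub> e, y), b)" by (simp add: f_eq push_def b_def)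
  define h where "h = ev ?k f"
  have h [simp]: "h \<in> Arr X" "Dom X h = qo (Dom I1 d) x" "Cod X h = qo (Dom I1 e) y"
    using f by (simp_all add: h_def f_eq T_sel)
  have h_cell: "h \<cdot>\<^bsub>X\<^esub> cell d x = cell e y \<cdot>\<^bsub>X\<^esub> qa ?k a"
    using f unfolding h_def f_eq by (intro ev_cell) auto
  have "ev m ((u \<circ>\<^bsub>I\<^esub> d, x), (u \<circ>\<^bsub>I\<^esub> e, y), b) = h"
  proof (rule ev_eqI)
    show "h \<cdot>\<^bsub>X\<^esub> cell (u \<circ>\<^bsub>I\<^esub> d) x = cell (u \<circ>\<^bsub>I\<^esub> e) y \<cdot>\<^bsub>X\<^esub> qa m b"
    proof (rule iso_cancel_right[of X "qa m (phi u d x)"])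
      have "cell (u \<circ>\<^bsub>I\<^esub> e) y \<cdot>\<^bsub>X\<^esub> qa m b \<cdot>\<^bsub>X\<^esub> qa m (phi u d x) = cell (u \<circ>\<^bsub>I\<^esub> e) y \<cdot>\<^bsub>X\<^esub> qa m (b \<cdot>\<^bsub>C m\<^esub> phi u d x)"
        by simp
      also have "\<dots> = cell (u \<circ>\<^bsub>I\<^esub> e) y \<cdot>\<^bsub>X\<^esub> qa (Cod I1 u) (phi u e y) \<cdot>\<^bsub>X\<^esub> qa m (Fa u a)"
        by (simp add: b_phi)
      also have "\<dots> = cell e y \<cdot>\<^bsub>X\<^esub> (cell u (Fo e y) \<cdot>\<^bsub>X\<^esub> qa m (Fa u a))"
        by (subst cell_comp) simp_all
      also have "cell u (Fo e y) \<cdot>\<^bsub>X\<^esub> qa m (Fa u a) = qa ?k a \<cdot>\<^bsub>X\<^esub> cell u (Fo d x)"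
        using cell_natural[of u a] by simp
      also have "cell e y \<cdot>\<^bsub>X\<^esub> (qa ?k a \<cdot>\<^bsub>X\<^esub> cell u (Fo d x)) = h \<cdot>\<^bsub>X\<^esub> cell d x \<cdot>\<^bsub>X\<^esub> cell u (Fo d x)"
        unfolding h_cell by simp
      also have "\<dots> = h \<cdot>\<^bsub>X\<^esub> cell (u \<circ>\<^bsub>I\<^esub> d) x \<cdot>\<^bsub>X\<^esub> qa m (phi u d x)"
        using cell_comp[of d u x] by simp
      finally show "h \<cdot>\<^bsub>X\<^esub> cell (u \<circ>\<^bsub>I\<^esub> d) x \<cdot>\<^bsub>X\<^esub> qa m (phi u d x) = cell (u \<circ>\<^bsub>I\<^esub> e) y \<cdot>\<^bsub>X\<^esub> qa m b \<cdot>\<^bsub>X\<^esub> qa m (phi u d x)" ..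
    qed simp_all
  qed (simp_all add: T_sel)
  then show ?thesis by (simp add: push_f h_def)
qed

lemma ev_K [simp]:
  assumes "\<alpha> \<in> Arr I2" "k = Cod I1 (Dom I2 \<alpha>)" "x \<in> Obj (C (Dom I1 (Dom I2 \<alpha>)))"
  shows "ev k (K \<alpha> x) = Id X (qo (Dom I1 (Dom I2 \<alpha>)) x)"
  unfolding K_def by (rule ev_eqI) (use assms cell_two[of \<alpha> x] in \<open>auto simp: T_sel\<close>)

lemma ev_im [simp]:
  assumes "d \<in> Arr I1" "k = Cod I1 d" "a \<in> Arr (C (Dom I1 d))"
  shows "ev k (im d a) = qa (Dom I1 d) a"
  unfolding im_def by (rule ev_eqI) (use assms cell_natural[of d a] in \<open>auto simp: T_sel\<close>)

lemma ev_Phi [simp]: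
  assumes "d \<in> Arr I1" "e \<in> Arr I1" "Cod I1 d = Dom I1 e" "k = Cod I1 e" "x \<in> Obj (C (Dom I1 d))"
  shows "ev k (Phi e d x) = cell d x"
  unfolding Phi_def by (rule ev_eqI) (use assms cell_comp[of d e x] in \<open>auto simp: T_sel\<close>)

text \<open>Evaluation sends every \<open>K\<close> to an identity and is invariant under pushing,
  so the equation that defines equality of germs evaluates to the claim.\<close>

lemma ev_germ_eq:
  assumes "(k, f) \<simeq> (k', f')"
  shows "ev k f = ev k' f'"
  using assms
proof (cases rule: germ_eqE)
  case (1 k1 f1 k2 f2 d x e y d' e' u v \<beta> \<gamma>)
  note [simp] = 1(3-35) and eq = 1(36)
  have "ev (Cod I1 u) (K \<gamma> y \<cdot>\<^bsub>T (Cod I1 u)\<^esub> push u f1) = ev (Cod I1 u) (push v f2 \<cdot>\<^bsub>T (Cod I1 u)\<^esub> K \<beta> x)"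
    by (simp only: eq)
  then show ?thesis using 1(1,2) by simp
qed

lemma ev_germ_comp:
  assumes "germ_comp (k, f) (k', g) (m, c)"
  shows "ev m c = ev k' g \<cdot>\<^bsub>X\<^esub> ev k f"
  using assms
proof (cases rule: germ_compE)
  case (1 k1 f1 k2 g1 d x e y e' h z u v \<epsilon>)
  note [simp] = 1(3-31)
  show ?thesis using 1(1,2,32) by simp
qed

end

lemma small_image: "small U A \<Longrightarrow> small U (f ` A)"
  unfolding small_def using card_of_image ordLeq_ordLess_trans by blast

section \<open>The pseudococone of germs\<close>

context germ_model
begin

lemma small_germ_cat [simp]: "small_cat germ_cat"
proof -
  have "small TYPE('u) (Obj germ_cat)" "small TYPE('u) (Arr germ_cat)"
    by (auto simp: germ_cat_def intro!: small_image bobj_small reps_small)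
  then show ?thesis by (simp add: small_cat_def)
qed

definition germ_leg :: "'i \<Rightarrow> ('u, 'u, 'u, 'u) func" where
  "germ_leg i = \<lparr>Src = C i, Tgt = germ_cat, OMap = (\<lambda>x\<in>Obj (C i). germ_obj i x),
     AMap = (\<lambda>a\<in>Arr (C i). germ i (im (Id I1 i) a))\<rparr>"

text \<open>At the target stage of \<open>d\<close>, the objects \<open>F d x\<close> and
  \<open>x\<close> are presented with transitions the identity and \<open>d\<close>;
  \<open>Phi\<close> is the canonical isomorphism between the two presentations.\<close>

definition germ_cell :: "'d \<Rightarrow> ('u, 'u, 'u, 'u) nt" where
  "germ_cell d = \<lparr>NSrc = func_comp (germ_leg (Cod I1 d)) (P1 F d), NTgt = germ_leg (Dom I1 d),
     NMap = (\<lambda>x\<in>Obj (C (Dom I1 d)). germ (Cod I1 d) (Phi (Id I1 (Cod I1 d)) d x))\<rparr>"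

definition germ_cocone :: "('i, 'd, ('u, 'u, 'u, 'u) func, ('u, 'u, 'u, 'u) nt) cocone" where
  "germ_cocone = \<lparr>Leg = (\<lambda>i\<in>Obj I1. germ_leg i), Cell = (\<lambda>d\<in>Arr I1. germ_cell d)\<rparr>"

lemma germ_leg_sel [simp]:
  "Src (germ_leg i) = C i" "Tgt (germ_leg i) = germ_cat"
  "x \<in> Obj (C i) \<Longrightarrow> OMap (germ_leg i) x = germ_obj i x"
  by (simp_all add: germ_leg_def)

text \<open>Seeing an arrow through \<open>d\<close> is pushing its view through the identity, and
  pushing does not change the germ.\<close>

lemma germ_im [simp]:
  assumes "d \<in> Arr I1" "k = Cod I1 d" "a \<in> Arr (C (Dom I1 d))"
  shows "germ k (im d a) = AMap (germ_leg (Dom I1 d)) a"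
  using germ_push_eq[of d k "im (Id I1 (Dom I1 d)) a"] assms by (simp add: germ_leg_def)

lemma germ_leg_hom:
  assumes "i \<in> Obj I1" "a \<in> Arr (C i)"
  shows "AMap (germ_leg i) a \<in> Arr germ_cat" "Dom germ_cat (AMap (germ_leg i) a) = germ_obj i (Dom (C i) a)"
    "Cod germ_cat (AMap (germ_leg i) a) = germ_obj i (Cod (C i) a)"
  using germ_hom[of i "im (Id I1 i) a"] assms by (simp_all del: germ_hom)

lemma germ_leg_functor [simp]:
  assumes i [simp]: "i \<in> Obj I1"
  shows "cat_functor (germ_leg i)"
proof (rule cat_functorI)
  fix x assume "x \<in> Obj (Src (germ_leg i))"
  then have x [simp]: "x \<in> Obj (C i)" by simp
  have "AMap (germ_leg i) (Id (C i) x) = germ i (im (Id I1 i) (Id (C i) x))"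
    using germ_im[of "Id I1 i" i "Id (C i) x"] by (simp del: germ_im im_Id)
  also have "\<dots> = Id germ_cat (germ_obj i x)" by (simp del: germ_im)
  finally show "AMap (germ_leg i) (Id (Src (germ_leg i)) x) = Id (Tgt (germ_leg i)) (OMap (germ_leg i) x)" by simp
next
  fix a b assume "a \<in> Arr (Src (germ_leg i))" "b \<in> Arr (Src (germ_leg i))" "Cod (Src (germ_leg i)) a = Dom (Src (germ_leg i)) b"
  then have [simp]: "a \<in> Arr (C i)" "b \<in> Arr (C i)" "Cod (C i) a = Dom (C i) b" by simp_all
  have "AMap (germ_leg i) (b \<cdot>\<^bsub>C i\<^esub> a) = germ i (im (Id I1 i) (b \<cdot>\<^bsub>C i\<^esub> a))"
    by (simp del: im_Comp)
  also have "\<dots> = germ i (im (Id I1 i) b \<cdot>\<^bsub>T i\<^esub> im (Id I1 i) a)" by simp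
  also have "\<dots> = AMap (germ_leg i) b \<cdot>\<^bsub>germ_cat\<^esub> AMap (germ_leg i) a"
    by (subst germ_Comp_stage) simp_all
  finally show "AMap (germ_leg i) (b \<cdot>\<^bsub>Src (germ_leg i)\<^esub> a) = AMap (germ_leg i) b \<cdot>\<^bsub>Tgt (germ_leg i)\<^esub> AMap (germ_leg i) a"
    by simp
qed (auto simp: in_hom germ_leg_hom, auto simp: germ_leg_def)

lemma germ_leg_small [simp]: "i \<in> Obj I1 \<Longrightarrow> small_functor (germ_leg i)"
  by (simp add: small_functor_def)

lemma germ_cell_sel [simp]:
  "NSrc (germ_cell d) = func_comp (germ_leg (Cod I1 d)) (P1 F d)" "NTgt (germ_cell d) = germ_leg (Dom I1 d)"
  by (simp_all add: germ_cell_def)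

lemma germ_Phi [simp]:
  assumes "d \<in> Arr I1" "e \<in> Arr I1" "Cod I1 d = Dom I1 e" "k = Cod I1 e" "x \<in> Obj (C (Dom I1 d))"
  shows "germ k (Phi e d x) = NMap (germ_cell d) x"
  using germ_push_eq[of e k "Phi (Id I1 (Dom I1 e)) d x"] assms by (simp add: germ_cell_def)

lemma germ_iso:
  assumes "k \<in> Obj I1" "is_iso (T k) f"
  shows "is_iso germ_cat (germ k f)"
proof (rule is_isoI[of _ _ "germ k (inverse_arr (T k) f)"])
  have f: "f \<in> Arr (T k)" using assms by simp
  have id: "germ k (Id (T k) Z) = Id germ_cat (germ_obj (Dom I1 (fst Z)) (snd Z))" if "Z \<in> Obj (T k)" for Z
    using that assms(1) by (cases Z) simp
  show "germ k (inverse_arr (T k) f) \<cdot>\<^bsub>germ_cat\<^esub> germ k f = Id germ_cat (Dom germ_cat (germ k f))"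
    using assms f id by (simp flip: germ_Comp_stage)
  show "germ k f \<cdot>\<^bsub>germ_cat\<^esub> germ k (inverse_arr (T k) f) = Id germ_cat (Cod germ_cat (germ k f))"
    using assms f id by (simp flip: germ_Comp_stage)
qed (use assms in auto)

lemma germ_cell_hom [simp]:
  assumes "d \<in> Arr I1" "x \<in> Obj (C (Dom I1 d))"
  shows "NMap (germ_cell d) x \<in> Arr germ_cat" "Dom germ_cat (NMap (germ_cell d) x) = germ_obj (Cod I1 d) (Fo d x)"
    "Cod germ_cat (NMap (germ_cell d) x) = germ_obj (Dom I1 d) x" "is_iso germ_cat (NMap (germ_cell d) x)"
  using germ_hom[of "Cod I1 d" "Phi (Id I1 (Cod I1 d)) d x"] germ_iso[of "Cod I1 d" "Phi (Id I1 (Cod I1 d)) d x"] assms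
  by (simp_all del: germ_hom)

lemma germ_cell_nat_iso [simp]:
  assumes d [simp]: "d \<in> Arr I1"
  shows "nat_iso (germ_cell d)"
proof -
  have "nat_trans (germ_cell d)"
  proof (rule nat_transI)
    fix a assume "a \<in> Arr (Src (NSrc (germ_cell d)))"
    then have [simp]: "a \<in> Arr (C (Dom I1 d))" by simp
    let ?i = "Dom I1 d" and ?j = "Cod I1 d"
    have "germ ?j (Phi (Id I1 ?j) d (Cod (C ?i) a) \<cdot>\<^bsub>T ?j\<^esub> im (Id I1 ?j) (Fa d a)) =
      germ ?j (im d a \<cdot>\<^bsub>T ?j\<^esub> Phi (Id I1 ?j) d (Dom (C ?i) a))"
      using Phi_natural[of d "Id I1 ?j" ?j ?i a] by simp
    then show "NMap (germ_cell d) (Cod (Src (NSrc (germ_cell d))) a) \<cdot>\<^bsub>Tgt (NSrc (germ_cell d))\<^esub> AMap (NSrc (germ_cell d)) a =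
         AMap (NTgt (germ_cell d)) a \<cdot>\<^bsub>Tgt (NSrc (germ_cell d))\<^esub> NMap (germ_cell d) (Dom (Src (NSrc (germ_cell d))) a)"
      by simp
  qed (auto simp: in_hom, auto simp: germ_cell_def)
  then show ?thesis unfolding nat_iso_def by simp
qed

lemma germ_cocone_sel [simp]:
  "i \<in> Obj I1 \<Longrightarrow> Leg germ_cocone i = germ_leg i" "d \<in> Arr I1 \<Longrightarrow> Cell germ_cocone d = germ_cell d"
  by (simp_all add: germ_cocone_def)

text \<open>Germs turn \<open>K\<close> into identities, \<open>im\<close> into the legs and
  \<open>Phi\<close> into the cells. Under this dictionary the axioms are \<open>K_Phi\<close>,
  \<open>Phi_unit\<close> and \<open>Phi_comp\<close>, taken at an identity 1-cell.\<close>

lemma pseudococone_germ: "pseudococone I Cat F germ_cat germ_cocone"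
proof (rule pseudococone.intro)
  show "Cell germ_cocone d' \<bullet>\<^bsub>Cat\<^esub> (Leg germ_cocone j \<rhd>\<^bsub>Cat\<^esub> P2 F \<alpha>) = Cell germ_cocone d"
    if "d \<in> hom (Cells1 I) i j" "\<alpha> \<in> hom (Cells2 I) d d'" for d i j \<alpha> d'
  proof -
    have [simp]: "\<alpha> \<in> Arr I2" "d = Dom I2 \<alpha>" "d' = Cod I2 \<alpha>" "j = Cod I1 (Dom I2 \<alpha>)" using that by (auto simp: in_hom)
    have "nt_vcomp (germ_cell d') (nt_hcomp (nt_id (germ_leg j)) (P2 F \<alpha>)) = germ_cell d"
    proof (rule nt_eqI)
      fix x assume "x \<in> Obj (Src (NSrc (germ_cell d)))"
      then have [simp]: "x \<in> Obj (C (Dom I1 (Dom I2 \<alpha>)))" by simp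
      have "K (Id I1 j \<rhd>\<^bsub>I\<^esub> \<alpha>) x \<cdot>\<^bsub>T j\<^esub> Phi (Id I1 j) (Dom I2 \<alpha>) x = Phi (Id I1 j) (Cod I2 \<alpha>) x \<cdot>\<^bsub>T j\<^esub> im (Id I1 j) (two \<alpha> x)"
        by (rule K_Phi) simp_all
      from arg_cong[OF this, of "germ j"] show "NMap (nt_vcomp (germ_cell d') (nt_hcomp (nt_id (germ_leg j)) (P2 F \<alpha>))) x = NMap (germ_cell d) x"
        by simp
    qed simp_all
    then show ?thesis by simp
  qed
  show "Cell germ_cocone (Id (Cells1 I) i) \<bullet>\<^bsub>Cat\<^esub> (Leg germ_cocone i \<rhd>\<^bsub>Cat\<^esub> PUnit F i) = Id (Cells2 Cat) (Leg germ_cocone i)"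
    if [simp]: "i \<in> Obj (Cells1 I)" for i
  proof -
    have "nt_vcomp (germ_cell (Id I1 i)) (nt_hcomp (nt_id (germ_leg i)) (PUnit F i)) = nt_id (germ_leg i)"
    proof (rule nt_eqI)
      fix x assume "x \<in> Obj (Src (NSrc (nt_id (germ_leg i))))"
      then have [simp]: "x \<in> Obj (C i)" by simp
      have "Phi (Id I1 i) (Id I1 i) x \<cdot>\<^bsub>T i\<^esub> im (Id I1 i) (eta i x) = Id (T i) (Id I1 i, x)"
        by (rule Phi_unit) simp_all
      from arg_cong[OF this, of "germ i"] show "NMap (nt_vcomp (germ_cell (Id I1 i)) (nt_hcomp (nt_id (germ_leg i)) (PUnit F i))) x = NMap (nt_id (germ_leg i)) x"
        by simp
    qed simp_all
    then show ?thesis by simp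
  qed
  show "Cell germ_cocone (e \<circ>\<^bsub>I\<^esub> d) \<bullet>\<^bsub>Cat\<^esub> (Leg germ_cocone k \<rhd>\<^bsub>Cat\<^esub> PComp F e d) =
       Cell germ_cocone d \<bullet>\<^bsub>Cat\<^esub> (Cell germ_cocone e \<lhd>\<^bsub>Cat\<^esub> P1 F d)"
    if "d \<in> hom (Cells1 I) i j" "e \<in> hom (Cells1 I) j k" for d i j e k
  proof -
    have [simp]: "d \<in> Arr I1" "e \<in> Arr I1" "j = Dom I1 e" "Cod I1 d = Dom I1 e" "k = Cod I1 e"
      using that by (auto simp: in_hom)
    have "nt_vcomp (germ_cell (e \<circ>\<^bsub>I\<^esub> d)) (nt_hcomp (nt_id (germ_leg k)) (PComp F e d)) =
        nt_vcomp (germ_cell d) (nt_hcomp (germ_cell e) (nt_id (P1 F d)))"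
    proof (rule nt_eqI)
      fix x assume "x \<in> Obj (Src (NSrc (nt_vcomp (germ_cell d) (nt_hcomp (germ_cell e) (nt_id (P1 F d))))))"
      then have [simp]: "x \<in> Obj (C (Dom I1 d))" by simp
      have "Phi (Id I1 k) (e \<circ>\<^bsub>I\<^esub> d) x \<cdot>\<^bsub>T k\<^esub> im (Id I1 k) (phi e d x) =
          Phi (Id I1 k \<circ>\<^bsub>I\<^esub> e) d x \<cdot>\<^bsub>T k\<^esub> Phi (Id I1 k) e (Fo d x)"
        by (rule Phi_comp) simp_all
      from arg_cong[OF this, of "germ k"] show "NMap (nt_vcomp (germ_cell (e \<circ>\<^bsub>I\<^esub> d)) (nt_hcomp (nt_id (germ_leg k)) (PComp F e d))) x =
        NMap (nt_vcomp (germ_cell d) (nt_hcomp (germ_cell e) (nt_id (P1 F d)))) x"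
        by simp
    qed (simp_all add: func_comp_assoc)
    then show ?thesis by simp
  qed
qed (auto simp: in_hom, auto simp: germ_cocone_def)

text \<open>The category of germs is generated by the images of the legs, the structure cells and
  the inverses of the latter. Naturality over it need only be checked against legs and
  cells.\<close>

lemma germ_decompose:
  assumes "k \<in> Obj I1" "((d, x), (e, y), a) \<in> Arr (T k)"
  shows "germ k ((d, x), (e, y), a) \<cdot>\<^bsub>germ_cat\<^esub> NMap (germ_cell d) x = NMap (germ_cell e) y \<cdot>\<^bsub>germ_cat\<^esub> AMap (germ_leg k) a"
proof -
  have [simp]: "d \<in> Arr I1" "Cod I1 d = k" "x \<in> Obj (C (Dom I1 d))" "e \<in> Arr I1" "Cod I1 e = k" "y \<in> Obj (C (Dom I1 e))"
    "a \<in> Arr (C k)" "Dom (C k) a = Fo d x" "Cod (C k) a = Fo e y" "((d, x), (e, y), a) \<in> Arr (T k)" "k \<in> Obj I1"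
    using assms by (auto simp: T_sel)
  have "((d, x), (e, y), a) \<cdot>\<^bsub>T k\<^esub> Phi (Id I1 k) d x = Phi (Id I1 k) e y \<cdot>\<^bsub>T k\<^esub> im (Id I1 k) a"
    by (subst T_decompose) (auto simp: T_sel(1-3))
  from arg_cong[OF this, of "germ k"] show ?thesis by (simp add: T_sel)
qed

end

section \<open>Universal property of the category of germs\<close>

locale germ_model_cocone = germ_model I F eo enc + cat_cocone I F X q
  for I :: "('i, 'd, 'e) twocat"
    and F :: "('i, 'd, 'e, ('u, 'u) cat, ('u, 'u, 'u, 'u) func, ('u, 'u, 'u, 'u) nt) psfun" and eo enc X q
begin

definition mediator :: "('u, 'u, 'u, 'u) func" where
  "mediator = \<lparr>Src = germ_cat, Tgt = X,
     OMap = (\<lambda>Y\<in>Obj germ_cat. let (i, x) = inv_into bobj eo Y in qo i x),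
     AMap = (\<lambda>\<alpha>\<in>Arr germ_cat. ev (fst (dec \<alpha>)) (snd (dec \<alpha>)))\<rparr>"

lemma mediator_sel [simp]:
  "Src mediator = germ_cat" "Tgt mediator = X"
  "i \<in> Obj I1 \<Longrightarrow> x \<in> Obj (C i) \<Longrightarrow> OMap mediator (germ_obj i x) = qo i x"
  using eo_inj germ_cat_obj[of i x] by (simp_all add: mediator_def germ_obj_def bobj_def)

lemma mediator_germ [simp]:
  assumes "k \<in> Obj I1" "f \<in> Arr (T k)"
  shows "AMap mediator (germ k f) = ev k f"
proof -
  obtain k' f' where r: "rep (k, f) = (k', f')" by (metis surj_pair)
  then have "(k', f') \<simeq> (k, f)" using rep_eq[of "(k, f)"] assms by simp
  then have "ev k' f' = ev k f" by (rule ev_germ_eq)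
  then show ?thesis using assms germ_hom(1)[of k f] r rep_reps[of "(k, f)"]
    by (simp add: mediator_def germ_def)
qed

lemma mediator_functor [simp]: "small_functor mediator"
proof -
  have "cat_functor mediator"
  proof (rule cat_functorI)
    fix Y assume "Y \<in> Obj (Src mediator)"
    then obtain i x where Y: "i \<in> Obj I1" "x \<in> Obj (C i)" "Y = germ_obj i x" by (auto elim: germ_cat_objE)
    then show "OMap mediator Y \<in> Obj (Tgt mediator)" by simp
    show "AMap mediator (Id (Src mediator) Y) = Id (Tgt mediator) (OMap mediator Y)"
      using Y germ_Id_stage[of i "Id I1 i" x, symmetric] by (simp del: germ_Id_stage)
  next
    fix \<alpha> assume "\<alpha> \<in> Arr (Src mediator)"
    then obtain k f where k: "k \<in> Obj I1" "f \<in> Arr (T k)" "\<alpha> = germ k f" by (auto elim: germ_cat_arrE)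
    obtain d x e y where de: "Dom (T k) f = (d, x)" "Cod (T k) f = (e, y)" by (metis surj_pair)
    show "AMap mediator \<alpha> \<in> hom (Tgt mediator) (OMap mediator (Dom (Src mediator) \<alpha>)) (OMap mediator (Cod (Src mediator) \<alpha>))"
      using k de T_ends[OF k(2) de] by (simp add: in_hom)
  next
    fix \<alpha> \<beta> assume "\<alpha> \<in> Arr (Src mediator)" "\<beta> \<in> Arr (Src mediator)" "Cod (Src mediator) \<alpha> = Dom (Src mediator) \<beta>"
    then obtain k f k' g where f: "k \<in> Obj I1" "f \<in> Arr (T k)" "\<alpha> = germ k f"
      and g: "k' \<in> Obj I1" "g \<in> Arr (T k')" "\<beta> = germ k' g" and fg: "Cod germ_cat \<alpha> = Dom germ_cat \<beta>"
      by (metis germ_cat_arrE mediator_sel(1))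
    obtain d x e y where de: "Dom (T k) f = (d, x)" "Cod (T k) f = (e, y)" by (metis surj_pair)
    obtain d' x' e' y' where de': "Dom (T k') g = (d', x')" "Cod (T k') g = (e', y')" by (metis surj_pair)
    have m: "Dom I1 d' = Dom I1 e" "x' = y"
      using fg f g de de' T_ends[OF f(2) de] T_ends[OF g(2) de'] by (auto simp: germ_obj_eq_iff)
    obtain m c where c: "germ_comp (k, f) (k', g) (m, c)"
      using germ_comp_exists[OF f(2) de g(2), of d' e' y'] m de' by (metis surj_pair)
    then have mc: "m \<in> Obj I1" "c \<in> Arr (T m)" by (cases rule: germ_compE; auto)+
    have "AMap mediator (\<beta> \<cdot>\<^bsub>germ_cat\<^esub> \<alpha>) = ev m c" using germ_Comp[OF c] f g mc by simp
    then show "AMap mediator (\<beta> \<cdot>\<^bsub>Src mediator\<^esub> \<alpha>) = AMap mediator \<beta> \<cdot>\<^bsub>Tgt mediator\<^esub> AMap mediator \<alpha>"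
      using ev_germ_comp[OF c] f g by simp
  qed (simp_all, simp_all add: mediator_def)
  then show ?thesis by (simp add: small_functor_def)
qed

text \<open>The factorisation is strict, since objects and arrows of the stages have explicit germs
  on which evaluation returns the legs and cells of \<open>q\<close>. Essential surjectivity of the
  comparison functor is therefore witnessed by identities.\<close>

lemma whisker_mediator: "whisker_cocone I Cat mediator germ_cocone = q"
proof (rule cocone_eqI[of I Cat F X])
  show "pseudococone I Cat F X (whisker_cocone I Cat mediator germ_cocone)"
    by (rule whisker_cocone_cocone) (use pseudococone_germ in simp_all)
  show "Leg (whisker_cocone I Cat mediator germ_cocone) i = Leg q i" if i: "i \<in> Obj I1" for i
  proof -
    have "AMap mediator (AMap (germ_leg i) a) = qa i a" if "a \<in> Arr (C i)" for a
      using germ_im[of "Id I1 i" i a, symmetric] that i by (simp del: germ_im)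
    then have "func_comp mediator (germ_leg i) = Leg q i"
      using i by (intro func_eqI) simp_all
    then show ?thesis using i by simp
  qed
  then have leg: "func_comp mediator (germ_leg i) = Leg q i" if "i \<in> Obj I1" for i using that by simp
  show "Cell (whisker_cocone I Cat mediator germ_cocone) d = Cell q d" if d [simp]: "d \<in> Arr I1" for d
  proof -
    have "nt_hcomp (nt_id mediator) (germ_cell d) = Cell q d"
    proof (rule nt_eqI)
      show "NSrc (nt_hcomp (nt_id mediator) (germ_cell d)) = NSrc (Cell q d)"
        by (simp add: leg flip: func_comp_assoc)
      fix x assume "x \<in> Obj (Src (NSrc (Cell q d)))"
      then show "NMap (nt_hcomp (nt_id mediator) (germ_cell d)) x = NMap (Cell q d) x"
        using germ_Phi[of d "Id I1 (Cod I1 d)" "Cod I1 d" x, symmetric] by (simp del: germ_Phi)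
    qed (simp_all add: leg)
    then show ?thesis by simp
  qed
qed (rule q)

end

context germ_model
begin

text \<open>Each object of \<open>germ_cat\<close> lies in the image of exactly one leg, so a
  transformation out of it is the same as its components along the legs; this gives faithfulness and
  the candidate for fullness. Naturality of the candidate is checked on the generators, where it
  says that the components along a leg are natural and that they respect the cells.\<close>

lemma weak_equivalence_germ:
  assumes X: "small_cat X"
  shows "weak_equivalence (cocone_action I Cat F germ_cat germ_cocone X)" (is "weak_equivalence ?W")
proof (rule weak_equivalenceI)
  note [simp] = X
  show "cat_functor ?W" by (rule cocone_action_functor) (use pseudococone_germ in simp_all)
  have arr: "\<sigma> \<in> Arr (homcat Cat germ_cat X) \<longleftrightarrow> nat_trans \<sigma> \<and> small_functor (NSrc \<sigma>) \<and> small_functor (NTgt \<sigma>) \<and>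
      Src (NSrc \<sigma>) = germ_cat \<and> Tgt (NSrc \<sigma>) = X" for \<sigma> :: "('u, 'u, 'u, 'u) nt"
    using Arr_homcat[OF two_cats(2)] by auto
  show "\<sigma> = \<tau>" if \<sigma>\<tau>: "\<sigma> \<in> Arr (Src ?W)" "\<tau> \<in> Arr (Src ?W)" "Dom (Src ?W) \<sigma> = Dom (Src ?W) \<tau>" "Cod (Src ?W) \<sigma> = Cod (Src ?W) \<tau>"
    and eq: "AMap ?W \<sigma> = AMap ?W \<tau>" for \<sigma> \<tau>
  proof (rule nt_eqI)
    show "nat_trans \<sigma>" "nat_trans \<tau>" "NSrc \<sigma> = NSrc \<tau>" "NTgt \<sigma> = NTgt \<tau>" using \<sigma>\<tau> by (auto simp: arr)
    fix Y assume "Y \<in> Obj (Src (NSrc \<tau>))"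
    then have "Y \<in> Obj germ_cat" using \<sigma>\<tau> by (simp add: arr)
    then obtain i x where [simp]: "i \<in> Obj I1" "x \<in> Obj (C i)" and Y: "Y = germ_obj i x"
      by (rule germ_cat_objE)
    have "NMap (MMap (AMap ?W \<sigma>) i) x = NMap (MMap (AMap ?W \<tau>) i) x" by (simp only: eq)
    then show "NMap \<sigma> Y = NMap \<tau> Y" using \<sigma>\<tau>(1,2) Y by (simp add: arr)
  qed
  show "\<exists>\<sigma>\<in>hom (Src ?W) f g. AMap ?W \<sigma> = m"
    if f0: "f \<in> Obj (Src ?W)" and g0: "g \<in> Obj (Src ?W)" and m0: "m \<in> hom (Tgt ?W) (OMap ?W f) (OMap ?W g)" for f g m
  proof -
    have f [simp]: "small_functor f" "Src f = germ_cat" "Tgt f = X" using f0 by (auto simp: in_hom)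
    have g [simp]: "small_functor g" "Src g = germ_cat" "Tgt g = X" using g0 by (auto simp: in_hom)
    have m: "modification I Cat F X m" "MSrc m = whisker_cocone I Cat f germ_cocone" "MTgt m = whisker_cocone I Cat g germ_cocone"
      using m0 f0 g0 by (auto simp: in_hom)
    define t where "t i = NMap (MMap m i)" for i
    have mi: "nat_trans (MMap m i)" "NSrc (MMap m i) = func_comp f (germ_leg i)" "NTgt (MMap m i) = func_comp g (germ_leg i)"
      if "i \<in> Obj I1" for i using modification_simps(3-5)[OF m(1) that] m(2,3) that by auto
    have t [simp]: "t i x \<in> Arr X" "Dom X (t i x) = OMap f (germ_obj i x)" "Cod X (t i x) = OMap g (germ_obj i x)"
      if "i \<in> Obj I1" "x \<in> Obj (C i)" for i x
      using nat_trans_NMap[OF mi(1)[OF that(1)], of X x] mi(2,3)[OF that(1)] that by (simp_all add: t_def)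
    have t_leg: "t i (Cod (C i) a) \<cdot>\<^bsub>X\<^esub> AMap f (AMap (germ_leg i) a) = AMap g (AMap (germ_leg i) a) \<cdot>\<^bsub>X\<^esub> t i (Dom (C i) a)"
      if "i \<in> Obj I1" "a \<in> Arr (C i)" for i a
      using nat_trans_natural[OF mi(1)[OF that(1)], of a] mi(2,3)[OF that(1)] that by (simp add: t_def)
    have t_cell: "t (Dom I1 d) x \<cdot>\<^bsub>X\<^esub> AMap f (NMap (germ_cell d) x) = AMap g (NMap (germ_cell d) x) \<cdot>\<^bsub>X\<^esub> t (Cod I1 d) (Fo d x)"
      if [simp]: "d \<in> Arr I1" "x \<in> Obj (C (Dom I1 d))" for d x
      using arg_cong[OF modification_Cell[OF m(1), of d], of "\<lambda>\<tau>. NMap \<tau> x"] m(2,3) mi by (simp add: t_def)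
    \<comment> \<open>Decoding the object selects the leg on which the component is prescribed by
      \<open>m\<close>.\<close>
    define \<tau> where "\<tau> = \<lparr>NSrc = f, NTgt = g, NMap = (\<lambda>Y\<in>Obj germ_cat. let (i, x) = inv_into bobj eo Y in t i x)\<rparr>"
    have \<tau>_obj [simp]: "NMap \<tau> (germ_obj i x) = t i x" if "i \<in> Obj I1" "x \<in> Obj (C i)" for i x
      using that eo_inj germ_cat_obj[of i x] by (simp add: \<tau>_def germ_obj_def bobj_def)
    have [simp]: "NSrc \<tau> = f" "NTgt \<tau> = g" by (simp_all add: \<tau>_def)
    have \<tau>: "nat_trans \<tau>"
    proof (rule nat_transI)
      show "NMap \<tau> Y \<in> hom (Tgt (NSrc \<tau>)) (OMap (NSrc \<tau>) Y) (OMap (NTgt \<tau>) Y)" if "Y \<in> Obj (Src (NSrc \<tau>))" for Y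
      proof -
        have "Y \<in> Obj germ_cat" using that by simp
        then obtain i x where "i \<in> Obj I1" "x \<in> Obj (C i)" "Y = germ_obj i x" by (rule germ_cat_objE)
        then show ?thesis by (simp add: in_hom)
      qed
      show "NMap \<tau> (Cod (Src (NSrc \<tau>)) \<alpha>) \<cdot>\<^bsub>Tgt (NSrc \<tau>)\<^esub> AMap (NSrc \<tau>) \<alpha> =
          AMap (NTgt \<tau>) \<alpha> \<cdot>\<^bsub>Tgt (NSrc \<tau>)\<^esub> NMap \<tau> (Dom (Src (NSrc \<tau>)) \<alpha>)" if "\<alpha> \<in> Arr (Src (NSrc \<tau>))" for \<alpha>
      proof -
        have "\<alpha> \<in> Arr germ_cat" using that by simp
        then obtain k h where k [simp]: "k \<in> Obj I1" and h: "h \<in> Arr (T k)" and \<alpha>: "\<alpha> = germ k h"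
          by (rule germ_cat_arrE)
        obtain d x e y a where h_eq: "h = ((d, x), (e, y), a)" and [simp]: "d \<in> Arr I1" "Cod I1 d = k" "x \<in> Obj (C (Dom I1 d))"
          "e \<in> Arr I1" "Cod I1 e = k" "y \<in> Obj (C (Dom I1 e))" "a \<in> Arr (C k)" "Dom (C k) a = Fo d x" "Cod (C k) a = Fo e y"
          using h by (rule Arr_T_cases)
        note [simp] = germ_leg_hom[of k a]
        have \<alpha>' [simp]: "\<alpha> \<in> Arr germ_cat" "Dom germ_cat \<alpha> = germ_obj (Dom I1 d) x" "Cod germ_cat \<alpha> = germ_obj (Dom I1 e) y"
          using h by (simp_all add: \<alpha>, simp_all add: h_eq T_sel)
        have dec: "\<alpha> \<cdot>\<^bsub>germ_cat\<^esub> NMap (germ_cell d) x = NMap (germ_cell e) y \<cdot>\<^bsub>germ_cat\<^esub> AMap (germ_leg k) a"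
          using germ_decompose[OF k h[unfolded h_eq]] by (simp add: \<alpha> h_eq)
        have "t (Dom I1 e) y \<cdot>\<^bsub>X\<^esub> AMap f \<alpha> = AMap g \<alpha> \<cdot>\<^bsub>X\<^esub> t (Dom I1 d) x"
        \<comment> \<open>Composed with the cell at the source, the germ becomes a cell after an
          arrow of a leg, and each of the two factors is covered by \<open>t_cell\<close> or
          \<open>t_leg\<close>.\<close>
        proof (rule iso_cancel_right[of X "AMap f (NMap (germ_cell d) x)"])
          have "t (Dom I1 e) y \<cdot>\<^bsub>X\<^esub> AMap f \<alpha> \<cdot>\<^bsub>X\<^esub> AMap f (NMap (germ_cell d) x)
            = t (Dom I1 e) y \<cdot>\<^bsub>X\<^esub> AMap f (\<alpha> \<cdot>\<^bsub>germ_cat\<^esub> NMap (germ_cell d) x)" by simp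
          also have "\<dots> = t (Dom I1 e) y \<cdot>\<^bsub>X\<^esub> AMap f (NMap (germ_cell e) y) \<cdot>\<^bsub>X\<^esub> AMap f (AMap (germ_leg k) a)"
            unfolding dec by simp
          also have "\<dots> = AMap g (NMap (germ_cell e) y) \<cdot>\<^bsub>X\<^esub> (t k (Fo e y) \<cdot>\<^bsub>X\<^esub> AMap f (AMap (germ_leg k) a))"
            using t_cell[of e y] by simp
          also have "t k (Fo e y) \<cdot>\<^bsub>X\<^esub> AMap f (AMap (germ_leg k) a) = AMap g (AMap (germ_leg k) a) \<cdot>\<^bsub>X\<^esub> t k (Fo d x)"
            using t_leg[of k a] by simp
          also have "AMap g (NMap (germ_cell e) y) \<cdot>\<^bsub>X\<^esub> (AMap g (AMap (germ_leg k) a) \<cdot>\<^bsub>X\<^esub> t k (Fo d x))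
            = AMap g (NMap (germ_cell e) y \<cdot>\<^bsub>germ_cat\<^esub> AMap (germ_leg k) a) \<cdot>\<^bsub>X\<^esub> t k (Fo d x)" by simp
          also have "\<dots> = AMap g \<alpha> \<cdot>\<^bsub>X\<^esub> (AMap g (NMap (germ_cell d) x) \<cdot>\<^bsub>X\<^esub> t k (Fo d x))"
            unfolding dec[symmetric] by simp
          also have "\<dots> = AMap g \<alpha> \<cdot>\<^bsub>X\<^esub> t (Dom I1 d) x \<cdot>\<^bsub>X\<^esub> AMap f (NMap (germ_cell d) x)"
            using t_cell[of d x] by simp
          finally show "t (Dom I1 e) y \<cdot>\<^bsub>X\<^esub> AMap f \<alpha> \<cdot>\<^bsub>X\<^esub> AMap f (NMap (germ_cell d) x) =
            AMap g \<alpha> \<cdot>\<^bsub>X\<^esub> t (Dom I1 d) x \<cdot>\<^bsub>X\<^esub> AMap f (NMap (germ_cell d) x)" .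
        qed simp_all
        then show ?thesis by simp
      qed
    qed (simp_all, simp add: \<tau>_def)
    have \<tau>_arr: "\<tau> \<in> Arr (homcat Cat germ_cat X)" using \<tau> by (simp add: arr)
    have "AMap ?W \<tau> = m"
    proof (rule modification_eqI[of I Cat F X])
      show "modification I Cat F X (AMap ?W \<tau>)" using \<tau>_arr pseudococone_germ by simp
      fix i assume i: "i \<in> Obj I1"
      have "nt_hcomp \<tau> (nt_id (germ_leg i)) = MMap m i"
        by (rule nt_eqI) (use i \<tau> mi in \<open>auto simp: t_def\<close>)
      then show "MMap (AMap ?W \<tau>) i = MMap m i" using \<tau>_arr i by simp
    qed (use \<tau>_arr m in simp_all)
    then show ?thesis using \<tau>_arr by (intro bexI[of _ \<tau>]) (auto simp: in_hom)
  qed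
  show "\<exists>f\<in>Obj (Src ?W). \<exists>m\<in>hom (Tgt ?W) (OMap ?W f) r. is_iso (Tgt ?W) m" if "r \<in> Obj (Tgt ?W)" for r
  proof -
    have r: "pseudococone I Cat F X r" using that by simp
    interpret M: germ_model_cocone I F eo enc X r
      by (intro germ_model_cocone.intro germ_model_axioms cat_cocone.intro cat_cocone_axioms.intro cat_diagram_axioms r)
    have "M.mediator \<in> hom (Cells1 Cat) germ_cat X" by (simp add: in_hom)
    then show ?thesis
      using r M.whisker_mediator category_pscocones[of X] Id_hom(1)[of "pscocones I Cat F X" r]
      by (intro bexI[of _ M.mediator] bexI[of _ "Id (pscocones I Cat F X) r"]) (auto simp: in_hom)
  qed
qed

theorem is_bicolimit_germ: "is_bicolimit I Cat F germ_cat germ_cocone"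
  by (rule bicolimitI) (use pseudococone_germ weak_equivalence_germ in simp_all)

end

section \<open>Comparing bicolimits\<close>

context pseudofunctor
begin

lemma modification_iso_MMap:
  assumes "is_iso (pscocones I B F X) m" "i \<in> Obj (Cells1 I)"
  shows "is_iso (Cells2 B) (MMap m i)"
proof -
  let ?n = "inverse_arr (pscocones I B F X) m"
  have m: "modification I B F X m" using is_iso_Arr[OF assms(1)] by simp
  have n: "modification I B F X ?n" using inverse_arr(1)[OF assms(1)] by simp
  have mn: "MSrc ?n = MTgt m" "MTgt ?n = MSrc m" using inverse_arr(2,3)[OF assms(1)] by simp_all
  note [simp] = modification_simps[OF m] modification_simps[OF n] mn assms(2)
  show ?thesis
    using arg_cong[OF inverse_arr(4)[OF assms(1)], of "\<lambda>p. MMap p i"] arg_cong[OF inverse_arr(5)[OF assms(1)], of "\<lambda>p. MMap p i"]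
    by (intro is_isoI[of _ _ "MMap ?n i"]) simp_all
qed

text \<open>Whiskering \<open>q\<close> with \<open>f g\<close> gives a pseudococone isomorphic to
  \<open>q\<close>, via \<open>n\<close> whiskered by \<open>f\<close> and then \<open>m\<close>.
  The identity of \<open>L\<close> whiskers \<open>q\<close> to itself, and full faithfulness lifts
  the isomorphism to a 2-cell.\<close>

lemma bicolimit_endo:
  assumes bc: "is_bicolimit I B F L q" and q': "pseudococone I B F L' q'"
    and f: "f \<in> hom (Cells1 B) L' L" and g: "g \<in> hom (Cells1 B) L L'"
    and m: "m \<in> hom (pscocones I B F L) (whisker_cocone I B f q') q" "is_iso (pscocones I B F L) m"
    and n: "n \<in> hom (pscocones I B F L') (whisker_cocone I B g q) q'" "is_iso (pscocones I B F L') n"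
  shows "\<exists>\<epsilon>. \<epsilon> \<in> hom (Cells2 B) (f \<circ>\<^bsub>B\<^esub> g) (Id (Cells1 B) L) \<and> is_iso (Cells2 B) \<epsilon>"
proof -
  let ?W = "cocone_action I B F L q L" and ?P = "pscocones I B F L"
  note q = bicolimitD(1)[OF bc]
  note f' [simp] = f[unfolded in_hom] and g' [simp] = g[unfolded in_hom]
  note [simp] = cocone_simps(1)[OF q] cocone_simps(1)[OF q'] q q'
  let ?fn = "AMap (cocone_post1 I B F f) n"
  have n': "modification I B F L' n" "MSrc n = whisker_cocone I B g q" "MTgt n = q'" using n by (auto simp: in_hom)
  have fn: "is_iso ?P ?fn" by (rule functor_iso) (use n in simp_all)
  have fn': "Dom ?P ?fn = whisker_cocone I B (f \<circ>\<^bsub>B\<^esub> g) q" "Cod ?P ?fn = whisker_cocone I B f q'"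
    using n' by (simp_all add: whisker_cocone_comp)
  have m': "m \<in> Arr ?P" "Dom ?P m = whisker_cocone I B f q'" "Cod ?P m = q" using m by (auto simp: in_hom)
  have "is_iso ?P (m \<cdot>\<^bsub>?P\<^esub> ?fn)"
    by (rule is_iso_Comp) (use fn fn' m(2) m' in simp_all)
  moreover have "m \<cdot>\<^bsub>?P\<^esub> ?fn \<in> hom ?P (whisker_cocone I B (f \<circ>\<^bsub>B\<^esub> g) q) q"
    using Comp_hom[of ?P ?fn m] is_iso_Arr[OF fn] fn' m' by (simp add: in_hom)
  moreover have fg: "f \<circ>\<^bsub>B\<^esub> g \<in> hom (Cells1 B) L L" "Id (Cells1 B) L \<in> hom (Cells1 B) L L" by (simp_all add: in_hom)
  ultimately have "\<exists>\<epsilon>\<in>hom (Src ?W) (f \<circ>\<^bsub>B\<^esub> g) (Id (Cells1 B) L). is_iso (Src ?W) \<epsilon> \<and> AMap ?W \<epsilon> = m \<cdot>\<^bsub>?P\<^esub> ?fn"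
    by (intro weak_equivalence_full_iso[OF bicolimitD(2)[OF bc]]) simp_all
  then show ?thesis using fg(1) by (auto simp: hom_homcat is_iso_homcat)
qed

text \<open>Two bicolimits are equivalent, each factoring through the other. The isomorphism
  \<open>m\<close> is retained because the germ conditions concern the inclusions as well as the
  vertex, and \<open>m\<close> relates the two families of inclusions.\<close>

lemma bicolimit_comparison:
  assumes bc: "is_bicolimit I B F L q" and bc': "is_bicolimit I B F L' q'"
  shows "\<exists>f g m \<eta> \<epsilon>. f \<in> hom (Cells1 B) L' L \<and> g \<in> hom (Cells1 B) L L' \<and>
    m \<in> hom (pscocones I B F L) (whisker_cocone I B f q') q \<and> is_iso (pscocones I B F L) m \<and>
    \<eta> \<in> hom (Cells2 B) (Id (Cells1 B) L') (g \<circ>\<^bsub>B\<^esub> f) \<and> is_iso (Cells2 B) \<eta> \<and>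
    \<epsilon> \<in> hom (Cells2 B) (f \<circ>\<^bsub>B\<^esub> g) (Id (Cells1 B) L) \<and> is_iso (Cells2 B) \<epsilon>"
proof -
  note q = bicolimitD(1)[OF bc] and q' = bicolimitD(1)[OF bc']
  have L: "L \<in> Obj (Cells1 B)" "L' \<in> Obj (Cells1 B)" using cocone_simps(1)[OF q] cocone_simps(1)[OF q'] by auto
  obtain f m where f: "f \<in> hom (Cells1 B) L' L"
    and m: "m \<in> hom (pscocones I B F L) (whisker_cocone I B f q') q" "is_iso (pscocones I B F L) m"
    using weak_equivalenceD(4)[OF bicolimitD(2)[OF bc' L(1)], of q] q by auto
  obtain g n where g: "g \<in> hom (Cells1 B) L L'"
    and n: "n \<in> hom (pscocones I B F L') (whisker_cocone I B g q) q'" "is_iso (pscocones I B F L') n"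
    using weak_equivalenceD(4)[OF bicolimitD(2)[OF bc L(2)], of q'] q' by auto
  obtain \<epsilon> where \<epsilon>: "\<epsilon> \<in> hom (Cells2 B) (f \<circ>\<^bsub>B\<^esub> g) (Id (Cells1 B) L)" "is_iso (Cells2 B) \<epsilon>"
    using bicolimit_endo[OF bc q' f g m n] by blast
  obtain \<eta> where \<eta>: "\<eta> \<in> hom (Cells2 B) (g \<circ>\<^bsub>B\<^esub> f) (Id (Cells1 B) L')" "is_iso (Cells2 B) \<eta>"
    using bicolimit_endo[OF bc' q g f n m] by blast
  have "inverse_arr (Cells2 B) \<eta> \<in> hom (Cells2 B) (Id (Cells1 B) L') (g \<circ>\<^bsub>B\<^esub> f)" using \<eta> by (auto simp: in_hom)
  then show ?thesis using f g m \<epsilon> is_iso_inverse[OF \<eta>(2)] by blast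
qed

end

lemma equivalence_CatI:
  assumes f: "f \<in> hom (Cells1 Cat) A B" and g: "g \<in> hom (Cells1 Cat) B A"
    and \<eta>: "\<eta> \<in> hom (Cells2 Cat) (Id (Cells1 Cat) A) (g \<circ>\<^bsub>Cat\<^esub> f)" "is_iso (Cells2 Cat) \<eta>"
    and \<epsilon>: "\<epsilon> \<in> hom (Cells2 Cat) (f \<circ>\<^bsub>Cat\<^esub> g) (Id (Cells1 Cat) B)" "is_iso (Cells2 Cat) \<epsilon>"
  shows "weak_equivalence f"
proof (rule is_equivalence_weak_equivalence)
  have "nat_trans \<eta>" "small_functor (NSrc \<eta>)" "small_functor (NTgt \<eta>)" using \<eta> by (auto simp: in_hom)
  then have 1: "nat_iso \<eta>" using \<eta>(2) by (simp only: is_iso_Cat_iff)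
  have "nat_trans \<epsilon>" "small_functor (NSrc \<epsilon>)" "small_functor (NTgt \<epsilon>)" using \<epsilon> by (auto simp: in_hom)
  then have 2: "nat_iso \<epsilon>" using \<epsilon>(2) by (simp only: is_iso_Cat_iff)
  show "is_equivalence f"
    unfolding is_equivalence_def
    by (intro conjI exI[of _ g] exI[of _ \<eta>] exI[of _ \<epsilon>]) (use f g 1 2 \<eta>(1) \<epsilon>(1) in \<open>auto simp: in_hom\<close>)
qed

text \<open>The three conditions characterise the bicolimits of \<open>F\<close> in \<open>Cat\<close> among the pseudococones.\<close>

locale germ_colimit = cat_cocone I F X q
  for I :: "('i, 'd, 'e) twocat"
    and F :: "('i, 'd, 'e, ('u, 'u) cat, ('u, 'u, 'u, 'u) func, ('u, 'u, 'u, 'u) nt) psfun" and X q +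
  assumes obj_repr: "Y \<in> Obj X \<Longrightarrow> \<exists>i x h. i \<in> Obj I1 \<and> x \<in> Obj (C i) \<and> h \<in> hom X (qo i x) Y \<and> is_iso X h"
    and arr_repr: "\<lbrakk>i \<in> Obj I1; j \<in> Obj I1; x \<in> Obj (C i); y \<in> Obj (C j); h \<in> hom X (qo i x) (qo j y)\<rbrakk> \<Longrightarrow>
      \<exists>k d e f. f \<in> Arr (T k) \<and> Dom (T k) f = (d, x) \<and> Cod (T k) f = (e, y) \<and> Dom I1 d = i \<and> Dom I1 e = j \<and> ev k f = h"
    and ev_faithful: "\<lbrakk>k \<in> Obj I1; f \<in> Arr (T k); g \<in> Arr (T k); Dom (T k) f = Dom (T k) g; Cod (T k) f = Cod (T k) g;
      ev k f = ev k g\<rbrakk> \<Longrightarrow> \<exists>u. u \<in> Arr I1 \<and> Dom I1 u = k \<and> push u f = push u g"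

context germ_model
begin

text \<open>The conditions hold for the category of germs essentially by construction. An
  equivalence compatible with the inclusions up to the isomorphisms \<open>t\<close> carries them to
  an arbitrary bicolimit.\<close>

lemma germ_colimit_bicolimit:
  assumes bc: "is_bicolimit I Cat F L q"
  shows "germ_colimit I F L q"
proof -
  have q: "pseudococone I Cat F L q" by (rule bicolimitD(1)[OF bc])
  interpret Q: cat_cocone I F L q
    by (intro cat_cocone.intro cat_cocone_axioms.intro cat_diagram_axioms q)
  obtain f g m \<eta> \<epsilon> where f: "f \<in> hom (Cells1 Cat) germ_cat L" and g: "g \<in> hom (Cells1 Cat) L germ_cat"
    and m: "m \<in> hom (pscocones I Cat F L) (whisker_cocone I Cat f germ_cocone) q" "is_iso (pscocones I Cat F L) m"
    and \<eta>: "\<eta> \<in> hom (Cells2 Cat) (Id (Cells1 Cat) germ_cat) (g \<circ>\<^bsub>Cat\<^esub> f)" "is_iso (Cells2 Cat) \<eta>"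
    and \<epsilon>: "\<epsilon> \<in> hom (Cells2 Cat) (f \<circ>\<^bsub>Cat\<^esub> g) (Id (Cells1 Cat) L)" "is_iso (Cells2 Cat) \<epsilon>"
    using bicolimit_comparison[OF bc is_bicolimit_germ] by blast
  have fw: "weak_equivalence f" by (rule equivalence_CatI[OF f g \<eta> \<epsilon>])
  have f' [simp]: "small_functor f" "Src f = germ_cat" "Tgt f = L" using f by (auto simp: in_hom)
  have m': "modification I Cat F L m" "MSrc m = whisker_cocone I Cat f germ_cocone" "MTgt m = q"
    using m by (auto simp: in_hom)
  have mi: "nat_iso (MMap m i)" "NSrc (MMap m i) = func_comp f (germ_leg i)" "NTgt (MMap m i) = Leg q i" if "i \<in> Obj I1" for i
  proof -
    show *: "NSrc (MMap m i) = func_comp f (germ_leg i)" "NTgt (MMap m i) = Leg q i"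
      using modification_simps(4,5)[OF m'(1) that] m'(2,3) that by auto
    have "nat_trans (MMap m i)" using modification_simps(3)[OF m'(1) that] by simp
    then show "nat_iso (MMap m i)"
      using modification_iso_MMap[OF m(2) that] is_iso_Cat_iff[of "MMap m i"] * that by simp
  qed
  define t where "t i = NMap (MMap m i)" for i
  have t [simp]: "t i x \<in> Arr L" "Dom L (t i x) = OMap f (germ_obj i x)" "Cod L (t i x) = Q.qo i x" "is_iso L (t i x)"
    if "i \<in> Obj I1" "x \<in> Obj (C i)" for i x
    using nat_trans_NMap[of "MMap m i" L x] nat_iso_NMap[of "MMap m i" L x] mi[OF that(1)] that by (simp_all add: t_def)
  have t_leg: "t i (Cod (C i) a) \<cdot>\<^bsub>L\<^esub> AMap f (AMap (germ_leg i) a) = Q.qa i a \<cdot>\<^bsub>L\<^esub> t i (Dom (C i) a)"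
    if "i \<in> Obj I1" "a \<in> Arr (C i)" for i a
    using nat_trans_natural[of "MMap m i" a] mi[OF that(1)] that by (simp add: t_def)
  have t_cell: "t (Dom I1 d) x \<cdot>\<^bsub>L\<^esub> AMap f (NMap (germ_cell d) x) = Q.cell d x \<cdot>\<^bsub>L\<^esub> t (Cod I1 d) (Fo d x)"
    if [simp]: "d \<in> Arr I1" "x \<in> Obj (C (Dom I1 d))" for d x
    using arg_cong[OF modification_Cell[OF m'(1), of d], of "\<lambda>\<tau>. NMap \<tau> x"] m'(2,3) mi by (simp add: t_def)
  \<comment> \<open>Evaluation along \<open>q\<close> is, up to conjugation by \<open>t\<close>, the
    image under \<open>f\<close> of the germ. With this, each of the remaining conditions becomes
    one about germs and \<open>f\<close>.\<close>
  have t_ev: "Q.ev k h \<cdot>\<^bsub>L\<^esub> t (Dom I1 d) x = t (Dom I1 e) y \<cdot>\<^bsub>L\<^esub> AMap f (germ k h)"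
    if k [simp]: "k \<in> Obj I1" and h: "h \<in> Arr (T k)" "Dom (T k) h = (d, x)" "Cod (T k) h = (e, y)" for k h d x e y
  proof (rule iso_cancel_right[of L "AMap f (NMap (germ_cell d) x)"])
    obtain a where h_eq: "h = ((d, x), (e, y), a)" using h(2,3) by (cases h) (auto simp: T_sel)
    have [simp]: "d \<in> Arr I1" "Cod I1 d = k" "x \<in> Obj (C (Dom I1 d))" "e \<in> Arr I1" "Cod I1 e = k" "y \<in> Obj (C (Dom I1 e))"
      "a \<in> Arr (C k)" "Dom (C k) a = Fo d x" "Cod (C k) a = Fo e y" using h(1) by (auto simp: h_eq T_sel)
    note [simp] = germ_leg_hom[of k a] h
    have dec: "germ k h \<cdot>\<^bsub>germ_cat\<^esub> NMap (germ_cell d) x = NMap (germ_cell e) y \<cdot>\<^bsub>germ_cat\<^esub> AMap (germ_leg k) a"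
      using germ_decompose[OF k h(1)[unfolded h_eq]] by (simp add: h_eq)
    have "Q.ev k h \<cdot>\<^bsub>L\<^esub> t (Dom I1 d) x \<cdot>\<^bsub>L\<^esub> AMap f (NMap (germ_cell d) x) = Q.ev k h \<cdot>\<^bsub>L\<^esub> Q.cell d x \<cdot>\<^bsub>L\<^esub> t k (Fo d x)"
      using t_cell[of d x] by simp
    also have "Q.ev k h \<cdot>\<^bsub>L\<^esub> Q.cell d x = Q.cell e y \<cdot>\<^bsub>L\<^esub> Q.qa k a"
      using Q.ev_cell[OF k h(1)[unfolded h_eq]] by (simp add: h_eq)
    also have "\<dots> \<cdot>\<^bsub>L\<^esub> t k (Fo d x) = Q.cell e y \<cdot>\<^bsub>L\<^esub> t k (Fo e y) \<cdot>\<^bsub>L\<^esub> AMap f (AMap (germ_leg k) a)"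
      using t_leg[of k a] by simp
    also have "\<dots> = t (Dom I1 e) y \<cdot>\<^bsub>L\<^esub> AMap f (NMap (germ_cell e) y \<cdot>\<^bsub>germ_cat\<^esub> AMap (germ_leg k) a)"
      using t_cell[of e y, symmetric] by simp
    also have "\<dots> = t (Dom I1 e) y \<cdot>\<^bsub>L\<^esub> AMap f (germ k h) \<cdot>\<^bsub>L\<^esub> AMap f (NMap (germ_cell d) x)"
      unfolding dec[symmetric] by simp
    finally show "Q.ev k h \<cdot>\<^bsub>L\<^esub> t (Dom I1 d) x \<cdot>\<^bsub>L\<^esub> AMap f (NMap (germ_cell d) x) =
      t (Dom I1 e) y \<cdot>\<^bsub>L\<^esub> AMap f (germ k h) \<cdot>\<^bsub>L\<^esub> AMap f (NMap (germ_cell d) x)" .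
  qed (use h T_ends[OF h] in simp_all)
  show ?thesis
  proof (intro germ_colimit.intro germ_colimit_axioms.intro Q.cat_cocone_axioms)
    fix Y assume "Y \<in> Obj L"
    then obtain Z h where Z: "Z \<in> Obj germ_cat" and h: "h \<in> hom L (OMap f Z) Y" "is_iso L h"
      using weak_equivalenceD(4)[OF fw, of Y] by auto
    obtain i x where ix: "i \<in> Obj I1" "x \<in> Obj (C i)" "Z = germ_obj i x" using Z by (rule germ_cat_objE)
    then show "\<exists>i x h. i \<in> Obj I1 \<and> x \<in> Obj (C i) \<and> h \<in> hom L (Q.qo i x) Y \<and> is_iso L h"
      using h by (intro exI[of _ i] exI[of _ x] exI[of _ "h \<cdot>\<^bsub>L\<^esub> inverse_arr L (t i x)"]) (auto simp: in_hom)
  next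
    fix i j x y h assume ij [simp]: "i \<in> Obj I1" "j \<in> Obj I1" "x \<in> Obj (C i)" "y \<in> Obj (C j)"
      and h0: "h \<in> hom L (Q.qo i x) (Q.qo j y)"
    note h [simp] = h0[unfolded in_hom]
    have "inverse_arr L (t j y) \<cdot>\<^bsub>L\<^esub> (h \<cdot>\<^bsub>L\<^esub> t i x) \<in> hom (Tgt f) (OMap f (germ_obj i x)) (OMap f (germ_obj j y))"
      by (simp add: in_hom)
    then obtain \<alpha> where \<alpha>: "\<alpha> \<in> hom germ_cat (germ_obj i x) (germ_obj j y)"
      "AMap f \<alpha> = inverse_arr L (t j y) \<cdot>\<^bsub>L\<^esub> (h \<cdot>\<^bsub>L\<^esub> t i x)"
      using weak_equivalenceD(3)[OF fw, of "germ_obj i x" "germ_obj j y"] by auto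
    then have "\<alpha> \<in> Arr germ_cat" by (simp add: in_hom)
    then obtain k a where k: "k \<in> Obj I1" "a \<in> Arr (T k)" "\<alpha> = germ k a" by (rule germ_cat_arrE)
    obtain d x' e y' where de: "Dom (T k) a = (d, x')" "Cod (T k) a = (e, y')" by (metis surj_pair)
    note ends = T_ends[OF k(2) de]
    have same: "Dom I1 d = i" "x' = x" "Dom I1 e = j" "y' = y"
      using \<alpha>(1) k de ends by (auto simp: in_hom germ_obj_eq_iff)
    have "Q.ev k a = h"
      by (rule iso_cancel_right[of L "t i x"]) (use t_ev[OF k(1,2) de] k \<alpha> same de in auto)
    then show "\<exists>k d e f. f \<in> Arr (T k) \<and> Dom (T k) f = (d, x) \<and> Cod (T k) f = (e, y) \<and> Dom I1 d = i \<and> Dom I1 e = j \<and> Q.ev k f = h"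
      using k de same by blast
  next
    fix k a b assume k: "k \<in> Obj I1" and a: "a \<in> Arr (T k)" and b: "b \<in> Arr (T k)"
      and par: "Dom (T k) a = Dom (T k) b" "Cod (T k) a = Cod (T k) b" and eq: "Q.ev k a = Q.ev k b"
    obtain d x e y where de: "Dom (T k) a = (d, x)" "Cod (T k) a = (e, y)" by (metis surj_pair)
    note ends = T_ends[OF a de]
    have de': "Dom (T k) b = (d, x)" "Cod (T k) b = (e, y)" using par de by auto
    have "AMap f (germ k a) = AMap f (germ k b)"
      by (rule iso_cancel_left[of L "t (Dom I1 e) y"])
        (use t_ev[OF k a de] t_ev[OF k b de'] eq de de' ends k a b in auto)
    then have "germ k a = germ k b"
      by (rule weak_equivalenceD(2)[OF fw, rotated 4]) (use k a b de de' in simp_all)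
    then show "\<exists>u. u \<in> Arr I1 \<and> Dom I1 u = k \<and> push u a = push u b"
      by (rule germ_parallel_eq[OF k a b par])
  qed
qed

end

section \<open>Properties that hold from some stage on\<close>

context cat_diagram
begin

text \<open>Invariance under invertible 2-cells is included because two stages beyond
  \<open>k\<close> can be merged only up to such a 2-cell; persistence alone would not let several
  properties be combined.\<close>

definition stable :: "'i \<Rightarrow> ('d \<Rightarrow> bool) \<Rightarrow> bool" where
  "stable k P \<longleftrightarrow> (\<forall>u v. u \<in> Arr I1 \<and> Dom I1 u = k \<and> v \<in> Arr I1 \<and> Dom I1 v = Cod I1 u \<and> P u \<longrightarrow> P (v \<circ>\<^bsub>I\<^esub> u)) \<and>
     (\<forall>\<sigma>. is_iso I2 \<sigma> \<and> Dom I1 (Dom I2 \<sigma>) = k \<and> P (Dom I2 \<sigma>) \<longrightarrow> P (Cod I2 \<sigma>)) \<and>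
     (\<exists>u. u \<in> Arr I1 \<and> Dom I1 u = k \<and> P u)"

text \<open>A stage for the properties treated so far and one for the new property are completed to
  a square. The new property persists along one side of the square and crosses its 2-cell to the
  other.\<close>

lemma stable_finite:
  assumes "finite S" "\<And>s. s \<in> S \<Longrightarrow> stable k (P s)" and k: "k \<in> Obj I1"
  shows "\<exists>u. u \<in> Arr I1 \<and> Dom I1 u = k \<and> (\<forall>s\<in>S. P s u)"
  using assms(1,2)
proof (induction S)
  case empty
  then show ?case using k by (intro exI[of _ "Id I1 k"]) simp
next
  case (insert s S)
  obtain u where u: "u \<in> Arr I1" "Dom I1 u = k" "\<forall>s\<in>S. P s u" using insert by auto
  obtain w where w: "w \<in> Arr I1" "Dom I1 w = k" "P s w" using insert.prems[of s] unfolding stable_def by auto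
  obtain a b \<sigma> where ab: "a \<in> Arr I1" "Dom I1 a = Cod I1 u" "b \<in> Arr I1" "Dom I1 b = Cod I1 w" "Cod I1 b = Cod I1 a"
    "is_iso I2 \<sigma>" "Dom I2 \<sigma> = a \<circ>\<^bsub>I\<^esub> u" "Cod I2 \<sigma> = b \<circ>\<^bsub>I\<^esub> w"
    by (rule iso_squareE[of u w]) (use u w in auto)
  have "P s (b \<circ>\<^bsub>I\<^esub> w)" using insert.prems[of s] w ab unfolding stable_def by auto
  \<comment> \<open>The square leads from the side of \<open>u\<close> to that of \<open>w\<close>,
    so its inverse is the 2-cell along which the property has to be moved.\<close>
  then have "P s (Cod I2 (inverse_arr I2 \<sigma>))"
    using insert.prems[of s] w ab is_iso_inverse[OF ab(6)] unfolding stable_def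
    by (metis Comp_hom(2) insertI1 inverse_arr(2) two_category_simps(1) two_category_I)
  then have "P s (a \<circ>\<^bsub>I\<^esub> u)" using ab by simp
  moreover have "P t (a \<circ>\<^bsub>I\<^esub> u)" if "t \<in> S" for t
    using insert.prems[of t] that u ab unfolding stable_def by auto
  ultimately show ?case using u ab by (intro exI[of _ "a \<circ>\<^bsub>I\<^esub> u"]) auto
qed

end

section \<open>Lifting finitely many arrows and equations to one stage\<close>

context germ_colimit
begin

text \<open>Lifts persist by pushing and cross an invertible 2-cell by conjugation with
  \<open>K\<close>, which evaluation ignores. A first lift comes from \<open>arr_repr\<close>, but
  its ends may be presented by other 1-cells than those in \<open>Z\<close> and
  \<open>W\<close>.\<close>

lemma stable_lift:
  assumes k [simp]: "k \<in> Obj I1" and ZW: "Z \<in> Obj (T k)" "W \<in> Obj (T k)" and h: "h \<in> hom X (evo Z) (evo W)"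
  shows "stable k (\<lambda>u. \<exists>f\<in>hom (T (Cod I1 u)) (push_obj u Z) (push_obj u W). ev (Cod I1 u) f = h)"
proof -
  obtain d x e y where Z: "Z = (d, x)" and W: "W = (e, y)" by (metis surj_pair)
  have [simp]: "d \<in> Arr I1" "Cod I1 d = k" "x \<in> Obj (C (Dom I1 d))" "e \<in> Arr I1" "Cod I1 e = k" "y \<in> Obj (C (Dom I1 e))"
    using ZW Z W by auto
  let ?P = "\<lambda>u. \<exists>f\<in>hom (T (Cod I1 u)) (push_obj u Z) (push_obj u W). ev (Cod I1 u) f = h"
  have 1: "?P (v \<circ>\<^bsub>I\<^esub> u)" if uv: "u \<in> Arr I1" "Dom I1 u = k" "v \<in> Arr I1" "Dom I1 v = Cod I1 u" and P: "?P u" for u v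
  proof -
    from P obtain f where "f \<in> hom (T (Cod I1 u)) (push_obj u Z) (push_obj u W)" "ev (Cod I1 u) f = h" ..
    then show ?thesis using uv by (intro bexI[of _ "push v f"]) (auto simp: in_hom Z W)
  qed
  have 2: "?P (Cod I2 \<sigma>)" if \<sigma> [simp]: "is_iso I2 \<sigma>" "Dom I1 (Dom I2 \<sigma>) = k" and P: "?P (Dom I2 \<sigma>)" for \<sigma>
  proof -
    have [simp]: "\<sigma> \<in> Arr I2" by (rule is_iso_Arr) simp
    from P obtain f where f: "f \<in> hom (T (Cod I1 (Dom I2 \<sigma>))) (push_obj (Dom I2 \<sigma>) Z) (push_obj (Dom I2 \<sigma>) W)" "ev (Cod I1 (Dom I2 \<sigma>)) f = h" ..
    note f' [simp] = f(1)[unfolded in_hom Z W push_obj_simps]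
    let ?m = "Cod I1 (Dom I2 \<sigma>)"
    let ?f = "K (\<sigma> \<lhd>\<^bsub>I\<^esub> e) y \<cdot>\<^bsub>T ?m\<^esub> (f \<cdot>\<^bsub>T ?m\<^esub> K (inverse_arr I2 \<sigma> \<lhd>\<^bsub>I\<^esub> d) x)"
    have "h \<in> Arr X" "Dom X h = evo Z" "Cod X h = evo W" using h by (auto simp: in_hom)
    then show ?thesis
      by (intro bexI[of _ ?f]) (use f(2) in \<open>auto simp: in_hom Z W\<close>)
  qed
  have 3: "\<exists>u. u \<in> Arr I1 \<and> Dom I1 u = k \<and> ?P u"
  proof -
    obtain k' d' e' f where f: "f \<in> Arr (T k')" "Dom (T k') f = (d', x)" "Cod (T k') f = (e', y)"
      "Dom I1 d' = Dom I1 d" "Dom I1 e' = Dom I1 e" "ev k' f = h"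
      using arr_repr[of "Dom I1 d" "Dom I1 e" x y h] h by (auto simp: Z W)
    note [simp] = T_ends[OF f(1-3)] f
    obtain s t \<sigma> where [simp]: "s \<in> Arr I1" "Dom I1 s = k" "t \<in> Arr I1" "Dom I1 t = k'" "Cod I1 t = Cod I1 s"
      "is_iso I2 \<sigma>" "Dom I2 \<sigma> = s \<circ>\<^bsub>I\<^esub> d" "Cod I2 \<sigma> = t \<circ>\<^bsub>I\<^esub> d'"
      by (rule iso_squareE[of d d']) auto
    \<comment> \<open>The sources have just been matched by a square over \<open>d\<close> and
      \<open>d'\<close>; going one step further with \<open>coinsert\<close> also matches the
      targets.\<close>
    obtain w \<tau> where [simp]: "w \<in> Arr I1" "Dom I1 w = Cod I1 s" "is_iso I2 \<tau>" "Dom I2 \<tau> = w \<circ>\<^bsub>I\<^esub> (t \<circ>\<^bsub>I\<^esub> e')" "Cod I2 \<tau> = w \<circ>\<^bsub>I\<^esub> (s \<circ>\<^bsub>I\<^esub> e)"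
      by (rule coinsertE[of "t \<circ>\<^bsub>I\<^esub> e'" "s \<circ>\<^bsub>I\<^esub> e"]) auto
    have [simp]: "\<sigma> \<in> Arr I2" "\<tau> \<in> Arr I2" by (auto intro: is_iso_Arr)
    have "h \<in> Arr X" "Dom X h = evo Z" "Cod X h = evo W" using h by (auto simp: in_hom)
    then show ?thesis
      by (intro exI[of _ "w \<circ>\<^bsub>I\<^esub> s"] conjI bexI[of _ "K \<tau> y \<cdot>\<^bsub>T (Cod I1 w)\<^esub> (push (w \<circ>\<^bsub>I\<^esub> t) f \<cdot>\<^bsub>T (Cod I1 w)\<^esub> K (w \<rhd>\<^bsub>I\<^esub> \<sigma>) x)"])
        (auto simp: in_hom Z W)
  qed
  show ?thesis unfolding stable_def using 1 2 3 by blast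
qed

text \<open>The initial stage is given by \<open>ev_faithful\<close>. The equality crosses an
  invertible 2-cell because \<open>K\<close> is natural and its component at the source can be
  cancelled.\<close>

lemma stable_push_eq:
  assumes k [simp]: "k \<in> Obj I1" and f: "f \<in> Arr (T k)" and g: "g \<in> Arr (T k)"
    and par: "Dom (T k) f = Dom (T k) g" "Cod (T k) f = Cod (T k) g" and eq: "ev k f = ev k g"
  shows "stable k (\<lambda>u. push u f = push u g)"
proof -
  obtain d x e y where de: "Dom (T k) f = (d, x)" "Cod (T k) f = (e, y)" by (metis surj_pair)
  note [simp] = T_ends[OF f de] f g de par[symmetric]
  have 1: "push (v \<circ>\<^bsub>I\<^esub> u) f = push (v \<circ>\<^bsub>I\<^esub> u) g"
    if "u \<in> Arr I1" "Dom I1 u = k" "v \<in> Arr I1" "Dom I1 v = Cod I1 u" "push u f = push u g" for u v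
    using arg_cong[OF that(5), of "push v"] that(1-4) by simp
  have 2: "push (Cod I2 \<sigma>) f = push (Cod I2 \<sigma>) g"
    if \<sigma> [simp]: "is_iso I2 \<sigma>" "Dom I1 (Dom I2 \<sigma>) = k" and eq: "push (Dom I2 \<sigma>) f = push (Dom I2 \<sigma>) g" for \<sigma>
  proof -
    have [simp]: "\<sigma> \<in> Arr I2" by (rule is_iso_Arr) simp
    let ?T = "T (Cod I1 (Dom I2 \<sigma>))"
    have "push (Cod I2 \<sigma>) f \<cdot>\<^bsub>?T\<^esub> K (\<sigma> \<lhd>\<^bsub>I\<^esub> d) x = K (\<sigma> \<lhd>\<^bsub>I\<^esub> e) y \<cdot>\<^bsub>?T\<^esub> push (Dom I2 \<sigma>) f"
      by (rule K_square[of _ _ _ _ k, symmetric]) simp_all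
    also have "\<dots> = push (Cod I2 \<sigma>) g \<cdot>\<^bsub>?T\<^esub> K (\<sigma> \<lhd>\<^bsub>I\<^esub> d) x"
      unfolding eq by (rule K_square[of _ _ _ _ k]) simp_all
    finally show ?thesis
      by (intro iso_cancel_right[of ?T "K (\<sigma> \<lhd>\<^bsub>I\<^esub> d) x" "push (Cod I2 \<sigma>) f" "push (Cod I2 \<sigma>) g"]) simp_all
  qed
  show ?thesis unfolding stable_def using 1 2 ev_faithful[OF k f g par eq] by blast
qed

text \<open>\<open>H\<close> lists the arrows of \<open>X\<close> to be lifted, with presentations
  of their ends at \<open>k\<close>; \<open>A\<close> lists arrows of \<open>T k\<close> whose
  values must lift to themselves. Lifts exist at a common stage but need not respect composition
  there. The expected equations are finitely many and hold after evaluation, so they hold after one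
  more push.\<close>

lemma finite_lift:
  assumes k [simp]: "k \<in> Obj I1" and H: "finite H" "\<And>Z W h. (Z, W, h) \<in> H \<Longrightarrow> Z \<in> Obj (T k) \<and> W \<in> Obj (T k) \<and> h \<in> hom X (evo Z) (evo W)"
    and A: "finite A" "A \<subseteq> Arr (T k)"
  obtains u r where "u \<in> Arr I1" "Dom I1 u = k"
    "\<And>Z W h. (Z, W, h) \<in> H \<Longrightarrow> r Z W h \<in> hom (T (Cod I1 u)) (push_obj u Z) (push_obj u W) \<and> ev (Cod I1 u) (r Z W h) = h"
    "\<And>Z W V g h. (Z, W, h) \<in> H \<Longrightarrow> (W, V, g) \<in> H \<Longrightarrow> (Z, V, g \<cdot>\<^bsub>X\<^esub> h) \<in> H \<Longrightarrow>
       r Z V (g \<cdot>\<^bsub>X\<^esub> h) = r W V g \<cdot>\<^bsub>T (Cod I1 u)\<^esub> r Z W h"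
    "\<And>Z. (Z, Z, Id X (evo Z)) \<in> H \<Longrightarrow> r Z Z (Id X (evo Z)) = Id (T (Cod I1 u)) (push_obj u Z)"
    "\<And>a. a \<in> A \<Longrightarrow> (Dom (T k) a, Cod (T k) a, ev k a) \<in> H \<Longrightarrow> r (Dom (T k) a) (Cod (T k) a) (ev k a) = push u a"
proof -
  have "\<exists>u. u \<in> Arr I1 \<and> Dom I1 u = k \<and>
    (\<forall>s\<in>H. \<exists>f\<in>hom (T (Cod I1 u)) (push_obj u (fst s)) (push_obj u (fst (snd s))). ev (Cod I1 u) f = snd (snd s))"
  proof (rule stable_finite[OF H(1) _ k])
    fix s assume "s \<in> H"
    then show "stable k (\<lambda>u. \<exists>f\<in>hom (T (Cod I1 u)) (push_obj u (fst s)) (push_obj u (fst (snd s))). ev (Cod I1 u) f = snd (snd s))"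
      using stable_lift[of k "fst s" "fst (snd s)" "snd (snd s)"] H(2)[of "fst s" "fst (snd s)" "snd (snd s)"] k by auto
  qed
  then obtain u r0 where u [simp]: "u \<in> Arr I1" "Dom I1 u = k"
    and r0: "\<And>s. s \<in> H \<Longrightarrow> r0 s \<in> hom (T (Cod I1 u)) (push_obj u (fst s)) (push_obj u (fst (snd s))) \<and> ev (Cod I1 u) (r0 s) = snd (snd s)"
    by metis
  let ?m = "Cod I1 u" and ?T = "T (Cod I1 u)"
  have r1 [simp]: "r0 (Z, W, h) \<in> Arr ?T" "Dom ?T (r0 (Z, W, h)) = push_obj u Z" "Cod ?T (r0 (Z, W, h)) = push_obj u W"
    "ev ?m (r0 (Z, W, h)) = h" if "(Z, W, h) \<in> H" for Z W h using r0[OF that] by (auto simp: in_hom)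
  \<comment> \<open>The pairs of parallel arrows to be made equal: composites, identities and
    prescribed lifts. Only composites that are themselves listed in \<open>H\<close> occur, which
    keeps the set finite.\<close>
  define S where "S = {(r0 (Z, V, g \<cdot>\<^bsub>X\<^esub> h), r0 (W, V, g) \<cdot>\<^bsub>?T\<^esub> r0 (Z, W, h)) | Z W V g h.
      (Z, W, h) \<in> H \<and> (W, V, g) \<in> H \<and> (Z, V, g \<cdot>\<^bsub>X\<^esub> h) \<in> H} \<union>
    {(r0 (Z, Z, Id X (evo Z)), Id ?T (push_obj u Z)) | Z. (Z, Z, Id X (evo Z)) \<in> H} \<union>
    {(r0 (Dom (T k) a, Cod (T k) a, ev k a), push u a) | a. a \<in> A \<and> (Dom (T k) a, Cod (T k) a, ev k a) \<in> H}"
  have "finite S"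
  proof -
    have "S \<subseteq> (\<lambda>((Z, W, h), (W', V, g)). (r0 (Z, V, g \<cdot>\<^bsub>X\<^esub> h), r0 (W', V, g) \<cdot>\<^bsub>?T\<^esub> r0 (Z, W, h))) ` (H \<times> H) \<union>
      (\<lambda>(Z, W, h). (r0 (Z, Z, Id X (evo Z)), Id ?T (push_obj u Z))) ` H \<union>
      (\<lambda>a. (r0 (Dom (T k) a, Cod (T k) a, ev k a), push u a)) ` A"
      unfolding S_def by (intro Un_mono subsetI) (force simp: image_iff)+
    then show ?thesis using H(1) A(1) by (auto intro: finite_subset)
  qed
  \<comment> \<open>The two members of a pair have the same value in \<open>X\<close>, so each
    equation is of the kind treated by \<open>stable_push_eq\<close>.\<close>
  have S: "stable ?m (\<lambda>v. push v (fst s) = push v (snd s))" if "s \<in> S" for s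
  proof -
    have hh: "Z \<in> Obj (T k)" "W \<in> Obj (T k)" "h \<in> Arr X" "Dom X h = evo Z" "Cod X h = evo W" if "(Z, W, h) \<in> H" for Z W h
      using H(2)[OF that] by (auto simp: in_hom)
    from that consider (comp) Z W V g h where "(Z, W, h) \<in> H" "(W, V, g) \<in> H" "(Z, V, g \<cdot>\<^bsub>X\<^esub> h) \<in> H"
        "s = (r0 (Z, V, g \<cdot>\<^bsub>X\<^esub> h), r0 (W, V, g) \<cdot>\<^bsub>?T\<^esub> r0 (Z, W, h))"
      | (id) Z where "(Z, Z, Id X (evo Z)) \<in> H" "s = (r0 (Z, Z, Id X (evo Z)), Id ?T (push_obj u Z))"
      | (arr) a where "a \<in> A" "(Dom (T k) a, Cod (T k) a, ev k a) \<in> H" "s = (r0 (Dom (T k) a, Cod (T k) a, ev k a), push u a)"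
      unfolding S_def by auto
    then show ?thesis
    proof cases
      case comp
      then show ?thesis by (intro stable_push_eq) simp_all
    next
      case id
      then show ?thesis using hh[OF id(1)] by (intro stable_push_eq) simp_all
    next
      case arr
      then have a: "a \<in> Arr (T k)" using A by auto
      show ?thesis
        unfolding arr(3) fst_conv snd_conv
        by (rule stable_push_eq) (use a r1[OF arr(2)] in \<open>simp_all only: u push_hom ev_push C1.Cod_in\<close>)
    qed
  qed
  have "\<exists>v. v \<in> Arr I1 \<and> Dom I1 v = ?m \<and> (\<forall>s\<in>S. push v (fst s) = push v (snd s))"
    by (rule stable_finite[OF \<open>finite S\<close> S]) simp_all
  then obtain v where v [simp]: "v \<in> Arr I1" "Dom I1 v = ?m" and eq: "\<And>s. s \<in> S \<Longrightarrow> push v (fst s) = push v (snd s)"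
    by blast
  have Comp: "push v (r0 (Z, V, g \<cdot>\<^bsub>X\<^esub> h)) = push v (r0 (W, V, g)) \<cdot>\<^bsub>T (Cod I1 v)\<^esub> push v (r0 (Z, W, h))"
    if "(Z, W, h) \<in> H" "(W, V, g) \<in> H" "(Z, V, g \<cdot>\<^bsub>X\<^esub> h) \<in> H" for Z W V g h
  proof -
    have "(r0 (Z, V, g \<cdot>\<^bsub>X\<^esub> h), r0 (W, V, g) \<cdot>\<^bsub>?T\<^esub> r0 (Z, W, h)) \<in> S"
      unfolding S_def using that by blast
    from eq[OF this] show ?thesis using that by simp
  qed
  have Ident: "push v (r0 (Z, Z, Id X (evo Z))) = Id (T (Cod I1 v)) (push_obj (v \<circ>\<^bsub>I\<^esub> u) Z)"
    if "(Z, Z, Id X (evo Z)) \<in> H" for Z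
  proof -
    have Z: "Z \<in> Obj (T k)" using H(2)[OF that] by simp
    have "push_obj v (push_obj u Z) = push_obj (v \<circ>\<^bsub>I\<^esub> u) Z" using Z by (cases Z) simp
    moreover have "(r0 (Z, Z, Id X (evo Z)), Id ?T (push_obj u Z)) \<in> S"
      unfolding S_def using that by blast
    from eq[OF this] have "push v (r0 (Z, Z, Id X (evo Z))) = push v (Id ?T (push_obj u Z))" by simp
    ultimately show ?thesis using Z by simp
  qed
  have Given: "push v (r0 (Dom (T k) a, Cod (T k) a, ev k a)) = push (v \<circ>\<^bsub>I\<^esub> u) a"
    if "a \<in> A" "(Dom (T k) a, Cod (T k) a, ev k a) \<in> H" for a
  proof -
    have "a \<in> Arr (T k)" using A that by auto
    moreover have "(r0 (Dom (T k) a, Cod (T k) a, ev k a), push u a) \<in> S"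
      unfolding S_def using that by blast
    from eq[OF this] have "push v (r0 (Dom (T k) a, Cod (T k) a, ev k a)) = push v (push u a)" by simp
    ultimately show ?thesis by simp
  qed
  have Hom: "push v (r0 (Z, W, h)) \<in> hom (T (Cod I1 v)) (push_obj (v \<circ>\<^bsub>I\<^esub> u) Z) (push_obj (v \<circ>\<^bsub>I\<^esub> u) W) \<and>
      ev (Cod I1 v) (push v (r0 (Z, W, h))) = h" if "(Z, W, h) \<in> H" for Z W h
  proof -
    have ZW: "Z \<in> Obj (T k)" "W \<in> Obj (T k)" using H(2)[OF that] by simp_all
    have "push_obj v (push_obj u Z) = push_obj (v \<circ>\<^bsub>I\<^esub> u) Z" "push_obj v (push_obj u W) = push_obj (v \<circ>\<^bsub>I\<^esub> u) W"
      using ZW by (cases Z, cases W, simp)+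
    then show ?thesis using that by (simp add: in_hom)
  qed
  show thesis
    by (rule that[of "v \<circ>\<^bsub>I\<^esub> u" "\<lambda>Z W h. push v (r0 (Z, W, h))"]) (use Comp Ident Given Hom in simp_all)
qed

end

section \<open>Finite limits\<close>

lemma is_coneI:
  assumes "x \<in> Obj (Tgt D)" "\<And>j. j \<in> Obj (Src D) \<Longrightarrow> \<pi> j \<in> hom (Tgt D) x (OMap D j)"
    "\<And>u. u \<in> Arr (Src D) \<Longrightarrow> AMap D u \<cdot>\<^bsub>Tgt D\<^esub> \<pi> (Dom (Src D) u) = \<pi> (Cod (Src D) u)"
  shows "is_cone D x \<pi>"
  using assms by (simp add: is_cone_def)

lemma is_coneD:
  assumes "is_cone D x \<pi>"
  shows "x \<in> Obj (Tgt D)" "j \<in> Obj (Src D) \<Longrightarrow> \<pi> j \<in> Arr (Tgt D)" "j \<in> Obj (Src D) \<Longrightarrow> Dom (Tgt D) (\<pi> j) = x"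
    "j \<in> Obj (Src D) \<Longrightarrow> Cod (Tgt D) (\<pi> j) = OMap D j"
    "u \<in> Arr (Src D) \<Longrightarrow> AMap D u \<cdot>\<^bsub>Tgt D\<^esub> \<pi> (Dom (Src D) u) = \<pi> (Cod (Src D) u)"
  using assms by (auto simp: is_cone_def in_hom)

lemma is_limitI:
  assumes "is_cone D x \<pi>"
    "\<And>y \<rho>. is_cone D y \<rho> \<Longrightarrow> \<exists>h. h \<in> hom (Tgt D) y x \<and> (\<forall>j \<in> Obj (Src D). \<pi> j \<cdot>\<^bsub>Tgt D\<^esub> h = \<rho> j)"
    "\<And>y h h'. \<lbrakk>h \<in> hom (Tgt D) y x; h' \<in> hom (Tgt D) y x;
      \<And>j. j \<in> Obj (Src D) \<Longrightarrow> \<pi> j \<cdot>\<^bsub>Tgt D\<^esub> h = \<pi> j \<cdot>\<^bsub>Tgt D\<^esub> h'\<rbrakk> \<Longrightarrow> h = h'"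
  shows "is_limit D x \<pi>"
  unfolding is_limit_def
proof (intro conjI allI impI assms(1))
  fix y \<rho> assume "is_cone D y \<rho>"
  then obtain h where "h \<in> hom (Tgt D) y x \<and> (\<forall>j \<in> Obj (Src D). \<pi> j \<cdot>\<^bsub>Tgt D\<^esub> h = \<rho> j)" using assms(2) by blast
  then show "\<exists>!h. h \<in> hom (Tgt D) y x \<and> (\<forall>j \<in> Obj (Src D). \<pi> j \<cdot>\<^bsub>Tgt D\<^esub> h = \<rho> j)"
    using assms(3)[of _ y] by (intro ex1I[of _ h]) simp_all
qed

lemma is_limit_cone: "is_limit D x \<pi> \<Longrightarrow> is_cone D x \<pi>"
  by (simp add: is_limit_def)

lemma is_limit_ex:
  assumes "is_limit D x \<pi>" "is_cone D y \<rho>"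
  obtains h where "h \<in> hom (Tgt D) y x" "\<And>j. j \<in> Obj (Src D) \<Longrightarrow> \<pi> j \<cdot>\<^bsub>Tgt D\<^esub> h = \<rho> j"
  using assms unfolding is_limit_def by blast

lemma cone_comp:
  assumes D: "cat_functor D" and \<pi>: "is_cone D x \<pi>" and h: "h \<in> hom (Tgt D) y x"
  shows "is_cone D y (\<lambda>j. \<pi> j \<cdot>\<^bsub>Tgt D\<^esub> h)"
proof (rule is_coneI)
  note [simp] = D h[unfolded in_hom] is_coneD[OF \<pi>]
  show "y \<in> Obj (Tgt D)" using Dom_Obj[of "Tgt D" h] by simp
  show "AMap D u \<cdot>\<^bsub>Tgt D\<^esub> (\<pi> (Dom (Src D) u) \<cdot>\<^bsub>Tgt D\<^esub> h) = \<pi> (Cod (Src D) u) \<cdot>\<^bsub>Tgt D\<^esub> h"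
    if "u \<in> Arr (Src D)" for u
    using that is_coneD(5)[OF \<pi> that] by (simp flip: Comp_assoc)
qed (use D h is_coneD[OF \<pi>] in \<open>auto simp: in_hom\<close>)

lemma is_limit_eqI:
  assumes D: "cat_functor D" and l: "is_limit D x \<pi>" and h: "h \<in> hom (Tgt D) y x" "h' \<in> hom (Tgt D) y x"
    and eq: "\<And>j. j \<in> Obj (Src D) \<Longrightarrow> \<pi> j \<cdot>\<^bsub>Tgt D\<^esub> h = \<pi> j \<cdot>\<^bsub>Tgt D\<^esub> h'"
  shows "h = h'"
proof -
  have "is_cone D y (\<lambda>j. \<pi> j \<cdot>\<^bsub>Tgt D\<^esub> h')" by (rule cone_comp[OF D is_limit_cone[OF l] h(2)])
  then have "\<exists>!h. h \<in> hom (Tgt D) y x \<and> (\<forall>j \<in> Obj (Src D). \<pi> j \<cdot>\<^bsub>Tgt D\<^esub> h = \<pi> j \<cdot>\<^bsub>Tgt D\<^esub> h')"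
    using l unfolding is_limit_def by blast
  then show ?thesis using h eq by blast
qed

lemma is_limit_cong:
  assumes "is_limit D x \<pi>" "\<And>j. j \<in> Obj (Src D) \<Longrightarrow> \<pi>' j = \<pi> j" "cat_functor D"
  shows "is_limit D x \<pi>'"
proof -
  have "is_cone D x \<pi>'" using is_limit_cone[OF assms(1)] assms(2,3) by (simp add: is_cone_def)
  then show ?thesis using assms unfolding is_limit_def by simp
qed

text \<open>Composition with \<open>t\<close> and with its inverses converts cones over one diagram
  into cones over the other and does not touch the mediating arrows.\<close>

lemma is_limit_diagram_iso:
  assumes D [simp]: "cat_functor D" "cat_functor D'" "Src D' = Src D" "Tgt D' = Tgt D" and l: "is_limit D x \<pi>"
    and t: "\<And>j. j \<in> Obj (Src D) \<Longrightarrow> t j \<in> hom (Tgt D) (OMap D j) (OMap D' j) \<and> is_iso (Tgt D) (t j)"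
    and nat: "\<And>u. u \<in> Arr (Src D) \<Longrightarrow>
      t (Cod (Src D) u) \<cdot>\<^bsub>Tgt D\<^esub> AMap D u = AMap D' u \<cdot>\<^bsub>Tgt D\<^esub> t (Dom (Src D) u)"
  shows "is_limit D' x (\<lambda>j. t j \<cdot>\<^bsub>Tgt D\<^esub> \<pi> j)"
proof (rule is_limitI)
  let ?X = "Tgt D" and ?J = "Src D"
  have t' [simp]: "t j \<in> Arr ?X" "Dom ?X (t j) = OMap D j" "Cod ?X (t j) = OMap D' j" "is_iso ?X (t j)" if "j \<in> Obj ?J" for j
    using t[OF that] by (auto simp: in_hom)
  note \<pi> [simp] = is_coneD(1-4)[OF is_limit_cone[OF l]]
  show "is_cone D' x (\<lambda>j. t j \<cdot>\<^bsub>?X\<^esub> \<pi> j)"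
  proof (rule is_coneI)
    fix u assume "u \<in> Arr (Src D')"
    then have u: "u \<in> Arr ?J" by simp
    then have "AMap D' u \<cdot>\<^bsub>?X\<^esub> (t (Dom ?J u) \<cdot>\<^bsub>?X\<^esub> \<pi> (Dom ?J u)) = t (Cod ?J u) \<cdot>\<^bsub>?X\<^esub> (AMap D u \<cdot>\<^bsub>?X\<^esub> \<pi> (Dom ?J u))"
      by (intro Comp_square nat[OF u, symmetric]) simp_all
    then show "AMap D' u \<cdot>\<^bsub>Tgt D'\<^esub> (t (Dom (Src D') u) \<cdot>\<^bsub>?X\<^esub> \<pi> (Dom (Src D') u)) = t (Cod (Src D') u) \<cdot>\<^bsub>?X\<^esub> \<pi> (Cod (Src D') u)"
      using is_coneD(5)[OF is_limit_cone[OF l] u] by simp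
  qed (auto simp: in_hom)
  fix y \<rho> assume \<rho>: "is_cone D' y \<rho>"
  note \<rho>' [simp] = is_coneD(1-4)[OF \<rho>, simplified]
  have "is_cone D y (\<lambda>j. inverse_arr ?X (t j) \<cdot>\<^bsub>?X\<^esub> \<rho> j)"
  proof (rule is_coneI)
    fix u assume u [simp]: "u \<in> Arr ?J"
    have "t (Cod ?J u) \<cdot>\<^bsub>?X\<^esub> (AMap D u \<cdot>\<^bsub>?X\<^esub> (inverse_arr ?X (t (Dom ?J u)) \<cdot>\<^bsub>?X\<^esub> \<rho> (Dom ?J u)))
      = AMap D' u \<cdot>\<^bsub>?X\<^esub> (t (Dom ?J u) \<cdot>\<^bsub>?X\<^esub> (inverse_arr ?X (t (Dom ?J u)) \<cdot>\<^bsub>?X\<^esub> \<rho> (Dom ?J u)))"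
      by (intro Comp_square nat[OF u]) simp_all
    also have "\<dots> = \<rho> (Cod ?J u)" using is_coneD(5)[OF \<rho>, of u] by simp
    finally show "AMap D u \<cdot>\<^bsub>?X\<^esub> (inverse_arr ?X (t (Dom ?J u)) \<cdot>\<^bsub>?X\<^esub> \<rho> (Dom ?J u)) = inverse_arr ?X (t (Cod ?J u)) \<cdot>\<^bsub>?X\<^esub> \<rho> (Cod ?J u)"
      by - (rule iso_cancel_left[of ?X "t (Cod ?J u)"], simp_all)
  qed (auto simp: in_hom)
  from is_limit_ex[OF l this] obtain h where h: "h \<in> hom ?X y x"
    "\<And>j. j \<in> Obj ?J \<Longrightarrow> \<pi> j \<cdot>\<^bsub>?X\<^esub> h = inverse_arr ?X (t j) \<cdot>\<^bsub>?X\<^esub> \<rho> j" by blast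
  note [simp] = h(1)[unfolded in_hom]
  have "t j \<cdot>\<^bsub>?X\<^esub> \<pi> j \<cdot>\<^bsub>?X\<^esub> h = \<rho> j" if "j \<in> Obj ?J" for j using h(2)[OF that] that by simp
  then show "\<exists>h. h \<in> hom (Tgt D') y x \<and> (\<forall>j\<in>Obj (Src D'). t j \<cdot>\<^bsub>?X\<^esub> \<pi> j \<cdot>\<^bsub>Tgt D'\<^esub> h = \<rho> j)"
    using h(1) by (intro exI[of _ h]) simp
next
  let ?X = "Tgt D" and ?J = "Src D"
  have t' [simp]: "t j \<in> Arr ?X" "Dom ?X (t j) = OMap D j" "Cod ?X (t j) = OMap D' j" "is_iso ?X (t j)" if "j \<in> Obj ?J" for j
    using t[OF that] by (auto simp: in_hom)
  note \<pi> [simp] = is_coneD(1-4)[OF is_limit_cone[OF l]]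
  fix y h h' assume "h \<in> hom (Tgt D') y x" "h' \<in> hom (Tgt D') y x"
    and eq: "\<And>j. j \<in> Obj (Src D') \<Longrightarrow> t j \<cdot>\<^bsub>?X\<^esub> \<pi> j \<cdot>\<^bsub>Tgt D'\<^esub> h = t j \<cdot>\<^bsub>?X\<^esub> \<pi> j \<cdot>\<^bsub>Tgt D'\<^esub> h'"
  then have h: "h \<in> hom ?X y x" "h' \<in> hom ?X y x" by simp_all
  note [simp] = h[unfolded in_hom]
  show "h = h'"
  proof (rule is_limit_eqI[OF D(1) l h])
    fix j assume j: "j \<in> Obj ?J"
    then have "t j \<cdot>\<^bsub>?X\<^esub> (\<pi> j \<cdot>\<^bsub>?X\<^esub> h) = t j \<cdot>\<^bsub>?X\<^esub> (\<pi> j \<cdot>\<^bsub>?X\<^esub> h')" using eq[of j] by simp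
    then show "\<pi> j \<cdot>\<^bsub>?X\<^esub> h = \<pi> j \<cdot>\<^bsub>?X\<^esub> h'" by - (rule iso_cancel_left[of ?X "t j"], use j in simp_all)
  qed
qed

lemma is_limit_apex_iso:
  assumes D [simp]: "cat_functor D" and l: "is_limit D x \<pi>" and g: "g \<in> hom (Tgt D) x' x" "is_iso (Tgt D) g"
  shows "is_limit D x' (\<lambda>j. \<pi> j \<cdot>\<^bsub>Tgt D\<^esub> g)"
proof (rule is_limitI)
  let ?X = "Tgt D"
  note [simp] = is_coneD(1-4)[OF is_limit_cone[OF l]] g[unfolded in_hom]
  show "is_cone D x' (\<lambda>j. \<pi> j \<cdot>\<^bsub>?X\<^esub> g)" by (rule cone_comp[OF D is_limit_cone[OF l] g(1)])
  show "\<exists>h. h \<in> hom ?X y x' \<and> (\<forall>j\<in>Obj (Src D). \<pi> j \<cdot>\<^bsub>?X\<^esub> g \<cdot>\<^bsub>?X\<^esub> h = \<rho> j)" if "is_cone D y \<rho>" for y \<rho>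
  proof -
    obtain h where h: "h \<in> hom ?X y x" "\<And>j. j \<in> Obj (Src D) \<Longrightarrow> \<pi> j \<cdot>\<^bsub>?X\<^esub> h = \<rho> j"
      using is_limit_ex[OF l \<open>is_cone D y \<rho>\<close>] by blast
    then show ?thesis by (intro exI[of _ "inverse_arr ?X g \<cdot>\<^bsub>?X\<^esub> h"]) (auto simp: in_hom)
  qed
  show "h = h'" if h: "h \<in> hom ?X y x'" "h' \<in> hom ?X y x'"
    and eq: "\<And>j. j \<in> Obj (Src D) \<Longrightarrow> \<pi> j \<cdot>\<^bsub>?X\<^esub> g \<cdot>\<^bsub>?X\<^esub> h = \<pi> j \<cdot>\<^bsub>?X\<^esub> g \<cdot>\<^bsub>?X\<^esub> h'" for y h h'
  proof -
    note [simp] = h[unfolded in_hom]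
    have "g \<cdot>\<^bsub>?X\<^esub> h = g \<cdot>\<^bsub>?X\<^esub> h'"
      by (rule is_limit_eqI[OF D l, of _ y]) (use eq in \<open>auto simp: in_hom\<close>)
    then show ?thesis by - (rule iso_cancel_left[of ?X g], simp_all)
  qed
qed

lemma is_limit_unique:
  assumes D [simp]: "cat_functor D" and l: "is_limit D x \<pi>" and l': "is_limit D x' \<pi>'"
  obtains g where "g \<in> hom (Tgt D) x' x" "is_iso (Tgt D) g" "\<And>j. j \<in> Obj (Src D) \<Longrightarrow> \<pi> j \<cdot>\<^bsub>Tgt D\<^esub> g = \<pi>' j"
proof -
  let ?X = "Tgt D"
  note [simp] = is_coneD(1-4)[OF is_limit_cone[OF l]] is_coneD(1-4)[OF is_limit_cone[OF l']]
  obtain g where g: "g \<in> hom ?X x' x" "\<And>j. j \<in> Obj (Src D) \<Longrightarrow> \<pi> j \<cdot>\<^bsub>?X\<^esub> g = \<pi>' j"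
    using is_limit_ex[OF l is_limit_cone[OF l']] by blast
  obtain h where h: "h \<in> hom ?X x x'" "\<And>j. j \<in> Obj (Src D) \<Longrightarrow> \<pi>' j \<cdot>\<^bsub>?X\<^esub> h = \<pi> j"
    using is_limit_ex[OF l' is_limit_cone[OF l]] by blast
  note [simp] = g(1)[unfolded in_hom] h(1)[unfolded in_hom]
  have 1: "h \<cdot>\<^bsub>?X\<^esub> g = Id ?X x'"
    by (rule is_limit_eqI[OF D l', of _ x'])
      (use g h in \<open>auto simp: in_hom simp flip: Comp_assoc\<close>)
  have 2: "g \<cdot>\<^bsub>?X\<^esub> h = Id ?X x"
    by (rule is_limit_eqI[OF D l, of _ x])
      (use g h in \<open>auto simp: in_hom simp flip: Comp_assoc\<close>)
  have "is_iso ?X g" by (rule is_isoI[of _ _ h]) (simp_all add: 1 2)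
  with g show ?thesis by (intro that)
qed

text \<open>Limit cones over a diagram differ by an isomorphism of their apices, which
  \<open>G\<close> preserves. Hence preservation may be tested on a single conveniently chosen
  limit.\<close>

lemma preserves_limit_transfer:
  assumes D [simp]: "cat_functor D" and G [simp]: "cat_functor G" "Tgt D = Src G" and l: "is_limit D x \<pi>" and l': "is_limit D x' \<pi>'"
    and Gl: "is_limit (func_comp G D) (OMap G x) (\<lambda>j. AMap G (\<pi> j))"
  shows "is_limit (func_comp G D) (OMap G x') (\<lambda>j. AMap G (\<pi>' j))"
proof -
  obtain g where g: "g \<in> hom (Tgt D) x' x" "is_iso (Tgt D) g" "\<And>j. j \<in> Obj (Src D) \<Longrightarrow> \<pi> j \<cdot>\<^bsub>Tgt D\<^esub> g = \<pi>' j"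
    using is_limit_unique[OF D l l'] by blast
  note [simp] = g(1)[unfolded in_hom] is_coneD(1-4)[OF is_limit_cone[OF l]]
  have "is_limit (func_comp G D) (OMap G x') (\<lambda>j. AMap G (\<pi> j) \<cdot>\<^bsub>Tgt (func_comp G D)\<^esub> AMap G g)"
    by (rule is_limit_apex_iso[OF _ Gl]) (use g(1,2) in \<open>auto simp: in_hom\<close>)
  then show ?thesis
  proof (rule is_limit_cong)
    fix j assume j: "j \<in> Obj (Src (func_comp G D))"
    then have "AMap G (\<pi>' j) = AMap G (\<pi> j \<cdot>\<^bsub>Src G\<^esub> g)" using g(3)[of j] by simp
    also have "\<dots> = AMap G (\<pi> j) \<cdot>\<^bsub>Tgt G\<^esub> AMap G g"
      using j is_coneD(2-4)[OF is_limit_cone[OF l], of j] g(1) by (intro functor_Comp) (auto simp: in_hom)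
    finally show "AMap G (\<pi>' j) = AMap G (\<pi> j) \<cdot>\<^bsub>Tgt (func_comp G D)\<^esub> AMap G g" by simp
  qed simp
qed

lemma preserves_finite_limitsD:
  "\<lbrakk>preserves_finite_limits G; finite_diagram D; Tgt D = Src G; is_limit D x \<pi>\<rbrakk> \<Longrightarrow>
    is_limit (func_comp G D) (OMap G x) (\<lambda>j. AMap G (\<pi> j))"
  unfolding preserves_finite_limits_def by blast

lemma finite_diagram_functor [simp]: "finite_diagram D \<Longrightarrow> cat_functor D"
  by (simp add: finite_diagram_def)

lemma finite_diagram_comp [simp]:
  "\<lbrakk>finite_diagram D; cat_functor G; Tgt D = Src G\<rbrakk> \<Longrightarrow> finite_diagram (func_comp G D)"
  unfolding finite_diagram_def by simp

lemma preserves_finite_limits_comp: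
  assumes F: "cat_functor F" "preserves_finite_limits F" and G: "cat_functor G" "preserves_finite_limits G" and FG: "Tgt F = Src G"
  shows "preserves_finite_limits (func_comp G F)"
  unfolding preserves_finite_limits_def
proof (intro allI impI, elim conjE)
  fix D x \<pi> assume D: "finite_diagram D" "Tgt D = Src (func_comp G F)" and l: "is_limit D x \<pi>"
  note c = is_coneD[OF is_limit_cone[OF l]]
  have DF: "Tgt D = Src F" using D by simp
  have "is_limit (func_comp G (func_comp F D)) (OMap G (OMap F x)) (\<lambda>j. AMap G (AMap F (\<pi> j)))"
    by (intro preserves_finite_limitsD[OF G(2)] preserves_finite_limitsD[OF F(2)]) (use D DF l F G FG in simp_all)
  then have "is_limit (func_comp G (func_comp F D)) (OMap G (OMap F x)) (\<lambda>j. AMap (func_comp G F) (\<pi> j))"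
    by (rule is_limit_cong) (use D DF F G FG c in simp_all)
  then show "is_limit (func_comp (func_comp G F) D) (OMap (func_comp G F) x) (\<lambda>j. AMap (func_comp G F) (\<pi> j))"
    using D DF F G FG c by (simp add: func_comp_assoc)
qed

text \<open>The image cone is transported twice, in the diagram and in the apex, and naturality of
  \<open>\<tau>\<close> at the projections identifies the outcome with the image under the other
  functor.\<close>

lemma preserves_finite_limits_iso:
  assumes \<tau>: "nat_iso \<tau>" and p: "preserves_finite_limits (NSrc \<tau>)"
  shows "preserves_finite_limits (NTgt \<tau>)"
  unfolding preserves_finite_limits_def
proof (intro allI impI, elim conjE)
  let ?F = "NSrc \<tau>" and ?G = "NTgt \<tau>" and ?X = "Tgt (NSrc \<tau>)"
  fix D x \<pi> assume D [simp]: "finite_diagram D" and DG: "Tgt D = Src ?G" and l: "is_limit D x \<pi>"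
  note [simp] = \<tau> nat_trans_NTgt[OF nat_iso_nat_trans[OF \<tau>]]
  have DF [simp]: "Tgt D = Src ?F" using DG by simp
  note c [simp] = is_coneD(1-4)[OF is_limit_cone[OF l], unfolded DF]
  have "is_limit (func_comp ?F D) (OMap ?F x) (\<lambda>j. AMap ?F (\<pi> j))"
    by (rule preserves_finite_limitsD[OF p D DF l])
  then have "is_limit (func_comp ?G D) (OMap ?F x) (\<lambda>j. NMap \<tau> (OMap D j) \<cdot>\<^bsub>Tgt (func_comp ?F D)\<^esub> AMap ?F (\<pi> j))"
  proof (rule is_limit_diagram_iso[rotated 4])
    fix u assume "u \<in> Arr (Src (func_comp ?F D))"
    then show "NMap \<tau> (OMap D (Cod (Src (func_comp ?F D)) u)) \<cdot>\<^bsub>Tgt (func_comp ?F D)\<^esub> AMap (func_comp ?F D) u =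
         AMap (func_comp ?G D) u \<cdot>\<^bsub>Tgt (func_comp ?F D)\<^esub> NMap \<tau> (OMap D (Dom (Src (func_comp ?F D)) u))"
      using nat_trans_natural[of \<tau> "AMap D u"] by simp
  qed (simp_all add: in_hom)
  then have "is_limit (func_comp ?G D) (OMap ?G x) (\<lambda>j. (NMap \<tau> (OMap D j) \<cdot>\<^bsub>?X\<^esub> AMap ?F (\<pi> j)) \<cdot>\<^bsub>Tgt (func_comp ?G D)\<^esub> inverse_arr ?X (NMap \<tau> x))"
    by (intro is_limit_apex_iso) (simp_all add: in_hom)
  then show "is_limit (func_comp ?G D) (OMap ?G x) (\<lambda>j. AMap ?G (\<pi> j))"
  proof (rule is_limit_cong)
    fix j assume "j \<in> Obj (Src (func_comp ?G D))"
    then have j [simp]: "j \<in> Obj (Src D)" by simp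
    show "AMap ?G (\<pi> j) = NMap \<tau> (OMap D j) \<cdot>\<^bsub>?X\<^esub> AMap ?F (\<pi> j) \<cdot>\<^bsub>Tgt (func_comp ?G D)\<^esub> inverse_arr ?X (NMap \<tau> x)"
      using nat_trans_natural[of \<tau> "\<pi> j"] by simp
  qed simp
qed

lemma lex_functor_comp:
  "\<lbrakk>lex_functor F; lex_functor G; Tgt F = Src G\<rbrakk> \<Longrightarrow> lex_functor (func_comp G F)"
  unfolding lex_functor_def by (simp add: preserves_finite_limits_comp)

lemma lex_functor_iso:
  assumes "nat_iso \<tau>" "lex_functor (NSrc \<tau>)"
  shows "lex_functor (NTgt \<tau>)"
  using assms preserves_finite_limits_iso[OF assms(1)] nat_trans_NTgt[of \<tau>] unfolding lex_functor_def by simp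

section \<open>Finite limits in the vertex\<close>

locale lex_germ_colimit = germ_colimit I F X q
  for I :: "('i, 'd, 'e) twocat"
    and F :: "('i, 'd, 'e, ('u, 'u) cat, ('u, 'u, 'u, 'u) func, ('u, 'u, 'u, 'u) nt) psfun" and X q +
  assumes lex_P1: "d \<in> Arr I1 \<Longrightarrow> lex_functor (P1 F d)"
begin

text \<open>The functor assigned to the identity 1-cell at \<open>i\<close> has source
  \<open>C i\<close>, so lexness of the transition functors already includes that of the
  stages.\<close>

lemma lex_C: "i \<in> Obj I1 \<Longrightarrow> lex_cat (C i)"
  using lex_functorD(2)[OF lex_P1[of "Id I1 i"]] by simp

text \<open>Forgets the formal presentation: the action on arrows of the equivalence from
  \<open>T k\<close> to \<open>F k\<close>. Lifting is done in \<open>T\<close>, but limits are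
  available in \<open>F\<close>.\<close>

definition und :: "('d \<times> 'u) \<times> ('d \<times> 'u) \<times> 'u \<Rightarrow> 'u" where
  "und f = snd (snd f)"

lemma und_hom [simp]:
  assumes "f \<in> Arr (T k)"
  shows "und f \<in> Arr (C k)" "Dom (C k) (und f) = Fo (fst (Dom (T k) f)) (snd (Dom (T k) f))"
    "Cod (C k) (und f) = Fo (fst (Cod (T k) f)) (snd (Cod (T k) f))"
  using assms by (auto elim!: Arr_T_cases simp: und_def T_sel)

lemma und_Comp: "f \<in> Arr (T k) \<Longrightarrow> g \<in> Arr (T k) \<Longrightarrow> und (g \<cdot>\<^bsub>T k\<^esub> f) = und g \<cdot>\<^bsub>C k\<^esub> und f"
  by (auto elim!: Arr_T_cases simp: und_def T_sel)

lemma und_Id: "und (Id (T k) Z) = Id (C k) (Fo (fst Z) (snd Z))"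
  by (cases Z) (simp add: und_def T_sel)

lemma und_im [simp]: "und (im d a) = Fa d a"
  by (simp add: und_def im_def)

lemma und_inject:
  assumes "f \<in> Arr (T k)" "g \<in> Arr (T k)" "Dom (T k) f = Dom (T k) g" "Cod (T k) f = Cod (T k) g" "und f = und g"
  shows "f = g"
proof -
  obtain Z W a Z' W' b where "f = (Z, W, a)" "g = (Z', W', b)" by (metis prod_cases3)
  then show ?thesis using assms(3-5) by (simp add: und_def T_sel)
qed

lemma ev_und:
  assumes "k \<in> Obj I1" "f \<in> Arr (T k)" "Dom (T k) f = (d, x)" "Cod (T k) f = (e, y)"
  shows "ev k f \<cdot>\<^bsub>X\<^esub> cell d x = cell e y \<cdot>\<^bsub>X\<^esub> qa k (und f)"
  using assms ev_cell by (cases f) (auto simp: und_def T_sel)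

lemma finite_cospan:
  assumes "finite S" "\<And>s. s \<in> S \<Longrightarrow> i s \<in> Obj I1"
  shows "\<exists>k. k \<in> Obj I1 \<and> (\<forall>s\<in>S. \<exists>d. d \<in> Arr I1 \<and> Dom I1 d = i s \<and> Cod I1 d = k)"
  using assms
proof (induction S)
  case empty
  \<comment> \<open>For the empty family any stage will do, which is where non-emptiness of
    \<open>I\<close> enters; it is what gives a terminal object.\<close>
  then show ?case using nonempty by auto
next
  case (insert s S)
  then obtain k where k: "k \<in> Obj I1" "\<forall>s\<in>S. \<exists>d. d \<in> Arr I1 \<and> Dom I1 d = i s \<and> Cod I1 d = k" by auto
  obtain u v where uv: "u \<in> Arr I1" "v \<in> Arr I1" "Dom I1 u = k" "Dom I1 v = i s" "Cod I1 v = Cod I1 u"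
    using cospanE[OF k(1) insert.prems[of s]] by blast
  have "\<exists>d. d \<in> Arr I1 \<and> Dom I1 d = i t \<and> Cod I1 d = Cod I1 u" if t: "t \<in> S" for t
  proof -
    obtain d where "d \<in> Arr I1" "Dom I1 d = i t" "Cod I1 d = k" using k t by blast
    then show ?thesis using uv by (intro exI[of _ "u \<circ>\<^bsub>I\<^esub> d"]) simp
  qed
  then show ?case using uv by (intro exI[of _ "Cod I1 u"]) auto
qed

text \<open>Replace the objects by isomorphic ones that come from a common stage. The transported
  arrows form a finite family closed under the composites and identities of the shape, so
  \<open>finite_lift\<close> lifts them functorially, and the lifted arrows form a genuine diagram
  in one \<open>F m\<close>.\<close>

lemma diagram_factors:
  assumes D: "finite_diagram D" and DX: "Tgt D = X"
  shows "\<exists>m D' t. m \<in> Obj I1 \<and> finite_diagram D' \<and> Src D' = Src D \<and> Tgt D' = C m \<and>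
    (\<forall>n\<in>Obj (Src D). t n \<in> hom X (qo m (OMap D' n)) (OMap D n) \<and> is_iso X (t n)) \<and>
    (\<forall>a\<in>Arr (Src D). t (Cod (Src D) a) \<cdot>\<^bsub>X\<^esub> qa m (AMap D' a) = AMap D a \<cdot>\<^bsub>X\<^esub> t (Dom (Src D) a))"
proof -
  let ?J = "Src D"
  note [simp] = D DX
  have fin: "finite (Obj ?J)" "finite (Arr ?J)" and J [simp]: "category ?J" using D by (auto simp: finite_diagram_def)
  have [simp]: "OMap D n \<in> Obj X" if "n \<in> Obj ?J" for n using functor_OMap[of D X n] that by simp
  have DA [simp]: "AMap D a \<in> Arr X" "Dom X (AMap D a) = OMap D (Dom ?J a)" "Cod X (AMap D a) = OMap D (Cod ?J a)"
    if "a \<in> Arr ?J" for a using functor_AMap[of D X a] that by simp_all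
  have "\<forall>n\<in>Obj ?J. \<exists>i x h. i \<in> Obj I1 \<and> x \<in> Obj (C i) \<and> h \<in> hom X (qo i x) (OMap D n) \<and> is_iso X h"
    using obj_repr by simp
  then obtain i x h where ixh: "\<And>n. n \<in> Obj ?J \<Longrightarrow> i n \<in> Obj I1 \<and> x n \<in> Obj (C (i n)) \<and>
      h n \<in> hom X (qo (i n) (x n)) (OMap D n) \<and> is_iso X (h n)"
    by metis
  obtain k where k [simp]: "k \<in> Obj I1" and "\<forall>n\<in>Obj ?J. \<exists>d. d \<in> Arr I1 \<and> Dom I1 d = i n \<and> Cod I1 d = k"
    using finite_cospan[OF fin(1), of i] ixh by blast
  then obtain d where d: "\<And>n. n \<in> Obj ?J \<Longrightarrow> d n \<in> Arr I1 \<and> Dom I1 (d n) = i n \<and> Cod I1 (d n) = k" by metis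
  have h [simp]: "i n \<in> Obj I1" "x n \<in> Obj (C (i n))" "h n \<in> Arr X" "Dom X (h n) = qo (i n) (x n)" "Cod X (h n) = OMap D n"
    "is_iso X (h n)" "d n \<in> Arr I1" "Dom I1 (d n) = i n" "Cod I1 (d n) = k" if "n \<in> Obj ?J" for n
    using ixh[OF that] d[OF that] by (auto simp: in_hom)
  \<comment> \<open>\<open>D\<close> transported along the isomorphisms \<open>h\<close>: still
    strictly functorial, but between objects that come from stages.\<close>
  define E where "E a = inverse_arr X (h (Cod ?J a)) \<cdot>\<^bsub>X\<^esub> (AMap D a \<cdot>\<^bsub>X\<^esub> h (Dom ?J a))" for a
  have E [simp]: "E a \<in> Arr X" "Dom X (E a) = qo (i (Dom ?J a)) (x (Dom ?J a))" "Cod X (E a) = qo (i (Cod ?J a)) (x (Cod ?J a))"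
    if "a \<in> Arr ?J" for a using that by (simp_all add: E_def)
  have E_Id: "E (Id ?J n) = Id X (qo (i n) (x n))" if "n \<in> Obj ?J" for n
    using that functor_Id[of D ?J n] by (simp add: E_def)
  have E_Comp: "E (b \<cdot>\<^bsub>?J\<^esub> a) = E b \<cdot>\<^bsub>X\<^esub> E a" if "a \<in> Arr ?J" "b \<in> Arr ?J" "Cod ?J a = Dom ?J b" for a b
    using that functor_Comp[of D ?J a b] by (simp add: E_def)
  define Z where "Z n = (d n, x n)" for n
  \<comment> \<open>Indexing by the arrows of the shape makes all required identities and composites
    members of \<open>H\<close>. Arrows with the same ends and the same transported value share a
    lift, which does no harm.\<close>
  define H where "H = (\<lambda>a. (Z (Dom ?J a), Z (Cod ?J a), E a)) ` Arr ?J"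
  have H_mem: "(Z (Dom ?J a), Z (Cod ?J a), E a) \<in> H" if "a \<in> Arr ?J" for a using that by (simp add: H_def)
  have fin': "finite H" using fin by (simp add: H_def)
  have H_ok: "Z' \<in> Obj (T k) \<and> W \<in> Obj (T k) \<and> g \<in> hom X (evo Z') (evo W)" if "(Z', W, g) \<in> H" for Z' W g
    using that by (auto simp: H_def Z_def in_hom)
  obtain u r where u [simp]: "u \<in> Arr I1" "Dom I1 u = k"
    and r: "\<And>Z W h. (Z, W, h) \<in> H \<Longrightarrow> r Z W h \<in> hom (T (Cod I1 u)) (push_obj u Z) (push_obj u W) \<and> ev (Cod I1 u) (r Z W h) = h"
    and r_Comp: "\<And>Z W V g h. (Z, W, h) \<in> H \<Longrightarrow> (W, V, g) \<in> H \<Longrightarrow> (Z, V, g \<cdot>\<^bsub>X\<^esub> h) \<in> H \<Longrightarrow>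
       r Z V (g \<cdot>\<^bsub>X\<^esub> h) = r W V g \<cdot>\<^bsub>T (Cod I1 u)\<^esub> r Z W h"
    and r_Id: "\<And>Z. (Z, Z, Id X (evo Z)) \<in> H \<Longrightarrow> r Z Z (Id X (evo Z)) = Id (T (Cod I1 u)) (push_obj u Z)"
    by (rule finite_lift[OF k fin' H_ok finite.emptyI empty_subsetI]) blast+
  let ?m = "Cod I1 u"
  define R where "R a = r (Z (Dom ?J a)) (Z (Cod ?J a)) (E a)" for a
  have R [simp]: "R a \<in> Arr (T ?m)" "Dom (T ?m) (R a) = (u \<circ>\<^bsub>I\<^esub> d (Dom ?J a), x (Dom ?J a))"
    "Cod (T ?m) (R a) = (u \<circ>\<^bsub>I\<^esub> d (Cod ?J a), x (Cod ?J a))" "ev ?m (R a) = E a" if "a \<in> Arr ?J" for a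
    using r[OF H_mem[OF that]] by (auto simp: R_def in_hom Z_def)
  have R_Id: "R (Id ?J n) = Id (T ?m) (u \<circ>\<^bsub>I\<^esub> d n, x n)" if n: "n \<in> Obj ?J" for n
  proof -
    have "evo (Z n) = qo (i n) (x n)" using n by (simp add: Z_def)
    then show ?thesis using r_Id[of "Z n"] H_mem[of "Id ?J n"] n by (simp add: R_def E_Id) (simp add: Z_def)
  qed
  have R_Comp: "R (b \<cdot>\<^bsub>?J\<^esub> a) = R b \<cdot>\<^bsub>T ?m\<^esub> R a" if ab: "a \<in> Arr ?J" "b \<in> Arr ?J" "Cod ?J a = Dom ?J b" for a b
    using r_Comp[of "Z (Dom ?J a)" "Z (Cod ?J a)" "E a" "Z (Cod ?J b)" "E b"] H_mem[of a] H_mem[of b] H_mem[of "b \<cdot>\<^bsub>?J\<^esub> a"] ab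
    by (simp add: R_def E_Comp)
  \<comment> \<open>The lifts are arrows between formal pairs; replacing each pair by the object it
    stands for and each arrow by its underlying one yields the diagram in \<open>F\<close>.\<close>
  define D' where "D' = \<lparr>Src = ?J, Tgt = C ?m, OMap = (\<lambda>n\<in>Obj ?J. Fo (u \<circ>\<^bsub>I\<^esub> d n) (x n)), AMap = (\<lambda>a\<in>Arr ?J. und (R a))\<rparr>"
  have D'_sel [simp]: "Src D' = ?J" "Tgt D' = C ?m" "\<And>n. n \<in> Obj ?J \<Longrightarrow> OMap D' n = Fo (u \<circ>\<^bsub>I\<^esub> d n) (x n)"
    "\<And>a. a \<in> Arr ?J \<Longrightarrow> AMap D' a = und (R a)" by (simp_all add: D'_def)
  have "cat_functor D'"
    by (rule cat_functorI) (simp_all add: in_hom R_Id R_Comp und_Id und_Comp, simp_all add: D'_def)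
  then have D': "finite_diagram D'" using fin by (simp add: finite_diagram_def)
  define t where "t n = h n \<cdot>\<^bsub>X\<^esub> cell (u \<circ>\<^bsub>I\<^esub> d n) (x n)" for n
  have "t n \<in> hom X (qo ?m (OMap D' n)) (OMap D n) \<and> is_iso X (t n)" if "n \<in> Obj ?J" for n
    using that by (simp add: t_def in_hom)
  moreover have "t (Cod ?J a) \<cdot>\<^bsub>X\<^esub> qa ?m (AMap D' a) = AMap D a \<cdot>\<^bsub>X\<^esub> t (Dom ?J a)" if a [simp]: "a \<in> Arr ?J" for a
  proof -
    have "E a \<cdot>\<^bsub>X\<^esub> cell (u \<circ>\<^bsub>I\<^esub> d (Dom ?J a)) (x (Dom ?J a)) = cell (u \<circ>\<^bsub>I\<^esub> d (Cod ?J a)) (x (Cod ?J a)) \<cdot>\<^bsub>X\<^esub> qa ?m (und (R a))"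
      using ev_und[of ?m "R a", OF _ _ R(2,3)] by simp
    then have "t (Cod ?J a) \<cdot>\<^bsub>X\<^esub> qa ?m (AMap D' a) = h (Cod ?J a) \<cdot>\<^bsub>X\<^esub> (E a \<cdot>\<^bsub>X\<^esub> cell (u \<circ>\<^bsub>I\<^esub> d (Dom ?J a)) (x (Dom ?J a)))"
      by (simp add: t_def)
    then show ?thesis by (simp add: E_def t_def)
  qed
  ultimately show ?thesis using D' by (intro exI[of _ ?m] exI[of _ D'] exI[of _ t]) simp
qed

text \<open>A cone in \<open>X\<close> involves finitely many arrows and equations, so after
  replacing its apex by an isomorphic object of a stage it lifts to a cone over an image of
  \<open>D\<close>. The transition functor preserves the limit of \<open>D\<close>, which provides a
  mediating arrow at that stage. Uniqueness is obtained in the same way, by lifting two competing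
  arrows together.\<close>

lemma leg_limit:
  assumes i [simp]: "i \<in> Obj I1" and D: "finite_diagram D" and DC: "Tgt D = C i" and l: "is_limit D x \<pi>"
  shows "is_limit (func_comp (Leg q i) D) (qo i x) (\<lambda>n. qa i (\<pi> n))"
proof -
  let ?J = "Src D" and ?Q = "func_comp (Leg q i) D"
  note [simp] = D DC
  have fin: "finite (Obj ?J)" "finite (Arr ?J)" and J [simp]: "category ?J" using D by (auto simp: finite_diagram_def)
  have DO [simp]: "OMap D n \<in> Obj (C i)" if "n \<in> Obj ?J" for n using functor_OMap[of D "C i" n] that by simp
  have DA [simp]: "AMap D a \<in> Arr (C i)" "Dom (C i) (AMap D a) = OMap D (Dom ?J a)" "Cod (C i) (AMap D a) = OMap D (Cod ?J a)"
    if "a \<in> Arr ?J" for a using functor_AMap[of D "C i" a] that by simp_all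
  note \<pi> [simp] = is_coneD(1-4)[OF is_limit_cone[OF l], unfolded DC]
  have \<pi>_cone: "AMap D a \<cdot>\<^bsub>C i\<^esub> \<pi> (Dom ?J a) = \<pi> (Cod ?J a)" if "a \<in> Arr ?J" for a
    using is_coneD(5)[OF is_limit_cone[OF l] that] by simp
  \<comment> \<open>A presentation of the apex may live at a stage unrelated to \<open>i\<close>; a
    cospan moves it and the diagram to a common stage \<open>k\<close>.\<close>
  have stage: "\<exists>k d e y' \<chi>. k \<in> Obj I1 \<and> d \<in> Arr I1 \<and> Dom I1 d = i \<and> Cod I1 d = k \<and> e \<in> Arr I1 \<and> Cod I1 e = k \<and>
      y' \<in> Obj (C (Dom I1 e)) \<and> \<chi> \<in> hom X (evo (e, y')) y \<and> is_iso X \<chi>" if y: "y \<in> Obj X" for y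
  proof -
    obtain j y' \<chi> where j: "j \<in> Obj I1" "y' \<in> Obj (C j)" "\<chi> \<in> hom X (qo j y') y" "is_iso X \<chi>" using obj_repr[OF y] by blast
    obtain d e where "d \<in> Arr I1" "e \<in> Arr I1" "Dom I1 d = i" "Dom I1 e = j" "Cod I1 e = Cod I1 d"
      using cospanE[OF i j(1)] by blast
    then show ?thesis using j by (intro exI[of _ "Cod I1 d"] exI[of _ d] exI[of _ e] exI[of _ y'] exI[of _ \<chi>]) simp
  qed
  have im_lim: "is_limit (func_comp (P1 F d) D) (Fo d x) (\<lambda>n. Fa d (\<pi> n))" if "d \<in> Arr I1" "Dom I1 d = i" for d
    by (rule preserves_finite_limitsD[OF lex_functorD(4)[OF lex_P1[OF that(1)]] D _ l]) (use that in simp)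
  show ?thesis
  proof (rule is_limitI)
    show "is_cone ?Q (qo i x) (\<lambda>n. qa i (\<pi> n))"
    proof (rule is_coneI)
      fix a assume "a \<in> Arr (Src ?Q)"
      then have a: "a \<in> Arr ?J" by simp
      then have "qa i (AMap D a) \<cdot>\<^bsub>X\<^esub> qa i (\<pi> (Dom ?J a)) = qa i (\<pi> (Cod ?J a))" by (simp flip: qa_Comp add: \<pi>_cone)
      then show "AMap ?Q a \<cdot>\<^bsub>Tgt ?Q\<^esub> qa i (\<pi> (Dom (Src ?Q) a)) = qa i (\<pi> (Cod (Src ?Q) a))" using a by simp
    qed (simp_all add: in_hom)
  next
    fix y \<rho> assume \<rho>0: "is_cone ?Q y \<rho>"
    note \<rho> [simp] = is_coneD(1-4)[OF \<rho>0, simplified]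
    have \<rho>_cone: "qa i (AMap D a) \<cdot>\<^bsub>X\<^esub> \<rho> (Dom ?J a) = \<rho> (Cod ?J a)" if "a \<in> Arr ?J" for a
      using is_coneD(5)[OF \<rho>0, of a] that by simp
    obtain k d e y' \<chi> where k [simp]: "k \<in> Obj I1" "d \<in> Arr I1" "Dom I1 d = i" "Cod I1 d = k" "e \<in> Arr I1" "Cod I1 e = k"
      "y' \<in> Obj (C (Dom I1 e))" and \<chi>0: "\<chi> \<in> hom X (evo (e, y')) y" "is_iso X \<chi>"
      using stage[of y] \<rho>(1) by blast
    note [simp] = \<chi>0[unfolded in_hom evo_pair]
    have \<rho>Q [simp]: "\<rho> n \<in> Arr X" "Dom X (\<rho> n) = y" "Cod X (\<rho> n) = qo i (OMap D n)" if "n \<in> Obj ?J" for n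
      using \<rho>(2-4)[OF that] that by simp_all
    \<comment> \<open>Listing the arrows of the diagram forces their lifts to be the given ones.
      Without this, the lifted cone might lie over a different diagram with the same image in
      \<open>X\<close>.\<close>
    define A where "A = (\<lambda>a. im d (AMap D a)) ` Arr ?J"
    define H where "H = (\<lambda>n. ((e, y'), (d, OMap D n), \<rho> n \<cdot>\<^bsub>X\<^esub> \<chi>)) ` Obj ?J \<union>
      (\<lambda>a. ((d, OMap D (Dom ?J a)), (d, OMap D (Cod ?J a)), qa i (AMap D a))) ` Arr ?J"
    have H: "Z \<in> Obj (T k) \<and> W \<in> Obj (T k) \<and> h \<in> hom X (evo Z) (evo W)" if "(Z, W, h) \<in> H" for Z W h
      using that by (auto simp: H_def in_hom)
    have fin': "finite H" "finite A" "A \<subseteq> Arr (T k)" using fin by (auto simp: H_def A_def)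
    obtain u r where u [simp]: "u \<in> Arr I1" "Dom I1 u = k"
      and r: "\<And>Z W h. (Z, W, h) \<in> H \<Longrightarrow> r Z W h \<in> hom (T (Cod I1 u)) (push_obj u Z) (push_obj u W) \<and> ev (Cod I1 u) (r Z W h) = h"
      and r_Comp: "\<And>Z W V g h. (Z, W, h) \<in> H \<Longrightarrow> (W, V, g) \<in> H \<Longrightarrow> (Z, V, g \<cdot>\<^bsub>X\<^esub> h) \<in> H \<Longrightarrow>
         r Z V (g \<cdot>\<^bsub>X\<^esub> h) = r W V g \<cdot>\<^bsub>T (Cod I1 u)\<^esub> r Z W h"
      and r_A: "\<And>a. a \<in> A \<Longrightarrow> (Dom (T k) a, Cod (T k) a, ev k a) \<in> H \<Longrightarrow> r (Dom (T k) a) (Cod (T k) a) (ev k a) = push u a"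
      by (rule finite_lift[OF k(1) fin'(1) H fin'(2,3)]) blast+
    let ?m = "Cod I1 u"
    define s where "s n = r (e, y') (d, OMap D n) (\<rho> n \<cdot>\<^bsub>X\<^esub> \<chi>)" for n
    have s [simp]: "s n \<in> Arr (T ?m)" "Dom (T ?m) (s n) = (u \<circ>\<^bsub>I\<^esub> e, y')" "Cod (T ?m) (s n) = (u \<circ>\<^bsub>I\<^esub> d, OMap D n)"
      "ev ?m (s n) = \<rho> n \<cdot>\<^bsub>X\<^esub> \<chi>" if "n \<in> Obj ?J" for n
      using r[of "(e, y')" "(d, OMap D n)" "\<rho> n \<cdot>\<^bsub>X\<^esub> \<chi>"] that by (auto simp: s_def H_def in_hom)
    have s_cone: "im (u \<circ>\<^bsub>I\<^esub> d) (AMap D a) \<cdot>\<^bsub>T ?m\<^esub> s (Dom ?J a) = s (Cod ?J a)" if a [simp]: "a \<in> Arr ?J" for a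
    proof -
      have 1: "((e, y'), (d, OMap D (Dom ?J a)), \<rho> (Dom ?J a) \<cdot>\<^bsub>X\<^esub> \<chi>) \<in> H" "((e, y'), (d, OMap D (Cod ?J a)), \<rho> (Cod ?J a) \<cdot>\<^bsub>X\<^esub> \<chi>) \<in> H"
        "((d, OMap D (Dom ?J a)), (d, OMap D (Cod ?J a)), qa i (AMap D a)) \<in> H" by (auto simp: H_def)
      have 2: "r (d, OMap D (Dom ?J a)) (d, OMap D (Cod ?J a)) (qa i (AMap D a)) = im (u \<circ>\<^bsub>I\<^esub> d) (AMap D a)"
        using r_A[of "im d (AMap D a)"] 1(3) by (simp add: A_def)
      have "qa i (AMap D a) \<cdot>\<^bsub>X\<^esub> (\<rho> (Dom ?J a) \<cdot>\<^bsub>X\<^esub> \<chi>) = qa i (AMap D a) \<cdot>\<^bsub>X\<^esub> \<rho> (Dom ?J a) \<cdot>\<^bsub>X\<^esub> \<chi>" by simp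
      also have "\<dots> = \<rho> (Cod ?J a) \<cdot>\<^bsub>X\<^esub> \<chi>" by (simp only: \<rho>_cone a)
      finally have 3: "qa i (AMap D a) \<cdot>\<^bsub>X\<^esub> (\<rho> (Dom ?J a) \<cdot>\<^bsub>X\<^esub> \<chi>) = \<rho> (Cod ?J a) \<cdot>\<^bsub>X\<^esub> \<chi>" .
      show ?thesis using r_Comp[OF 1(1,3)] 1(2) by (simp only: 2 3 s_def)
    qed
    let ?D = "func_comp (P1 F (u \<circ>\<^bsub>I\<^esub> d)) D"
    have "is_cone ?D (Fo (u \<circ>\<^bsub>I\<^esub> e) y') (\<lambda>n. und (s n))"
    proof (rule is_coneI)
      fix a assume "a \<in> Arr (Src ?D)"
      then have a: "a \<in> Arr ?J" by simp
      then show "AMap ?D a \<cdot>\<^bsub>Tgt ?D\<^esub> und (s (Dom (Src ?D) a)) = und (s (Cod (Src ?D) a))"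
        using arg_cong[OF s_cone[OF a], of und] by (simp add: und_Comp)
    qed (simp_all add: in_hom)
    \<comment> \<open>The functor of the composite of \<open>u\<close> and \<open>d\<close> is lex,
      so it carries the given limit of \<open>D\<close> to a limit at the stage of the lifted
      cone.\<close>
    then obtain h' where h': "h' \<in> hom (C ?m) (Fo (u \<circ>\<^bsub>I\<^esub> e) y') (Fo (u \<circ>\<^bsub>I\<^esub> d) x)"
      and h'_eq: "\<And>n. n \<in> Obj ?J \<Longrightarrow> Fa (u \<circ>\<^bsub>I\<^esub> d) (\<pi> n) \<cdot>\<^bsub>C ?m\<^esub> h' = und (s n)"
      using is_limit_ex[OF im_lim[of "u \<circ>\<^bsub>I\<^esub> d"]] by auto
    define f where "f = ((u \<circ>\<^bsub>I\<^esub> e, y'), (u \<circ>\<^bsub>I\<^esub> d, x), h')"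
    have f [simp]: "f \<in> Arr (T ?m)" "Dom (T ?m) f = (u \<circ>\<^bsub>I\<^esub> e, y')" "Cod (T ?m) f = (u \<circ>\<^bsub>I\<^esub> d, x)" "und f = h'"
      using h' by (simp_all add: f_def T_sel in_hom und_def)
    have f_eq: "im (u \<circ>\<^bsub>I\<^esub> d) (\<pi> n) \<cdot>\<^bsub>T ?m\<^esub> f = s n" if n: "n \<in> Obj ?J" for n
      by (rule und_inject[of _ ?m]) (use n h'_eq in \<open>simp_all add: und_Comp\<close>)
    have "qa i (\<pi> n) \<cdot>\<^bsub>X\<^esub> ev ?m f = \<rho> n \<cdot>\<^bsub>X\<^esub> \<chi>" if n: "n \<in> Obj ?J" for n
      using arg_cong[OF f_eq[OF n], of "ev ?m"] n by simp
    then have "qa i (\<pi> n) \<cdot>\<^bsub>X\<^esub> (ev ?m f \<cdot>\<^bsub>X\<^esub> inverse_arr X \<chi>) = \<rho> n" if n: "n \<in> Obj ?J" for n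
      using n by (subst Comp_assoc[symmetric]) (simp_all add: Comp_assoc)
    then show "\<exists>h. h \<in> hom (Tgt ?Q) y (qo i x) \<and> (\<forall>n\<in>Obj (Src ?Q). qa i (\<pi> n) \<cdot>\<^bsub>Tgt ?Q\<^esub> h = \<rho> n)"
      by (intro exI[of _ "ev ?m f \<cdot>\<^bsub>X\<^esub> inverse_arr X \<chi>"]) (simp add: in_hom)
  next
    fix y h1 h2 assume h0: "h1 \<in> hom (Tgt ?Q) y (qo i x)" "h2 \<in> hom (Tgt ?Q) y (qo i x)"
      and eq0: "\<And>n. n \<in> Obj (Src ?Q) \<Longrightarrow> qa i (\<pi> n) \<cdot>\<^bsub>Tgt ?Q\<^esub> h1 = qa i (\<pi> n) \<cdot>\<^bsub>Tgt ?Q\<^esub> h2"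
    have h [simp]: "h1 \<in> Arr X" "Dom X h1 = y" "Cod X h1 = qo i x" "h2 \<in> Arr X" "Dom X h2 = y" "Cod X h2 = qo i x"
      using h0 by (auto simp: in_hom)
    have eq: "qa i (\<pi> n) \<cdot>\<^bsub>X\<^esub> h2 = qa i (\<pi> n) \<cdot>\<^bsub>X\<^esub> h1" if "n \<in> Obj ?J" for n using eq0[of n] that by simp
    have "y \<in> Obj X" using Dom_Obj[of X h1] by simp
    then obtain k d e y' \<chi> where k [simp]: "k \<in> Obj I1" "d \<in> Arr I1" "Dom I1 d = i" "Cod I1 d = k" "e \<in> Arr I1" "Cod I1 e = k"
      "y' \<in> Obj (C (Dom I1 e))" and \<chi>0: "\<chi> \<in> hom X (evo (e, y')) y" "is_iso X \<chi>"
      using stage[of y] by blast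
    note [simp] = \<chi>0[unfolded in_hom evo_pair]
    define A where "A = (\<lambda>n. im d (\<pi> n)) ` Obj ?J"
    \<comment> \<open>By \<open>eq\<close>, the composites of a projection with the two competing
      arrows are one arrow of \<open>X\<close>, hence one entry of \<open>H\<close>. Both composites
      of lifts then equal the single lift of this entry.\<close>
    define H where "H = {((e, y'), (d, x), h1 \<cdot>\<^bsub>X\<^esub> \<chi>), ((e, y'), (d, x), h2 \<cdot>\<^bsub>X\<^esub> \<chi>)} \<union>
      (\<lambda>n. ((d, x), (d, OMap D n), qa i (\<pi> n))) ` Obj ?J \<union>
      (\<lambda>n. ((e, y'), (d, OMap D n), qa i (\<pi> n) \<cdot>\<^bsub>X\<^esub> (h1 \<cdot>\<^bsub>X\<^esub> \<chi>))) ` Obj ?J"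
    have H: "Z \<in> Obj (T k) \<and> W \<in> Obj (T k) \<and> h \<in> hom X (evo Z) (evo W)" if "(Z, W, h) \<in> H" for Z W h
      using that by (auto simp: H_def in_hom)
    have fin': "finite H" "finite A" "A \<subseteq> Arr (T k)" using fin by (auto simp: H_def A_def)
    obtain u r where u [simp]: "u \<in> Arr I1" "Dom I1 u = k"
      and r: "\<And>Z W h. (Z, W, h) \<in> H \<Longrightarrow> r Z W h \<in> hom (T (Cod I1 u)) (push_obj u Z) (push_obj u W) \<and> ev (Cod I1 u) (r Z W h) = h"
      and r_Comp: "\<And>Z W V g h. (Z, W, h) \<in> H \<Longrightarrow> (W, V, g) \<in> H \<Longrightarrow> (Z, V, g \<cdot>\<^bsub>X\<^esub> h) \<in> H \<Longrightarrow>
         r Z V (g \<cdot>\<^bsub>X\<^esub> h) = r W V g \<cdot>\<^bsub>T (Cod I1 u)\<^esub> r Z W h"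
      and r_A: "\<And>a. a \<in> A \<Longrightarrow> (Dom (T k) a, Cod (T k) a, ev k a) \<in> H \<Longrightarrow> r (Dom (T k) a) (Cod (T k) a) (ev k a) = push u a"
      by (rule finite_lift[OF k(1) fin'(1) H fin'(2,3)]) blast+
    let ?m = "Cod I1 u"
    define f1 where "f1 = r (e, y') (d, x) (h1 \<cdot>\<^bsub>X\<^esub> \<chi>)"
    define f2 where "f2 = r (e, y') (d, x) (h2 \<cdot>\<^bsub>X\<^esub> \<chi>)"
    have mem: "((e, y'), (d, x), h1 \<cdot>\<^bsub>X\<^esub> \<chi>) \<in> H" "((e, y'), (d, x), h2 \<cdot>\<^bsub>X\<^esub> \<chi>) \<in> H" by (auto simp: H_def)
    have f [simp]: "f1 \<in> Arr (T ?m)" "Dom (T ?m) f1 = (u \<circ>\<^bsub>I\<^esub> e, y')" "Cod (T ?m) f1 = (u \<circ>\<^bsub>I\<^esub> d, x)"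
      "f2 \<in> Arr (T ?m)" "Dom (T ?m) f2 = (u \<circ>\<^bsub>I\<^esub> e, y')" "Cod (T ?m) f2 = (u \<circ>\<^bsub>I\<^esub> d, x)"
      and ev_f: "ev ?m f1 = h1 \<cdot>\<^bsub>X\<^esub> \<chi>" "ev ?m f2 = h2 \<cdot>\<^bsub>X\<^esub> \<chi>"
      using r[OF mem(1)] r[OF mem(2)] by (auto simp: f1_def f2_def in_hom)
    have f_eq: "im (u \<circ>\<^bsub>I\<^esub> d) (\<pi> n) \<cdot>\<^bsub>T ?m\<^esub> f1 = im (u \<circ>\<^bsub>I\<^esub> d) (\<pi> n) \<cdot>\<^bsub>T ?m\<^esub> f2" if n [simp]: "n \<in> Obj ?J" for n
    proof -
      have 1: "((d, x), (d, OMap D n), qa i (\<pi> n)) \<in> H" "((e, y'), (d, OMap D n), qa i (\<pi> n) \<cdot>\<^bsub>X\<^esub> (h1 \<cdot>\<^bsub>X\<^esub> \<chi>)) \<in> H"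
        by (auto simp: H_def)
      have 2: "r (d, x) (d, OMap D n) (qa i (\<pi> n)) = im (u \<circ>\<^bsub>I\<^esub> d) (\<pi> n)"
        using r_A[of "im d (\<pi> n)"] 1(1) by (simp add: A_def)
      have "qa i (\<pi> n) \<cdot>\<^bsub>X\<^esub> (h2 \<cdot>\<^bsub>X\<^esub> \<chi>) = qa i (\<pi> n) \<cdot>\<^bsub>X\<^esub> h2 \<cdot>\<^bsub>X\<^esub> \<chi>" by simp
      also have "\<dots> = qa i (\<pi> n) \<cdot>\<^bsub>X\<^esub> (h1 \<cdot>\<^bsub>X\<^esub> \<chi>)" unfolding eq[OF n] by simp
      finally have 3: "qa i (\<pi> n) \<cdot>\<^bsub>X\<^esub> (h2 \<cdot>\<^bsub>X\<^esub> \<chi>) = qa i (\<pi> n) \<cdot>\<^bsub>X\<^esub> (h1 \<cdot>\<^bsub>X\<^esub> \<chi>)" .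
      have "im (u \<circ>\<^bsub>I\<^esub> d) (\<pi> n) \<cdot>\<^bsub>T ?m\<^esub> f1 = r (e, y') (d, OMap D n) (qa i (\<pi> n) \<cdot>\<^bsub>X\<^esub> (h1 \<cdot>\<^bsub>X\<^esub> \<chi>))"
        using r_Comp[OF mem(1) 1(1) 1(2)] by (simp only: 2 f1_def)
      also have "\<dots> = im (u \<circ>\<^bsub>I\<^esub> d) (\<pi> n) \<cdot>\<^bsub>T ?m\<^esub> f2"
        using r_Comp[OF mem(2) 1(1), unfolded 3, OF 1(2)] by (simp only: 2 f2_def)
      finally show ?thesis .
    qed
    have und_eq: "Fa (u \<circ>\<^bsub>I\<^esub> d) (\<pi> n) \<cdot>\<^bsub>C ?m\<^esub> und f1 = Fa (u \<circ>\<^bsub>I\<^esub> d) (\<pi> n) \<cdot>\<^bsub>C ?m\<^esub> und f2" if n: "n \<in> Obj ?J" for n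
      using arg_cong[OF f_eq[OF n], of und] n by (simp add: und_Comp)
    have "und f1 = und f2"
      by (rule is_limit_eqI[OF _ im_lim[of "u \<circ>\<^bsub>I\<^esub> d"], of _ "Fo (u \<circ>\<^bsub>I\<^esub> e) y'"]) (use und_eq in \<open>simp_all add: in_hom\<close>)
    then have "f1 = f2" by (intro und_inject[of f1 ?m f2]) simp_all
    then have "h1 \<cdot>\<^bsub>X\<^esub> \<chi> = h2 \<cdot>\<^bsub>X\<^esub> \<chi>" using ev_f by simp
    then show "h1 = h2" by - (rule iso_cancel_right[of X \<chi> h1 h2], simp_all)
  qed
qed

text \<open>The origin of the limit is recorded along with its existence: it is the image of a limit
  at a stage, corrected by \<open>t\<close>. A functor on \<open>X\<close> whose composites with the
  legs are lex can be tested on a limit of this form.\<close>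

lemma finite_limit_X:
  assumes D: "finite_diagram D" and DX: "Tgt D = X"
  shows "\<exists>m D' x \<pi> t. m \<in> Obj I1 \<and> finite_diagram D' \<and> Src D' = Src D \<and> Tgt D' = C m \<and> is_limit D' x \<pi> \<and>
    (\<forall>n\<in>Obj (Src D). t n \<in> hom X (qo m (OMap D' n)) (OMap D n) \<and> is_iso X (t n)) \<and>
    (\<forall>a\<in>Arr (Src D). t (Cod (Src D) a) \<cdot>\<^bsub>X\<^esub> qa m (AMap D' a) = AMap D a \<cdot>\<^bsub>X\<^esub> t (Dom (Src D) a)) \<and>
    is_limit D (qo m x) (\<lambda>n. t n \<cdot>\<^bsub>X\<^esub> qa m (\<pi> n))"
proof -
  obtain m D' t where m: "m \<in> Obj I1" and D': "finite_diagram D'" "Src D' = Src D" "Tgt D' = C m"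
    and t: "\<And>n. n \<in> Obj (Src D) \<Longrightarrow> t n \<in> hom X (qo m (OMap D' n)) (OMap D n) \<and> is_iso X (t n)"
    and nat: "\<And>a. a \<in> Arr (Src D) \<Longrightarrow> t (Cod (Src D) a) \<cdot>\<^bsub>X\<^esub> qa m (AMap D' a) = AMap D a \<cdot>\<^bsub>X\<^esub> t (Dom (Src D) a)"
    using diagram_factors[OF D DX] by blast
  obtain x \<pi> where l: "is_limit D' x \<pi>"
    using lex_C[OF m] D' unfolding lex_cat_def has_finite_limits_def by blast
  have "is_limit D (qo m x) (\<lambda>n. t n \<cdot>\<^bsub>Tgt (func_comp (Leg q m) D')\<^esub> qa m (\<pi> n))"
    by (rule is_limit_diagram_iso[OF _ _ _ _ leg_limit[OF m D'(1,3) l]]) (use m D D' DX t nat in simp_all)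
  then have "is_limit D (qo m x) (\<lambda>n. t n \<cdot>\<^bsub>X\<^esub> qa m (\<pi> n))" using m by simp
  with m D' l t nat show ?thesis by blast
qed

lemma lex_X: "lex_cat X"
proof -
  have "\<exists>x \<pi>. is_limit D x \<pi>" if D: "finite_diagram D" "Tgt D = X" for D :: "(nat, nat, 'u, 'u) func"
    using finite_limit_X[OF D] by blast
  then show ?thesis unfolding lex_cat_def has_finite_limits_def by simp
qed

lemma lex_leg: "i \<in> Obj I1 \<Longrightarrow> lex_functor (Leg q i)"
  unfolding lex_functor_def preserves_finite_limits_def using lex_X lex_C leg_limit by simp

text \<open>By \<open>preserves_limit_transfer\<close> it is enough to treat the limit that comes
  from a stage. That one is preserved by the composite of \<open>G\<close> with the leg, and the
  isomorphisms \<open>t\<close> are carried along.\<close>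

lemma preserves_finite_limits_from_legs:
  assumes G [simp]: "cat_functor G" "Src G = X"
    and legs: "\<And>i. i \<in> Obj I1 \<Longrightarrow> preserves_finite_limits (func_comp G (Leg q i))"
  shows "preserves_finite_limits G"
  unfolding preserves_finite_limits_def
proof (intro allI impI, elim conjE)
  fix D x0 \<pi>0 assume D: "finite_diagram D" and DX0: "Tgt D = Src G" and l0: "is_limit D x0 \<pi>0"
  have DX [simp]: "Tgt D = X" using DX0 by simp
  note [simp] = D
  obtain m D' x \<pi> t where m [simp]: "m \<in> Obj I1" and D' [simp]: "finite_diagram D'" "Src D' = Src D" "Tgt D' = C m" and l: "is_limit D' x \<pi>"
    and t: "\<And>n. n \<in> Obj (Src D) \<Longrightarrow> t n \<in> hom X (qo m (OMap D' n)) (OMap D n) \<and> is_iso X (t n)"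
    and nat: "\<And>a. a \<in> Arr (Src D) \<Longrightarrow> t (Cod (Src D) a) \<cdot>\<^bsub>X\<^esub> qa m (AMap D' a) = AMap D a \<cdot>\<^bsub>X\<^esub> t (Dom (Src D) a)"
    and lX: "is_limit D (qo m x) (\<lambda>n. t n \<cdot>\<^bsub>X\<^esub> qa m (\<pi> n))"
    using finite_limit_X[OF D DX] by blast
  note \<pi> [simp] = is_coneD(1-4)[OF is_limit_cone[OF l], unfolded D']
  have t' [simp]: "t n \<in> Arr X" "Dom X (t n) = qo m (OMap D' n)" "Cod X (t n) = OMap D n" "is_iso X (t n)" if "n \<in> Obj (Src D)" for n
    using t[OF that] by (auto simp: in_hom)
  have DA [simp]: "AMap D a \<in> Arr X" "Dom X (AMap D a) = OMap D (Dom (Src D) a)" "Cod X (AMap D a) = OMap D (Cod (Src D) a)"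
    if "a \<in> Arr (Src D)" for a using functor_AMap[of D X a] that by simp_all
  have DA' [simp]: "AMap D' a \<in> Arr (C m)" "Dom (C m) (AMap D' a) = OMap D' (Dom (Src D) a)" "Cod (C m) (AMap D' a) = OMap D' (Cod (Src D) a)"
    if "a \<in> Arr (Src D)" for a using functor_AMap[of D' "C m" a] that by simp_all
  have J [simp]: "category (Src D)" by simp
  let ?GQ = "func_comp (func_comp G (Leg q m)) D'" and ?Y = "Tgt G"
  have "is_limit ?GQ (OMap (func_comp G (Leg q m)) x) (\<lambda>n. AMap (func_comp G (Leg q m)) (\<pi> n))"
    by (rule preserves_finite_limitsD[OF legs[OF m] D'(1) _ l]) simp
  then have "is_limit (func_comp G D) (OMap (func_comp G (Leg q m)) x)
      (\<lambda>n. AMap G (t n) \<cdot>\<^bsub>Tgt ?GQ\<^esub> AMap (func_comp G (Leg q m)) (\<pi> n))"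
  proof (rule is_limit_diagram_iso[rotated 4])
    fix a assume "a \<in> Arr (Src ?GQ)"
    then have a [simp]: "a \<in> Arr (Src D)" by simp
    have "AMap G (t (Cod (Src D) a) \<cdot>\<^bsub>X\<^esub> qa m (AMap D' a)) = AMap G (AMap D a \<cdot>\<^bsub>X\<^esub> t (Dom (Src D) a))"
      by (simp only: nat[OF a])
    then show "AMap G (t (Cod (Src ?GQ) a)) \<cdot>\<^bsub>Tgt ?GQ\<^esub> AMap ?GQ a =
         AMap (func_comp G D) a \<cdot>\<^bsub>Tgt ?GQ\<^esub> AMap G (t (Dom (Src ?GQ) a))"
      by simp
  qed (simp_all add: in_hom)
  then have "is_limit (func_comp G D) (OMap (func_comp G (Leg q m)) x) (\<lambda>n. AMap G (t n \<cdot>\<^bsub>X\<^esub> qa m (\<pi> n)))"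
    by (rule is_limit_cong) simp_all
  then have "is_limit (func_comp G D) (OMap G (qo m x)) (\<lambda>n. AMap G (t n \<cdot>\<^bsub>X\<^esub> qa m (\<pi> n)))"
    by simp
  then show "is_limit (func_comp G D) (OMap G x0) (\<lambda>n. AMap G (\<pi>0 n))"
    by (rule preserves_limit_transfer[OF finite_diagram_functor[OF D] G(1) DX0 lX l0])
qed

end

section \<open>Bicolimits of categories with finite limits\<close>

lemma nat_iso_nt_inverse:
  assumes "nat_iso \<tau>"
  shows "nat_iso (nt_inverse \<tau>)"
  using nt_inverse_nat_trans[OF assms] nat_trans_NTgt[of \<tau>] assms unfolding nat_iso_def[of "nt_inverse \<tau>"] by simp

lemma is_iso_Lex_Cat:
  assumes "is_iso (Cells2 Lex) \<tau>"
  shows "is_iso (Cells2 Cat) \<tau>"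
proof -
  have \<tau>: "nat_trans \<tau>" "lex_functor (NSrc \<tau>)" "lex_functor (NTgt \<tau>)" using is_iso_Arr[OF assms] by auto
  show ?thesis using \<tau> lex_functorD(1)[OF \<tau>(2)] lex_functorD(1)[OF \<tau>(3)] assms by simp
qed

lemma is_iso_Cat_Lex:
  assumes "is_iso (Cells2 Cat) \<tau>" "lex_functor (NSrc \<tau>)" "lex_functor (NTgt \<tau>)"
  shows "is_iso (Cells2 Lex) \<tau>"
proof -
  have "nat_trans \<tau>" using is_iso_Arr[OF assms(1)] by auto
  then show ?thesis using lex_functorD(1)[OF assms(2)] lex_functorD(1)[OF assms(3)] assms by simp
qed

lemma lex_cat_small: "lex_cat X \<Longrightarrow> small_cat X"
  by (simp add: lex_cat_def)

lemma pseudofunctor_Cat: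
  assumes "pseudofunctor I Lex F"
  shows "pseudofunctor I Cat F"
proof -
  interpret L: pseudofunctor I Lex F by (rule assms)
  show ?thesis
  proof (intro pseudofunctor.intro pseudofunctor_axioms.intro L.two_cats(1) two_category_Cat)
    show "is_iso (Cells2 Cat) (PUnit F i)" if "i \<in> Obj (Cells1 I)" for i
      by (rule is_iso_Lex_Cat[OF L.PUnit_iso[OF that]])
    show "is_iso (Cells2 Cat) (PComp F e d)" if "d \<in> hom (Cells1 I) i j" "e \<in> hom (Cells1 I) j k" for d i j e k
      by (rule is_iso_Lex_Cat[OF L.PComp_iso[OF that]])
    show "P0 F i \<in> Obj (Cells1 Cat)" if "i \<in> Obj (Cells1 I)" for i
      using L.P0_in[OF that] by (simp add: lex_cat_small)
    show "P1 F d \<in> hom (Cells1 Cat) (P0 F i) (P0 F j)" if "d \<in> hom (Cells1 I) i j" for d i j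
      using L.P1_in[OF that] by (simp add: in_hom lex_functorD)
    show "P2 F \<alpha> \<in> hom (Cells2 Cat) (P1 F d) (P1 F d')" if "\<alpha> \<in> hom (Cells2 I) d d'" for \<alpha> d d'
      using L.P2_in[OF that] by (auto simp: in_hom lex_functorD)
    show "PUnit F i \<in> hom (Cells2 Cat) (Id (Cells1 Cat) (P0 F i)) (P1 F (Id (Cells1 I) i))" if "i \<in> Obj (Cells1 I)" for i
      using L.PUnit_in[OF that] by (auto simp: in_hom lex_functorD)
    show "PComp F e d \<in> hom (Cells2 Cat) (P1 F e \<circ>\<^bsub>Cat\<^esub> P1 F d) (P1 F (e \<circ>\<^bsub>I\<^esub> d))"
      if "d \<in> hom (Cells1 I) i j" "e \<in> hom (Cells1 I) j k" for d i j e k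
      using L.PComp_in[OF that] by (auto simp: in_hom lex_functorD)
  next
    fix d i j e k \<alpha> d' \<beta> e'
    assume "d \<in> hom (Cells1 I) i j" "e \<in> hom (Cells1 I) j k" "\<alpha> \<in> hom (Cells2 I) d d'" "\<beta> \<in> hom (Cells2 I) e e'"
    from L.PComp_natural[OF this]
    show "P2 F (\<beta> \<star>\<^bsub>I\<^esub> \<alpha>) \<bullet>\<^bsub>Cat\<^esub> PComp F e d = PComp F e' d' \<bullet>\<^bsub>Cat\<^esub> (P2 F \<beta> \<star>\<^bsub>Cat\<^esub> P2 F \<alpha>)"
      by simp
  next
    fix c h i d j e k assume "c \<in> hom (Cells1 I) h i" "d \<in> hom (Cells1 I) i j" "e \<in> hom (Cells1 I) j k"
    from L.PComp_assoc[OF this]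
    show "PComp F e (d \<circ>\<^bsub>I\<^esub> c) \<bullet>\<^bsub>Cat\<^esub> (P1 F e \<rhd>\<^bsub>Cat\<^esub> PComp F d c) = PComp F (e \<circ>\<^bsub>I\<^esub> d) c \<bullet>\<^bsub>Cat\<^esub> (PComp F e d \<lhd>\<^bsub>Cat\<^esub> P1 F c)"
      by simp
  qed (use L.P2_Id L.P2_vcomp L.PComp_unit_right L.PComp_unit_left in simp_all)
qed

text \<open>\<open>Lex\<close> is full on 2-cells between lex functors, so the structure cells
  impose no further condition, and inverses of cells stay in \<open>Lex\<close>. Only the vertex and
  the legs have to be lex.\<close>

lemma lex_cocone_iff:
  assumes "pseudofunctor I Lex F"
  shows "pseudococone I Lex F X q \<longleftrightarrow>
    pseudococone I Cat F X q \<and> lex_cat X \<and> (\<forall>i\<in>Obj (Cells1 I). lex_functor (Leg q i))"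
proof
  assume q: "pseudococone I Lex F X q"
  note Q = cocone_simps[OF q]
  have "pseudococone I Cat F X q"
  proof (rule pseudococone.intro)
    show "is_iso (Cells2 Cat) (Cell q d)" if "d \<in> Arr (Cells1 I)" for d
      by (rule is_iso_Lex_Cat[OF Q(8)[OF that]])
    show "X \<in> Obj (Cells1 Cat)" using Q(1) by (simp add: lex_cat_small)
    show "Leg q i \<in> hom (Cells1 Cat) (P0 F i) X" if "i \<in> Obj (Cells1 I)" for i
      using pseudococone.Leg_in[OF q that] by (simp add: in_hom lex_functorD)
    show "Cell q d \<in> hom (Cells2 Cat) (Leg q j \<circ>\<^bsub>Cat\<^esub> P1 F d) (Leg q i)" if "d \<in> hom (Cells1 I) i j" for d i j
      using pseudococone.Cell_in[OF q that] by (auto simp: in_hom lex_functorD)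
    show "Cell q d' \<bullet>\<^bsub>Cat\<^esub> (Leg q j \<rhd>\<^bsub>Cat\<^esub> P2 F \<alpha>) = Cell q d"
      if "d \<in> hom (Cells1 I) i j" "\<alpha> \<in> hom (Cells2 I) d d'" for d i j \<alpha> d'
      using pseudococone.Cell_natural[OF q that] by simp
    show "Cell q (Id (Cells1 I) i) \<bullet>\<^bsub>Cat\<^esub> (Leg q i \<rhd>\<^bsub>Cat\<^esub> PUnit F i) = Id (Cells2 Cat) (Leg q i)"
      if "i \<in> Obj (Cells1 I)" for i
      using pseudococone.Cell_Id[OF q that] by simp
    show "Cell q (e \<circ>\<^bsub>I\<^esub> d) \<bullet>\<^bsub>Cat\<^esub> (Leg q k \<rhd>\<^bsub>Cat\<^esub> PComp F e d) = Cell q d \<bullet>\<^bsub>Cat\<^esub> (Cell q e \<lhd>\<^bsub>Cat\<^esub> P1 F d)"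
      if "d \<in> hom (Cells1 I) i j" "e \<in> hom (Cells1 I) j k" for d i j e k
      using pseudococone.Cell_comp[OF q that] by simp
  qed (use pseudococone.Leg_ext[OF q] pseudococone.Cell_ext[OF q] in simp_all)
  then show "pseudococone I Cat F X q \<and> lex_cat X \<and> (\<forall>i\<in>Obj (Cells1 I). lex_functor (Leg q i))"
    using Q(1,2) by simp
next
  assume "pseudococone I Cat F X q \<and> lex_cat X \<and> (\<forall>i\<in>Obj (Cells1 I). lex_functor (Leg q i))"
  then have q: "pseudococone I Cat F X q" and X: "lex_cat X"
    and leg: "\<And>i. i \<in> Obj (Cells1 I) \<Longrightarrow> lex_functor (Leg q i)" by auto
  interpret L: pseudofunctor I Lex F by (rule assms)
  have Cell_lex: "Cell q d \<in> hom (Cells2 Lex) (Leg q j \<circ>\<^bsub>Lex\<^esub> P1 F d) (Leg q i)" if d: "d \<in> hom (Cells1 I) i j" for d i j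
  proof -
    have d': "d \<in> Arr (Cells1 I)" "Dom (Cells1 I) d = i" "Cod (Cells1 I) d = j" using d by (auto simp: in_hom)
    then have ij: "i \<in> Obj (Cells1 I)" "j \<in> Obj (Cells1 I)"
      using Dom_Obj[of "Cells1 I" d] Cod_Obj[of "Cells1 I" d] by auto
    have "lex_functor (func_comp (Leg q j) (P1 F d))"
      by (rule lex_functor_comp)
        (use L.P1_in[OF d] leg[OF ij(2)] pseudococone.Leg_in[OF q ij(2)] in \<open>auto simp: in_hom\<close>)
    then show ?thesis using pseudococone.Cell_in[OF q d] leg[OF ij(1)] by (auto simp: in_hom)
  qed
  show "pseudococone I Lex F X q"
  proof (rule pseudococone.intro)
    show "is_iso (Cells2 Lex) (Cell q d)" if "d \<in> Arr (Cells1 I)" for d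
    proof -
      have "lex_functor (NSrc (Cell q d))" "lex_functor (NTgt (Cell q d))"
        using Cell_lex[of d] that by (auto simp: in_hom)
      then show ?thesis by (rule is_iso_Cat_Lex[OF cocone_simps(8)[OF q that]])
    qed
    show "Leg q i \<in> hom (Cells1 Lex) (P0 F i) X" if "i \<in> Obj (Cells1 I)" for i
      using pseudococone.Leg_in[OF q that] leg[OF that] by (simp add: in_hom)
    show "Cell q d' \<bullet>\<^bsub>Lex\<^esub> (Leg q j \<rhd>\<^bsub>Lex\<^esub> P2 F \<alpha>) = Cell q d"
      if "d \<in> hom (Cells1 I) i j" "\<alpha> \<in> hom (Cells2 I) d d'" for d i j \<alpha> d'
      using pseudococone.Cell_natural[OF q that] by simp
    show "Cell q (Id (Cells1 I) i) \<bullet>\<^bsub>Lex\<^esub> (Leg q i \<rhd>\<^bsub>Lex\<^esub> PUnit F i) = Id (Cells2 Lex) (Leg q i)"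
      if "i \<in> Obj (Cells1 I)" for i
      using pseudococone.Cell_Id[OF q that] by simp
    show "Cell q (e \<circ>\<^bsub>I\<^esub> d) \<bullet>\<^bsub>Lex\<^esub> (Leg q k \<rhd>\<^bsub>Lex\<^esub> PComp F e d) = Cell q d \<bullet>\<^bsub>Lex\<^esub> (Cell q e \<lhd>\<^bsub>Lex\<^esub> P1 F d)"
      if "d \<in> hom (Cells1 I) i j" "e \<in> hom (Cells1 I) j k" for d i j e k
      using pseudococone.Cell_comp[OF q that] by simp
  qed (use X Cell_lex pseudococone.Leg_ext[OF q] pseudococone.Cell_ext[OF q] in simp_all)
qed

lemma lex_modification_iff:
  assumes F: "pseudofunctor I Lex F"
  shows "modification I Lex F X m \<longleftrightarrow>
    modification I Cat F X m \<and> pseudococone I Lex F X (MSrc m) \<and> pseudococone I Lex F X (MTgt m)"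
proof
  assume m: "modification I Lex F X m"
  note M = modification_simps[OF m]
  have "modification I Cat F X m"
  proof (rule modification.intro)
    show "MMap m i \<bullet>\<^bsub>Cat\<^esub> Cell (MSrc m) d = Cell (MTgt m) d \<bullet>\<^bsub>Cat\<^esub> (MMap m j \<lhd>\<^bsub>Cat\<^esub> P1 F d)"
      if "d \<in> hom (Cells1 I) i j" for d i j
      using modification.MMap_Cell[OF m that] by simp
    show "MMap m i \<in> hom (Cells2 Cat) (Leg (MSrc m) i) (Leg (MTgt m) i)" if "i \<in> Obj (Cells1 I)" for i
      using modification.MMap_in[OF m that] by (auto simp: in_hom lex_functorD)
  qed (use M(1,2) modification.MMap_ext[OF m] in \<open>simp_all add: lex_cocone_iff[OF F]\<close>)
  then show "modification I Cat F X m \<and> pseudococone I Lex F X (MSrc m) \<and> pseudococone I Lex F X (MTgt m)"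
    using M(1,2) by simp
next
  assume "modification I Cat F X m \<and> pseudococone I Lex F X (MSrc m) \<and> pseudococone I Lex F X (MTgt m)"
  then have m: "modification I Cat F X m" and M: "pseudococone I Lex F X (MSrc m)" "pseudococone I Lex F X (MTgt m)" by auto
  show "modification I Lex F X m"
  proof (rule modification.intro)
    show "MMap m i \<bullet>\<^bsub>Lex\<^esub> Cell (MSrc m) d = Cell (MTgt m) d \<bullet>\<^bsub>Lex\<^esub> (MMap m j \<lhd>\<^bsub>Lex\<^esub> P1 F d)"
      if "d \<in> hom (Cells1 I) i j" for d i j
      using modification.MMap_Cell[OF m that] by simp
    show "MMap m i \<in> hom (Cells2 Lex) (Leg (MSrc m) i) (Leg (MTgt m) i)" if "i \<in> Obj (Cells1 I)" for i
      using modification.MMap_in[OF m that] cocone_simps(2)[OF M(1) that] cocone_simps(2)[OF M(2) that] by (auto simp: in_hom)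
  qed (use M modification.MMap_ext[OF m] in simp_all)
qed

lemma whisker_cocone_Lex: "whisker_cocone I Lex f q = whisker_cocone I Cat f q"
  by (simp add: whisker_cocone_def)

lemma pscocones_Lex_Cat:
  "Id (pscocones I Lex F X) = Id (pscocones I Cat F X)" "Comp (pscocones I Lex F X) = Comp (pscocones I Cat F X)"
  by (simp_all add: pscocones_def)

context lex_germ_colimit
begin

text \<open>The hom categories and the categories of pseudococones in \<open>Lex\<close> are full
  subcategories of those in \<open>Cat\<close>, so full faithfulness is inherited. For essential
  surjectivity, the functor found in \<open>Cat\<close> is lex because its composites with the legs
  are isomorphic to the lex legs of the given pseudococone.\<close>

lemma weak_equivalence_Lex:
  assumes F: "pseudofunctor I Lex F" and W: "weak_equivalence (cocone_action I Cat F X q Y)" and Y: "lex_cat Y"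
  shows "weak_equivalence (cocone_action I Lex F X q Y)" (is "weak_equivalence ?L")
proof -
  interpret L: pseudofunctor I Lex F by (rule F)
  let ?C = "cocone_action I Cat F X q Y"
  have q_lex: "pseudococone I Lex F X q" using q lex_X lex_leg by (simp add: lex_cocone_iff[OF F])
  have arr: "\<alpha> \<in> Arr (homcat Lex X Y) \<longleftrightarrow> \<alpha> \<in> Arr (homcat Cat X Y) \<and> lex_functor (NSrc \<alpha>) \<and> lex_functor (NTgt \<alpha>)"
    for \<alpha> :: "('u, 'u, 'u, 'u) nt"
    using lex_functorD(1)[of "NSrc \<alpha>"] lex_functorD(1)[of "NTgt \<alpha>"] by (auto simp: Arr_homcat two_category_Cat)
  have AMap_eq: "AMap ?L \<alpha> = AMap ?C \<alpha>" if "\<alpha> \<in> Arr (homcat Lex X Y)" for \<alpha>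
    using that arr[of \<alpha>] by (simp add: cocone_action_def whisker_cocone_Lex)
  have ob: "f \<in> Obj (homcat Lex X Y) \<longleftrightarrow> f \<in> Obj (homcat Cat X Y) \<and> lex_functor f" for f :: "('u, 'u, 'u, 'u) func"
    using lex_functorD(1)[of f] by (auto simp: in_hom)
  have OMap_eq: "OMap ?L f = OMap ?C f" if "f \<in> Obj (homcat Lex X Y)" for f
    using that ob[of f] by (simp add: whisker_cocone_Lex)
  show ?thesis
  proof (rule weak_equivalenceI)
    show "cat_functor ?L" by (rule L.cocone_action_functor) (use q_lex Y in simp_all)
    show "\<alpha> = \<beta>" if "\<alpha> \<in> Arr (Src ?L)" "\<beta> \<in> Arr (Src ?L)" "Dom (Src ?L) \<alpha> = Dom (Src ?L) \<beta>" "Cod (Src ?L) \<alpha> = Cod (Src ?L) \<beta>"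
      "AMap ?L \<alpha> = AMap ?L \<beta>" for \<alpha> \<beta>
      by (rule weak_equivalenceD(2)[OF W]) (use that AMap_eq[of \<alpha>] AMap_eq[of \<beta>] arr[of \<alpha>] arr[of \<beta>] in simp_all)
    show "\<exists>\<alpha>\<in>hom (Src ?L) f g. AMap ?L \<alpha> = m"
      if f: "f \<in> Obj (Src ?L)" and g: "g \<in> Obj (Src ?L)" and m: "m \<in> hom (Tgt ?L) (OMap ?L f) (OMap ?L g)" for f g m
    proof -
      have fg: "f \<in> Obj (homcat Lex X Y)" "g \<in> Obj (homcat Lex X Y)" using f g by simp_all
      have m': "m \<in> hom (Tgt ?C) (OMap ?C f) (OMap ?C g)"
        using m OMap_eq[OF fg(1)] OMap_eq[OF fg(2)] by (simp add: in_hom lex_modification_iff[OF F])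
      have "\<exists>\<alpha>\<in>hom (Src ?C) f g. AMap ?C \<alpha> = m"
        by (rule weak_equivalenceD(3)[OF W]) (use m' fg ob[of f] ob[of g] in simp_all)
      then obtain \<alpha> where \<alpha>: "\<alpha> \<in> hom (homcat Cat X Y) f g" "AMap ?C \<alpha> = m" by auto
      have "\<alpha> \<in> Arr (homcat Lex X Y)" using \<alpha>(1) fg ob[of f] ob[of g] arr[of \<alpha>] by (simp add: in_hom)
      then show ?thesis using \<alpha> AMap_eq[of \<alpha>] by (intro bexI[of _ \<alpha>]) (simp_all add: in_hom)
    qed
    show "\<exists>f\<in>Obj (Src ?L). \<exists>m\<in>hom (Tgt ?L) (OMap ?L f) r. is_iso (Tgt ?L) m" if r0: "r \<in> Obj (Tgt ?L)" for r
    proof -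
      have r: "pseudococone I Lex F Y r" using r0 by simp
      then have r': "pseudococone I Cat F Y r" and r_leg: "\<And>i. i \<in> Obj I1 \<Longrightarrow> lex_functor (Leg r i)"
        by (auto simp: lex_cocone_iff[OF F])
      obtain f m where f: "f \<in> hom (Cells1 Cat) X Y"
        and m: "m \<in> hom (pscocones I Cat F Y) (whisker_cocone I Cat f q) r" "is_iso (pscocones I Cat F Y) m"
        using weak_equivalenceD(4)[OF W, of r] r' by auto
      have f' [simp]: "small_functor f" "Src f = X" "Tgt f = Y" using f by (auto simp: in_hom)
      have m': "modification I Cat F Y m" "MSrc m = whisker_cocone I Cat f q" "MTgt m = r" using m by (auto simp: in_hom)
      have "preserves_finite_limits (func_comp f (Leg q i))" if i: "i \<in> Obj I1" for i
      proof -
        have s: "NSrc (MMap m i) = func_comp f (Leg q i)" "NTgt (MMap m i) = Leg r i"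
          using modification_simps(4,5)[OF m'(1) i] m'(2,3) i by auto
        have "nat_iso (MMap m i)"
          using modification_simps(3)[OF m'(1) i] modification_iso_MMap[OF m(2) i] by simp
        \<comment> \<open>The component of \<open>m\<close> leads from the composite to the leg of
          \<open>r\<close>; it is reversed because lexness is known of the latter and has to be
          carried to the former.\<close>
        then have "nat_iso (nt_inverse (MMap m i))" by (rule nat_iso_nt_inverse)
        then show ?thesis
          using lex_functor_iso[of "nt_inverse (MMap m i)"] r_leg[OF i] s lex_functorD(4) by simp
      qed
      then have "preserves_finite_limits f" by (rule preserves_finite_limits_from_legs[rotated 2]) simp_all
      then have f_lex: "lex_functor f" using lex_X Y by (simp add: lex_functor_def)
      have f_ob: "f \<in> Obj (homcat Lex X Y)" using f f_lex ob[of f] by simp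
      have w_lex: "pseudococone I Lex F Y (whisker_cocone I Cat f q)"
        using L.whisker_cocone_cocone[of f q Y] q_lex f_lex by (simp add: whisker_cocone_Lex)
      have m_lex: "modification I Lex F Y m" using m' r w_lex by (simp add: lex_modification_iff[OF F])
      \<comment> \<open>Both end pseudococones are lex, so the inverse computed over
        \<open>Cat\<close> is a modification over \<open>Lex\<close> too, and invertibility
        descends.\<close>
      let ?n = "inverse_arr (pscocones I Cat F Y) m"
      have n: "modification I Cat F Y ?n" "MSrc ?n = r" "MTgt ?n = whisker_cocone I Cat f q"
        using inverse_arr(1-3)[OF m(2)] m' by simp_all
      have n_lex: "modification I Lex F Y ?n" using n r w_lex by (simp add: lex_modification_iff[OF F])
      have "is_iso (pscocones I Lex F Y) m"
        by (rule is_isoI[of _ _ ?n])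
          (use m_lex n_lex n m' inverse_arr(4,5)[OF m(2)] in \<open>simp_all add: pscocones_Lex_Cat\<close>)
      then show ?thesis
        using f_ob m_lex m' by (intro bexI[of _ f] bexI[of _ m]) (simp_all add: in_hom whisker_cocone_Lex)
    qed
  qed
qed

end

section \<open>Smallness\<close>

lemma small_subset: "small U B \<Longrightarrow> A \<subseteq> B \<Longrightarrow> small U A"
  unfolding small_def using card_of_mono1 ordLeq_ordLess_trans by blast

text \<open>An infinite regular cardinal is stable: fewer than that many sets, each of smaller
  cardinality, have a disjoint sum of smaller cardinality. Closure of \<open>small\<close> under
  products and small unions comes from this.\<close>

lemma universe_stable: "universe TYPE('u) \<Longrightarrow> stable |UNIV :: 'u set|"
  unfolding universe_def by (intro regularCard_stable card_of_Card_order) (auto simp: Field_card_of)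

lemma small_Times:
  assumes "universe TYPE('u)" "small TYPE('u) A" "small TYPE('u) B"
  shows "small TYPE('u) (A \<times> B)"
  using stable_elim[OF universe_stable[OF assms(1)], of A "\<lambda>_. B"] assms(2,3) unfolding small_def by blast

lemma small_UN:
  assumes "universe TYPE('u)" and "small TYPE('u) A" "\<And>a. a \<in> A \<Longrightarrow> small TYPE('u) (f a)"
  shows "small TYPE('u) (\<Union>a\<in>A. f a)"
  using stable_UNION[OF universe_stable[OF assms(1)]] assms(2,3) unfolding small_def by blast

lemma small_inj:
  assumes "small TYPE('u) A"
  obtains f :: "'a \<Rightarrow> 'u" where "inj_on f A"
proof -
  have "|A| \<le>o |UNIV :: 'u set|" using assms unfolding small_def by (rule ordLess_imp_ordLeq)
  then show ?thesis using that unfolding card_of_ordLeq[symmetric] by blast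
qed

context cat_diagram
begin

text \<open>There are few enough objects and representatives to be coded injectively in the universe
  itself. This is what makes the category of germs an object of \<open>Cat\<close>, on the same type
  as the categories of the diagram.\<close>

lemma germ_model_exists:
  assumes U: "universe TYPE('u)" and I: "small_twocat TYPE('u) I"
  obtains eo enc where "germ_model I F eo enc"
proof -
  have I_small: "small TYPE('u) (Obj I1)" "small TYPE('u) (Arr I1)" using I by (simp_all add: small_twocat_def)
  let ?O = "\<Union>i\<in>Obj I1. Obj (C i)" and ?A = "\<Union>i\<in>Obj I1. Arr (C i)"
  have C_small: "small TYPE('u) (Obj (C i))" "small TYPE('u) (Arr (C i))" if "i \<in> Obj I1" for i
    using C_simps(1)[OF that] by (simp_all add: small_cat_def)
  have O: "small TYPE('u) ?O" and A: "small TYPE('u) ?A"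
    by (intro small_UN U I_small C_small; assumption)+
  have b: "small TYPE('u) bobj"
    by (rule small_subset[OF small_Times[OF U I_small(1) O]]) (auto simp: bobj_def)
  \<comment> \<open>A representative is determined by its stage, two 1-cells of \<open>I\<close>,
    two objects and one arrow of stages, so a finite product of small sets bounds all of
    them.\<close>
  have "reps \<subseteq> Obj I1 \<times> ((Arr I1 \<times> ?O) \<times> (Arr I1 \<times> ?O) \<times> ?A)"
  proof
    fix z assume "z \<in> reps"
    then obtain k f where z: "z = (k, f)" "k \<in> Obj I1" "f \<in> Arr (T k)" by (auto simp: reps_def)
    from z(3) obtain d x e y a where "f = ((d, x), (e, y), a)" "d \<in> Arr I1" "Cod I1 d = k" "x \<in> Obj (C (Dom I1 d))"
      "e \<in> Arr I1" "Cod I1 e = k" "y \<in> Obj (C (Dom I1 e))" "a \<in> Arr (C k)" by (rule Arr_T_cases)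
    moreover from this have "Dom I1 d \<in> Obj I1" "Dom I1 e \<in> Obj I1" by simp_all
    ultimately show "z \<in> Obj I1 \<times> ((Arr I1 \<times> ?O) \<times> (Arr I1 \<times> ?O) \<times> ?A)" using z by blast
  qed
  then have r: "small TYPE('u) reps"
    by (rule small_subset[rotated]) (intro small_Times U I_small O A)
  obtain eo :: "'i \<times> 'u \<Rightarrow> 'u" where eo: "inj_on eo bobj" using small_inj[OF b] by blast
  obtain enc :: "'i \<times> ('d \<times> 'u) \<times> ('d \<times> 'u) \<times> 'u \<Rightarrow> 'u" where enc: "inj_on enc reps" using small_inj[OF r] by blast
  show ?thesis
    by (rule that[of eo enc]) (intro germ_model.intro germ_model_axioms.intro cat_diagram_axioms eo enc b r)
qed

end

text \<open>The second conjunct covers every bicolimit in \<open>Cat\<close> together with its own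
  inclusions, not just the model built from germs; the first ensures that it is not vacuous.\<close>

theorem lemma6p3p2:
  fixes I :: "('i, 'd, 'e) twocat"
    and F :: "('i, 'd, 'e, ('u, 'u) cat, ('u, 'u, 'u, 'u) func, ('u, 'u, 'u, 'u) nt) psfun"
  assumes "universe TYPE('u)"
    and "small_twocat TYPE('u) I"
    and "bifiltered I"
    and "pseudofunctor I Lex F"
  shows "(\<exists>L q. is_bicolimit I Cat F L q) \<and>
    (\<forall>L q. is_bicolimit I Cat F L q \<longrightarrow> has_finite_limits L \<and> is_bicolimit I Lex F L q)"
proof -
  interpret cat_diagram I F
    by (intro cat_diagram.intro assms(3) pseudofunctor_Cat[OF assms(4)])
  interpret L: pseudofunctor I Lex F by (rule assms(4))
  obtain eo enc where "germ_model I F eo enc" by (rule germ_model_exists[OF assms(1,2)])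
  then interpret G: germ_model I F eo enc .
  have "has_finite_limits L \<and> is_bicolimit I Lex F L q" if bc: "is_bicolimit I Cat F L q" for L q
  proof -
    \<comment> \<open>The category of germs is left behind here: it only served to show that an
      arbitrary bicolimit satisfies the three germ conditions.\<close>
    interpret lex_germ_colimit I F L q
      using L.pseudofunctor_simps(2)
      by (intro lex_germ_colimit.intro lex_germ_colimit_axioms.intro G.germ_colimit_bicolimit[OF bc]) simp
    have "pseudococone I Lex F L q" using q lex_X lex_leg by (simp add: lex_cocone_iff[OF assms(4)])
    moreover have "weak_equivalence (cocone_action I Lex F L q Y)" if "Y \<in> Obj (Cells1 Lex)" for Y
      by (rule weak_equivalence_Lex[OF assms(4) bicolimitD(2)[OF bc]]) (use that in \<open>simp_all add: lex_cat_small\<close>)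
    ultimately have "is_bicolimit I Lex F L q" by (rule L.bicolimitI)
    then show ?thesis using lex_X by (simp add: lex_cat_def)
  qed
  then show ?thesis using G.is_bicolimit_germ by blast
qed

end
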